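(* Let $\alpha\in(0,2]$, $\alpha+\gamma\in[0,2]$, $\beta\in(0,1]$, $H\in[1/2,1)$, and $\psi(s)=s^{\alpha/2}(1+s)^{\gamma/2}$. Let $\mathbf B^H(t,\mathbf x)$ be the tangential fractional Brownian motion on $\mathbb S^2$ with Hurst index $H$ and variances $A^1_\ell, A^2_\ell$ at $t=1$ (defined in the context), and suppose that $$\sum_{\ell\ge1}(2\ell+1)\,(\psi(\lambda_\ell))^{\tau}A_\ell^1<\infty,\qquad \sum_{\ell\ge1}(2\ell+1)\,(\psi(\lambda_\ell))^{\tau}A_\ell^2<\infty,\qquad \tau:=\max\Big\{\tfrac2\beta(1-\beta-H),0\Big\}.$$ Then the solution of $$\frac{\partial^\beta}{\partial t^\beta}\mathbf X(t,\mathbf x)=-\psi(-\Delta^* )\mathbf X(t,\mathbf x)+\mathrm d\mathbf B^H(t,\mathbf x),\qquad t\ge0,\ \mathbf x\in\mathbb S^2,$$ is given by $$\mathbf X(t,\mathbf x)=\sum_{\ell=1}^\infty\sum_{m=-\ell}^{\ell}\Big(\int_0^t(t-s)^{\beta-1}E_{\beta,\beta}\big(-(t-s)^\beta\psi(\lambda_\ell)\big)\,\mathrm d\hat B_{\ell m}(s)\,\mathbf y_{\ell,m}(\mathbf x)+\int_0^t(t-s)^{\beta-1}E_{\beta,\beta}\big(-(t-s)^\beta\psi(\lambda_\ell)\big)\,\mathrm d\tilde B_{\ell m}(s)\,\mathbf z_{\ell,m}(\mathbf x)\Big),$$ where the expansion is convergent in $\mathbf L_2(\Omega\times\mathbb 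S^2)$.
   Context: Vector spherical harmonics. $\mathbb S^2\subset\mathbb R^3$ is the unit sphere with surface measure, $\Delta^*$ its Laplace–Beltrami operator, $\{Y_{\ell,m}:\ell\ge0,\ m=-\ell,\dots,\ell\}$ an orthonormal basis of complex spherical harmonics of $L_2(\mathbb S^2)$, $\Delta^*Y_{\ell,m}=-\lambda_\ell Y_{\ell,m}$, $\lambda_\ell=\ell(\ell+1)$. For column vectors in $\mathbb C^3$, $\mathbf a\cdot\mathbf b=\mathbf a^T\overline{\mathbf b}$, $|\mathbf a|=\sqrt{\mathbf a\cdot\mathbf a}$. A field $\mathbf f:\mathbb S^2\to\mathbb C^3$ is tangent if $\mathbf f(\mathbf x)\cdot\mathbf x=0$. $\mathbf L_2(\mathbb S^2)$ denotes the Hilbert space of square-integrable tangent fields with $\langle\mathbf f,\mathbf g\rangle=\int_{\mathbb S^2}\mathbf f\cdot\mathbf g$. The surface gradient is $\nabla^*=(I-\mathbf x\mathbf x^T)\nabla$ and the surface curl is $\mathbf L=Q_{\mathbf x}\nabla$, with $Q_{\mathbf x}=\begin{pmatrix}0&-x_3&x_2\\ x_3&0&-x_1\\ -x_2&x_1&0\end{pmatrix}$. For $\ell\ge1$, $\mathbf y_{\ell,m}=\mathbf L Y_{\ell,m}/\sqrt{\lambda_\ell}$ (divergence-free) and $\mathbf z_{\ell,m}=\nabla^*Y_{\ell,m}/\sqrt{\lambda_\ell}$ (curl-free); together they form an orthonormal basis of $\mathbf L_2(\mathbb S^2)$. Random fields. $(\Omega,\mathcal F,\mathbf P)$ is a probability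 space; $\mathbf L_2(\Omega\times\mathbb S^2)$ is the space of random tangent fields $\mathbf f(\xi,\mathbf x)$ with $\|\mathbf f\|^2_{\mathbf L_2(\Omega\times\mathbb S^2)}=\mathbb E\int_{\mathbb S^2}|\mathbf f(\cdot,\mathbf x)|^2<\infty$. Noise. A real fractional Brownian motion with Hurst index $H$ and variance $A$ at $t=1$ is a centred Gaussian process with value $0$ at $t=0$ and $\mathbb E|B(t)-B(s)|^2=A|t-s|^{2H}$; a complex one is $B^1+\mathrm iB^2$ with $B^1,B^2$ independent real fractional Brownian motions of Hurst index $H$ and variance $A$ at $t=1$. $\hat B_{\ell m},\tilde B_{\ell m}$ ($\ell\ge1$, $|m|\le\ell$) are independent centred complex fractional Brownian motions with Hurst index $H$ and variances $A^1_\ell$ and $A^2_\ell$ at $t=1$ respectively, where $\sum_\ell(2\ell+1)A^i_\ell<\infty$, $i=1,2$. The tangential fractional Brownian motion is $\mathbf B^H(t,\mathbf x)=\sum_{\ell\ge1}\sum_{|m|\le\ell}(\hat B_{\ell m}(t)\mathbf y_{\ell,m}(\mathbf x)+\tilde B_{\ell m}(t)\mathbf z_{\ell,m}(\mathbf x))$. For deterministic $g$, $\int_0^tg\,\mathrm dB=\int_0^tg\,\mathrm dB^1+\mathrm i\int_0^tg\,\mathrm dB^2$ (Riemann–Stieltjes integrals). Operators. $E_{a,b}(z)=\sum_{k\ge0}z^k/\Gamma(ak+b)$. The fractional diffusion operator is $\psi(-\Delta^* )\mathbf f=-\int_0^\infty(\mathrm P_t\mathbf f-\mathbf f)\,\nu(\mathrm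 dt)$, where $\psi(z)=\int_0^\infty(1-e^{-tz})\nu(\mathrm dt)$ and $\mathrm P_t$ multiplies the coefficients of $\mathbf f$ at $\mathbf y_{\ell,m},\mathbf z_{\ell,m}$ by $e^{-t\lambda_\ell}$; thus $\psi(-\Delta^* )\mathbf y_{\ell,m}=\psi(\lambda_\ell)\mathbf y_{\ell,m}$, $\psi(-\Delta^* )\mathbf z_{\ell,m}=\psi(\lambda_\ell)\mathbf z_{\ell,m}$. $\frac{\partial^\beta}{\partial t^\beta}$ is $\partial/\partial t$ if $\beta=1$, and for $\beta\in(0,1)$ it is the regularized (Caputo–Djrbashian) derivative $\frac1{\Gamma(1-\beta)}\big[\frac{\partial}{\partial t}\int_0^t(t-s)^{-\beta}u(s)\,\mathrm ds-u(0)t^{-\beta}\big]$. Meaning of the equation. It is understood coefficientwise in the basis $\mathbf y_{\ell,m},\mathbf z_{\ell,m}$, with $\mathrm d\mathbf B^H$ the formal time derivative of $\mathbf B^H$ and with $\mathbf X(0,\cdot)=0$: the coefficient $\hat X=\hat X_{\ell m}$ of $\mathbf y_{\ell,m}$ satisfies (after one integration in time) $\frac1{\Gamma(1-\beta)}\int_0^t(t-s)^{-\beta}(\hat X(s)-\hat X(0))\,\mathrm ds=-\psi(\lambda_\ell)\int_0^t\hat X(s)\,\mathrm ds+\hat B_{\ell m}(t)$, the left side being replaced by $\hat X(t)-\hat X(0)$ if $\beta=1$; and similarly for $\mathbf z_{\ell,m}$ with $\tilde B_{\ell m}$.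
   Formalization: Existence of the solution and convergence of the expansion are claimed only where the stochastic integrals exist, which is shown for β+H>1; for β+H≤1 and any nonzero variance they diverge. "Solution" means jointly measurable, L2-continuous in t, with X(0)=0. *)

theory Defs
  imports "HOL-Probability.Probability"
begin

section \<open>Square-integrable functions and orthonormal bases\<close>

definition sq_dist :: "'a measure \<Rightarrow> ('a \<Rightarrow> 'v::real_normed_vector) \<Rightarrow> ('a \<Rightarrow> 'v) \<Rightarrow> ennreal" where
  "sq_dist N f g = (\<integral>\<^sup>+ x. ennreal ((norm (f x - g x))\<^sup>2) \<partial>N)"

definition L2_space :: "'a measure \<Rightarrow> ('a \<Rightarrow> 'v::{real_normed_vector,second_countable_topology,banach}) set" where
  "L2_space N = {f \<in> borel_measurable N. integrable N (\<lambda>x. (norm (f x))\<^sup>2)}"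

text \<open>
  An orthonormal basis of a space \<open>\<H>\<close> of square-integrable functions (taken modulo null sets):
  an orthonormal family with dense linear span. The pointwise inner product \<open>ip\<close> and the scalar
  multiplication \<open>scl\<close> are parameters, so that the definition covers values in
  \<^typ>\<open>complex\<close> and in \<^typ>\<open>complex ^ 3\<close>.
\<close>
definition orthonormal_basis_L2 ::
  "'a measure \<Rightarrow> ('v \<Rightarrow> 'v \<Rightarrow> complex) \<Rightarrow> (complex \<Rightarrow> 'v \<Rightarrow> 'v) \<Rightarrow>
   ('a \<Rightarrow> 'v::real_normed_vector) set \<Rightarrow> 'i set \<Rightarrow> ('i \<Rightarrow> 'a \<Rightarrow> 'v) \<Rightarrow> bool" where
  "orthonormal_basis_L2 N ip scl \<H> I e \<longleftrightarrow>
     (\<forall>i\<in>I. e i \<in> \<H>) \<and>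
     (\<forall>i\<in>I. \<forall>j\<in>I. (LINT x|N. ip (e i x) (e j x)) = (if i = j then 1 else 0)) \<and>
     (\<forall>f\<in>\<H>. \<forall>\<epsilon>>0. \<exists>J c. finite J \<and> J \<subseteq> I \<and>
        sq_dist N f (\<lambda>x. \<Sum>i\<in>J. scl (c i) (e i x)) < ennreal \<epsilon>)"

section \<open>Calculus on the unit sphere\<close>

text \<open>
  Surface measure as three times the cone measure, a measure on the sphere itself:
  \<open>\<sigma>(A) = 3 vol {r x | x \<in> A, 0 < r < 1}\<close>; here \<^term>\<open>sgn x = x /\<^sub>R norm x\<close>.
\<close>
definition S2_measure :: "(real ^ 3) measure" where
  "S2_measure = scale_measure 3
     (distr (restrict_space lborel (ball 0 1 - {0})) (restrict_space borel (sphere 0 1)) sgn)"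

definition cdot :: "complex ^ 3 \<Rightarrow> complex ^ 3 \<Rightarrow> complex" where
  "cdot a b = (\<Sum>i\<in>UNIV. a $ i * cnj (b $ i))"

definition cvec :: "real ^ 3 \<Rightarrow> complex ^ 3" where
  "cvec x = (\<chi> i. complex_of_real (x $ i))"

definition pderiv3 :: "3 \<Rightarrow> (real ^ 3 \<Rightarrow> complex) \<Rightarrow> real ^ 3 \<Rightarrow> complex" where
  "pderiv3 i F x = vector_derivative (\<lambda>h. F (x + h *\<^sub>R axis i 1)) (at 0)"

definition gradient3 :: "(real ^ 3 \<Rightarrow> complex) \<Rightarrow> real ^ 3 \<Rightarrow> complex ^ 3" where
  "gradient3 F x = (\<chi> i. pderiv3 i F x)"

definition laplacian3 :: "(real ^ 3 \<Rightarrow> complex) \<Rightarrow> real ^ 3 \<Rightarrow> complex" where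
  "laplacian3 F x = (\<Sum>i\<in>UNIV. pderiv3 i (pderiv3 i F) x)"

text \<open>
  A function on the sphere is represented by a function on \<^typ>\<open>real ^ 3\<close> whose values off the
  sphere are irrelevant. Before differentiating, it is extended to be constant along rays,
  \<open>x \<mapsto> f (x / |x|)\<close>. Surface gradient and surface curl do not depend on the choice of a
  differentiable extension; the Laplace--Beltrami operator is the Laplacian of this one.
\<close>
definition ray_extension :: "(real ^ 3 \<Rightarrow> complex) \<Rightarrow> real ^ 3 \<Rightarrow> complex" where
  "ray_extension f = (\<lambda>x. f (sgn x))"

definition laplace_beltrami :: "(real ^ 3 \<Rightarrow> complex) \<Rightarrow> real ^ 3 \<Rightarrow> complex" where
  "laplace_beltrami f x = laplacian3 (ray_extension f) x"

definition tangent_projection :: "real ^ 3 \<Rightarrow> complex ^ 3 ^ 3" where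
  "tangent_projection x = mat 1 - (\<chi> i j. complex_of_real (x $ i * x $ j))"

definition Qmat :: "real ^ 3 \<Rightarrow> complex ^ 3 ^ 3" where
  "Qmat x = vector
     [vector [0, - complex_of_real (x $ 3), complex_of_real (x $ 2)],
      vector [complex_of_real (x $ 3), 0, - complex_of_real (x $ 1)],
      vector [- complex_of_real (x $ 2), complex_of_real (x $ 1), 0]]"

definition surface_gradient :: "(real ^ 3 \<Rightarrow> complex) \<Rightarrow> real ^ 3 \<Rightarrow> complex ^ 3" where
  "surface_gradient f x = tangent_projection x *v gradient3 (ray_extension f) x"

definition surface_curl :: "(real ^ 3 \<Rightarrow> complex) \<Rightarrow> real ^ 3 \<Rightarrow> complex ^ 3" where
  "surface_curl f x = Qmat x *v gradient3 (ray_extension f) x"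

section \<open>Scalar and vector spherical harmonics\<close>

definition eigval :: "nat \<Rightarrow> real" where
  "eigval l = real l * (real l + 1)"

text \<open>Restriction to the sphere of a harmonic homogeneous polynomial of degree \<open>l\<close>.\<close>
definition spherical_harmonic :: "nat \<Rightarrow> (real ^ 3 \<Rightarrow> complex) \<Rightarrow> bool" where
  "spherical_harmonic l f \<longleftrightarrow>
     (\<exists>c p. p = (\<lambda>x. \<Sum>(i, j, k) \<in> {(i, j, k). i + j + k = l}.
                  c i j k * complex_of_real (x $ 1 ^ i * x $ 2 ^ j * x $ 3 ^ k)) \<and>
            (\<forall>x. laplacian3 p x = 0) \<and> (\<forall>x\<in>sphere 0 1. f x = p x))"

definition spherical_harmonic_basis :: "(nat \<Rightarrow> int \<Rightarrow> real ^ 3 \<Rightarrow> complex) \<Rightarrow> bool" where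
  "spherical_harmonic_basis Y \<longleftrightarrow>
     (\<forall>l m. \<bar>m\<bar> \<le> int l \<longrightarrow> spherical_harmonic l (Y l m) \<and>
        (\<forall>x\<in>sphere 0 1. laplace_beltrami (Y l m) x = - of_real (eigval l) * Y l m x)) \<and>
     orthonormal_basis_L2 S2_measure (\<lambda>a b. a * cnj b) (*) (L2_space S2_measure)
       {(l, m). \<bar>m\<bar> \<le> int l} (\<lambda>(l, m). Y l m)"

definition yv :: "(nat \<Rightarrow> int \<Rightarrow> real ^ 3 \<Rightarrow> complex) \<Rightarrow> nat \<Rightarrow> int \<Rightarrow> real ^ 3 \<Rightarrow> complex ^ 3" where
  "yv Y l m x = (1 / sqrt (eigval l)) *\<^sub>R surface_curl (Y l m) x"

definition zv :: "(nat \<Rightarrow> int \<Rightarrow> real ^ 3 \<Rightarrow> complex) \<Rightarrow> nat \<Rightarrow> int \<Rightarrow> real ^ 3 \<Rightarrow> complex ^ 3" where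
  "zv Y l m x = (1 / sqrt (eigval l)) *\<^sub>R surface_gradient (Y l m) x"

definition vec_indices :: "(nat \<times> int) set" where
  "vec_indices = {(l, m). 1 \<le> l \<and> \<bar>m\<bar> \<le> int l}"

definition L2_tangent :: "(real ^ 3 \<Rightarrow> complex ^ 3) set" where
  "L2_tangent = {f \<in> L2_space S2_measure. AE x in S2_measure. cdot (f x) (cvec x) = 0}"

text \<open>The fields \<open>y\<close> (index \<^const>\<open>Inl\<close>) and \<open>z\<close> (index \<^const>\<open>Inr\<close>) together.\<close>
definition vector_harmonic_basis :: "(nat \<Rightarrow> int \<Rightarrow> real ^ 3 \<Rightarrow> complex) \<Rightarrow> bool" where
  "vector_harmonic_basis Y \<longleftrightarrow>
     orthonormal_basis_L2 S2_measure cdot (*s) L2_tangent (vec_indices <+> vec_indices)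
       (case_sum (\<lambda>(l, m). yv Y l m) (\<lambda>(l, m). zv Y l m))"

definition coeff :: "(real ^ 3 \<Rightarrow> complex ^ 3) \<Rightarrow> (real ^ 3 \<Rightarrow> complex ^ 3) \<Rightarrow> complex" where
  "coeff f e = (LINT x|S2_measure. cdot (f x) (e x))"

section \<open>Random tangent fields\<close>

definition L2_random_tangent :: "'w measure \<Rightarrow> ('w \<times> (real ^ 3) \<Rightarrow> complex ^ 3) set" where
  "L2_random_tangent M = {f \<in> L2_space (M \<Otimes>\<^sub>M S2_measure).
     AE p in M \<Otimes>\<^sub>M S2_measure. cdot (f p) (cvec (snd p)) = 0}"

text \<open>A random tangent field evolving in time; joint measurability gives a meaning to time integrals
  along sample paths.\<close>
definition random_tangent_field :: "'w measure \<Rightarrow> (real \<Rightarrow> 'w \<Rightarrow> real ^ 3 \<Rightarrow> complex ^ 3) \<Rightarrow> bool" where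
  "random_tangent_field M X \<longleftrightarrow>
     (\<lambda>(t, \<omega>, x). X t \<omega> x) \<in> borel_measurable (restrict_space borel {0..} \<Otimes>\<^sub>M (M \<Otimes>\<^sub>M S2_measure)) \<and>
     (\<forall>t\<ge>0. case_prod (X t) \<in> L2_random_tangent M)"

text \<open>\<open>F\<close> is the sum, with convergence in \<open>L\<^sub>2(\<Omega> \<times> S\<^sup>2)\<close>, of
  \<open>\<Sum>\<^sub>l \<Sum>\<^sub>m (a\<^sub>l\<^sub>m y\<^sub>l\<^sub>m + b\<^sub>l\<^sub>m z\<^sub>l\<^sub>m)\<close> with random coefficients \<open>a, b\<close>.\<close>
definition has_L2_expansion ::
  "'w measure \<Rightarrow> (nat \<Rightarrow> int \<Rightarrow> real ^ 3 \<Rightarrow> complex) \<Rightarrow> (nat \<Rightarrow> int \<Rightarrow> 'w \<Rightarrow> complex) \<Rightarrow>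
   (nat \<Rightarrow> int \<Rightarrow> 'w \<Rightarrow> complex) \<Rightarrow> ('w \<Rightarrow> real ^ 3 \<Rightarrow> complex ^ 3) \<Rightarrow> bool" where
  "has_L2_expansion M Y a b F \<longleftrightarrow>
     case_prod F \<in> L2_random_tangent M \<and>
     (\<lambda>N. sq_dist (M \<Otimes>\<^sub>M S2_measure) (case_prod F)
        (\<lambda>(\<omega>, x). \<Sum>l = 1..N. \<Sum>m = - int l..int l.
            a l m \<omega> *s yv Y l m x + b l m \<omega> *s zv Y l m x)) \<longlonglongrightarrow> 0"

section \<open>Fractional Brownian motion\<close>

definition centred_gaussian :: "'w measure \<Rightarrow> ('w \<Rightarrow> real) \<Rightarrow> bool" where
  "centred_gaussian M Z \<longleftrightarrow> Z \<in> borel_measurable M \<and>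
     ((AE \<omega> in M. Z \<omega> = 0) \<or> (\<exists>s>0. distributed M lborel Z (normal_density 0 s)))"

definition centred_gaussian_process :: "'w measure \<Rightarrow> (real \<Rightarrow> 'w \<Rightarrow> real) \<Rightarrow> bool" where
  "centred_gaussian_process M B \<longleftrightarrow>
     (\<forall>T c. finite T \<and> T \<subseteq> {0..} \<longrightarrow> centred_gaussian M (\<lambda>\<omega>. \<Sum>t\<in>T. c t * B t \<omega>))"

definition real_fbm :: "'w measure \<Rightarrow> real \<Rightarrow> real \<Rightarrow> (real \<Rightarrow> 'w \<Rightarrow> real) \<Rightarrow> bool" where
  "real_fbm M H A B \<longleftrightarrow>
     centred_gaussian_process M B \<and> (AE \<omega> in M. B 0 \<omega> = 0) \<and>
     (\<forall>s\<ge>0. \<forall>t\<ge>0. (LINT \<omega>|M. (B t \<omega> - B s \<omega>)\<^sup>2) = A * \<bar>t - s\<bar> powr (2 * H))"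

text \<open>A process on \<open>[0, \<infinity>)\<close> as one random element of the product space; independence of
  processes is independence of these.\<close>
definition path :: "(real \<Rightarrow> 'w \<Rightarrow> 'v) \<Rightarrow> 'w \<Rightarrow> real \<Rightarrow> 'v" where
  "path B \<omega> = (\<lambda>t\<in>{0..}. B t \<omega>)"

definition path_space :: "(real \<Rightarrow> 'v::topological_space) measure" where
  "path_space = (\<Pi>\<^sub>M t\<in>{0..}. borel)"

definition complex_fbm :: "'w measure \<Rightarrow> real \<Rightarrow> real \<Rightarrow> (real \<Rightarrow> 'w \<Rightarrow> complex) \<Rightarrow> bool" where
  "complex_fbm M H A B \<longleftrightarrow>
     real_fbm M H A (\<lambda>t \<omega>. Re (B t \<omega>)) \<and> real_fbm M H A (\<lambda>t \<omega>. Im (B t \<omega>)) \<and>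
     prob_space.indep_var M path_space (path (\<lambda>t \<omega>. Re (B t \<omega>))) path_space (path (\<lambda>t \<omega>. Im (B t \<omega>)))"

definition tangential_fbm ::
  "'w measure \<Rightarrow> (nat \<Rightarrow> int \<Rightarrow> real ^ 3 \<Rightarrow> complex) \<Rightarrow> real \<Rightarrow> (nat \<Rightarrow> real) \<Rightarrow> (nat \<Rightarrow> real) \<Rightarrow>
   (nat \<Rightarrow> int \<Rightarrow> real \<Rightarrow> 'w \<Rightarrow> complex) \<Rightarrow> (nat \<Rightarrow> int \<Rightarrow> real \<Rightarrow> 'w \<Rightarrow> complex) \<Rightarrow>
   (real \<Rightarrow> 'w \<Rightarrow> real ^ 3 \<Rightarrow> complex ^ 3) \<Rightarrow> bool" where
  "tangential_fbm M Y H A1 A2 Bh Bt BH \<longleftrightarrow>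
     (\<lambda>l. (2 * real l + 1) * A1 l) summable_on {1..} \<and>
     (\<lambda>l. (2 * real l + 1) * A2 l) summable_on {1..} \<and>
     (\<forall>(l, m)\<in>vec_indices. complex_fbm M H (A1 l) (Bh l m) \<and> complex_fbm M H (A2 l) (Bt l m)) \<and>
     prob_space.indep_vars M (\<lambda>_. path_space)
       (case_sum (\<lambda>(l, m). path (Bh l m)) (\<lambda>(l, m). path (Bt l m))) (vec_indices <+> vec_indices) \<and>
     (\<forall>t\<ge>0. has_L2_expansion M Y (\<lambda>l m. Bh l m t) (\<lambda>l m. Bt l m t) (BH t))"

section \<open>Riemann--Stieltjes integrals with respect to a process\<close>

text \<open>
  Mean-square Riemann--Stieltjes integral of a deterministic function: limit in \<open>L\<^sub>2(\<Omega>)\<close> of the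
  Riemann--Stieltjes sums over tagged partitions \<open>a = u\<^sub>0 \<le> \<dots> \<le> u\<^sub>n = b\<close>, \<open>v\<^sub>i \<in> [u\<^sub>i, u\<^sub>i\<^sub>+\<^sub>1]\<close>, as the
  mesh tends to 0.
\<close>
definition has_RS_integral ::
  "'w measure \<Rightarrow> (real \<Rightarrow> real) \<Rightarrow> (real \<Rightarrow> 'w \<Rightarrow> real) \<Rightarrow> real \<Rightarrow> real \<Rightarrow> ('w \<Rightarrow> real) \<Rightarrow> bool" where
  "has_RS_integral M g B a b J \<longleftrightarrow> J \<in> L2_space M \<and>
     (\<forall>\<epsilon>>0. \<exists>\<delta>>0. \<forall>(n::nat) u v.
        u 0 = a \<and> u n = b \<and> (\<forall>i<n. u i \<le> v i \<and> v i \<le> u (Suc i) \<and> u (Suc i) - u i < \<delta>) \<longrightarrow>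
        sq_dist M (\<lambda>\<omega>. \<Sum>i<n. g (v i) * (B (u (Suc i)) \<omega> - B (u i) \<omega>)) J < ennreal \<epsilon>)"

text \<open>
  Integral over \<open>[0, t]\<close> of a function that may be singular at the upper limit \<open>t\<close>:
  \<open>\<integral>\<^sub>0\<^sup>t g dB = lim\<^sub>r\<^sub>\<up>\<^sub>t \<integral>\<^sub>0\<^sup>r g dB\<close> in \<open>L\<^sub>2(\<Omega>)\<close>.
\<close>
definition has_improper_RS_integral ::
  "'w measure \<Rightarrow> (real \<Rightarrow> real) \<Rightarrow> (real \<Rightarrow> 'w \<Rightarrow> real) \<Rightarrow> real \<Rightarrow> ('w \<Rightarrow> real) \<Rightarrow> bool" where
  "has_improper_RS_integral M g B t J \<longleftrightarrow> J \<in> L2_space M \<and>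
     (if t = 0 then (AE \<omega> in M. J \<omega> = 0)
      else \<exists>K. (\<forall>r\<in>{0..<t}. has_RS_integral M g B 0 r (K r)) \<and>
               ((\<lambda>r. sq_dist M (K r) J) \<longlongrightarrow> 0) (at_left t))"

definition has_complex_RS_integral ::
  "'w measure \<Rightarrow> (real \<Rightarrow> real) \<Rightarrow> (real \<Rightarrow> 'w \<Rightarrow> complex) \<Rightarrow> real \<Rightarrow> ('w \<Rightarrow> complex) \<Rightarrow> bool" where
  "has_complex_RS_integral M g B t J \<longleftrightarrow>
     has_improper_RS_integral M g (\<lambda>s \<omega>. Re (B s \<omega>)) t (\<lambda>\<omega>. Re (J \<omega>)) \<and>
     has_improper_RS_integral M g (\<lambda>s \<omega>. Im (B s \<omega>)) t (\<lambda>\<omega>. Im (J \<omega>))"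

section \<open>The equation and the solution formula\<close>

definition mittag_leffler :: "real \<Rightarrow> real \<Rightarrow> real \<Rightarrow> real" where
  "mittag_leffler a b z = (\<Sum>k. z ^ k / Gamma (a * real k + b))"

definition psi :: "real \<Rightarrow> real \<Rightarrow> real \<Rightarrow> real" where
  "psi \<alpha> \<gamma> s = s powr (\<alpha> / 2) * (1 + s) powr (\<gamma> / 2)"

text \<open>
  The derivative \<open>\<partial>\<^sup>\<beta>u/\<partial>t\<^sup>\<beta>\<close> (Caputo--Djrbashian for \<open>\<beta> < 1\<close>) after one integration in time.
\<close>
definition integrated_caputo :: "real \<Rightarrow> (real \<Rightarrow> complex) \<Rightarrow> real \<Rightarrow> complex" where
  "integrated_caputo \<beta> u t =
     (if \<beta> = 1 then u t - u 0
      else (1 / Gamma (1 - \<beta>)) *\<^sub>R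
             set_lebesgue_integral lborel {0..t} (\<lambda>s. (t - s) powr (- \<beta>) *\<^sub>R (u s - u 0)))"

definition solves_coefficient ::
  "'w measure \<Rightarrow> real \<Rightarrow> real \<Rightarrow> (real \<Rightarrow> 'w \<Rightarrow> complex) \<Rightarrow> (real \<Rightarrow> 'w \<Rightarrow> complex) \<Rightarrow> bool" where
  "solves_coefficient M \<beta> \<mu> b u \<longleftrightarrow>
     (\<forall>t\<ge>0. AE \<omega> in M.
        set_integrable lborel {0..t} (\<lambda>s. u s \<omega>) \<and>
        (\<beta> < 1 \<longrightarrow> set_integrable lborel {0..t} (\<lambda>s. (t - s) powr (- \<beta>) *\<^sub>R (u s \<omega> - u 0 \<omega>))) \<and>
        integrated_caputo \<beta> (\<lambda>s. u s \<omega>) t =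
          - (\<mu> *\<^sub>R set_lebesgue_integral lborel {0..t} (\<lambda>s. u s \<omega>)) + b t \<omega>)"

text \<open>
  \<open>X\<close> solves \<open>\<partial>\<^sup>\<beta>X/\<partial>t\<^sup>\<beta> = -\<psi>(-\<Delta>\<^sup>*)X + dW\<close>, \<open>X(0) = 0\<close>, coefficientwise in the basis \<open>y, z\<close>, on whose members
  of degree \<open>l\<close> the operator \<open>\<psi>(-\<Delta>\<^sup>*)\<close> acts as multiplication by \<open>\<psi>(\<lambda>\<^sub>l)\<close>. For \<open>\<beta> < 1\<close> the integrated
  equation determines \<open>X\<close> only for almost all \<open>t\<close>; continuity of \<open>t \<mapsto> X(t)\<close> in \<open>L\<^sub>2(\<Omega> \<times> S\<^sup>2)\<close>, part of the
  notion of solution, determines it for all \<open>t\<close> and gives the initial condition its meaning.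
\<close>
definition solves_equation ::
  "'w measure \<Rightarrow> (nat \<Rightarrow> int \<Rightarrow> real ^ 3 \<Rightarrow> complex) \<Rightarrow> real \<Rightarrow> (real \<Rightarrow> real) \<Rightarrow>
   (real \<Rightarrow> 'w \<Rightarrow> real ^ 3 \<Rightarrow> complex ^ 3) \<Rightarrow> (real \<Rightarrow> 'w \<Rightarrow> real ^ 3 \<Rightarrow> complex ^ 3) \<Rightarrow> bool" where
  "solves_equation M Y \<beta> \<psi> W X \<longleftrightarrow>
     (\<forall>t\<ge>0. ((\<lambda>s. sq_dist (M \<Otimes>\<^sub>M S2_measure) (case_prod (X s)) (case_prod (X t))) \<longlongrightarrow> 0)
               (at t within {0..})) \<and>
     (AE (\<omega>, x) in M \<Otimes>\<^sub>M S2_measure. X 0 \<omega> x = 0) \<and>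
     (\<forall>(l, m)\<in>vec_indices.
        solves_coefficient M \<beta> (\<psi> (eigval l))
          (\<lambda>t \<omega>. coeff (W t \<omega>) (yv Y l m)) (\<lambda>t \<omega>. coeff (X t \<omega>) (yv Y l m)) \<and>
        solves_coefficient M \<beta> (\<psi> (eigval l))
          (\<lambda>t \<omega>. coeff (W t \<omega>) (zv Y l m)) (\<lambda>t \<omega>. coeff (X t \<omega>) (zv Y l m)))"

definition kernel :: "real \<Rightarrow> real \<Rightarrow> real \<Rightarrow> real \<Rightarrow> real" where
  "kernel \<beta> \<mu> t s = (t - s) powr (\<beta> - 1) * mittag_leffler \<beta> \<beta> (- ((t - s) powr \<beta> * \<mu>))"

text \<open>\<open>Jh l m t\<close> and \<open>Jt l m t\<close> are the stochastic integrals in the solution formula (determined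
  almost surely).\<close>
definition solution_integrals ::
  "'w measure \<Rightarrow> real \<Rightarrow> (real \<Rightarrow> real) \<Rightarrow>
   (nat \<Rightarrow> int \<Rightarrow> real \<Rightarrow> 'w \<Rightarrow> complex) \<Rightarrow> (nat \<Rightarrow> int \<Rightarrow> real \<Rightarrow> 'w \<Rightarrow> complex) \<Rightarrow>
   (nat \<Rightarrow> int \<Rightarrow> real \<Rightarrow> 'w \<Rightarrow> complex) \<Rightarrow> (nat \<Rightarrow> int \<Rightarrow> real \<Rightarrow> 'w \<Rightarrow> complex) \<Rightarrow> bool" where
  "solution_integrals M \<beta> \<psi> Bh Bt Jh Jt \<longleftrightarrow>
     (\<forall>(l, m)\<in>vec_indices. \<forall>t\<ge>0.
        has_complex_RS_integral M (kernel \<beta> (\<psi> (eigval l)) t) (Bh l m) t (Jh l m t) \<and>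
        has_complex_RS_integral M (kernel \<beta> (\<psi> (eigval l)) t) (Bt l m) t (Jt l m t))"

definition given_by_formula ::
  "'w measure \<Rightarrow> (nat \<Rightarrow> int \<Rightarrow> real ^ 3 \<Rightarrow> complex) \<Rightarrow> real \<Rightarrow> (real \<Rightarrow> real) \<Rightarrow>
   (nat \<Rightarrow> int \<Rightarrow> real \<Rightarrow> 'w \<Rightarrow> complex) \<Rightarrow> (nat \<Rightarrow> int \<Rightarrow> real \<Rightarrow> 'w \<Rightarrow> complex) \<Rightarrow>
   (real \<Rightarrow> 'w \<Rightarrow> real ^ 3 \<Rightarrow> complex ^ 3) \<Rightarrow> bool" where
  "given_by_formula M Y \<beta> \<psi> Bh Bt X \<longleftrightarrow>
     (\<exists>Jh Jt. solution_integrals M \<beta> \<psi> Bh Bt Jh Jt \<and>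
        (\<forall>t\<ge>0. has_L2_expansion M Y (\<lambda>l m. Jh l m t) (\<lambda>l m. Jt l m t) (X t)))"

end

theory Submission
  imports Defs
begin

text \<open>
  The problem reduces to one real coefficient, with noise \<open>B\<close> of variance \<open>A t\<^sup>2\<^sup>H\<close> and rate \<open>\<mu> \<ge> 0\<close>. The kernel
  \<open>k(s) = s\<^sup>\<beta>\<^sup>-\<^sup>1 E\<^sub>\<beta>\<^sub>,\<^sub>\<beta>(- \<mu> s\<^sup>\<beta>)\<close> lies between \<open>0\<close> and \<open>s\<^sup>\<beta>\<^sup>-\<^sup>1 / \<Gamma>(\<beta>)\<close>. For \<open>H \<ge> 1/2\<close> the increments of \<open>B\<close> are
  nonnegatively correlated, so the \<open>L\<^sub>2\<close> norm of a Riemann--Stieltjes sum is monotone in a nonnegative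
  integrand; hence, for \<open>\<beta> + H > 1\<close>, the stochastic integral of \<open>k\<close> exists, and its norm is at most
  \<open>\<surd>A\<close> times a bound uniform in \<open>\<mu>\<close>, which gives convergence and continuity of the expansion. The
  integrated equation is verified in the closed span of the increments: its inner product with \<open>B(a)\<close> is
  an identity for the Stieltjes measure of \<open>s \<mapsto> E[B(a) B(s)]\<close>, and follows by Tonelli from the equation
  satisfied by \<open>k\<close>. Solutions are unique because \<open>k\<close> inverts the convolution operator of the equation.
  For \<open>\<beta> + H \<le> 1\<close>, the formula and the equation each force \<open>A = 0\<close>.
\<close>

section \<open>Square-integrable functions\<close>

text \<open>Integrals with respect to the noise exist only as limits in L2(\<Omega>), so no argument
  can follow a single path. Identities are tested against a fixed random variable Z instead. If Z is
  nonnegatively correlated with all increments, s -> E[Z B(s)] is nondecreasing and continuous, and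
  the test turns a stochastic integral into a Stieltjes integral of a nonnegative function. Monotone
  convergence and Tonelli then deal with the singularity of the kernel at the upper limit without
  any integrability known in advance. The norm bounds have to be uniform in the degree. This comes
  from the Volterra equation k = g - \<mu> (g convolved with k), where g(s) = s^(\<beta>-1) /
  Gamma(\<beta>): once k > 0 is known, k \<le> g follows. So positivity of k has to be established
  first. The equation speaks of time integrals along sample paths, whereas the formula fixes each
  X(t) only up to a null set that depends on t. Joint measurability is the link, and a field built
  from the formula has to be replaced by a jointly measurable version.\<close>

definition l2norm :: "'a measure \<Rightarrow> ('a \<Rightarrow> 'v::{real_normed_vector,second_countable_topology,banach}) \<Rightarrow> real" where
  "l2norm N f = sqrt (LINT x|N. (norm (f x))\<^sup>2)"

lemma L2_space_measurable [measurable_dest]: "f \<in> L2_space N \<Longrightarrow> f \<in> borel_measurable N"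
  by (simp add: L2_space_def)

lemma L2_space_integrable: "f \<in> L2_space N \<Longrightarrow> integrable N (\<lambda>x. (norm (f x))\<^sup>2)"
  by (simp add: L2_space_def)

lemma L2_space_iff:
  "f \<in> L2_space N \<longleftrightarrow> f \<in> borel_measurable N \<and> (\<integral>\<^sup>+x. ennreal ((norm (f x))\<^sup>2) \<partial>N) < \<infinity>"
proof (cases "f \<in> borel_measurable N")
  case True
  then have [measurable]: "(\<lambda>x. (norm (f x))\<^sup>2) \<in> borel_measurable N" by measurable
  show ?thesis using True by (auto simp: L2_space_def integrable_iff_bounded)
qed (simp add: L2_space_def)

lemma l2norm_nonneg [simp]: "0 \<le> l2norm N f"
  by (simp add: l2norm_def)

lemma l2norm_power2: "(l2norm N f)\<^sup>2 = (LINT x|N. (norm (f x))\<^sup>2)"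
  by (simp add: l2norm_def)

lemma nn_integral_norm_power2:
  "f \<in> L2_space N \<Longrightarrow> (\<integral>\<^sup>+x. ennreal ((norm (f x))\<^sup>2) \<partial>N) = ennreal ((l2norm N f)\<^sup>2)"
  by (simp add: l2norm_power2 L2_space_integrable nn_integral_eq_integral)

lemma l2norm_le_iff_nn_integral:
  assumes "f \<in> L2_space N" "0 \<le> c"
  shows "l2norm N f \<le> c \<longleftrightarrow> (\<integral>\<^sup>+x. ennreal ((norm (f x))\<^sup>2) \<partial>N) \<le> ennreal (c\<^sup>2)"
  using assms by (simp add: nn_integral_norm_power2 power_mono_iff)

lemma L2_space_AE_cong:
  assumes "f \<in> L2_space N" "g \<in> borel_measurable N" "AE x in N. f x = g x"
  shows "g \<in> L2_space N" and "l2norm N g = l2norm N f"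
proof -
  have [measurable]: "f \<in> borel_measurable N" "g \<in> borel_measurable N"
    using assms by auto
  have ae: "AE x in N. (norm (f x))\<^sup>2 = (norm (g x))\<^sup>2"
    using assms(3) by auto
  have "integrable N (\<lambda>x. (norm (g x))\<^sup>2)"
    by (rule integrable_cong_AE_imp[OF L2_space_integrable[OF assms(1)] _ ae]) simp
  then show "g \<in> L2_space N"
    using assms(2) by (simp add: L2_space_def)
  show "l2norm N g = l2norm N f"
    unfolding l2norm_def using ae by (intro arg_cong[of _ _ sqrt] integral_cong_AE) auto
qed

lemma L2_space_norm_mult:
  assumes "f \<in> L2_space N" "g \<in> L2_space N"
  shows "integrable N (\<lambda>x. norm (f x) * norm (g x))"
    and "(LINT x|N. norm (f x) * norm (g x)) \<le> l2norm N f * l2norm N g"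
proof -
  have [measurable]: "f \<in> borel_measurable N" "g \<in> borel_measurable N"
    using assms by auto
  show int: "integrable N (\<lambda>x. norm (f x) * norm (g x))"
  proof (rule Bochner_Integration.integrable_bound)
    show "integrable N (\<lambda>x. (norm (f x))\<^sup>2 + (norm (g x))\<^sup>2)"
      using assms by (intro Bochner_Integration.integrable_add L2_space_integrable)
    have "\<bar>a * b\<bar> \<le> \<bar>a\<^sup>2 + b\<^sup>2\<bar>" if "0 \<le> a" "0 \<le> b" for a b :: real
    proof -
      have "a * b \<le> a\<^sup>2 + b\<^sup>2"
        using sum_squares_bound[of a b] mult_nonneg_nonneg[OF that] by linarith
      then show ?thesis using that by simp
    qed
    then show "AE x in N. norm (norm (f x) * norm (g x)) \<le> norm ((norm (f x))\<^sup>2 + (norm (g x))\<^sup>2)"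
      by simp
  qed simp
  have "(\<integral>\<^sup>+x. ennreal (norm (f x)) * ennreal (norm (g x)) \<partial>N)\<^sup>2
      \<le> (\<integral>\<^sup>+x. ennreal (norm (f x)) ^ 2 \<partial>N) * (\<integral>\<^sup>+x. ennreal (norm (g x)) ^ 2 \<partial>N)"
    by (rule Cauchy_Schwarz_nn_integral) simp_all
  also have "\<dots> = ennreal ((l2norm N f * l2norm N g)\<^sup>2)"
    using assms by (simp add: ennreal_power nn_integral_norm_power2 ennreal_mult[symmetric] power_mult_distrib)
  also have "(\<integral>\<^sup>+x. ennreal (norm (f x)) * ennreal (norm (g x)) \<partial>N)
      = ennreal (LINT x|N. norm (f x) * norm (g x))"
    using int by (subst nn_integral_eq_integral[symmetric]) (auto simp: ennreal_mult)
  finally have "(LINT x|N. norm (f x) * norm (g x))\<^sup>2 \<le> (l2norm N f * l2norm N g)\<^sup>2"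
    by (simp add: ennreal_power)
  then show "(LINT x|N. norm (f x) * norm (g x)) \<le> l2norm N f * l2norm N g"
    by (rule power2_le_imp_le) simp
qed

lemma L2_space_zero [simp]: "(\<lambda>_. 0) \<in> L2_space N"
  by (simp add: L2_space_def)

lemma L2_space_add:
  assumes "f \<in> L2_space N" "g \<in> L2_space N"
  shows "(\<lambda>x. f x + g x) \<in> L2_space N" and "l2norm N (\<lambda>x. f x + g x) \<le> l2norm N f + l2norm N g"
proof -
  have [measurable]: "f \<in> borel_measurable N" "g \<in> borel_measurable N"
    using assms by auto
  let ?b = "\<lambda>x. (norm (f x))\<^sup>2 + 2 * (norm (f x) * norm (g x)) + (norm (g x))\<^sup>2"
  have intb: "integrable N ?b"
    using assms by (intro Bochner_Integration.integrable_add L2_space_integrable integrable_mult_right L2_space_norm_mult)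
  have le: "(norm (f x + g x))\<^sup>2 \<le> ?b x" for x
    using power_mono[OF norm_triangle_ineq[of "f x" "g x"], of 2] by (simp add: power2_sum)
  have int: "integrable N (\<lambda>x. (norm (f x + g x))\<^sup>2)"
    by (rule Bochner_Integration.integrable_bound[OF intb]) (use le in \<open>auto intro: order_trans[OF _ abs_ge_self]\<close>)
  then show "(\<lambda>x. f x + g x) \<in> L2_space N"
    by (simp add: L2_space_def)
  have "(l2norm N (\<lambda>x. f x + g x))\<^sup>2 \<le> (LINT x|N. ?b x)"
    unfolding l2norm_power2 using int intb le by (intro integral_mono)
  also have "\<dots> = (l2norm N f)\<^sup>2 + 2 * (LINT x|N. norm (f x) * norm (g x)) + (l2norm N g)\<^sup>2"
    using assms by (simp add: l2norm_power2 L2_space_integrable L2_space_norm_mult)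
  also have "\<dots> \<le> (l2norm N f + l2norm N g)\<^sup>2"
    using L2_space_norm_mult(2)[OF assms] by (simp add: power2_sum)
  finally show "l2norm N (\<lambda>x. f x + g x) \<le> l2norm N f + l2norm N g"
    by (rule power2_le_imp_le) simp
qed

lemma L2_space_scaleR:
  assumes "f \<in> L2_space N"
  shows "(\<lambda>x. c *\<^sub>R f x) \<in> L2_space N" and "l2norm N (\<lambda>x. c *\<^sub>R f x) = \<bar>c\<bar> * l2norm N f"
proof -
  show "(\<lambda>x. c *\<^sub>R f x) \<in> L2_space N"
    using assms by (auto simp: L2_space_def power_mult_distrib)
  show "l2norm N (\<lambda>x. c *\<^sub>R f x) = \<bar>c\<bar> * l2norm N f"
    by (simp add: l2norm_def power_mult_distrib real_sqrt_mult)
qed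

lemma L2_space_mult_left:
  fixes f :: "'a \<Rightarrow> real"
  assumes "f \<in> L2_space N"
  shows "(\<lambda>x. c * f x) \<in> L2_space N" and "l2norm N (\<lambda>x. c * f x) = \<bar>c\<bar> * l2norm N f"
  using L2_space_scaleR[OF assms, of c] by simp_all

lemma l2norm_minus: "l2norm N (\<lambda>x. - f x) = l2norm N f"
  by (simp add: l2norm_def)

lemma l2norm_minus_commute: "l2norm N (\<lambda>x. f x - g x) = l2norm N (\<lambda>x. g x - f x)"
  by (simp add: l2norm_def norm_minus_commute)

lemma L2_space_uminus: "f \<in> L2_space N \<Longrightarrow> (\<lambda>x. - f x) \<in> L2_space N"
  by (simp add: L2_space_def)

lemma L2_space_diff:
  assumes "f \<in> L2_space N" "g \<in> L2_space N"
  shows "(\<lambda>x. f x - g x) \<in> L2_space N" and "l2norm N (\<lambda>x. f x - g x) \<le> l2norm N f + l2norm N g"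
  using L2_space_add[OF assms(1) L2_space_uminus[OF assms(2)]] by (simp_all add: l2norm_minus)

lemma l2norm_triangle_diff:
  assumes "f \<in> L2_space N" "g \<in> L2_space N" "h \<in> L2_space N"
  shows "l2norm N (\<lambda>x. f x - h x) \<le> l2norm N (\<lambda>x. f x - g x) + l2norm N (\<lambda>x. g x - h x)"
  using L2_space_add(2)[OF L2_space_diff(1)[OF assms(1,2)] L2_space_diff(1)[OF assms(2,3)]] by simp

lemma l2norm_diff_ineq:
  assumes "f \<in> L2_space N" "g \<in> L2_space N"
  shows "\<bar>l2norm N f - l2norm N g\<bar> \<le> l2norm N (\<lambda>x. f x - g x)"
  using L2_space_add(2)[OF L2_space_diff(1)[OF assms(1,2)] assms(2)]
    L2_space_add(2)[OF L2_space_diff(1)[OF assms(2,1)] assms(1)]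
    l2norm_minus_commute[of N f g] by auto

lemma L2_space_sum:
  assumes "\<And>i. i \<in> I \<Longrightarrow> f i \<in> L2_space N"
  shows "(\<lambda>x. \<Sum>i\<in>I. f i x) \<in> L2_space N"
  using assms by (induction I rule: infinite_finite_induct) (auto intro: L2_space_add)

lemma sq_dist_eq_l2norm:
  assumes "f \<in> L2_space N" "g \<in> L2_space N"
  shows "sq_dist N f g = ennreal ((l2norm N (\<lambda>x. f x - g x))\<^sup>2)"
  unfolding sq_dist_def using assms by (intro nn_integral_norm_power2 L2_space_diff)

lemma sq_dist_less_iff:
  assumes "f \<in> L2_space N" "g \<in> L2_space N" "0 < \<epsilon>"
  shows "sq_dist N f g < ennreal (\<epsilon>\<^sup>2) \<longleftrightarrow> l2norm N (\<lambda>x. f x - g x) < \<epsilon>"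
  using assms power2_less_imp_less[of "l2norm N (\<lambda>x. f x - g x)" \<epsilon>]
    power_strict_mono[of "l2norm N (\<lambda>x. f x - g x)" \<epsilon> 2]
  by (auto simp: sq_dist_eq_l2norm ennreal_less_iff)

lemma tendsto_sq_dist_iff:
  assumes "\<forall>\<^sub>F i in F. f i \<in> L2_space N" "\<forall>\<^sub>F i in F. g i \<in> L2_space N"
  shows "((\<lambda>i. sq_dist N (f i) (g i)) \<longlongrightarrow> 0) F \<longleftrightarrow> ((\<lambda>i. l2norm N (\<lambda>x. f i x - g i x)) \<longlongrightarrow> 0) F"
proof -
  have "((\<lambda>i. sq_dist N (f i) (g i)) \<longlongrightarrow> 0) F
      \<longleftrightarrow> ((\<lambda>i. ennreal ((l2norm N (\<lambda>x. f i x - g i x))\<^sup>2)) \<longlongrightarrow> ennreal 0) F"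
    unfolding ennreal_0
    by (intro tendsto_cong eventually_mono[OF eventually_conj[OF assms]]) (auto simp: sq_dist_eq_l2norm)
  also have "\<dots> \<longleftrightarrow> ((\<lambda>i. (l2norm N (\<lambda>x. f i x - g i x))\<^sup>2) \<longlongrightarrow> 0) F"
    by (rule tendsto_ennreal_iff) auto
  also have "\<dots> \<longleftrightarrow> ((\<lambda>i. l2norm N (\<lambda>x. f i x - g i x)) \<longlongrightarrow> 0) F"
  proof
    assume "((\<lambda>i. (l2norm N (\<lambda>x. f i x - g i x))\<^sup>2) \<longlongrightarrow> 0) F"
    from tendsto_real_sqrt[OF this] show "((\<lambda>i. l2norm N (\<lambda>x. f i x - g i x)) \<longlongrightarrow> 0) F"
      by simp
  next
    assume "((\<lambda>i. l2norm N (\<lambda>x. f i x - g i x)) \<longlongrightarrow> 0) F"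
    from tendsto_power[OF this, of 2] show "((\<lambda>i. (l2norm N (\<lambda>x. f i x - g i x))\<^sup>2) \<longlongrightarrow> 0) F"
      by simp
  qed
  finally show ?thesis .
qed

lemma l2norm_eq_0_iff_AE:
  assumes "f \<in> L2_space N"
  shows "l2norm N f = 0 \<longleftrightarrow> (AE x in N. f x = 0)"
  using integral_nonneg_eq_0_iff_AE[OF L2_space_integrable[OF assms]] by (simp add: l2norm_def)

lemma (in finite_measure) L2_space_integrable_norm:
  assumes "f \<in> L2_space M"
  shows "integrable M f" and "(LINT x|M. norm (f x)) \<le> sqrt (measure M (space M)) * l2norm M f"
proof -
  have [measurable]: "f \<in> borel_measurable M"
    using assms by auto
  have one: "(\<lambda>_. 1::real) \<in> L2_space M"
    by (simp add: L2_space_def)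
  have "integrable M (\<lambda>x. norm (f x))"
    using L2_space_norm_mult(1)[OF assms one] by simp
  then show "integrable M f"
    by (rule integrable_norm_cancel) simp
  show "(LINT x|M. norm (f x)) \<le> sqrt (measure M (space M)) * l2norm M f"
    using L2_space_norm_mult(2)[OF assms one] by (simp add: l2norm_def mult.commute)
qed

text \<open>On a finite measure space an L2 Cauchy sequence is L1 Cauchy, hence has an almost
  everywhere convergent subsequence. Fatou's lemma along that subsequence carries the Cauchy
  estimate over to the limit.\<close>

lemma (in finite_measure) L2_space_complete:
  fixes f :: "nat \<Rightarrow> 'a \<Rightarrow> 'v::{real_normed_vector,second_countable_topology,banach}"
  assumes L2: "\<And>n. f n \<in> L2_space M"
    and Cauchy: "\<And>\<epsilon>. 0 < \<epsilon> \<Longrightarrow> \<exists>N. \<forall>m\<ge>N. \<forall>n\<ge>N. l2norm M (\<lambda>x. f m x - f n x) < \<epsilon>"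
  obtains F where "F \<in> L2_space M" "(\<lambda>n. l2norm M (\<lambda>x. f n x - F x)) \<longlonglongrightarrow> 0"
proof -
  have [measurable]: "\<And>n. f n \<in> borel_measurable M"
    using L2 by auto
  \<comment> \<open>The summand 1 keeps the constant positive when the measure is 0, so that
    \<epsilon> may be divided by it.\<close>
  let ?c = "sqrt (measure M (space M)) + 1"
  have c: "?c > 0"
    by (simp add: add_nonneg_pos)
  obtain r where r: "strict_mono r" and Cau: "AE x in M. Cauchy (\<lambda>i. f (r i) x)"
  proof (rule cauchy_L1_AE_cauchy_subseq[of M f])
    fix e :: real assume "0 < e"
    then obtain N where N: "\<And>m n. m \<ge> N \<Longrightarrow> n \<ge> N \<Longrightarrow> l2norm M (\<lambda>x. f m x - f n x) < e / ?c"
      using Cauchy[of "e / ?c"] c by (metis divide_pos_pos)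
    have "(LINT x|M. norm (f m x - f n x)) < e" if "m \<ge> N" "n \<ge> N" for m n
    proof -
      have "(LINT x|M. norm (f m x - f n x)) \<le> ?c * l2norm M (\<lambda>x. f m x - f n x)"
        by (rule order_trans[OF L2_space_integrable_norm(2)[OF L2_space_diff(1)[OF L2 L2]]])
          (intro mult_right_mono, auto)
      also have "\<dots> < e"
        using N[OF that] c by (simp add: field_simps)
      finally show ?thesis .
    qed
    then show "\<exists>N. \<forall>i\<ge>N. \<forall>j\<ge>N. (LINT x|M. norm (f i x - f j x)) < e"
      by blast
  qed (use L2 L2_space_integrable_norm in auto)
  define F where "F = (\<lambda>x. lim (\<lambda>i. f (r i) x))"
  have [measurable]: "F \<in> borel_measurable M"
    unfolding F_def by (intro borel_measurable_lim_metric) simp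
  have lim: "AE x in M. (\<lambda>i. f (r i) x) \<longlonglongrightarrow> F x"
    using Cau by eventually_elim (auto simp: F_def Cauchy_convergent_iff convergent_LIMSEQ_iff)
  have bound: "\<exists>N. \<forall>n\<ge>N. (\<integral>\<^sup>+x. ennreal ((norm (f n x - F x))\<^sup>2) \<partial>M) \<le> ennreal (\<epsilon>\<^sup>2)" if "0 < \<epsilon>" for \<epsilon> :: real
  proof -
    obtain N where N: "\<And>m n. m \<ge> N \<Longrightarrow> n \<ge> N \<Longrightarrow> l2norm M (\<lambda>x. f m x - f n x) < \<epsilon>"
      using Cauchy[OF \<open>0 < \<epsilon>\<close>] by metis
    have "(\<integral>\<^sup>+x. ennreal ((norm (f n x - F x))\<^sup>2) \<partial>M) \<le> ennreal (\<epsilon>\<^sup>2)" if n: "n \<ge> N" for n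
    proof -
      have "(\<integral>\<^sup>+x. ennreal ((norm (f n x - F x))\<^sup>2) \<partial>M)
          = (\<integral>\<^sup>+x. liminf (\<lambda>i. ennreal ((norm (f n x - f (r i) x))\<^sup>2)) \<partial>M)"
        using lim
      proof (intro nn_integral_cong_AE, eventually_elim)
        case (elim x)
        then have "(\<lambda>i. ennreal ((norm (f n x - f (r i) x))\<^sup>2)) \<longlonglongrightarrow> ennreal ((norm (f n x - F x))\<^sup>2)"
          by (intro tendsto_ennrealI tendsto_intros)
        then show ?case
          by (intro lim_imp_Liminf[symmetric]) auto
      qed
      also have "\<dots> \<le> liminf (\<lambda>i. \<integral>\<^sup>+x. ennreal ((norm (f n x - f (r i) x))\<^sup>2) \<partial>M)"
        by (rule nn_integral_liminf) simp
      also have "\<dots> \<le> ennreal (\<epsilon>\<^sup>2)"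
      proof (rule Liminf_le)
        have "(\<integral>\<^sup>+x. ennreal ((norm (f n x - f (r i) x))\<^sup>2) \<partial>M) \<le> ennreal (\<epsilon>\<^sup>2)" if "i \<ge> N" for i
        proof -
          have "r i \<ge> N"
            using seq_suble[OF r, of i] that by simp
          then show ?thesis
            using N[OF n] L2_space_diff(1)[OF L2 L2] \<open>0 < \<epsilon>\<close>
            by (subst l2norm_le_iff_nn_integral[symmetric]) (auto intro: less_imp_le)
        qed
        then show "\<forall>\<^sub>F i in sequentially. (\<integral>\<^sup>+x. ennreal ((norm (f n x - f (r i) x))\<^sup>2) \<partial>M) \<le> ennreal (\<epsilon>\<^sup>2)"
          by (auto simp: eventually_at_top_linorder)
      qed simp
      finally show ?thesis .
    qed
    then show ?thesis by blast
  qed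
  have FL2: "F \<in> L2_space M"
  proof -
    obtain N where "(\<integral>\<^sup>+x. ennreal ((norm (f N x - F x))\<^sup>2) \<partial>M) \<le> ennreal (1\<^sup>2)"
      using bound[of 1] by auto
    then have "(\<integral>\<^sup>+x. ennreal ((norm (f N x - F x))\<^sup>2) \<partial>M) < \<infinity>"
      by (rule le_less_trans) simp
    then have "(\<lambda>x. f N x - F x) \<in> L2_space M"
      by (simp add: L2_space_iff)
    from L2_space_diff(1)[OF L2[of N] this] show ?thesis by simp
  qed
  moreover have "(\<lambda>n. l2norm M (\<lambda>x. f n x - F x)) \<longlonglongrightarrow> 0"
  proof (rule LIMSEQ_I)
    fix e :: real assume e: "0 < e"
    obtain N where N: "\<And>n. n \<ge> N \<Longrightarrow> (\<integral>\<^sup>+x. ennreal ((norm (f n x - F x))\<^sup>2) \<partial>M) \<le> ennreal ((e/2)\<^sup>2)"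
      using bound[of "e/2"] e by auto
    have "l2norm M (\<lambda>x. f n x - F x) \<le> e / 2" if "n \<ge> N" for n
      using N[OF that] e l2norm_le_iff_nn_integral[OF L2_space_diff(1)[OF L2[of n] FL2], of "e / 2"] by simp
    then have "\<forall>n\<ge>N. norm (l2norm M (\<lambda>x. f n x - F x) - 0) < e"
      using e by fastforce
    then show "\<exists>N. \<forall>n\<ge>N. norm (l2norm M (\<lambda>x. f n x - F x) - 0) < e"
      by blast
  qed
  ultimately show thesis by (rule that)
qed

section \<open>Mean-square continuity and jointly measurable versions\<close>

definition l2_continuous :: "'a measure \<Rightarrow> (real \<Rightarrow> 'a \<Rightarrow> 'v::{real_normed_vector,second_countable_topology,banach}) \<Rightarrow> bool" where
  "l2_continuous N f \<longleftrightarrow> (\<forall>t\<ge>0. f t \<in> L2_space N) \<and>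
     (\<forall>t\<ge>0. \<forall>\<epsilon>>0. \<exists>\<delta>>0. \<forall>s\<ge>0. \<bar>s - t\<bar> < \<delta> \<longrightarrow> l2norm N (\<lambda>x. f s x - f t x) < \<epsilon>)"

lemma l2_continuousD:
  assumes "l2_continuous N f" "0 \<le> t"
  shows "f t \<in> L2_space N"
    and "((\<lambda>s. l2norm N (\<lambda>x. f s x - f t x)) \<longlongrightarrow> 0) (at t within {0..})"
proof -
  show "f t \<in> L2_space N"
    using assms by (simp add: l2_continuous_def)
  have "\<exists>\<delta>>0. \<forall>s\<in>{0..}. s \<noteq> t \<and> dist s t < \<delta> \<longrightarrow> dist (l2norm N (\<lambda>x. f s x - f t x)) 0 < \<epsilon>" if "0 < \<epsilon>" for \<epsilon>
    using assms that unfolding l2_continuous_def dist_real_def by fastforce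
  then show "((\<lambda>s. l2norm N (\<lambda>x. f s x - f t x)) \<longlongrightarrow> 0) (at t within {0..})"
    unfolding tendsto_iff eventually_at by blast
qed

lemma l2_continuousI:
  assumes "\<And>t. 0 \<le> t \<Longrightarrow> f t \<in> L2_space N"
    and "\<And>t. 0 \<le> t \<Longrightarrow> ((\<lambda>s. l2norm N (\<lambda>x. f s x - f t x)) \<longlongrightarrow> 0) (at t within {0..})"
  shows "l2_continuous N f"
  unfolding l2_continuous_def
proof (intro conjI allI impI)
  fix t \<epsilon> :: real assume t: "0 \<le> t" and e: "0 < \<epsilon>"
  obtain \<delta> where d: "\<delta> > 0" "\<And>s. s \<in> {0..} \<Longrightarrow> s \<noteq> t \<Longrightarrow> dist s t < \<delta> \<Longrightarrow> dist (l2norm N (\<lambda>x. f s x - f t x)) 0 < \<epsilon>"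
    using assms(2)[OF t] e unfolding tendsto_iff eventually_at by metis
  have "l2norm N (\<lambda>x. f s x - f t x) < \<epsilon>" if "s \<ge> 0" "\<bar>s - t\<bar> < \<delta>" for s
    using d(2)[of s] that e by (cases "s = t") (auto simp: dist_real_def l2norm_def)
  then show "\<exists>\<delta>>0. \<forall>s\<ge>0. \<bar>s - t\<bar> < \<delta> \<longrightarrow> l2norm N (\<lambda>x. f s x - f t x) < \<epsilon>"
    using d(1) by auto
qed (use assms in auto)

text \<open>A Lebesgue number of the cover of \<open>{0..T}\<close> by balls on which
  \<open>f\<close> stays within \<epsilon>/2 of its value at the centre.\<close>

lemma l2_continuous_uniform:
  assumes "l2_continuous N f" "0 < \<epsilon>"
  obtains \<delta> where "0 < \<delta>" "\<And>s t. s \<in> {0..T} \<Longrightarrow> t \<in> {0..T} \<Longrightarrow> \<bar>s - t\<bar> < \<delta> \<Longrightarrow> l2norm N (\<lambda>x. f s x - f t x) < \<epsilon>"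
proof -
  have L2: "\<And>t. 0 \<le> t \<Longrightarrow> f t \<in> L2_space N"
    using assms by (simp add: l2_continuous_def)
  have "\<forall>t\<in>{0..T}. \<exists>\<delta>>0. \<forall>s\<ge>0. \<bar>s - t\<bar> < \<delta> \<longrightarrow> l2norm N (\<lambda>x. f s x - f t x) < \<epsilon> / 2"
    using assms(1) half_gt_zero[OF assms(2)] unfolding l2_continuous_def by (metis atLeastAtMost_iff)
  then obtain d where d: "\<And>t. t \<in> {0..T} \<Longrightarrow> d t > 0"
      "\<And>t s. t \<in> {0..T} \<Longrightarrow> s \<ge> 0 \<Longrightarrow> \<bar>s - t\<bar> < d t \<Longrightarrow> l2norm N (\<lambda>x. f s x - f t x) < \<epsilon> / 2"
    by metis
  obtain \<delta> where \<delta>: "0 < \<delta>" "\<And>t. t \<in> {0..T} \<Longrightarrow> \<exists>G\<in>(\<lambda>t. ball t (d t)) ` {0..T}. ball t \<delta> \<subseteq> G"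
  proof (rule Heine_Borel_lemma[of "{0..T}" "(\<lambda>t. ball t (d t)) ` {0..T}"])
    show "{0..T} \<subseteq> \<Union> ((\<lambda>t. ball t (d t)) ` {0..T})"
      using d(1) by force
  qed auto
  have "l2norm N (\<lambda>x. f s x - f t x) < \<epsilon>" if st: "s \<in> {0..T}" "t \<in> {0..T}" "\<bar>s - t\<bar> < \<delta>" for s t
  proof -
    obtain c where c: "c \<in> {0..T}" "ball t \<delta> \<subseteq> ball c (d c)"
      using \<delta>(2)[OF st(2)] by auto
    have "t \<in> ball t \<delta>" "s \<in> ball t \<delta>"
      using st(3) \<delta>(1) by (auto simp: dist_real_def)
    then have "t \<in> ball c (d c)" "s \<in> ball c (d c)"
      using c(2) by blast+
    then have "l2norm N (\<lambda>x. f s x - f c x) < \<epsilon> / 2" "l2norm N (\<lambda>x. f t x - f c x) < \<epsilon> / 2"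
      using d(2)[OF c(1)] st by (auto simp: dist_real_def abs_minus_commute)
    then show ?thesis
      using l2norm_triangle_diff[OF L2 L2 L2, of s c t] st c l2norm_minus_commute[of N "f t" "f c"]
      by auto
  qed
  then show thesis using \<delta>(1) that by blast
qed

lemma l2_continuous_bounded:
  assumes "l2_continuous N f"
  obtains C where "0 \<le> C" "\<And>t. t \<in> {0..T} \<Longrightarrow> l2norm N (f t) \<le> C"
proof (cases "0 \<le> T")
  case True
  have "continuous_on {0..T} (\<lambda>t. l2norm N (f t))"
    unfolding continuous_on_iff
  proof (intro ballI allI impI)
    fix t \<epsilon> :: real assume t: "t \<in> {0..T}" and e: "0 < \<epsilon>"
    obtain \<delta> where \<delta>: "\<delta> > 0" "\<And>s. s \<ge> 0 \<Longrightarrow> \<bar>s - t\<bar> < \<delta> \<Longrightarrow> l2norm N (\<lambda>x. f s x - f t x) < \<epsilon>"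
      using assms t e unfolding l2_continuous_def by (metis atLeastAtMost_iff)
    have "dist (l2norm N (f s)) (l2norm N (f t)) < \<epsilon>" if "s \<in> {0..T}" "dist s t < \<delta>" for s
    proof -
      have "\<bar>l2norm N (f s) - l2norm N (f t)\<bar> \<le> l2norm N (\<lambda>x. f s x - f t x)"
        using l2norm_diff_ineq[of "f s" N "f t"] assms that t by (auto simp: l2_continuous_def)
      then show ?thesis
        using \<delta>(2)[of s] that by (auto simp: dist_real_def)
    qed
    then show "\<exists>d>0. \<forall>x'\<in>{0..T}. dist x' t < d \<longrightarrow> dist (l2norm N (f x')) (l2norm N (f t)) < \<epsilon>"
      using \<delta>(1) by blast
  qed
  then obtain x where "\<forall>y\<in>{0..T}. l2norm N (f y) \<le> l2norm N (f x)"
    using continuous_attains_sup[of "{0..T}" "\<lambda>t. l2norm N (f t)"] True by auto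
  then show ?thesis
    using that[of "l2norm N (f x)"] by auto
qed (use that[of 0] in auto)

text \<open>Continuity in mean constrains \<open>f t\<close> only up to a null set for each
  \<open>t\<close>, so \<open>f\<close> itself may fail to be jointly measurable. Step processes
  sampled on finer and finer grids are jointly measurable; with grids fine enough for the squared
  errors to be summable, they converge almost everywhere at every fixed time.\<close>

lemma (in finite_measure) l2_continuous_modification:
  fixes f :: "real \<Rightarrow> 'a \<Rightarrow> 'v::{real_normed_vector,second_countable_topology,banach}"
  assumes cont: "l2_continuous M f"
  obtains F where "(\<lambda>(t, x). F t x) \<in> borel_measurable (restrict_space borel {0..} \<Otimes>\<^sub>M M)"
    "\<forall>t\<ge>0. AE x in M. F t x = f t x"
proof -
  have L2: "\<And>t. 0 \<le> t \<Longrightarrow> f t \<in> L2_space M"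
    using cont by (simp add: l2_continuous_def)
  \<comment> \<open>A grid of mesh 1/n on which sampling costs at most 2^-k. The interval grows with
    \<open>k\<close>, so that each time is eventually covered.\<close>
  have "\<exists>n::nat. 0 < n \<and> (\<forall>s\<in>{0..real k}. \<forall>t\<in>{0..real k}. \<bar>s - t\<bar> \<le> 1 / real n \<longrightarrow>
      l2norm M (\<lambda>x. f s x - f t x) \<le> (1/2)^k)" for k
  proof -
    obtain \<delta> where \<delta>: "0 < \<delta>" "\<And>s t. s \<in> {0..real k} \<Longrightarrow> t \<in> {0..real k} \<Longrightarrow> \<bar>s - t\<bar> < \<delta>
        \<Longrightarrow> l2norm M (\<lambda>x. f s x - f t x) < (1/2)^k"
      using l2_continuous_uniform[OF cont, of "(1/2)^k" "real k"] by auto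
    obtain n where n: "n > 0" "1 / real n < \<delta>"
      using \<delta>(1) by (metis nat_approx_posE of_nat_Suc zero_less_Suc)
    then show ?thesis
      using \<delta>(2) by (intro exI[of _ n]) (force intro: less_imp_le)
  qed
  then obtain n where n: "\<And>k. 0 < n k" "\<And>k s t. s \<in> {0..real k} \<Longrightarrow> t \<in> {0..real k} \<Longrightarrow>
      \<bar>s - t\<bar> \<le> 1 / real (n k) \<Longrightarrow> l2norm M (\<lambda>x. f s x - f t x) \<le> (1/2)^k"
    by metis
  \<comment> \<open>\<open>p k t\<close> is \<open>t\<close> rounded down to the k-th grid. It takes
    countably many values, which reduces joint measurability to measurability of each sampled
    \<open>f (real i / real (n k))\<close>.\<close>
  define p where "p = (\<lambda>k t. real (nat \<lfloor>real (n k) * t\<rfloor>) / real (n k))"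
  have p: "0 \<le> p k t" "p k t \<le> t" "\<bar>p k t - t\<bar> \<le> 1 / real (n k)" if "0 \<le> t" for k t
  proof -
    have np: "real (n k) > 0" using n(1) by simp
    have fl: "real (nat \<lfloor>real (n k) * t\<rfloor>) = of_int \<lfloor>real (n k) * t\<rfloor>"
      using that np by simp
    show "0 \<le> p k t" by (simp add: p_def)
    show 1: "p k t \<le> t"
      unfolding p_def fl using np by (simp add: pos_divide_le_eq mult.commute)
    have "real (n k) * t - 1 \<le> of_int \<lfloor>real (n k) * t\<rfloor>"
      by linarith
    then have "(real (n k) * t - 1) / real (n k) \<le> p k t"
      unfolding p_def fl using np by (intro divide_right_mono) auto
    then have "t - 1 / real (n k) \<le> p k t"
      using np by (simp add: diff_divide_distrib)
    then show "\<bar>p k t - t\<bar> \<le> 1 / real (n k)"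
      using 1 by simp
  qed
  define F where "F = (\<lambda>t x. lim (\<lambda>k. f (p k t) x))"
  have "(\<lambda>z. f (p k (fst z)) (snd z)) \<in> borel_measurable (restrict_space borel {0..} \<Otimes>\<^sub>M M)" for k
  proof -
    have [measurable]: "f (real i / real (n k)) \<in> borel_measurable M" for i
      using L2 by auto
    have m: "(\<lambda>z. f (real i / real (n k)) (snd z)) \<in> borel_measurable (restrict_space borel {0..} \<Otimes>\<^sub>M M)" for i
      by measurable
    have [measurable]: "fst \<in> borel_measurable (restrict_space borel {0..} \<Otimes>\<^sub>M M :: (real \<times> 'a) measure)"
      by (rule measurable_compose[OF measurable_fst]) (simp add: measurable_restrict_space1)
    have m2: "(\<lambda>z. nat \<lfloor>real (n k) * fst z\<rfloor>) \<in> restrict_space borel {0..} \<Otimes>\<^sub>M M \<rightarrow>\<^sub>M count_space UNIV"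
      by measurable
    show ?thesis
      using measurable_compose_countable[OF m m2] by (simp add: p_def)
  qed
  then have "(\<lambda>z. lim (\<lambda>k. f (p k (fst z)) (snd z))) \<in> borel_measurable (restrict_space borel {0..} \<Otimes>\<^sub>M M)"
    by (rule borel_measurable_lim_metric)
  then have "(\<lambda>(t, x). F t x) \<in> borel_measurable (restrict_space borel {0..} \<Otimes>\<^sub>M M)"
    by (simp add: F_def case_prod_beta')
  moreover have "AE x in M. F t x = f t x" if t: "0 \<le> t" for t
  proof -
    \<comment> \<open>From index \<open>k0\<close> on the sampling bounds apply at \<open>t\<close>.
      The expected squared errors then sum to at most a geometric series, so almost surely the
      errors themselves tend to 0.\<close>
    obtain k0 where k0: "t \<le> real k0"
      using real_arch_simple by blast
    have fp: "f (p k t) \<in> L2_space M" "f t \<in> L2_space M" for k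
      using L2 p(1) t by auto
    have [measurable]: "f (p k t) \<in> borel_measurable M" "f t \<in> borel_measurable M" for k
      using fp by auto
    have "(\<integral>\<^sup>+x. (\<Sum>k. ennreal ((norm (f (p (k + k0) t) x - f t x))\<^sup>2)) \<partial>M)
        = (\<Sum>k. \<integral>\<^sup>+x. ennreal ((norm (f (p (k + k0) t) x - f t x))\<^sup>2) \<partial>M)"
      by (rule nn_integral_suminf) simp
    also have "\<dots> \<le> (\<Sum>k. ennreal ((1/2)^k))"
    proof (rule suminf_le)
      fix k
      have "l2norm M (\<lambda>x. f (p (k + k0) t) x - f t x) \<le> (1/2)^(k + k0)"
        using p[OF t, of "k + k0"] k0 t by (intro n(2)) auto
      then have "(\<integral>\<^sup>+x. ennreal ((norm (f (p (k + k0) t) x - f t x))\<^sup>2) \<partial>M) \<le> ennreal (((1/2)^(k + k0))\<^sup>2)"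
        using l2norm_le_iff_nn_integral[OF L2_space_diff(1)[OF fp(1) fp(2)], of "(1/2)^(k + k0)" "k + k0"] by simp
      also have "((1/2)^(k + k0))\<^sup>2 \<le> (1/2::real)^k"
        unfolding power_mult[symmetric] by (rule power_decreasing) auto
      finally show "(\<integral>\<^sup>+x. ennreal ((norm (f (p (k + k0) t) x - f t x))\<^sup>2) \<partial>M) \<le> ennreal ((1/2)^k)"
        by (simp add: ennreal_leI)
    qed auto
    also have "\<dots> = ennreal (\<Sum>k. (1/2)^k)"
      by (rule suminf_ennreal2) auto
    also have "\<dots> < \<infinity>" by simp
    finally have fin: "(\<integral>\<^sup>+x. (\<Sum>k. ennreal ((norm (f (p (k + k0) t) x - f t x))\<^sup>2)) \<partial>M) \<noteq> \<infinity>"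
      by simp
    have "AE x in M. (\<Sum>k. ennreal ((norm (f (p (k + k0) t) x - f t x))\<^sup>2)) \<noteq> \<infinity>"
      by (rule nn_integral_PInf_AE[OF _ fin]) simp
    then show ?thesis
    proof eventually_elim
      case (elim x)
      then have "summable (\<lambda>k. (norm (f (p (k + k0) t) x - f t x))\<^sup>2)"
        by (intro summable_suminf_not_top) auto
      then have "(\<lambda>k. (norm (f (p (k + k0) t) x - f t x))\<^sup>2) \<longlonglongrightarrow> 0"
        by (rule summable_LIMSEQ_zero)
      from tendsto_real_sqrt[OF this] have "(\<lambda>k. f (p (k + k0) t) x - f t x) \<longlonglongrightarrow> 0"
        by (simp add: tendsto_norm_zero_iff)
      then have "(\<lambda>k. f (p (k + k0) t) x) \<longlonglongrightarrow> f t x"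
        by (simp add: LIM_zero_iff)
      then have "(\<lambda>k. f (p k t) x) \<longlonglongrightarrow> f t x"
        by (rule LIMSEQ_offset)
      then show ?case
        by (simp add: F_def limI)
    qed
  qed
  ultimately show thesis using that by blast
qed

section \<open>Mittag-Leffler functions and the relaxation kernel\<close>

text \<open>Only the part of Euler's integral over \<open>{R..R+1}\<close> is kept. Since
  \<open>R\<close> is free, Gamma outgrows every geometric sequence along an arithmetic progression,
  which is what the Mittag-Leffler series needs.\<close>

lemma Gamma_real_lower_bound:
  fixes x R :: real
  assumes "1 \<le> x" "0 < R"
  shows "R powr (x - 1) * exp (- (R + 1)) \<le> Gamma x"
proof -
  have "ennreal (R powr (x - 1) * exp (- (R + 1)))
      = (\<integral>\<^sup>+t. ennreal (R powr (x - 1) * exp (- (R + 1))) * indicator {R..R+1} t \<partial>lborel)"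
    by (simp add: nn_integral_cmult)
  also have "\<dots> \<le> (\<integral>\<^sup>+t. ennreal (indicator {0..} t * t powr (x - 1) / exp t) \<partial>lborel)"
  proof (rule nn_integral_mono)
    fix t :: real
    have "R powr (x - 1) * exp (- (R + 1)) \<le> t powr (x - 1) * exp (- t)" if "t \<in> {R..R+1}"
      using that assms by (intro mult_mono powr_mono2) auto
    then show "ennreal (R powr (x - 1) * exp (- (R + 1))) * indicator {R..R+1} t
        \<le> ennreal (indicator {0..} t * t powr (x - 1) / exp t)"
      using assms by (auto simp: indicator_def exp_minus field_simps intro!: ennreal_leI)
  qed
  also have "\<dots> = ennreal (Gamma x)"
    using Gamma_conv_nn_integral_real[of x] assms by simp
  finally show ?thesis
    using assms by (subst (asm) ennreal_le_iff) (auto intro!: Gamma_real_nonneg)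
qed

lemma summable_mittag_leffler:
  fixes z :: real
  assumes "0 < a" "0 < b"
  shows "summable (\<lambda>n. z ^ n / Gamma (a * real n + b))"
proof (rule summable_comparison_test_ev)
  \<comment> \<open>Chosen so that \<open>R powr a\<close> is at least twice |z|, which gives
    domination by a geometric series of ratio 1/2. The added 1 keeps \<open>R\<close> positive for z
    = 0.\<close>
  define R where "R = (2 * \<bar>z\<bar> + 1) powr (1 / a)"
  have R: "R > 0" "R powr a = 2 * \<bar>z\<bar> + 1"
    using assms by (auto simp: R_def powr_powr)
  let ?C = "R powr (1 - b) * exp (R + 1)"
  obtain n0 :: nat where n0: "real n0 \<ge> 1 / a"
    using real_arch_simple by blast
  have "norm (z ^ n / Gamma (a * real n + b)) \<le> ?C * (1/2) ^ n" if "n \<ge> n0" for n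
  proof -
    have "1 / a \<le> real n"
      using n0 that by linarith
    then have "1 \<le> a * real n + b"
      using assms by (simp add: field_simps)
    then have G: "R powr (a * real n + b - 1) * exp (- (R + 1)) \<le> Gamma (a * real n + b)"
      using R by (intro Gamma_real_lower_bound) auto
    have "R powr (a * real n + b - 1) = (R powr a) powr real n * R powr (b - 1)"
      by (simp add: powr_powr powr_add[symmetric] algebra_simps)
    also have "\<dots> = (2 * \<bar>z\<bar> + 1) ^ n * R powr (b - 1)"
      using R by (simp add: powr_realpow)
    finally have eq: "R powr (a * real n + b - 1) = (2 * \<bar>z\<bar> + 1) ^ n * R powr (b - 1)" .
    have "norm (z ^ n / Gamma (a * real n + b)) = \<bar>z\<bar> ^ n / Gamma (a * real n + b)"
      using \<open>1 \<le> a * real n + b\<close> Gamma_real_pos[of "a * real n + b"] by (simp add: power_abs)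
    also have "\<dots> \<le> \<bar>z\<bar> ^ n / (R powr (a * real n + b - 1) * exp (- (R + 1)))"
      using G R \<open>1 \<le> a * real n + b\<close> by (intro divide_left_mono mult_pos_pos Gamma_real_pos) auto
    also have "\<dots> = ?C * (\<bar>z\<bar> / (2 * \<bar>z\<bar> + 1)) ^ n"
      using R unfolding eq
      using abs_ge_zero[of z]
      by (simp add: add_nonneg_eq_0_iff power_divide exp_minus_inverse powr_diff field_simps del: minus_add_distrib)
    also have "\<dots> \<le> ?C * (1/2) ^ n"
      by (intro mult_left_mono power_mono) (auto simp: field_simps)
    finally show ?thesis .
  qed
  then show "\<forall>\<^sub>F n in sequentially. norm (z ^ n / Gamma (a * real n + b)) \<le> ?C * (1/2) ^ n"
    by (auto simp: eventually_at_top_linorder)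
  show "summable (\<lambda>n. ?C * (1/2::real) ^ n)"
    by (intro summable_mult summable_geometric) simp
qed

lemma mittag_leffler_recurrence:
  assumes "0 < a" "0 < b"
  shows "mittag_leffler a b z = 1 / Gamma b + z * mittag_leffler a (a + b) z"
proof -
  have "mittag_leffler a b z = 1 / Gamma b + (\<Sum>n. z ^ Suc n / Gamma (a * real (Suc n) + b))"
    unfolding mittag_leffler_def using suminf_split_head[OF summable_mittag_leffler[OF assms, of z]] by simp
  also have "(\<Sum>n. z ^ Suc n / Gamma (a * real (Suc n) + b)) = (\<Sum>n. z * (z ^ n / Gamma (a * real n + (a + b))))"
    by (simp add: algebra_simps)
  also have "\<dots> = z * mittag_leffler a (a + b) z"
    unfolding mittag_leffler_def using assms by (intro suminf_mult summable_mittag_leffler) auto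
  finally show ?thesis .
qed

lemma mittag_leffler_has_derivative:
  assumes "0 < a" "0 < b"
  shows "\<exists>D. (mittag_leffler a b has_field_derivative D) (at z)"
proof -
  have "((\<lambda>z. \<Sum>n. (1 / Gamma (a * real n + b)) * z ^ n) has_field_derivative
      (\<Sum>n. diffs (\<lambda>n. 1 / Gamma (a * real n + b)) n * z ^ n)) (at z)"
    using summable_mittag_leffler[OF assms] by (intro termdiffs_strong_converges_everywhere) simp
  then show ?thesis
    unfolding mittag_leffler_def[abs_def] by auto
qed

lemma continuous_on_mittag_leffler:
  assumes "0 < a" "0 < b"
  shows "continuous_on S (mittag_leffler a b)"
  using mittag_leffler_has_derivative[OF assms] DERIV_isCont
  by (intro continuous_at_imp_continuous_on) blast

lemma mittag_leffler_one_one: "mittag_leffler 1 1 z = exp z"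
  unfolding mittag_leffler_def exp_def
  by (simp add: Gamma_fact[symmetric] add.commute divide_inverse mult.commute)

section \<open>Power kernels and the relaxation kernel\<close>

text \<open>The Riemann-Liouville kernel: convolution with it is fractional integration of order
  \<open>a\<close>.\<close>

definition frac_kernel :: "real \<Rightarrow> real \<Rightarrow> real" where
  "frac_kernel a x = x powr (a - 1) / Gamma a"

text \<open>For \<open>b = \<beta>\<close> this is the kernel of the solution formula. Fractional
  integration of order \<open>a\<close> raises \<open>b\<close> by \<open>a\<close>, so one family
  contains the kernel together with all its fractional integrals.\<close>

definition relaxation :: "real \<Rightarrow> real \<Rightarrow> real \<Rightarrow> real \<Rightarrow> real" where
  "relaxation \<beta> b \<mu> x = x powr (b - 1) * mittag_leffler \<beta> b (- (x powr \<beta> * \<mu>))"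

lemma kernel_eq_relaxation: "kernel \<beta> \<mu> t s = relaxation \<beta> \<beta> \<mu> (t - s)"
  by (simp add: kernel_def relaxation_def)

lemma frac_kernel_nonneg: "0 < a \<Longrightarrow> 0 \<le> frac_kernel a x"
  by (simp add: frac_kernel_def)

lemma frac_kernel_measurable [measurable]: "frac_kernel a \<in> borel_measurable borel"
  unfolding frac_kernel_def by measurable

lemma relaxation_measurable [measurable]:
  assumes "0 < \<beta>" "0 < b"
  shows "relaxation \<beta> b \<mu> \<in> borel_measurable borel"
proof -
  have [measurable]: "mittag_leffler \<beta> b \<in> borel_measurable borel"
    by (intro borel_measurable_continuous_onI continuous_on_mittag_leffler assms)
  show ?thesis
    unfolding relaxation_def[abs_def] by measurable
qed

text \<open>The family is a Neumann series in powers of -\<mu> times fractional integration of order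
  \<beta>. The absolute summability is recorded because it licenses termwise integration.\<close>

lemma relaxation_sums:
  assumes "0 < \<beta>" "0 < b" "0 < x"
  shows "(\<lambda>n. (- \<mu>) ^ n * frac_kernel (\<beta> * real n + b) x) sums relaxation \<beta> b \<mu> x"
    and "summable (\<lambda>n. norm ((- \<mu>) ^ n * frac_kernel (\<beta> * real n + b) x))"
proof -
  have eq: "(- \<mu>) ^ n * frac_kernel (\<beta> * real n + b) x
      = x powr (b - 1) * ((- (x powr \<beta> * \<mu>)) ^ n / Gamma (\<beta> * real n + b))" for n \<mu>
  proof -
    have "x powr (\<beta> * real n + b - 1) = x powr (b - 1) * (x powr \<beta>) ^ n"
      using assms by (simp add: powr_realpow[symmetric] powr_powr powr_add[symmetric] algebra_simps)
    moreover have "(- (x powr \<beta> * \<mu>)) ^ n = (x powr \<beta>) ^ n * (- \<mu>) ^ n"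
      by (simp flip: power_mult_distrib)
    ultimately show ?thesis
      by (simp add: frac_kernel_def)
  qed
  show "(\<lambda>n. (- \<mu>) ^ n * frac_kernel (\<beta> * real n + b) x) sums relaxation \<beta> b \<mu> x"
    unfolding eq relaxation_def mittag_leffler_def
    using assms by (intro sums_mult summable_sums summable_mittag_leffler) auto
  have "summable (\<lambda>n. (- (- \<bar>\<mu>\<bar>)) ^ n * frac_kernel (\<beta> * real n + b) x)"
    unfolding eq using assms by (intro summable_mult summable_mittag_leffler) auto
  moreover have "norm ((- \<mu>) ^ n * frac_kernel (\<beta> * real n + b) x) = (- (- \<bar>\<mu>\<bar>)) ^ n * frac_kernel (\<beta> * real n + b) x" for n
  proof -
    have "\<beta> * real n + b > 0"
      using assms by (simp add: add_nonneg_pos)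
    then show ?thesis
      by (simp add: abs_mult power_abs frac_kernel_nonneg)
  qed
  ultimately show "summable (\<lambda>n. norm ((- \<mu>) ^ n * frac_kernel (\<beta> * real n + b) x))"
    by simp
qed

text \<open>The substitution s = t x produces a Beta integral, whose Gamma quotient is absorbed by
  the normalisation of the kernels: fractional integrals form a semigroup.\<close>

lemma frac_kernel_convolution:
  assumes a: "0 < a" and b: "0 < b" and t: "0 < t"
  shows "has_bochner_integral lborel (\<lambda>s. indicator {0<..<t} s * (frac_kernel a (t - s) * frac_kernel b s)) (frac_kernel (a + b) t)"
proof (rule has_bochner_integral_nn_integral)
  let ?f = "\<lambda>s. indicator {0<..<t} s * (frac_kernel a (t - s) * frac_kernel b s)"
  let ?c = "t powr (a + b - 2) / (Gamma a * Gamma b)"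
  have G: "Gamma a > 0" "Gamma b > 0" "Gamma (a + b) > 0"
    using a b by auto
  have eq: "?f (t * x) = ?c * (indicator {0..1} x * (x powr (b - 1) * (1 - x) powr (a - 1)))" for x
  proof (cases "x \<in> {0<..<1}")
    case True
    have "(t - t * x) powr (a - 1) = t powr (a - 1) * (1 - x) powr (a - 1)"
      using t True by (subst powr_mult[symmetric]) (auto simp: algebra_simps)
    moreover have "(t * x) powr (b - 1) = t powr (b - 1) * x powr (b - 1)"
      using t True by (simp add: powr_mult)
    moreover have "t powr (a - 1) * t powr (b - 1) = t powr (a + b - 2)"
      by (simp add: powr_add[symmetric])
    ultimately show ?thesis
      using True t by (simp add: frac_kernel_def)
  next
    case False
    then have "t * x \<notin> {0<..<t}"
      using t by (auto simp: zero_less_mult_iff mult_less_cancel_left2)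
    moreover have "indicator {0..1} x * (x powr (b - 1) * (1 - x) powr (a - 1)) = 0"
      using False by (cases "x = 0 \<or> x = 1") (auto simp: indicator_def)
    ultimately show ?thesis
      by simp
  qed
  have "(\<integral>\<^sup>+s. ennreal (?f s) \<partial>lborel) = ennreal t * (\<integral>\<^sup>+x. ennreal (?f (0 + t * x)) \<partial>lborel)"
    using t by (subst nn_integral_real_affine[of "\<lambda>s. ennreal (?f s)" t 0]) auto
  also have "\<dots> = ennreal t * (\<integral>\<^sup>+x. ennreal ?c * ennreal (indicator {0..1} x * (x powr (b - 1) * (1 - x) powr (a - 1))) \<partial>lborel)"
    unfolding add_0 eq using G by (subst ennreal_mult) auto
  also have "\<dots> = ennreal t * (ennreal ?c * (\<integral>\<^sup>+x. ennreal (indicator {0..1} x * (x powr (b - 1) * (1 - x) powr (a - 1))) \<partial>lborel))"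
    by (subst nn_integral_cmult) auto
  also have "(\<integral>\<^sup>+x. ennreal (indicator {0..1} x * (x powr (b - 1) * (1 - x) powr (a - 1))) \<partial>lborel) = ennreal (Beta b a)"
    by (rule nn_integral_has_integral_lebesgue[OF _ has_integral_Beta_real[OF b a]]) simp
  also have "ennreal t * (ennreal ?c * ennreal (Beta b a)) = ennreal (t * (?c * Beta b a))"
    using t G by (simp add: ennreal_mult[symmetric] Beta_def add.commute)
  also have "t * (?c * Beta b a) = frac_kernel (a + b) t"
  proof -
    have "t * t powr (a + b - 2) = t powr (a + b - 1)"
      using t powr_add[of t 1 "a + b - 2"] by simp
    then show ?thesis
      using G by (simp add: frac_kernel_def Beta_def add.commute field_simps)
  qed
  finally show "(\<integral>\<^sup>+s. ennreal (?f s) \<partial>lborel) = ennreal (frac_kernel (a + b) t)" .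
qed (use a b in \<open>auto intro!: mult_nonneg_nonneg frac_kernel_nonneg\<close>)

text \<open>The semigroup law, term by term. The norms of the terms integrate to the absolutely
  convergent series at \<open>a + b\<close>, which justifies exchanging sum and integral.\<close>

lemma relaxation_convolution:
  assumes \<beta>: "0 < \<beta>" and a: "0 < a" and b: "0 < b" and t: "0 < t"
  shows "has_bochner_integral lborel (\<lambda>s. indicator {0<..<t} s * (frac_kernel a (t - s) * relaxation \<beta> b \<mu> s))
    (relaxation \<beta> (a + b) \<mu> t)"
proof -
  let ?b = "\<lambda>n. \<beta> * real n + b"
  let ?f = "\<lambda>n s. (- \<mu>) ^ n * (indicator {0<..<t} s * (frac_kernel a (t - s) * frac_kernel (?b n) s))"
  have bp: "?b n > 0" for n
    using \<beta> b by (simp add: add_nonneg_pos)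
  have hb: "has_bochner_integral lborel (?f n) ((- \<mu>) ^ n * frac_kernel (a + ?b n) t)" for n
    by (intro has_bochner_integral_mult_right frac_kernel_convolution a bp t)
  have nb: "(\<integral>s. norm (?f n s) \<partial>lborel) = norm ((- \<mu>) ^ n * frac_kernel (\<beta> * real n + (a + b)) t)" for n
  proof -
    have "(\<integral>s. norm (?f n s) \<partial>lborel)
        = (\<integral>s. \<bar>\<mu>\<bar> ^ n * (indicator {0<..<t} s * (frac_kernel a (t - s) * frac_kernel (?b n) s)) \<partial>lborel)"
      using a bp[of n] by (intro Bochner_Integration.integral_cong)
        (auto simp: abs_mult power_abs frac_kernel_nonneg)
    also have "\<dots> = \<bar>\<mu>\<bar> ^ n * frac_kernel (a + ?b n) t"
      using frac_kernel_convolution[OF a bp t, THEN has_bochner_integral_integral_eq] by simp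
    also have "\<dots> = norm ((- \<mu>) ^ n * frac_kernel (\<beta> * real n + (a + b)) t)"
    proof -
      have e: "a + ?b n = \<beta> * real n + (a + b)" by simp
      have "frac_kernel (a + ?b n) t \<ge> 0"
        using a bp[of n] by (intro frac_kernel_nonneg) simp
      then show ?thesis
        unfolding e by (simp add: abs_mult power_abs)
    qed
    finally show ?thesis .
  qed
  have int: "integrable lborel (?f n)" for n
    using hb by (rule integrable.intros)
  have ae: "AE s in lborel. summable (\<lambda>n. norm (?f n s))"
  proof (rule AE_I2)
    fix s
    show "summable (\<lambda>n. norm (?f n s))"
    proof (cases "s \<in> {0<..<t}")
      case True
      then have "summable (\<lambda>n. \<bar>frac_kernel a (t - s)\<bar> * norm ((- \<mu>) ^ n * frac_kernel (?b n) s))"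
        using relaxation_sums(2)[OF \<beta> b, of s] by (intro summable_mult) auto
      then show ?thesis
        using True by (simp add: abs_mult mult.left_commute)
    qed simp
  qed
  have sm: "summable (\<lambda>n. \<integral>s. norm (?f n s) \<partial>lborel)"
    unfolding nb using \<beta> a b t by (intro relaxation_sums) auto
  have sumf: "(\<Sum>n. ?f n s) = indicator {0<..<t} s * (frac_kernel a (t - s) * relaxation \<beta> b \<mu> s)" for s
  proof (cases "s \<in> {0<..<t}")
    case True
    have "(\<lambda>n. frac_kernel a (t - s) * ((- \<mu>) ^ n * frac_kernel (?b n) s)) sums (frac_kernel a (t - s) * relaxation \<beta> b \<mu> s)"
      using True by (intro sums_mult relaxation_sums \<beta> b) auto
    from sums_unique[OF this] show ?thesis
      using True by (simp add: mult.left_commute)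
  qed simp
  have "(\<integral>s. (\<Sum>n. ?f n s) \<partial>lborel) = (\<Sum>n. integral\<^sup>L lborel (?f n))"
    by (rule integral_suminf[OF int ae sm])
  also have "\<dots> = (\<Sum>n. (- \<mu>) ^ n * frac_kernel (\<beta> * real n + (a + b)) t)"
    unfolding has_bochner_integral_integral_eq[OF hb] by (simp add: algebra_simps)
  also have "\<dots> = relaxation \<beta> (a + b) \<mu> t"
    using relaxation_sums(1)[of \<beta> "a + b" t \<mu>] \<beta> a b t by (simp add: sums_iff)
  finally show ?thesis
    using integrable_suminf[OF int ae sm] unfolding sumf by (simp add: has_bochner_integral_iff)
qed

text \<open>The first term of the series is split off. Read together with the convolution rule this
  is a Volterra equation: each member is its power kernel minus \<mu> times its own fractional
  integral of order \<beta>.\<close>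

lemma relaxation_recurrence:
  assumes "0 < \<beta>" "0 < b" "0 < x"
  shows "relaxation \<beta> b \<mu> x = frac_kernel b x - \<mu> * relaxation \<beta> (\<beta> + b) \<mu> x"
proof -
  have "x powr (\<beta> + b - 1) = x powr (b - 1) * x powr \<beta>"
    by (simp add: powr_add[symmetric] algebra_simps)
  then show ?thesis
    unfolding relaxation_def mittag_leffler_recurrence[OF assms(1,2)]
    by (simp add: frac_kernel_def algebra_simps)
qed

lemma frac_kernel_1: "x \<noteq> 0 \<Longrightarrow> frac_kernel 1 x = 1"
  by (simp add: frac_kernel_def)

lemma relaxation_primitive:
  assumes "0 < \<beta>" "0 < t"
  shows "has_bochner_integral lborel (\<lambda>s. indicator {0<..<t} s * relaxation \<beta> \<beta> \<mu> s) (relaxation \<beta> (1 + \<beta>) \<mu> t)"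
proof -
  have "(\<lambda>s. indicator {0<..<t} s * (frac_kernel 1 (t - s) * relaxation \<beta> \<beta> \<mu> s)) = (\<lambda>s. indicator {0<..<t} s * relaxation \<beta> \<beta> \<mu> s)"
    by (auto simp: fun_eq_iff indicator_def frac_kernel_1)
  then show ?thesis
    using relaxation_convolution[of \<beta> 1 \<beta> t \<mu>] assms by simp
qed

lemma continuous_on_relaxation_factor:
  assumes "0 < \<beta>"
  shows "continuous_on {0..} (\<lambda>x. mittag_leffler \<beta> \<beta> (- (x powr \<beta> * \<mu>)))"
proof (rule continuous_on_compose2[OF continuous_on_mittag_leffler[of \<beta> \<beta> UNIV]])
  have "continuous_on {0..} (\<lambda>x. x powr \<beta>)"
    using assms by (intro continuous_on_powr' continuous_intros) auto
  then show "continuous_on {0..} (\<lambda>x. - (x powr \<beta> * \<mu>))"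
    by (intro continuous_on_minus continuous_on_mult_right)
qed (use assms in auto)

lemma continuous_on_relaxation:
  assumes "0 < \<beta>"
  shows "continuous_on {0<..} (relaxation \<beta> \<beta> \<mu>)"
  unfolding relaxation_def[abs_def]
  by (intro continuous_on_mult continuous_on_subset[OF continuous_on_relaxation_factor[OF assms]])
    (auto intro!: continuous_intros)

lemma relaxation_has_derivative:
  assumes "0 < \<beta>" "0 < x"
  shows "\<exists>D. (relaxation \<beta> \<beta> \<mu> has_field_derivative D) (at x)"
proof -
  obtain D where D: "(mittag_leffler \<beta> \<beta> has_field_derivative D) (at (- (x powr \<beta> * \<mu>)))"
    using mittag_leffler_has_derivative assms by blast
  have "((\<lambda>x. - (x powr \<beta> * \<mu>)) has_field_derivative (- (\<beta> * x powr (\<beta> - 1) * \<mu>))) (at x)"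
    using assms by (auto intro!: derivative_eq_intros)
  from DERIV_chain2[OF D this]
  have "((\<lambda>x. mittag_leffler \<beta> \<beta> (- (x powr \<beta> * \<mu>))) has_field_derivative D * - (\<beta> * x powr (\<beta> - 1) * \<mu>)) (at x)" .
  moreover have "((\<lambda>x. x powr (\<beta> - 1)) has_field_derivative ((\<beta> - 1) * x powr (\<beta> - 1 - 1))) (at x)"
    using assms by (auto intro!: derivative_eq_intros)
  ultimately show ?thesis
    unfolding relaxation_def[abs_def] using DERIV_mult by blast
qed

lemma tendsto_powr_zero:
  fixes a :: real
  assumes "(f \<longlongrightarrow> 0) F" "\<forall>\<^sub>F x in F. 0 \<le> f x" "0 < a"
  shows "((\<lambda>x. f x powr a) \<longlongrightarrow> 0) F"
  using tendsto_powr'[OF assms(1) tendsto_const[of a F]] assms(2,3) by simp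

section \<open>Positivity and two-sided bounds of the relaxation kernel\<close>

text \<open>The mean value theorem. It measures how much weight a past value at distance
  \<open>x\<close> loses in the fractional integral of order 1 - \<beta> when time advances by
  \<open>h\<close>.\<close>

lemma powr_neg_diff_lower_bound:
  fixes x h \<beta> :: real
  assumes "0 < x" "0 \<le> h" "0 < \<beta>"
  shows "\<beta> * h * (x + h) powr (- \<beta> - 1) \<le> x powr (- \<beta>) - (x + h) powr (- \<beta>)"
proof (cases "h = 0")
  case False
  then have h: "h > 0" using assms by simp
  have "\<exists>z>x. z < x + h \<and> (x + h) powr (- \<beta>) - x powr (- \<beta>) = (x + h - x) * (- \<beta> * z powr (- \<beta> - 1))"
    using assms h by (intro MVT2) (auto intro!: derivative_eq_intros)
  then obtain z where z: "x < z" "z < x + h"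
      "(x + h) powr (- \<beta>) - x powr (- \<beta>) = (x + h - x) * (- \<beta> * z powr (- \<beta> - 1))"
    by blast
  have "(x + h) powr (- \<beta> - 1) \<le> z powr (- \<beta> - 1)"
    using z assms by (intro powr_mono2') auto
  then have "\<beta> * h * (x + h) powr (- \<beta> - 1) \<le> \<beta> * h * z powr (- \<beta> - 1)"
    using assms by (intro mult_left_mono) auto
  then show ?thesis
    using z(3) by (simp add: algebra_simps)
qed simp

text \<open>
  At a first zero \<open>t0\<close> of the relaxation kernel \<open>k\<close>, the fractional integral of order \<open>1 - \<beta>\<close> of \<open>k\<close> has
  a negative derivative, since past positive values lose weight and \<open>k\<close> is negligible near
  \<open>t0\<close>; but that derivative equals \<open>- \<mu> k(t0) = 0\<close>.
\<close>
lemma mittag_leffler_pos_aux: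
  assumes \<beta>: "0 < \<beta>" "\<beta> < 1" and t0: "0 < t0"
    and pos: "\<And>x. 0 < x \<Longrightarrow> x < t0 \<Longrightarrow> 0 < relaxation \<beta> \<beta> \<mu> x"
    and zero: "relaxation \<beta> \<beta> \<mu> t0 = 0"
    and \<mu>: "0 \<le> \<mu>"
  shows False
proof -
  let ?k = "relaxation \<beta> \<beta> \<mu>" and ?g = "frac_kernel (1 - \<beta>)"
  have km [measurable]: "?k \<in> borel_measurable borel"
    using \<beta> by measurable
  have Gp: "Gamma (1 - \<beta>) > 0"
    using \<beta> by auto
  obtain D where "(?k has_field_derivative D) (at t0)"
    using relaxation_has_derivative \<beta> t0 by blast
  then have "((\<lambda>h. (?k (t0 + h) - ?k t0) / h) \<longlongrightarrow> D) (at 0)"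
    by (simp add: DERIV_def)
  then obtain d where d: "d > 0" "\<And>h. h \<noteq> 0 \<Longrightarrow> dist h 0 < d \<Longrightarrow> dist ((?k (t0 + h) - ?k t0) / h) D < 1"
    unfolding tendsto_iff eventually_at by (metis UNIV_I zero_less_one)
  \<comment> \<open>The kernel vanishes at \<open>t0\<close> with derivative \<open>D\<close>, so
    shortly after \<open>t0\<close> its absolute value is at most (|D| + 1) (s - t0).\<close>
  define C where "C = \<bar>D\<bar> + 1"
  have C: "C > 0" by (simp add: C_def)
  have kC: "\<bar>?k s\<bar> \<le> C * (s - t0)" if "t0 < s" "s < t0 + d" for s
  proof -
    have "dist (?k s / (s - t0)) D < 1"
      using d(2)[of "s - t0"] that zero by (simp add: dist_real_def)
    then have "\<bar>?k s / (s - t0)\<bar> \<le> C"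
      unfolding C_def dist_real_def by linarith
    then show ?thesis
      using that by (simp add: abs_divide pos_divide_le_eq)
  qed
  define K where "K = (\<integral>s. indicator {0<..<t0} s * ?k s \<partial>lborel)"
  have intk: "integrable lborel (\<lambda>s. indicator {0<..<t} s * ?k s)"
    and valk: "(\<integral>s. indicator {0<..<t} s * ?k s \<partial>lborel) = relaxation \<beta> (1 + \<beta>) \<mu> t" if "0 < t" for t
    using relaxation_primitive[OF \<beta>(1) that] by (simp_all add: has_bochner_integral_iff)
  have inte: "integrable lborel (\<lambda>s. indicator {0<..<t} s * (?g (t - s) * ?k s))"
    and vale: "(\<integral>s. indicator {0<..<t} s * (?g (t - s) * ?k s) \<partial>lborel) = 1 - \<mu> * relaxation \<beta> (1 + \<beta>) \<mu> t" if "0 < t" for t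
  proof -
    have "relaxation \<beta> 1 \<mu> t = 1 - \<mu> * relaxation \<beta> (\<beta> + 1) \<mu> t"
      using relaxation_recurrence[of \<beta> 1 t \<mu>] that \<beta> by (simp add: frac_kernel_1)
    then show "integrable lborel (\<lambda>s. indicator {0<..<t} s * (?g (t - s) * ?k s))"
      "(\<integral>s. indicator {0<..<t} s * (?g (t - s) * ?k s) \<partial>lborel) = 1 - \<mu> * relaxation \<beta> (1 + \<beta>) \<mu> t"
      using relaxation_convolution[of \<beta> "1 - \<beta>" \<beta> t \<mu>] \<beta> that
      by (simp_all add: has_bochner_integral_iff add.commute)
  qed
  have "K > 0"
  proof -
    have nn: "AE s in lborel. 0 \<le> indicator {0<..<t0} s * ?k s"
      using pos by (intro AE_I2) (auto simp: indicator_def less_imp_le)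
    have "K \<noteq> 0"
    proof
      assume "K = 0"
      then have "AE s in lborel. indicator {0<..<t0} s * ?k s = 0"
        unfolding K_def using integral_nonneg_eq_0_iff_AE[OF intk[OF t0] nn] by simp
      then have "AE s in lborel. s \<notin> {0<..<t0}"
        by eventually_elim (use pos in \<open>fastforce simp: indicator_def\<close>)
      then have "emeasure lborel {0<..<t0} = 0"
        by (subst (asm) AE_iff_measurable[of "{0<..<t0}"]) auto
      then show False
        using t0 by simp
    qed
    moreover have "K \<ge> 0"
      unfolding K_def by (rule integral_nonneg_AE[OF nn])
    ultimately show ?thesis by simp
  qed
  \<comment> \<open>A lower bound for the rate at which the weight of any time in (0, t0) decreases:
    the relevant distances stay below 2 t0 as long as h \<le> t0.\<close>
  define c where "c = \<beta> * (2 * t0) powr (- \<beta> - 1) / Gamma (1 - \<beta>)"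
  have c: "c > 0"
    using \<beta> t0 Gp by (simp add: c_def)
  \<comment> \<open>The change of the fractional integral between \<open>t0\<close> and
    \<open>t0 + h\<close> is bounded from below through the equation and from above through the loss
    of weight -c h K. Dividing by \<open>h\<close> and letting it tend to 0 leaves c K \<le> 0,
    although c and K are positive.\<close>
  have main: "c * K \<le> \<mu> * C * h + C * (h powr (1 - \<beta>) / Gamma (2 - \<beta>))" if h: "0 < h" "h < d" "h \<le> t0" for h
  proof -
    let ?t = "t0 + h"
    have tp: "0 < ?t" using t0 h by simp
    have intg: "integrable lborel (\<lambda>s. indicator {t0<..<?t} s * ?g (?t - s))"
      and valg: "(\<integral>s. indicator {t0<..<?t} s * ?g (?t - s) \<partial>lborel) = h powr (1 - \<beta>) / Gamma (2 - \<beta>)"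
    proof -
      have e: "(\<lambda>s. indicator {0<..<h} s * (?g (h - s) * frac_kernel 1 s)) = (\<lambda>s. indicator {t0<..<?t} (t0 + 1 * s) * ?g (?t - (t0 + 1 * s)))"
        by (auto simp: fun_eq_iff indicator_def frac_kernel_1)
      have hb: "has_bochner_integral lborel (\<lambda>s. indicator {t0<..<?t} (t0 + 1 * s) * ?g (?t - (t0 + 1 * s))) (frac_kernel (1 - \<beta> + 1) h)"
        using frac_kernel_convolution[of "1 - \<beta>" 1 h] \<beta> h unfolding e by simp
      then show "integrable lborel (\<lambda>s. indicator {t0<..<?t} s * ?g (?t - s))"
        using lborel_integrable_real_affine_iff[of 1 "\<lambda>s. indicator {t0<..<?t} s * ?g (?t - s)" t0]
        by (simp add: has_bochner_integral_iff)
      show "(\<integral>s. indicator {t0<..<?t} s * ?g (?t - s) \<partial>lborel) = h powr (1 - \<beta>) / Gamma (2 - \<beta>)"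
        using hb lborel_integral_real_affine[of 1 "\<lambda>s. indicator {t0<..<?t} s * ?g (?t - s)" t0]
        by (simp add: has_bochner_integral_iff frac_kernel_def)
    qed
    \<comment> \<open>By the equation the change is -\<mu> times the integral of the kernel over the
      new interval, which has length \<open>h\<close> and on which the kernel is at most C
      h.\<close>
    have "- (\<mu> * C * h) * h \<le> - \<mu> * (relaxation \<beta> (1 + \<beta>) \<mu> ?t - K)"
    proof -
      have "relaxation \<beta> (1 + \<beta>) \<mu> ?t - K
          = (\<integral>s. indicator {0<..<?t} s * ?k s - indicator {0<..<t0} s * ?k s \<partial>lborel)"
        unfolding K_def by (simp add: valk[OF tp] valk[OF t0] intk tp t0)
      also have "\<dots> \<le> (\<integral>s. C * h * indicator {t0..?t} s \<partial>lborel)"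
      proof (rule integral_mono)
        show "integrable lborel (\<lambda>s. C * h * indicator {t0..?t} s)"
          using h by (intro integrable_mult_right integrable_real_indicator) auto
        fix s
        have "?k s \<le> C * h" if "t0 < s" "s < ?t"
        proof -
          have "\<bar>?k s\<bar> \<le> C * (s - t0)"
            using kC[of s] that h by auto
          also have "\<dots> \<le> C * h"
            using C that h by (intro mult_left_mono) auto
          finally show ?thesis by simp
        qed
        then show "indicator {0<..<?t} s * ?k s - indicator {0<..<t0} s * ?k s \<le> C * h * indicator {t0..?t} s"
          using t0 h C zero by (cases "s = t0") (auto simp: indicator_def)
      qed (simp add: intk tp t0)
      also have "\<dots> = C * h * h"
        using h by simp
      finally show ?thesis
        using \<mu> mult_left_mono[of "relaxation \<beta> (1 + \<beta>) \<mu> ?t - K" "C * h * h" \<mu>] by (simp add: mult.assoc)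
    qed
    also have "\<dots> = (\<integral>s. indicator {0<..<?t} s * (?g (?t - s) * ?k s) - indicator {0<..<t0} s * (?g (t0 - s) * ?k s) \<partial>lborel)"
      unfolding K_def valk[OF t0]
      by (subst Bochner_Integration.integral_diff[OF inte[OF tp] inte[OF t0]])
        (simp only: vale[OF tp] vale[OF t0], simp add: algebra_simps)
    also have "\<dots> \<le> (\<integral>s. C * h * (indicator {t0<..<?t} s * ?g (?t - s)) - c * h * (indicator {0<..<t0} s * ?k s) \<partial>lborel)"
    proof (rule integral_mono)
      show "integrable lborel (\<lambda>s. C * h * (indicator {t0<..<?t} s * ?g (?t - s)) - c * h * (indicator {0<..<t0} s * ?k s))"
        by (intro Bochner_Integration.integrable_diff integrable_mult_right intg intk t0)
      fix s
      consider "s \<le> 0 \<or> s \<ge> ?t \<or> s = t0" | "0 < s" "s < t0" | "t0 < s" "s < ?t"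
        by linarith
      then show "indicator {0<..<?t} s * (?g (?t - s) * ?k s) - indicator {0<..<t0} s * (?g (t0 - s) * ?k s)
          \<le> C * h * (indicator {t0<..<?t} s * ?g (?t - s)) - c * h * (indicator {0<..<t0} s * ?k s)"
      proof cases
        case 1
        then show ?thesis
          using t0 h zero by (auto simp: indicator_def)
      next
        case 2
        have "\<beta> * h * (2 * t0) powr (- \<beta> - 1) \<le> \<beta> * h * (t0 - s + h) powr (- \<beta> - 1)"
          using \<beta> 2 h by (intro mult_left_mono powr_mono2') auto
        also have "\<dots> \<le> (t0 - s) powr (- \<beta>) - (t0 - s + h) powr (- \<beta>)"
          using \<beta> 2 h by (intro powr_neg_diff_lower_bound) auto
        finally have "c * h \<le> ?g (t0 - s) - ?g (?t - s)"
          using Gp by (simp add: c_def frac_kernel_def field_simps)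
        from mult_right_mono[OF this, of "?k s"] show ?thesis
          using 2 h pos[of s] by (simp add: indicator_def algebra_simps)
      next
        case 3
        have "?k s \<le> C * h"
        proof -
          have "\<bar>?k s\<bar> \<le> C * (s - t0)"
            using kC[of s] 3 h by auto
          also have "\<dots> \<le> C * h"
            using C 3 h by (intro mult_left_mono) auto
          finally show ?thesis by simp
        qed
        from mult_left_mono[OF this, of "?g (?t - s)"] show ?thesis
          using 3 t0 \<beta> by (simp add: indicator_def frac_kernel_nonneg algebra_simps)
      qed
    qed (simp add: inte tp t0)
    also have "\<dots> = C * h * (h powr (1 - \<beta>) / Gamma (2 - \<beta>)) - c * h * K"
      using intg intk[OF t0] valg by (simp add: K_def)
    finally have "h * (c * K) \<le> h * (\<mu> * C * h + C * (h powr (1 - \<beta>) / Gamma (2 - \<beta>)))"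
      by (simp add: algebra_simps)
    then show ?thesis
      using h by simp
  qed
  have "((\<lambda>h. \<mu> * C * h + C * (h powr (1 - \<beta>) / Gamma (2 - \<beta>))) \<longlongrightarrow> \<mu> * C * 0 + C * (0 / Gamma (2 - \<beta>))) (at_right 0)"
  proof (intro tendsto_intros)
    show "((\<lambda>h. h powr (1 - \<beta>)) \<longlongrightarrow> 0) (at_right 0)"
      using \<beta> by (intro tendsto_powr_zero tendsto_ident_at) (auto simp: eventually_at_filter)
    have "2 - \<beta> > 0" using \<beta> by simp
    then show "Gamma (2 - \<beta>) \<noteq> 0"
      using Gamma_real_pos[of "2 - \<beta>"] by linarith
  qed
  then have "c * K \<le> \<mu> * C * 0 + C * (0 / Gamma (2 - \<beta>))"
  proof (rule tendsto_lowerbound)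
    show "\<forall>\<^sub>F h in at_right 0. c * K \<le> \<mu> * C * h + C * (h powr (1 - \<beta>) / Gamma (2 - \<beta>))"
      using main t0 d(1) by (intro eventually_at_rightI[of 0 "min d t0"]) auto
  qed simp
  then show False
    using mult_pos_pos[OF c \<open>K > 0\<close>] by simp
qed

text \<open>At 0 the Mittag-Leffler factor equals 1 / Gamma(\<beta>) > 0. If it failed to be
  positive at \<open>x\<close>, its zeros in [0, x] would form a nonempty compact set, and the least
  of them would be a first zero of the kernel, which is impossible. For \<beta> = 1 the factor is an
  exponential.\<close>

lemma mittag_leffler_pos:
  assumes \<beta>: "0 < \<beta>" "\<beta> \<le> 1" and \<mu>: "0 \<le> \<mu>" and x: "0 \<le> x"
  shows "0 < mittag_leffler \<beta> \<beta> (- (x powr \<beta> * \<mu>))"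
proof (cases "\<beta> = 1")
  case True
  then show ?thesis by (simp add: mittag_leffler_one_one)
next
  case False
  then have \<beta>1: "\<beta> < 1" using \<beta> by simp
  let ?q = "\<lambda>x. mittag_leffler \<beta> \<beta> (- (x powr \<beta> * \<mu>))"
  have cont: "continuous_on {0..x} ?q"
    by (rule continuous_on_subset[OF continuous_on_relaxation_factor[OF \<beta>(1)]]) auto
  have q0: "?q 0 > 0"
    using mittag_leffler_recurrence[of \<beta> \<beta> 0] \<beta> by simp
  show ?thesis
  proof (rule ccontr)
    assume neg: "\<not> 0 < ?q x"
    define S where "S = {0..x} \<inter> ?q -` {0}"
    have "closed S"
      unfolding S_def by (rule continuous_closed_preimage[OF cont]) auto
    then have "compact S"
      unfolding S_def by (metis Int_lower1 bounded_closed_interval bounded_subset compact_eq_bounded_closed S_def)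
    moreover have "S \<noteq> {}"
    proof -
      obtain z where "0 \<le> z" "z \<le> x" "?q z = 0"
        using IVT2'[of ?q x 0 0, OF _ less_imp_le[OF q0] x cont] neg by (meson not_less)
      then show ?thesis by (auto simp: S_def)
    qed
    ultimately have "\<exists>t0\<in>S. \<forall>t\<in>S. t0 \<le> t"
      by (rule compact_attains_inf)
    then obtain t0 where t0: "t0 \<in> S" "\<And>t. t \<in> S \<Longrightarrow> t0 \<le> t"
      by metis
    have t0q: "?q t0 = 0" "0 \<le> t0" "t0 \<le> x"
      using t0(1) by (auto simp: S_def)
    then have t0pos: "0 < t0"
      using q0 by (cases "t0 = 0") auto
    have qpos: "0 < ?q y" if y: "0 < y" "y < t0" for y
    proof (rule ccontr)
      assume "\<not> 0 < ?q y"
      moreover have "continuous_on {0..y} ?q"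
        using that t0q by (intro continuous_on_subset[OF cont]) auto
      ultimately obtain z where "0 \<le> z" "z \<le> y" "?q z = 0"
        using IVT2'[of ?q y 0 0] less_imp_le[OF q0] less_imp_le[OF y(1)] by (meson not_less)
      then have "z \<in> S"
        using that t0q by (auto simp: S_def)
      then show False
        using t0(2)[of z] \<open>z \<le> y\<close> that by simp
    qed
    show False
    proof (rule mittag_leffler_pos_aux[OF \<beta>(1) \<beta>1 t0pos _ _ \<mu>])
      show "0 < relaxation \<beta> \<beta> \<mu> y" if "0 < y" "y < t0" for y
        using qpos[OF that] that unfolding relaxation_def by (intro mult_pos_pos) auto
      show "relaxation \<beta> \<beta> \<mu> t0 = 0"
        unfolding relaxation_def t0q(1) by simp
    qed
  qed
qed

lemma relaxation_pos:
  assumes "0 < \<beta>" "\<beta> \<le> 1" "0 \<le> \<mu>" "0 < x"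
  shows "0 < relaxation \<beta> \<beta> \<mu> x"
  using mittag_leffler_pos[OF assms(1-3), of x] assms by (simp add: relaxation_def)

text \<open>In the Volterra equation of the kernel the subtracted convolution is nonnegative, by
  positivity. The bound does not involve \<mu>, which makes the later estimates uniform in the
  degree of the harmonic.\<close>

lemma relaxation_le:
  assumes "0 < \<beta>" "\<beta> \<le> 1" "0 \<le> \<mu>" "0 < x"
  shows "relaxation \<beta> \<beta> \<mu> x \<le> x powr (\<beta> - 1) / Gamma \<beta>"
proof -
  have "0 \<le> relaxation \<beta> (\<beta> + \<beta>) \<mu> x"
  proof -
    have "relaxation \<beta> (\<beta> + \<beta>) \<mu> x = (\<integral>s. indicator {0<..<x} s * (frac_kernel \<beta> (x - s) * relaxation \<beta> \<beta> \<mu> s) \<partial>lborel)"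
      using relaxation_convolution[of \<beta> \<beta> \<beta> x \<mu>] assms by (simp add: has_bochner_integral_iff)
    also have "\<dots> \<ge> 0"
      using assms
      by (intro Bochner_Integration.integral_nonneg)
        (auto simp: indicator_def frac_kernel_nonneg less_imp_le[OF relaxation_pos])
    finally show ?thesis .
  qed
  then show ?thesis
    using relaxation_recurrence[of \<beta> \<beta> x \<mu>] assms by (simp add: frac_kernel_def)
qed

text \<open>The Mittag-Leffler factor is continuous and positive on [0, T] and attains its minimum
  there. So the singularity at 0 is really of order \<beta> - 1, which decides when the stochastic
  integral diverges.\<close>

lemma relaxation_lower_bound:
  assumes "0 < \<beta>" "\<beta> \<le> 1" "0 \<le> \<mu>" "0 \<le> T"
  obtains c where "0 < c" "\<And>x. 0 < x \<Longrightarrow> x \<le> T \<Longrightarrow> c * x powr (\<beta> - 1) \<le> relaxation \<beta> \<beta> \<mu> x"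
proof -
  let ?q = "\<lambda>x. mittag_leffler \<beta> \<beta> (- (x powr \<beta> * \<mu>))"
  have "continuous_on {0..T} ?q"
    by (rule continuous_on_subset[OF continuous_on_relaxation_factor[OF assms(1)]]) auto
  then obtain x0 where "x0 \<in> {0..T}" "\<forall>x\<in>{0..T}. ?q x0 \<le> ?q x"
    using continuous_attains_inf[of "{0..T}" ?q] assms by auto
  then show thesis
    using mittag_leffler_pos[OF assms(1-3)]
    by (intro that[of "?q x0"]) (auto simp: relaxation_def mult.commute intro!: mult_left_mono)
qed

section \<open>Inner products of real square-integrable functions\<close>

definition l2inner :: "'a measure \<Rightarrow> ('a \<Rightarrow> real) \<Rightarrow> ('a \<Rightarrow> real) \<Rightarrow> real" where
  "l2inner N f g = (LINT x|N. f x * g x)"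

lemma L2_space_integrable_mult:
  fixes f g :: "'a \<Rightarrow> real"
  assumes "f \<in> L2_space N" "g \<in> L2_space N"
  shows "integrable N (\<lambda>x. f x * g x)"
proof (rule integrable_norm_cancel)
  show "integrable N (\<lambda>x. norm (f x * g x))"
    using L2_space_norm_mult(1)[OF assms] by (simp add: abs_mult)
  have [measurable]: "f \<in> borel_measurable N" "g \<in> borel_measurable N"
    using assms by auto
  show "(\<lambda>x. f x * g x) \<in> borel_measurable N"
    by measurable
qed

lemma l2inner_commute: "l2inner N f g = l2inner N g f"
  by (simp add: l2inner_def mult.commute)

lemma l2inner_self: "l2inner N f f = (l2norm N f)\<^sup>2"
  by (simp add: l2inner_def l2norm_power2 flip: power2_eq_square)

lemma abs_l2inner_le:
  assumes "f \<in> L2_space N" "g \<in> L2_space N"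
  shows "\<bar>l2inner N f g\<bar> \<le> l2norm N f * l2norm N g"
proof -
  have "\<bar>l2inner N f g\<bar> \<le> (LINT x|N. norm (f x * g x))"
    unfolding l2inner_def using integral_norm_bound[of N "\<lambda>x. f x * g x"] by simp
  also have "\<dots> \<le> l2norm N f * l2norm N g"
    using L2_space_norm_mult(2)[OF assms] by (simp add: abs_mult)
  finally show ?thesis .
qed

lemma l2inner_diff_right:
  assumes "f \<in> L2_space N" "g \<in> L2_space N" "h \<in> L2_space N"
  shows "l2inner N f (\<lambda>x. g x - h x) = l2inner N f g - l2inner N f h"
  using assms by (simp add: l2inner_def right_diff_distrib L2_space_integrable_mult)

lemma l2inner_diff_left:
  assumes "f \<in> L2_space N" "g \<in> L2_space N" "h \<in> L2_space N"
  shows "l2inner N (\<lambda>x. g x - h x) f = l2inner N g f - l2inner N h f"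
  using l2inner_diff_right[OF assms] by (simp add: l2inner_commute)

lemma l2inner_mult_right: "l2inner N f (\<lambda>x. c * g x) = c * l2inner N f g"
  by (simp add: l2inner_def mult.left_commute)

lemma l2inner_mult_left: "l2inner N (\<lambda>x. c * g x) f = c * l2inner N g f"
  by (simp add: l2inner_def mult.assoc)

lemma l2inner_sum_right:
  assumes "f \<in> L2_space N" "\<And>i. i \<in> I \<Longrightarrow> g i \<in> L2_space N"
  shows "l2inner N f (\<lambda>x. \<Sum>i\<in>I. g i x) = (\<Sum>i\<in>I. l2inner N f (g i))"
  using assms by (simp add: l2inner_def sum_distrib_left L2_space_integrable_mult)

lemma l2inner_sum_left:
  assumes "f \<in> L2_space N" "\<And>i. i \<in> I \<Longrightarrow> g i \<in> L2_space N"
  shows "l2inner N (\<lambda>x. \<Sum>i\<in>I. g i x) f = (\<Sum>i\<in>I. l2inner N (g i) f)"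
  using l2inner_sum_right[OF assms] by (simp add: l2inner_commute)

lemma tendsto_l2inner:
  assumes "f \<in> L2_space N" "g \<in> L2_space N" "\<forall>\<^sub>F i in F. h i \<in> L2_space N"
    and "((\<lambda>i. l2norm N (\<lambda>x. h i x - g x)) \<longlongrightarrow> 0) F"
  shows "((\<lambda>i. l2inner N f (h i)) \<longlongrightarrow> l2inner N f g) F"
proof (rule Lim_null[THEN iffD2], rule Lim_null_comparison)
  show "\<forall>\<^sub>F i in F. norm (l2inner N f (h i) - l2inner N f g) \<le> l2norm N f * l2norm N (\<lambda>x. h i x - g x)"
    using assms(3)
  proof eventually_elim
    case (elim i)
    then show ?case
      using abs_l2inner_le[OF assms(1) L2_space_diff(1)[OF elim assms(2)]]
      by (simp add: l2inner_diff_right assms)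
  qed
  show "((\<lambda>i. l2norm N f * l2norm N (\<lambda>x. h i x - g x)) \<longlongrightarrow> 0) F"
    using tendsto_mult_right_zero[OF assms(4)] by simp
qed

lemma tendsto_l2norm:
  assumes "g \<in> L2_space N" "\<forall>\<^sub>F i in F. h i \<in> L2_space N"
    and "((\<lambda>i. l2norm N (\<lambda>x. h i x - g x)) \<longlongrightarrow> 0) F"
  shows "((\<lambda>i. l2norm N (h i)) \<longlongrightarrow> l2norm N g) F"
proof (rule Lim_null[THEN iffD2], rule Lim_null_comparison[OF _ assms(3)])
  show "\<forall>\<^sub>F i in F. norm (l2norm N (h i) - l2norm N g) \<le> l2norm N (\<lambda>x. h i x - g x)"
    using assms(2) by eventually_elim (simp add: l2norm_diff_ineq assms(1))
qed

section \<open>Riemann--Stieltjes sums of functions\<close>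

definition tagged_partition :: "real \<Rightarrow> real \<Rightarrow> real \<Rightarrow> nat \<Rightarrow> (nat \<Rightarrow> real) \<Rightarrow> (nat \<Rightarrow> real) \<Rightarrow> bool" where
  "tagged_partition a b \<delta> n u v \<longleftrightarrow>
     u 0 = a \<and> u n = b \<and> (\<forall>i<n. u i \<le> v i \<and> v i \<le> u (Suc i) \<and> u (Suc i) - u i < \<delta>)"

lemma tagged_partition_mono:
  assumes "tagged_partition a b \<delta> n u v" "i \<le> j" "j \<le> n"
  shows "u i \<le> u j"
  using assms(2,3)
proof (induction j rule: dec_induct)
  case (step j)
  then have "u i \<le> u j" by simp
  also have "u j \<le> u (Suc j)"
    using assms(1) step order_trans[of "u j" "v j" "u (Suc j)"] by (simp add: tagged_partition_def)
  finally show ?case .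
qed simp

lemma tagged_partition_bounds:
  assumes "tagged_partition a b \<delta> n u v" "i \<le> n"
  shows "u i \<in> {a..b}" and "i < n \<Longrightarrow> v i \<in> {a..b}"
proof -
  have *: "u j \<in> {a..b}" if "j \<le> n" for j
    using tagged_partition_mono[OF assms(1), of 0 j] tagged_partition_mono[OF assms(1), of j n] that assms(1)
    by (auto simp: tagged_partition_def)
  show "u i \<in> {a..b}" using * assms by simp
  show "v i \<in> {a..b}" if "i < n"
    using *[of i] *[of "Suc i"] that assms(1) by (force simp: tagged_partition_def)
qed

definition uniform_point :: "real \<Rightarrow> real \<Rightarrow> nat \<Rightarrow> nat \<Rightarrow> real" where
  "uniform_point a b n i = a + (b - a) * real i / real n"

lemma uniform_tagged_partition:
  assumes "a \<le> b" "0 < n" "b - a < \<delta> * real n"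
  shows "tagged_partition a b \<delta> n (uniform_point a b n) (uniform_point a b n)"
proof -
  have "uniform_point a b n (Suc i) - uniform_point a b n i = (b - a) / real n" for i
    using assms(2) by (simp add: uniform_point_def field_simps)
  moreover have "0 \<le> (b - a) / real n" "(b - a) / real n < \<delta>"
    using assms by (auto simp: field_simps)
  ultimately have "uniform_point a b n i \<le> uniform_point a b n (Suc i)"
    "uniform_point a b n (Suc i) - uniform_point a b n i < \<delta>" for i
    by (simp_all add: diff_le_eq[symmetric] le_diff_eq[symmetric] add.commute)
      (metis diff_ge_0_iff_ge)
  then show ?thesis
    using assms by (auto simp: tagged_partition_def uniform_point_def)
qed

lemma eventually_uniform_partition:
  assumes "a \<le> b" "0 < \<delta>"
  shows "\<forall>\<^sub>F n in sequentially. tagged_partition a b \<delta> n (uniform_point a b n) (uniform_point a b n)"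
proof -
  obtain n0 :: nat where n0: "(b - a) / \<delta> < real n0"
    using reals_Archimedean2 by blast
  have "tagged_partition a b \<delta> n (uniform_point a b n) (uniform_point a b n)" if "n \<ge> max n0 1" for n
  proof -
    have "(b - a) / \<delta> < real n"
      using n0 that by linarith
    then show ?thesis
      using assms that by (intro uniform_tagged_partition) (auto simp: field_simps)
  qed
  then show ?thesis
    unfolding eventually_at_top_linorder by blast
qed

section \<open>Riemann sums against an atomless Stieltjes measure\<close>

locale stieltjes =
  fixes \<phi> :: "real \<Rightarrow> real"
  assumes mono: "\<And>x y. x \<le> y \<Longrightarrow> \<phi> x \<le> \<phi> y"
    and cont: "continuous_on UNIV \<phi>"
begin

lemma right_cont: "continuous (at_right x) \<phi>"
  using cont continuous_at_imp_continuous_at_within by (auto simp: continuous_on_eq_continuous_at)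

lemma emeasure_Ioc: "emeasure (interval_measure \<phi>) {a<..b} = ennreal (if a \<le> b then \<phi> b - \<phi> a else 0)"
  using emeasure_interval_measure_Ioc_eq[OF mono right_cont] by simp

lemma measure_Ioc: "a \<le> b \<Longrightarrow> measure (interval_measure \<phi>) {a<..b} = \<phi> b - \<phi> a"
  using measure_interval_measure_Ioc[OF _ mono right_cont] by simp

lemma emeasure_singleton: "emeasure (interval_measure \<phi>) {x} = 0"
  using emeasure_interval_measure_Icc[of x x, OF _ mono cont] by simp

lemma continuous_set_integrable:
  assumes "continuous_on {a..b} (g :: real \<Rightarrow> real)" "a \<le> c" "d \<le> b"
  shows "set_integrable (interval_measure \<phi>) {c<..d} g"
proof -
  have g: "continuous_on {c..d} g"
    using assms by (intro continuous_on_subset[OF assms(1)]) auto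
  have "bounded (g ` {c..d})"
    using g by (intro compact_imp_bounded compact_continuous_image) auto
  then obtain B where B: "\<forall>x\<in>{c..d}. norm (g x) \<le> B"
    unfolding bounded_iff by auto
  have m: "(\<lambda>x. indicator {c<..d} x *\<^sub>R g x) \<in> borel_measurable borel"
    by (intro borel_measurable_continuous_on_indicator continuous_on_subset[OF g]) auto
  show ?thesis
    unfolding set_integrable_def
    by (rule integrableI_bounded_set[where A = "{c<..d}" and B = B])
      (use m B in \<open>auto simp: emeasure_Ioc measurable_cong_sets[OF sets_interval_measure refl]\<close>)
qed

text \<open>On each cell the sum and the integral differ by at most \<omega> times the increase of
  \<phi>, and the increases add up. Only the mesh of the partition enters, so any two fine
  partitions are comparable through one common integral.\<close>

lemma RS_sum_error:
  assumes "tagged_partition a b \<delta> n u v" "continuous_on {a..b} g"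
    and \<omega>: "\<And>x y. x \<in> {a..b} \<Longrightarrow> y \<in> {a..b} \<Longrightarrow> \<bar>x - y\<bar> < \<delta> \<Longrightarrow> \<bar>g x - g y\<bar> \<le> \<omega>"
  shows "\<bar>(\<Sum>i<n. g (v i) * (\<phi> (u (Suc i)) - \<phi> (u i))) - (LINT x:{a<..b}|interval_measure \<phi>. g x)\<bar> \<le> \<omega> * (\<phi> b - \<phi> a)"
proof -
  let ?I = "\<lambda>c d. LINT x:{c<..d}|interval_measure \<phi>. g x"
  have "\<bar>(\<Sum>i<k. g (v i) * (\<phi> (u (Suc i)) - \<phi> (u i))) - ?I a (u k)\<bar> \<le> \<omega> * (\<phi> (u k) - \<phi> a)" if "k \<le> n" for k
    using that
  proof (induction k)
    case 0
    then show ?case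
      using assms(1) by (simp add: tagged_partition_def set_lebesgue_integral_def)
  next
    case (Suc k)
    have uk: "a \<le> u k" "u k \<le> u (Suc k)" "u (Suc k) \<le> b"
      using tagged_partition_mono[OF assms(1), of k "Suc k"] tagged_partition_bounds[OF assms(1), of k]
        tagged_partition_bounds[OF assms(1), of "Suc k"] Suc by auto
    have split: "{a<..u (Suc k)} = {a<..u k} \<union> {u k<..u (Suc k)}"
      using uk by auto
    have i1: "set_integrable (interval_measure \<phi>) {a<..u k} g"
      and i2: "set_integrable (interval_measure \<phi>) {u k<..u (Suc k)} g"
      using uk by (auto intro!: continuous_set_integrable[OF assms(2)])
    have I: "?I a (u (Suc k)) = ?I a (u k) + ?I (u k) (u (Suc k))"
      unfolding split by (rule set_integral_Un[OF _ i1 i2]) auto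
    have c: "set_integrable (interval_measure \<phi>) {u k<..u (Suc k)} (\<lambda>_. g (v k))"
      by (rule continuous_set_integrable[of "u k" "u (Suc k)"]) auto
    have "g (v k) * (\<phi> (u (Suc k)) - \<phi> (u k)) - ?I (u k) (u (Suc k))
        = (LINT x:{u k<..u (Suc k)}|interval_measure \<phi>. g (v k) - g x)"
      using uk set_integral_diff(2)[OF c i2] by (simp add: set_integral_const measure_Ioc emeasure_Ioc set_lebesgue_integral_def mult.commute)
    also have "\<bar>\<dots>\<bar> \<le> (LINT x:{u k<..u (Suc k)}|interval_measure \<phi>. \<omega>)"
    proof -
      have "\<bar>LINT x:{u k<..u (Suc k)}|interval_measure \<phi>. g (v k) - g x\<bar>
          \<le> (LINT x|interval_measure \<phi>. norm (indicator {u k<..u (Suc k)} x *\<^sub>R (g (v k) - g x)))"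
        unfolding set_lebesgue_integral_def
        using integral_norm_bound[of "interval_measure \<phi>" "\<lambda>x. indicator {u k<..u (Suc k)} x *\<^sub>R (g (v k) - g x)"]
        by simp
      also have "\<dots> \<le> (LINT x:{u k<..u (Suc k)}|interval_measure \<phi>. \<omega>)"
        unfolding set_lebesgue_integral_def
      proof (rule integral_mono)
        show "integrable (interval_measure \<phi>) (\<lambda>x. norm (indicator {u k<..u (Suc k)} x *\<^sub>R (g (v k) - g x)))"
          using set_integral_diff(1)[OF c i2] unfolding set_integrable_def by (rule integrable_norm)
        show "integrable (interval_measure \<phi>) (\<lambda>x. indicator {u k<..u (Suc k)} x *\<^sub>R \<omega>)"
          using continuous_set_integrable[of "u k" "u (Suc k)" "\<lambda>_. \<omega>" "u k" "u (Suc k)"] by (simp add: set_integrable_def)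
        fix x
        have "\<bar>g (v k) - g x\<bar> \<le> \<omega>" if "u k < x" "x \<le> u (Suc k)"
        proof (rule \<omega>)
          have v: "u k \<le> v k" "v k \<le> u (Suc k)" "u (Suc k) - u k < \<delta>"
            using assms(1) Suc by (auto simp: tagged_partition_def)
          then show "v k \<in> {a..b}" "x \<in> {a..b}" "\<bar>v k - x\<bar> < \<delta>"
            using uk that by auto
        qed
        then show "norm (indicator {u k<..u (Suc k)} x *\<^sub>R (g (v k) - g x)) \<le> indicator {u k<..u (Suc k)} x *\<^sub>R \<omega>"
          by (auto simp: indicator_def)
      qed
      finally show ?thesis .
    qed
    also have "\<dots> = \<omega> * (\<phi> (u (Suc k)) - \<phi> (u k))"
      using uk by (simp add: set_lebesgue_integral_def measure_Ioc mult.commute)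
    finally have "\<bar>g (v k) * (\<phi> (u (Suc k)) - \<phi> (u k)) - ?I (u k) (u (Suc k))\<bar> \<le> \<omega> * (\<phi> (u (Suc k)) - \<phi> (u k))" .
    moreover have "\<bar>(\<Sum>i<k. g (v i) * (\<phi> (u (Suc i)) - \<phi> (u i))) - ?I a (u k)\<bar> \<le> \<omega> * (\<phi> (u k) - \<phi> a)"
      using Suc by simp
    ultimately show ?case
      unfolding I by (simp add: right_diff_distrib) 
  qed
  from this[of n] show ?thesis
    using assms(1) by (simp add: tagged_partition_def)
qed

end

text \<open>\<open>y\<close> and \<open>z\<close> are mirror-image convex combinations of the end
  points \<open>x\<close> and \<open>w\<close>. In the sum of the two convexity inequalities for
  |r|^p the weights of each end point add up to 1.\<close>

lemma abs_powr_convex_quadruple: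
  fixes p :: real
  assumes p: "1 \<le> p" and "x \<le> y" "y \<le> w" "x + w = y + z"
  shows "\<bar>y\<bar> powr p + \<bar>z\<bar> powr p \<le> \<bar>x\<bar> powr p + \<bar>w\<bar> powr p"
proof (cases "x = w")
  case True
  then show ?thesis using assms by simp
next
  case False
  then have xw: "x < w" using assms by simp
  \<comment> \<open>With an end point at 0 the inequality reduces to c powr p \<le> c for c in
    [0, 1]; positive end points fall under convexity of the power on the positive axis.\<close>
  have conv: "((1 - l) * s + l * t) powr p \<le> (1 - l) * s powr p + l * t powr p"
    if l: "0 \<le> l" "l \<le> 1" and st: "0 \<le> s" "0 \<le> t" for l s t :: real
  proof -
    have sc: "(c * q) powr p \<le> c * q powr p" if "0 \<le> c" "c \<le> 1" "0 \<le> q" for c q :: real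
    proof (cases "c = 0")
      case False
      have "c powr p \<le> c powr 1"
        using that False p by (intro powr_mono') auto
      then show ?thesis
        using that False by (simp add: powr_mult mult_right_mono)
    qed simp
    consider "s = 0" | "t = 0" | "s > 0" "t > 0"
      using st by linarith
    then show ?thesis
    proof cases
      case 1
      then show ?thesis using sc[of l t] l st by simp
    next
      case 2
      then show ?thesis using sc[of "1 - l" s] l st by simp
    next
      case 3
      then show ?thesis
        using convex_onD[OF powr_convex[OF p], of l s t] l by simp
    qed
  qed
  define l where "l = (y - x) / (w - x)"
  have l: "0 \<le> l" "l \<le> 1"
    using assms xw by (auto simp: l_def)
  have lw: "l * (w - x) = y - x"
    using xw by (simp add: l_def)
  then have y: "y = (1 - l) * x + l * w" and z: "z = (1 - (1 - l)) * x + (1 - l) * w"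
    using assms(4) by (simp_all add: algebra_simps)
  have *: "\<bar>(1 - q) * x + q * w\<bar> powr p \<le> (1 - q) * \<bar>x\<bar> powr p + q * \<bar>w\<bar> powr p" if q: "0 \<le> q" "q \<le> 1" for q
  proof -
    have "\<bar>(1 - q) * x + q * w\<bar> \<le> (1 - q) * \<bar>x\<bar> + q * \<bar>w\<bar>"
      using q abs_triangle_ineq[of "(1 - q) * x" "q * w"] by (simp add: abs_mult)
    then have "\<bar>(1 - q) * x + q * w\<bar> powr p \<le> ((1 - q) * \<bar>x\<bar> + q * \<bar>w\<bar>) powr p"
      using p by (intro powr_mono2) auto
    also have "\<dots> \<le> (1 - q) * \<bar>x\<bar> powr p + q * \<bar>w\<bar> powr p"
      using q by (intro conv) auto
    finally show ?thesis .
  qed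
  have "\<bar>y\<bar> powr p \<le> (1 - l) * \<bar>x\<bar> powr p + l * \<bar>w\<bar> powr p"
    using *[OF l] y by simp
  moreover have "\<bar>z\<bar> powr p \<le> (1 - (1 - l)) * \<bar>x\<bar> powr p + (1 - l) * \<bar>w\<bar> powr p"
    unfolding z using l by (intro *) auto
  ultimately show ?thesis
    by (simp add: algebra_simps)
qed

section \<open>Integrals with respect to fractional Brownian motion\<close>

definition rs_sum :: "(real \<Rightarrow> 'w \<Rightarrow> real) \<Rightarrow> (real \<Rightarrow> real) \<Rightarrow> nat \<Rightarrow> (nat \<Rightarrow> real) \<Rightarrow> (nat \<Rightarrow> real) \<Rightarrow> 'w \<Rightarrow> real" where
  "rs_sum B g n u v = (\<lambda>\<omega>. \<Sum>i<n. g (v i) * (B (u (Suc i)) \<omega> - B (u i) \<omega>))"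

lemma sum_lessThan_add: "sum f {..<m + n :: nat} = sum f {..<m} + (\<Sum>i<n. f (m + i))"
  for f :: "nat \<Rightarrow> 'a::comm_monoid_add"
  by (induction n) (auto simp: add.assoc)

lemma centred_gaussian_L2:
  assumes "centred_gaussian M Z"
  shows "Z \<in> L2_space M"
proof -
  have [measurable]: "Z \<in> borel_measurable M"
    using assms by (simp add: centred_gaussian_def)
  have "integrable M (\<lambda>\<omega>. (Z \<omega>)\<^sup>2)"
  proof (cases "AE \<omega> in M. Z \<omega> = 0")
    case True
    then have "AE \<omega> in M. 0 = (Z \<omega>)\<^sup>2"
      by eventually_elim simp
    from integrable_cong_AE_imp[OF integrable_zero _ this] show ?thesis
      by simp
  next
    case False
    then obtain s where s: "s > 0" "distributed M lborel Z (normal_density 0 s)"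
      using assms by (auto simp: centred_gaussian_def)
    have "integrable lborel (\<lambda>x. normal_density 0 s x * x\<^sup>2)"
      using integrable_normal_moment[OF s(1), of 0 2] by (simp only: diff_zero)
    then show ?thesis
      by (subst (asm) distributed_integrable[OF s(2)]) (simp_all add: normal_density_nonneg)
  qed
  then show ?thesis
    by (simp add: L2_space_def)
qed

locale fbm = prob_space M for M :: "'w measure" +
  fixes H A :: real and B :: "real \<Rightarrow> 'w \<Rightarrow> real"
  assumes H: "1 / 2 \<le> H" "H < 1" and fbm: "real_fbm M H A B"
begin

lemma B_L2:
  assumes t: "0 \<le> t"
  shows "B t \<in> L2_space M"
proof -
  have "centred_gaussian_process M B"
    using fbm by (simp add: real_fbm_def)
  from this[unfolded centred_gaussian_process_def, rule_format, of "{t}" "\<lambda>_. 1"] t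
  have "centred_gaussian M (\<lambda>\<omega>. B t \<omega>)"
    by simp
  then show ?thesis
    by (rule centred_gaussian_L2)
qed

lemma B_0: "AE \<omega> in M. B 0 \<omega> = 0"
  using fbm by (simp add: real_fbm_def)

lemma incr_L2: "0 \<le> s \<Longrightarrow> 0 \<le> t \<Longrightarrow> (\<lambda>\<omega>. B t \<omega> - B s \<omega>) \<in> L2_space M"
  by (intro L2_space_diff B_L2)

lemma incr_second_moment:
  "0 \<le> s \<Longrightarrow> 0 \<le> t \<Longrightarrow> (LINT \<omega>|M. (B t \<omega> - B s \<omega>)\<^sup>2) = A * \<bar>t - s\<bar> powr (2 * H)"
  using fbm by (simp add: real_fbm_def)

lemma A_nonneg: "0 \<le> A"
proof -
  have "A = (LINT \<omega>|M. (B 1 \<omega> - B 0 \<omega>)\<^sup>2)"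
    using incr_second_moment[of 0 1] by simp
  also have "\<dots> \<ge> 0"
    by simp
  finally show ?thesis .
qed

lemma incr_norm:
  assumes "0 \<le> s" "0 \<le> t"
  shows "l2norm M (\<lambda>\<omega>. B t \<omega> - B s \<omega>) = sqrt A * \<bar>t - s\<bar> powr H"
proof (rule power2_eq_imp_eq)
  have "\<bar>t - s\<bar> powr (2 * H) = (\<bar>t - s\<bar> powr H)\<^sup>2"
    by (simp add: power2_eq_square powr_add[symmetric])
  then show "(l2norm M (\<lambda>\<omega>. B t \<omega> - B s \<omega>))\<^sup>2 = (sqrt A * \<bar>t - s\<bar> powr H)\<^sup>2"
    using incr_second_moment[OF assms] A_nonneg by (simp add: l2norm_power2 power_mult_distrib)
qed (use A_nonneg in auto)

lemma B_norm:
  assumes "0 \<le> t"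
  shows "l2norm M (B t) = sqrt A * t powr H"
proof -
  have "l2norm M (B t) = l2norm M (\<lambda>\<omega>. B t \<omega> - B 0 \<omega>)"
    using B_0 B_L2[of t] B_L2[of 0] assms
    by (intro L2_space_AE_cong(2)[symmetric] incr_L2) auto
  then show ?thesis
    using incr_norm[of 0 t] assms by simp
qed

text \<open>By convexity of \<open>r \<mapsto> r\<^sup>2\<^sup>H\<close>: this is where \<open>H \<ge> 1/2\<close> enters.\<close>
lemma incr_cov_nonneg:
  assumes "0 \<le> a" "a \<le> b" "0 \<le> c" "c \<le> d"
  shows "0 \<le> l2inner M (\<lambda>\<omega>. B b \<omega> - B a \<omega>) (\<lambda>\<omega>. B d \<omega> - B c \<omega>)"
proof -
  have int: "integrable M (\<lambda>\<omega>. (B t \<omega> - B s \<omega>)\<^sup>2)" if "0 \<le> s" "0 \<le> t" for s t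
    using L2_space_integrable[OF incr_L2[OF that]] by simp
  \<comment> \<open>Polarization: twice the product of two increments is an alternating sum of four
    squared increments, whose expectations are prescribed.\<close>
  have pt: "2 * ((B b \<omega> - B a \<omega>) * (B d \<omega> - B c \<omega>))
      = (B b \<omega> - B c \<omega>)\<^sup>2 + (B a \<omega> - B d \<omega>)\<^sup>2 - (B a \<omega> - B c \<omega>)\<^sup>2 - (B b \<omega> - B d \<omega>)\<^sup>2" for \<omega>
    by (simp add: power2_eq_square algebra_simps)
  have "2 * l2inner M (\<lambda>\<omega>. B b \<omega> - B a \<omega>) (\<lambda>\<omega>. B d \<omega> - B c \<omega>)
      = A * \<bar>b - c\<bar> powr (2 * H) + A * \<bar>a - d\<bar> powr (2 * H) - A * \<bar>a - c\<bar> powr (2 * H) - A * \<bar>b - d\<bar> powr (2 * H)"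
    unfolding l2inner_def integral_mult_right_zero[symmetric] pt
    using assms by (simp add: int incr_second_moment)
  also have "\<dots> = A * ((\<bar>a - d\<bar> powr (2 * H) + \<bar>b - c\<bar> powr (2 * H)) - (\<bar>a - c\<bar> powr (2 * H) + \<bar>b - d\<bar> powr (2 * H)))"
    by (simp add: algebra_simps)
  also have "\<dots> \<ge> 0"
    using A_nonneg abs_powr_convex_quadruple[of "2 * H" "a - d" "a - c" "b - c" "b - d"] H assms
    by (intro mult_nonneg_nonneg) auto
  finally show ?thesis by simp
qed

section \<open>Covariance with the noise as a Stieltjes function\<close>

text \<open>The cone of test variables whose covariance with \<open>B\<close> is nondecreasing in
  time. It contains the increments, the values of \<open>B\<close> and the Riemann-Stieltjes sums of
  nonnegative integrands.\<close>

definition positive :: "('w \<Rightarrow> real) \<Rightarrow> bool" where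
  "positive Z \<longleftrightarrow> Z \<in> L2_space M \<and> (\<forall>s\<ge>0. \<forall>t\<ge>s. 0 \<le> l2inner M Z (\<lambda>\<omega>. B t \<omega> - B s \<omega>))"

text \<open>Time is frozen at 0 on the negative axis: this extends the covariance continuously to
  the whole line, as a Stieltjes measure requires, and puts no mass on negative times.\<close>

definition cov :: "('w \<Rightarrow> real) \<Rightarrow> real \<Rightarrow> real" where
  "cov Z s = l2inner M Z (B (max 0 s))"

lemma cov_diff:
  assumes "Z \<in> L2_space M" "0 \<le> s" "0 \<le> t"
  shows "l2inner M Z (\<lambda>\<omega>. B t \<omega> - B s \<omega>) = cov Z t - cov Z s"
  using assms by (simp add: cov_def l2inner_diff_right B_L2)

lemma cov_0:
  assumes "Z \<in> L2_space M"
  shows "cov Z 0 = 0"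
proof -
  have "\<bar>cov Z 0\<bar> \<le> l2norm M Z * l2norm M (B 0)"
    using abs_l2inner_le[OF assms B_L2[of 0]] by (simp add: cov_def)
  then show ?thesis
    using H by (simp add: B_norm)
qed

text \<open>By Cauchy-Schwarz the covariance inherits Hoelder continuity of order H from the
  increments. For variables in the cone the associated measure therefore has no atoms.\<close>

lemma cov_continuous:
  assumes "Z \<in> L2_space M"
  shows "continuous_on UNIV (cov Z)"
  unfolding continuous_on_eq_continuous_at[OF open_UNIV]
proof
  fix s :: real
  show "isCont (cov Z) s"
    unfolding isCont_def
  proof (rule Lim_null[THEN iffD2], rule Lim_null_comparison)
    show "\<forall>\<^sub>F t in at s. norm (cov Z t - cov Z s) \<le> l2norm M Z * (sqrt A * \<bar>max 0 t - max 0 s\<bar> powr H)"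
    proof (rule always_eventually, rule allI)
      fix t :: real
      show "norm (cov Z t - cov Z s) \<le> l2norm M Z * (sqrt A * \<bar>max 0 t - max 0 s\<bar> powr H)"
        using abs_l2inner_le[OF assms incr_L2[of "max 0 s" "max 0 t"]] incr_norm[of "max 0 s" "max 0 t"]
          cov_diff[OF assms, of "max 0 s" "max 0 t"]
        by (simp add: cov_def)
    qed
    have "((\<lambda>t. \<bar>max 0 t - max 0 s\<bar>) \<longlongrightarrow> \<bar>max 0 s - max 0 s\<bar>) (at s)"
      by (intro tendsto_intros)
    then have "((\<lambda>t. \<bar>max 0 t - max 0 s\<bar> powr H) \<longlongrightarrow> 0) (at s)"
      using H by (intro tendsto_powr_zero) auto
    then show "((\<lambda>t. l2norm M Z * (sqrt A * \<bar>max 0 t - max 0 s\<bar> powr H)) \<longlongrightarrow> 0) (at s)"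
      by (intro tendsto_mult_right_zero)
  qed
qed

lemma positive_stieltjes:
  assumes "positive Z"
  shows "stieltjes (cov Z)"
proof
  have Z: "Z \<in> L2_space M"
    using assms by (simp add: positive_def)
  show "cov Z x \<le> cov Z y" if "x \<le> y" for x y
  proof -
    have "0 \<le> l2inner M Z (\<lambda>\<omega>. B (max 0 y) \<omega> - B (max 0 x) \<omega>)"
      using assms that by (auto simp: positive_def)
    then show ?thesis
      using cov_diff[OF Z, of "max 0 x" "max 0 y"] by (simp add: cov_def)
  qed
  show "continuous_on UNIV (cov Z)"
    by (rule cov_continuous[OF Z])
qed

lemma rs_sum_L2:
  assumes "tagged_partition a b \<delta> n u v" "0 \<le> a"
  shows "rs_sum B g n u v \<in> L2_space M"
  unfolding rs_sum_def
proof (intro L2_space_sum L2_space_mult_left incr_L2)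
  show "0 \<le> u i" "0 \<le> u (Suc i)" if "i \<in> {..<n}" for i
    using tagged_partition_bounds[OF assms(1), of i] tagged_partition_bounds[OF assms(1), of "Suc i"] that assms(2)
    by auto
qed

lemma l2inner_rs_sum:
  assumes "tagged_partition a b \<delta> n u v" "0 \<le> a" "Z \<in> L2_space M"
  shows "l2inner M Z (rs_sum B g n u v) = (\<Sum>i<n. g (v i) * (cov Z (u (Suc i)) - cov Z (u i)))"
proof -
  have nn: "0 \<le> u i" if "i \<le> n" for i
    using tagged_partition_bounds(1)[OF assms(1) that] assms(2) by auto
  have "l2inner M Z (rs_sum B g n u v) = (\<Sum>i<n. l2inner M Z (\<lambda>\<omega>. g (v i) * (B (u (Suc i)) \<omega> - B (u i) \<omega>)))"
    unfolding rs_sum_def using nn assms(3) by (intro l2inner_sum_right L2_space_mult_left incr_L2) auto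
  also have "\<dots> = (\<Sum>i<n. g (v i) * (cov Z (u (Suc i)) - cov Z (u i)))"
    using nn assms(3) by (intro sum.cong) (auto simp: l2inner_mult_right cov_diff)
  finally show ?thesis .
qed

lemma positive_incr:
  assumes "0 \<le> a" "a \<le> b"
  shows "positive (\<lambda>\<omega>. B b \<omega> - B a \<omega>)"
  unfolding positive_def using assms by (auto intro: incr_cov_nonneg incr_L2)

text \<open>\<open>B 0\<close> vanishes almost surely, so \<open>B a\<close> is an
  increment.\<close>

lemma positive_B:
  assumes "0 \<le> a"
  shows "positive (B a)"
proof -
  have "l2inner M (B a) (\<lambda>\<omega>. B t \<omega> - B s \<omega>) = l2inner M (\<lambda>\<omega>. B a \<omega> - B 0 \<omega>) (\<lambda>\<omega>. B t \<omega> - B s \<omega>)"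
    if "0 \<le> s" "s \<le> t" for s t
  proof -
    have [measurable]: "B a \<in> borel_measurable M" "B 0 \<in> borel_measurable M"
        "B s \<in> borel_measurable M" "B t \<in> borel_measurable M"
      using B_L2 assms that by (auto intro: L2_space_measurable)
    show ?thesis
      unfolding l2inner_def by (rule integral_cong_AE) (use B_0 in auto)
  qed
  then show ?thesis
    using assms incr_cov_nonneg[of 0 a] by (auto simp: positive_def B_L2)
qed

lemma positive_rs_sum:
  assumes "tagged_partition a b \<delta> n u v" "0 \<le> a" "\<And>x. x \<in> {a..b} \<Longrightarrow> 0 \<le> g x"
  shows "positive (rs_sum B g n u v)"
  unfolding positive_def
proof (intro conjI allI impI)
  show L2: "rs_sum B g n u v \<in> L2_space M"
    by (rule rs_sum_L2[OF assms(1,2)])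
  fix s t :: real assume st: "0 \<le> s" "s \<le> t"
  have Z: "(\<lambda>\<omega>. B t \<omega> - B s \<omega>) \<in> L2_space M"
    using st by (intro incr_L2) auto
  interpret stieltjes "cov (\<lambda>\<omega>. B t \<omega> - B s \<omega>)"
    using st by (intro positive_stieltjes positive_incr) auto
  have "0 \<le> (\<Sum>i<n. g (v i) * (cov (\<lambda>\<omega>. B t \<omega> - B s \<omega>) (u (Suc i)) - cov (\<lambda>\<omega>. B t \<omega> - B s \<omega>) (u i)))"
    using assms(3) tagged_partition_bounds(2)[OF assms(1)] tagged_partition_mono[OF assms(1)] mono
    by (intro sum_nonneg mult_nonneg_nonneg) auto
  then show "0 \<le> l2inner M (rs_sum B g n u v) (\<lambda>\<omega>. B t \<omega> - B s \<omega>)"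
    using l2inner_rs_sum[OF assms(1,2) Z] by (simp add: l2inner_commute)
qed

lemma rs_sum_one:
  assumes "tagged_partition a b \<delta> n u v"
  shows "rs_sum B (\<lambda>_. m) n u v = (\<lambda>\<omega>. m * (B b \<omega> - B a \<omega>))"
  using assms unfolding rs_sum_def
  by (simp add: sum_distrib_left[symmetric] sum_lessThan_telescope[of "\<lambda>i. B (u i) _"] tagged_partition_def)

text \<open>The squared norm is a quadratic form in the values of the integrand whose coefficients,
  the covariances of increments, are nonnegative. This monotonicity takes the place of an
  isometry.\<close>

lemma rs_sum_norm_mono:
  assumes P: "tagged_partition a b \<delta> n u v" and a: "0 \<le> a"
    and le: "\<And>x. x \<in> {a..b} \<Longrightarrow> \<bar>g x\<bar> \<le> h x"
  shows "l2norm M (rs_sum B g n u v) \<le> l2norm M (rs_sum B h n u v)"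
proof (rule power2_le_imp_le)
  have nn: "0 \<le> u i" if "i \<le> n" for i
    using tagged_partition_bounds(1)[OF P that] a by auto
  let ?c = "\<lambda>i j. l2inner M (\<lambda>\<omega>. B (u (Suc i)) \<omega> - B (u i) \<omega>) (\<lambda>\<omega>. B (u (Suc j)) \<omega> - B (u j) \<omega>)"
  have sq: "(l2norm M (rs_sum B g n u v))\<^sup>2 = (\<Sum>i<n. \<Sum>j<n. g (v i) * g (v j) * ?c i j)" for g
  proof -
    have "(l2norm M (rs_sum B g n u v))\<^sup>2 = l2inner M (rs_sum B g n u v) (rs_sum B g n u v)"
      by (simp add: l2inner_self)
    also have "\<dots> = (\<Sum>i<n. l2inner M (\<lambda>\<omega>. g (v i) * (B (u (Suc i)) \<omega> - B (u i) \<omega>)) (rs_sum B g n u v))"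
      by (subst (1) rs_sum_def, rule l2inner_sum_left[OF rs_sum_L2[OF P a]])
        (use nn in \<open>auto intro!: L2_space_mult_left incr_L2\<close>)
    also have "\<dots> = (\<Sum>i<n. \<Sum>j<n. g (v i) * g (v j) * ?c i j)"
    proof (rule sum.cong[OF refl])
      fix i assume "i \<in> {..<n}"
      have "l2inner M (\<lambda>\<omega>. B (u (Suc i)) \<omega> - B (u i) \<omega>) (rs_sum B g n u v)
          = (\<Sum>j<n. g (v j) * ?c i j)"
        using nn \<open>i \<in> {..<n}\<close>
        by (subst rs_sum_def, subst l2inner_sum_right)
          (auto intro!: L2_space_mult_left incr_L2 simp: l2inner_mult_right)
      then show "l2inner M (\<lambda>\<omega>. g (v i) * (B (u (Suc i)) \<omega> - B (u i) \<omega>)) (rs_sum B g n u v)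
          = (\<Sum>j<n. g (v i) * g (v j) * ?c i j)"
        by (simp add: l2inner_mult_left sum_distrib_left mult.assoc)
    qed
    finally show ?thesis .
  qed
  show "(l2norm M (rs_sum B g n u v))\<^sup>2 \<le> (l2norm M (rs_sum B h n u v))\<^sup>2"
    unfolding sq
  proof (intro sum_mono mult_right_mono)
    fix i j assume ij: "i \<in> {..<n}" "j \<in> {..<n}"
    have "g (v i) * g (v j) \<le> \<bar>g (v i)\<bar> * \<bar>g (v j)\<bar>"
      by (metis abs_ge_self abs_mult)
    also have "\<dots> \<le> h (v i) * h (v j)"
      using ij le tagged_partition_bounds(2)[OF P] by (intro mult_mono) (auto intro: order_trans[OF abs_ge_zero])
    finally show "g (v i) * g (v j) \<le> h (v i) * h (v j)" .
    show "0 \<le> ?c i j"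
      using ij nn tagged_partition_mono[OF P] by (intro incr_cov_nonneg) auto
  qed
qed simp

text \<open>The comparison integrand \<open>m\<close> is constant, so its sum telescopes to one
  increment of known norm.\<close>

lemma rs_sum_norm_le:
  assumes P: "tagged_partition a b \<delta> n u v" and "0 \<le> a" "a \<le> b"
    and le: "\<And>x. x \<in> {a..b} \<Longrightarrow> \<bar>g x\<bar> \<le> m"
  shows "l2norm M (rs_sum B g n u v) \<le> m * (sqrt A * (b - a) powr H)"
proof -
  have "0 \<le> m"
    using le[of a] assms by (auto intro: order_trans[OF abs_ge_zero])
  then show ?thesis
    using rs_sum_norm_mono[OF P assms(2) le] assms
    by (simp add: rs_sum_one[OF P] L2_space_mult_left(2)[OF incr_L2] incr_norm)
qed

lemma rs_sum_norm_ge: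
  assumes P: "tagged_partition a b \<delta> n u v" and "0 \<le> a" "a \<le> b" "0 \<le> m"
    and le: "\<And>x. x \<in> {a..b} \<Longrightarrow> m \<le> g x"
  shows "m * (sqrt A * (b - a) powr H) \<le> l2norm M (rs_sum B g n u v)"
  using rs_sum_norm_mono[OF P assms(2), of "\<lambda>_. m" g] assms
  by (simp add: rs_sum_one[OF P] L2_space_mult_left(2)[OF incr_L2] incr_norm)

section \<open>Stochastic integrals over intervals without singularity\<close>

lemma has_RS_integral_iff:
  assumes "0 \<le> a"
  shows "has_RS_integral M g B a b K \<longleftrightarrow> K \<in> L2_space M \<and>
    (\<forall>\<epsilon>>0. \<exists>\<delta>>0. \<forall>n u v. tagged_partition a b \<delta> n u v \<longrightarrow> l2norm M (\<lambda>\<omega>. rs_sum B g n u v \<omega> - K \<omega>) < \<epsilon>)"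
    (is "?L \<longleftrightarrow> ?K \<and> ?R")
proof (intro iffI conjI)
  have 1: "?L \<longleftrightarrow> ?K \<and> (\<forall>\<epsilon>>0. \<exists>\<delta>>0. \<forall>n u v. tagged_partition a b \<delta> n u v \<longrightarrow>
      sq_dist M (rs_sum B g n u v) K < ennreal \<epsilon>)"
    unfolding has_RS_integral_def tagged_partition_def rs_sum_def by simp
  have eq: "sq_dist M (rs_sum B g n u v) K < ennreal (\<epsilon>\<^sup>2) \<longleftrightarrow> l2norm M (\<lambda>\<omega>. rs_sum B g n u v \<omega> - K \<omega>) < \<epsilon>"
    if "tagged_partition a b \<delta> n u v" "?K" "0 < \<epsilon>" for n u v \<delta> \<epsilon>
    using that assms by (intro sq_dist_less_iff rs_sum_L2)
  show ?K if ?L using that 1 by simp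
  show ?R if L: ?L
  proof (intro allI impI)
    fix \<epsilon> :: real assume e: "0 < \<epsilon>"
    then have e2: "0 < \<epsilon>\<^sup>2" by simp
    have K: ?K using L 1 by simp
    have "\<forall>\<epsilon>>0. \<exists>\<delta>>0. \<forall>n u v. tagged_partition a b \<delta> n u v \<longrightarrow> sq_dist M (rs_sum B g n u v) K < ennreal \<epsilon>"
      using L 1 by simp
    from this[rule_format, OF e2] obtain \<delta> where d: "\<delta> > 0"
      "\<forall>n u v. tagged_partition a b \<delta> n u v \<longrightarrow> sq_dist M (rs_sum B g n u v) K < ennreal (\<epsilon>\<^sup>2)"
      by (elim exE conjE)
    show "\<exists>\<delta>>0. \<forall>n u v. tagged_partition a b \<delta> n u v \<longrightarrow> l2norm M (\<lambda>\<omega>. rs_sum B g n u v \<omega> - K \<omega>) < \<epsilon>"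
    proof (intro exI[of _ \<delta>] conjI allI impI d(1))
      fix n u v assume P: "tagged_partition a b \<delta> n u v"
      show "l2norm M (\<lambda>\<omega>. rs_sum B g n u v \<omega> - K \<omega>) < \<epsilon>"
        using d(2) eq[OF P K e] P by simp
    qed
  qed
  show ?L if R: "?K \<and> ?R"
    unfolding 1
  proof (intro conjI allI impI)
    show K: ?K using R by simp
    fix \<epsilon> :: real assume e: "0 < \<epsilon>"
    then have e2: "0 < sqrt \<epsilon>" by simp
    have ?R using R by simp
    from this[rule_format, OF e2] obtain \<delta> where d: "\<delta> > 0"
      "\<forall>n u v. tagged_partition a b \<delta> n u v \<longrightarrow> l2norm M (\<lambda>\<omega>. rs_sum B g n u v \<omega> - K \<omega>) < sqrt \<epsilon>"
      by (elim exE conjE)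
    show "\<exists>\<delta>>0. \<forall>n u v. tagged_partition a b \<delta> n u v \<longrightarrow> sq_dist M (rs_sum B g n u v) K < ennreal \<epsilon>"
    proof (intro exI[of _ \<delta>] conjI allI impI d(1))
      fix n u v assume P: "tagged_partition a b \<delta> n u v"
      show "sq_dist M (rs_sum B g n u v) K < ennreal \<epsilon>"
        using d(2) eq[OF P K e2] P e by simp
    qed
  qed
qed

lemma has_RS_integralE:
  assumes "has_RS_integral M g B a b K" "0 \<le> a" "0 < \<epsilon>"
  obtains \<delta> where "0 < \<delta>" "\<forall>n u v. tagged_partition a b \<delta> n u v \<longrightarrow> l2norm M (\<lambda>\<omega>. rs_sum B g n u v \<omega> - K \<omega>) < \<epsilon>"
proof -
  have "\<forall>\<epsilon>>0. \<exists>\<delta>>0. \<forall>n u v. tagged_partition a b \<delta> n u v \<longrightarrow> l2norm M (\<lambda>\<omega>. rs_sum B g n u v \<omega> - K \<omega>) < \<epsilon>"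
    using assms(1) has_RS_integral_iff[OF assms(2)] by simp
  from this[rule_format, OF assms(3)] show thesis
    using that by (elim exE conjE)
qed

abbreviation usum :: "(real \<Rightarrow> real) \<Rightarrow> real \<Rightarrow> real \<Rightarrow> nat \<Rightarrow> 'w \<Rightarrow> real" where
  "usum g a b n \<equiv> rs_sum B g n (uniform_point a b n) (uniform_point a b n)"

lemma eventually_usum_L2:
  assumes "0 \<le> a" "a \<le> b"
  shows "\<forall>\<^sub>F n in sequentially. usum g a b n \<in> L2_space M"
  using eventually_uniform_partition[OF assms(2) zero_less_one] by eventually_elim (rule rs_sum_L2[OF _ assms(1)])

lemma has_RS_integral_usum:
  assumes "has_RS_integral M g B a b K" "0 \<le> a" "a \<le> b"
  shows "(\<lambda>n. l2norm M (\<lambda>\<omega>. usum g a b n \<omega> - K \<omega>)) \<longlonglongrightarrow> 0"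
  unfolding tendsto_iff
proof (intro allI impI)
  fix \<epsilon> :: real assume "0 < \<epsilon>"
  then obtain \<delta> where d: "\<delta> > 0" "\<forall>n u v. tagged_partition a b \<delta> n u v \<longrightarrow> l2norm M (\<lambda>\<omega>. rs_sum B g n u v \<omega> - K \<omega>) < \<epsilon>"
    by (rule has_RS_integralE[OF assms(1,2)])
  show "\<forall>\<^sub>F n in sequentially. dist (l2norm M (\<lambda>\<omega>. usum g a b n \<omega> - K \<omega>)) 0 < \<epsilon>"
    using eventually_uniform_partition[OF assms(3) d(1)] by eventually_elim (use d(2) in simp)
qed

lemma has_RS_integral_L2: "has_RS_integral M g B a b K \<Longrightarrow> K \<in> L2_space M"
  by (simp add: has_RS_integral_def)

lemma has_RS_integral_norm_le:
  assumes K: "has_RS_integral M g B a b K" and "0 \<le> a" "a \<le> b" and "\<And>x. x \<in> {a..b} \<Longrightarrow> \<bar>g x\<bar> \<le> m"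
  shows "l2norm M K \<le> m * (sqrt A * (b - a) powr H)"
proof (rule tendsto_upperbound[OF tendsto_l2norm])
  show "(\<lambda>n. l2norm M (\<lambda>\<omega>. usum g a b n \<omega> - K \<omega>)) \<longlonglongrightarrow> 0"
    by (rule has_RS_integral_usum[OF assms(1-3)])
  show "\<forall>\<^sub>F n in sequentially. l2norm M (usum g a b n) \<le> m * (sqrt A * (b - a) powr H)"
    using eventually_uniform_partition[OF assms(3) zero_less_one]
    by eventually_elim (use assms in \<open>auto intro: rs_sum_norm_le\<close>)
qed (use assms in \<open>auto intro: eventually_usum_L2 has_RS_integral_L2\<close>)

lemma has_RS_integral_norm_ge:
  assumes K: "has_RS_integral M g B a b K" and "0 \<le> a" "a \<le> b" "0 \<le> m" and "\<And>x. x \<in> {a..b} \<Longrightarrow> m \<le> g x"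
  shows "m * (sqrt A * (b - a) powr H) \<le> l2norm M K"
proof (rule tendsto_lowerbound[OF tendsto_l2norm])
  show "(\<lambda>n. l2norm M (\<lambda>\<omega>. usum g a b n \<omega> - K \<omega>)) \<longlonglongrightarrow> 0"
    by (rule has_RS_integral_usum[OF assms(1-3)])
  show "\<forall>\<^sub>F n in sequentially. m * (sqrt A * (b - a) powr H) \<le> l2norm M (usum g a b n)"
    using eventually_uniform_partition[OF assms(3) zero_less_one]
    by eventually_elim (use assms in \<open>auto intro: rs_sum_norm_ge\<close>)
qed (use assms in \<open>auto intro: eventually_usum_L2 has_RS_integral_L2\<close>)

lemma has_RS_integral_diff:
  assumes "has_RS_integral M g B a b K" "has_RS_integral M h B a b L" "0 \<le> a"
  shows "has_RS_integral M (\<lambda>x. g x - h x) B a b (\<lambda>\<omega>. K \<omega> - L \<omega>)"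
  unfolding has_RS_integral_iff[OF assms(3)]
proof (intro conjI allI impI)
  have L2: "K \<in> L2_space M" "L \<in> L2_space M"
    using assms by (auto intro: has_RS_integral_L2)
  then show "(\<lambda>\<omega>. K \<omega> - L \<omega>) \<in> L2_space M"
    by (rule L2_space_diff)
  fix \<epsilon> :: real assume "0 < \<epsilon>"
  then have e: "0 < \<epsilon> / 2" by simp
  obtain d1 where d1: "d1 > 0" "\<forall>n u v. tagged_partition a b d1 n u v \<longrightarrow> l2norm M (\<lambda>\<omega>. rs_sum B g n u v \<omega> - K \<omega>) < \<epsilon> / 2"
    by (rule has_RS_integralE[OF assms(1,3) e])
  obtain d2 where d2: "d2 > 0" "\<forall>n u v. tagged_partition a b d2 n u v \<longrightarrow> l2norm M (\<lambda>\<omega>. rs_sum B h n u v \<omega> - L \<omega>) < \<epsilon> / 2"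
    by (rule has_RS_integralE[OF assms(2,3) e])
  have "l2norm M (\<lambda>\<omega>. rs_sum B (\<lambda>x. g x - h x) n u v \<omega> - (K \<omega> - L \<omega>)) < \<epsilon>"
    if P: "tagged_partition a b (min d1 d2) n u v" for n u v
  proof -
    have P': "tagged_partition a b d1 n u v" "tagged_partition a b d2 n u v"
      using P by (auto simp: tagged_partition_def)
    have eq: "(\<lambda>\<omega>. rs_sum B (\<lambda>x. g x - h x) n u v \<omega> - (K \<omega> - L \<omega>))
        = (\<lambda>\<omega>. (rs_sum B g n u v \<omega> - K \<omega>) - (rs_sum B h n u v \<omega> - L \<omega>))"
      by (simp add: fun_eq_iff rs_sum_def left_diff_distrib sum_subtractf)
    have "l2norm M (\<lambda>\<omega>. rs_sum B (\<lambda>x. g x - h x) n u v \<omega> - (K \<omega> - L \<omega>))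
        \<le> l2norm M (\<lambda>\<omega>. rs_sum B g n u v \<omega> - K \<omega>) + l2norm M (\<lambda>\<omega>. rs_sum B h n u v \<omega> - L \<omega>)"
      unfolding eq using P L2 assms(3) by (intro L2_space_diff rs_sum_L2)
    also have "\<dots> < \<epsilon>"
      using d1(2)[rule_format, OF P'(1)] d2(2)[rule_format, OF P'(2)] by simp
    finally show ?thesis .
  qed
  then show "\<exists>\<delta>>0. \<forall>n u v. tagged_partition a b \<delta> n u v \<longrightarrow>
      l2norm M (\<lambda>\<omega>. rs_sum B (\<lambda>x. g x - h x) n u v \<omega> - (K \<omega> - L \<omega>)) < \<epsilon>"
    using d1(1) d2(1) by (intro exI[of _ "min d1 d2"]) auto
qed

text \<open>A fine partition of [b, c] is prefixed with one fixed fine partition of [a, b]. The sum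
  over [b, c] is then the difference of a sum close to \<open>L\<close> and a sum close to
  \<open>K\<close>.\<close>

lemma has_RS_integral_split:
  assumes K: "has_RS_integral M g B a b K" "has_RS_integral M g B a c L" and ab: "0 \<le> a" "a \<le> b" "b \<le> c"
  shows "has_RS_integral M g B b c (\<lambda>\<omega>. L \<omega> - K \<omega>)"
proof -
  have b: "0 \<le> b" using ab by simp
  have L2: "K \<in> L2_space M" "L \<in> L2_space M"
    using K by (auto intro: has_RS_integral_L2)
  show ?thesis
    unfolding has_RS_integral_iff[OF b]
  proof (intro conjI allI impI)
    show "(\<lambda>\<omega>. L \<omega> - K \<omega>) \<in> L2_space M"
      using L2 by (intro L2_space_diff)
    fix \<epsilon> :: real assume "0 < \<epsilon>"
    then have e: "0 < \<epsilon> / 2" by simp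
    obtain d1 where d1: "d1 > 0" "\<forall>n u v. tagged_partition a b d1 n u v \<longrightarrow> l2norm M (\<lambda>\<omega>. rs_sum B g n u v \<omega> - K \<omega>) < \<epsilon> / 2"
      by (rule has_RS_integralE[OF K(1) ab(1) e])
    obtain d2 where d2: "d2 > 0" "\<forall>n u v. tagged_partition a c d2 n u v \<longrightarrow> l2norm M (\<lambda>\<omega>. rs_sum B g n u v \<omega> - L \<omega>) < \<epsilon> / 2"
      by (rule has_RS_integralE[OF K(2) ab(1) e])
    have "min d1 d2 > 0" using d1 d2 by simp
    from eventually_uniform_partition[OF ab(2) this] obtain m where
      m: "tagged_partition a b (min d1 d2) m (uniform_point a b m) (uniform_point a b m)"
      unfolding eventually_at_top_linorder by blast
    have "l2norm M (\<lambda>\<omega>. rs_sum B g n u v \<omega> - (L \<omega> - K \<omega>)) < \<epsilon>"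
      if P: "tagged_partition b c (min d1 d2) n u v" for n u v
    proof -
      \<comment> \<open>The point with index \<open>m\<close> is \<open>b\<close> in both halves,
        but the tag with index \<open>m\<close> already belongs to the second half: hence \<le> for
        the points and < for the tags.\<close>
      define u' where "u' = (\<lambda>i. if i \<le> m then uniform_point a b m i else u (i - m))"
      define v' where "v' = (\<lambda>i. if i < m then uniform_point a b m i else v (i - m))"
      have joint: "u' (m + i) = u i" for i
        using m P by (cases "i = 0") (auto simp: u'_def tagged_partition_def)
      have J0: "tagged_partition a c (min d1 d2) (m + n) u' v'"
        unfolding tagged_partition_def
      proof (intro conjI allI impI)
        show "u' 0 = a" using m by (simp add: u'_def tagged_partition_def)
        show "u' (m + n) = c" using P joint[of n] by (simp add: tagged_partition_def)
        fix i assume i: "i < m + n"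
        have "u' i \<le> v' i \<and> v' i \<le> u' (Suc i) \<and> u' (Suc i) - u' i < min d1 d2"
        proof (cases "i < m")
          case True
          then show ?thesis
            using m by (simp add: u'_def v'_def tagged_partition_def)
        next
          case False
          then obtain j where j: "i = m + j" "j < n"
            using i by (metis add_diff_inverse_nat nat_add_left_cancel_less)
          then show ?thesis
            using P joint[of j] joint[of "Suc j"] by (simp add: v'_def tagged_partition_def)
        qed
        then show "u' i \<le> v' i" "v' i \<le> u' (Suc i)" "u' (Suc i) - u' i < min d1 d2"
          by auto
      qed
      then have "tagged_partition a c d2 (m + n) u' v'"
        by (simp add: tagged_partition_def)
      then have J: "l2norm M (\<lambda>\<omega>. rs_sum B g (m + n) u' v' \<omega> - L \<omega>) < \<epsilon> / 2"
        "rs_sum B g (m + n) u' v' \<in> L2_space M"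
        using d2(2) rs_sum_L2[OF J0 ab(1)] by auto
      have "tagged_partition a b d1 m (uniform_point a b m) (uniform_point a b m)"
        using m by (simp add: tagged_partition_def)
      then have U: "l2norm M (\<lambda>\<omega>. usum g a b m \<omega> - K \<omega>) < \<epsilon> / 2" "usum g a b m \<in> L2_space M"
        using d1(2) rs_sum_L2[OF m ab(1)] by auto
      have "rs_sum B g (m + n) u' v' = (\<lambda>\<omega>. usum g a b m \<omega> + rs_sum B g n u v \<omega>)"
        unfolding rs_sum_def sum_lessThan_add
      proof (intro ext arg_cong2[where f = "(+)"] sum.cong refl)
        fix \<omega> i assume "i \<in> {..<n}"
        show "g (v' (m + i)) * (B (u' (Suc (m + i))) \<omega> - B (u' (m + i)) \<omega>) = g (v i) * (B (u (Suc i)) \<omega> - B (u i) \<omega>)"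
          using joint[of i] joint[of "Suc i"] by (simp add: v'_def)
      qed (simp add: u'_def v'_def)
      then have eq: "(\<lambda>\<omega>. rs_sum B g n u v \<omega> - (L \<omega> - K \<omega>))
          = (\<lambda>\<omega>. (rs_sum B g (m + n) u' v' \<omega> - L \<omega>) - (usum g a b m \<omega> - K \<omega>))"
        by (simp add: fun_eq_iff)
      have "l2norm M (\<lambda>\<omega>. rs_sum B g n u v \<omega> - (L \<omega> - K \<omega>))
          \<le> l2norm M (\<lambda>\<omega>. rs_sum B g (m + n) u' v' \<omega> - L \<omega>) + l2norm M (\<lambda>\<omega>. usum g a b m \<omega> - K \<omega>)"
        unfolding eq using J U L2 by (intro L2_space_diff)
      also have "\<dots> < \<epsilon>"
        using J U by simp
      finally show ?thesis .
    qed
    then show "\<exists>\<delta>>0. \<forall>n u v. tagged_partition b c \<delta> n u v \<longrightarrow> l2norm M (\<lambda>\<omega>. rs_sum B g n u v \<omega> - (L \<omega> - K \<omega>)) < \<epsilon>"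
      using d1(1) d2(1) by (intro exI[of _ "min d1 d2"]) auto
  qed
qed

text \<open>
  Two Riemann--Stieltjes sums are compared through their inner products: for a fixed sum \<open>S\<close> with
  nonnegative weights, \<open>s \<mapsto> E[S B(s)]\<close> is nondecreasing, so that \<open>E[S S']\<close> is close to one and
  the same Stieltjes integral for all fine sums \<open>S'\<close>.
\<close>
lemma has_RS_integral_exists:
  assumes ab: "0 \<le> a" "a \<le> b" and g: "continuous_on {a..b} g" "\<And>x. x \<in> {a..b} \<Longrightarrow> 0 \<le> g x"
  obtains K where "has_RS_integral M g B a b K"
proof -
  have "bounded (g ` {a..b})"
    using g by (intro compact_imp_bounded compact_continuous_image) auto
  then obtain m where m: "\<forall>x\<in>{a..b}. norm (g x) \<le> m"
    unfolding bounded_iff by auto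
  define V where "V = sqrt A * (b - a) powr H"
  have V: "V \<ge> 0" using A_nonneg by (simp add: V_def)
  have m0: "m \<ge> 0"
    using m ab by (metis atLeastAtMost_iff norm_ge_zero order_refl order_trans)
  have Cauchy: thesis if e: "0 < \<epsilon>" and gl: "\<And>\<delta>. 0 < \<delta> \<Longrightarrow> (\<forall>n u v n' u' v'. tagged_partition a b \<delta> n u v \<longrightarrow>
      tagged_partition a b \<delta> n' u' v' \<longrightarrow> l2norm M (\<lambda>\<omega>. rs_sum B g n u v \<omega> - rs_sum B g n' u' v' \<omega>) < \<epsilon>) \<Longrightarrow> thesis" for \<epsilon> thesis
  proof -
    \<comment> \<open>The two comparisons below cost \<open>4 * (w * (m * V\<^sup>2))\<close>
      together, which has to stay below \<open>\<epsilon>\<^sup>2\<close>. The summand 1 covers m =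
      0 and V = 0.\<close>
    define w where "w = \<epsilon>\<^sup>2 / (4 * m * V\<^sup>2 + 1)"
    have den: "4 * m * V\<^sup>2 + 1 > 0"
      using m0 by (simp add: add_nonneg_pos)
    then have w: "w > 0" using e by (simp add: w_def)
    have "uniformly_continuous_on {a..b} g"
      using g by (intro compact_uniformly_continuous) auto
    then obtain \<delta> where d: "\<delta> > 0" "\<And>x y. x \<in> {a..b} \<Longrightarrow> y \<in> {a..b} \<Longrightarrow> dist y x < \<delta> \<Longrightarrow> dist (g y) (g x) < w"
      unfolding uniformly_continuous_on_def using w by metis
    have osc: "\<bar>g x - g y\<bar> \<le> w" if "x \<in> {a..b}" "y \<in> {a..b}" "\<bar>x - y\<bar> < \<delta>" for x y
      using d(2)[of y x] that by (simp add: dist_real_def)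
    \<comment> \<open>Paired with the fixed first sum, both sums approximate the same Stieltjes
      integral of \<open>g\<close> with error at most \<open>w\<close> times the mass of the
      measure, and that mass is at most \<open>m * V\<^sup>2\<close>.\<close>
    have key: "\<bar>l2inner M (rs_sum B g n u v) (rs_sum B g n' u' v') - l2inner M (rs_sum B g n u v) (rs_sum B g n u v)\<bar> \<le> 2 * (w * (m * V\<^sup>2))"
      if P: "tagged_partition a b \<delta> n u v" "tagged_partition a b \<delta> n' u' v'" for n u v n' u' v'
    proof -
      let ?Z = "rs_sum B g n u v"
      have Z: "positive ?Z" "?Z \<in> L2_space M"
        using P(1) ab g(2) by (auto intro: positive_rs_sum rs_sum_L2)
      interpret stieltjes "cov ?Z"
        by (rule positive_stieltjes[OF Z(1)])
      have "cov ?Z b - cov ?Z a = l2inner M ?Z (\<lambda>\<omega>. B b \<omega> - B a \<omega>)"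
        using ab Z by (simp add: cov_diff)
      also have "\<dots> \<le> l2norm M ?Z * l2norm M (\<lambda>\<omega>. B b \<omega> - B a \<omega>)"
        using abs_l2inner_le[OF Z(2) incr_L2, of a b] ab by auto
      also have "\<dots> \<le> (m * V) * V"
      proof (rule mult_mono)
        show "l2norm M ?Z \<le> m * V"
          unfolding V_def using m by (intro rs_sum_norm_le[OF P(1) ab]) auto
        show "l2norm M (\<lambda>\<omega>. B b \<omega> - B a \<omega>) \<le> V"
          using ab by (simp add: V_def incr_norm)
      qed (use m0 V in auto)
      finally have le: "w * (cov ?Z b - cov ?Z a) \<le> w * (m * V\<^sup>2)"
        using w by (simp add: power2_eq_square mult.assoc)
      show ?thesis
        using RS_sum_error[OF P(1) g(1) osc] RS_sum_error[OF P(2) g(1) osc] le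
          l2inner_rs_sum[OF P(1) ab(1) Z(2), of g] l2inner_rs_sum[OF P(2) ab(1) Z(2), of g] by auto
    qed
    have "l2norm M (\<lambda>\<omega>. rs_sum B g n u v \<omega> - rs_sum B g n' u' v' \<omega>) < \<epsilon>"
      if P: "tagged_partition a b \<delta> n u v" "tagged_partition a b \<delta> n' u' v'" for n u v n' u' v'
    proof (rule power2_less_imp_less)
      let ?S = "rs_sum B g n u v" and ?T = "rs_sum B g n' u' v'"
      have L2: "?S \<in> L2_space M" "?T \<in> L2_space M"
        using P ab by (auto intro: rs_sum_L2)
      \<comment> \<open>Expanding the square leaves two differences of inner products, one with
        \<open>?S\<close> fixed and one with \<open>?T\<close> fixed; \<open>key\<close> bounds each
        of them.\<close>
      have "(l2norm M (\<lambda>\<omega>. ?S \<omega> - ?T \<omega>))\<^sup>2 = l2inner M ?S ?S - l2inner M ?S ?T + (l2inner M ?T ?T - l2inner M ?T ?S)"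
        using L2 by (simp add: l2inner_self[symmetric] l2inner_diff_left l2inner_diff_right L2_space_diff)
      also have "\<dots> \<le> 4 * (w * (m * V\<^sup>2))"
        using key[OF P] key[OF P(2) P(1)] by linarith
      also have "\<dots> < w * (4 * m * V\<^sup>2 + 1)"
        using w by (simp add: algebra_simps)
      also have "\<dots> = \<epsilon>\<^sup>2"
        using den by (simp add: w_def)
      finally show "(l2norm M (\<lambda>\<omega>. ?S \<omega> - ?T \<omega>))\<^sup>2 < \<epsilon>\<^sup>2" .
    qed (use e in simp)
    then show thesis
      using gl[OF d(1)] by simp
  qed
  \<comment> \<open>Uniform sums are known to be square-integrable only from some index on;
    completeness needs it for all terms, hence the shift by \<open>n0\<close>.\<close>
  obtain n0 where n0: "\<And>n. n \<ge> n0 \<Longrightarrow> usum g a b n \<in> L2_space M"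
    using eventually_usum_L2[OF ab] unfolding eventually_at_top_linorder by blast
  obtain K where K: "K \<in> L2_space M" "(\<lambda>n. l2norm M (\<lambda>\<omega>. usum g a b (n + n0) \<omega> - K \<omega>)) \<longlonglongrightarrow> 0"
  proof (rule L2_space_complete[of "\<lambda>n. usum g a b (n + n0)"])
    fix \<epsilon> :: real assume "0 < \<epsilon>"
    then obtain \<delta> where d: "\<delta> > 0" "\<forall>n u v n' u' v'. tagged_partition a b \<delta> n u v \<longrightarrow> tagged_partition a b \<delta> n' u' v' \<longrightarrow>
        l2norm M (\<lambda>\<omega>. rs_sum B g n u v \<omega> - rs_sum B g n' u' v' \<omega>) < \<epsilon>"
      by (rule Cauchy)
    obtain N where "\<And>n. n \<ge> N \<Longrightarrow> tagged_partition a b \<delta> n (uniform_point a b n) (uniform_point a b n)"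
      using eventually_uniform_partition[OF ab(2) d(1)] unfolding eventually_at_top_linorder by blast
    then show "\<exists>N. \<forall>m\<ge>N. \<forall>n\<ge>N. l2norm M (\<lambda>\<omega>. usum g a b (m + n0) \<omega> - usum g a b (n + n0) \<omega>) < \<epsilon>"
      using d(2)[rule_format] by (intro exI[of _ N]) auto
  qed (use n0 in auto)
  have "has_RS_integral M g B a b K"
    unfolding has_RS_integral_iff[OF ab(1)]
  proof (intro conjI allI impI K(1))
    fix \<epsilon> :: real assume e: "0 < \<epsilon>"
    then have "\<epsilon> / 2 > 0" by simp
    then obtain \<delta> where d: "\<delta> > 0" "\<forall>n u v n' u' v'. tagged_partition a b \<delta> n u v \<longrightarrow> tagged_partition a b \<delta> n' u' v' \<longrightarrow>
        l2norm M (\<lambda>\<omega>. rs_sum B g n u v \<omega> - rs_sum B g n' u' v' \<omega>) < \<epsilon> / 2"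
      by (rule Cauchy)
    obtain N where N: "\<And>n. n \<ge> N \<Longrightarrow> tagged_partition a b \<delta> n (uniform_point a b n) (uniform_point a b n)"
      using eventually_uniform_partition[OF ab(2) d(1)] unfolding eventually_at_top_linorder by blast
    have "\<forall>\<^sub>F n in sequentially. dist (l2norm M (\<lambda>\<omega>. usum g a b (n + n0) \<omega> - K \<omega>)) 0 < \<epsilon> / 2"
      using K(2) \<open>\<epsilon> / 2 > 0\<close> unfolding tendsto_iff by blast
    then obtain N' where N': "\<And>n. n \<ge> N' \<Longrightarrow> l2norm M (\<lambda>\<omega>. usum g a b (n + n0) \<omega> - K \<omega>) < \<epsilon> / 2"
      unfolding eventually_at_top_linorder by auto
    let ?n = "max N N' + n0"
    have "l2norm M (\<lambda>\<omega>. rs_sum B g n u v \<omega> - K \<omega>) < \<epsilon>" if P: "tagged_partition a b \<delta> n u v" for n u v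
    proof -
      have "l2norm M (\<lambda>\<omega>. rs_sum B g n u v \<omega> - K \<omega>)
          \<le> l2norm M (\<lambda>\<omega>. rs_sum B g n u v \<omega> - usum g a b ?n \<omega>) + l2norm M (\<lambda>\<omega>. usum g a b ?n \<omega> - K \<omega>)"
        using rs_sum_L2[OF P ab(1)] n0 K(1) by (intro l2norm_triangle_diff) auto
      also have "\<dots> < \<epsilon> / 2 + \<epsilon> / 2"
        using d(2)[rule_format, OF P N, of ?n] N'[of "max N N'"] by (intro add_strict_mono) auto
      finally show ?thesis by simp
    qed
    then show "\<exists>\<delta>>0. \<forall>n u v. tagged_partition a b \<delta> n u v \<longrightarrow> l2norm M (\<lambda>\<omega>. rs_sum B g n u v \<omega> - K \<omega>) < \<epsilon>"
      using d(1) by blast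
  qed
  then show thesis by (rule that)
qed

text \<open>Paired with a variable from the cone, the uniform sums become Riemann-Stieltjes sums for
  the measure of \<open>cov Z\<close>. So a stochastic integral is accessible through ordinary
  integrals.\<close>

lemma l2inner_has_RS_integral:
  assumes K: "has_RS_integral M g B a b K" and ab: "0 \<le> a" "a \<le> b" and g: "continuous_on {a..b} g"
    and Z: "positive Z"
  shows "l2inner M Z K = (LINT x:{a<..b}|interval_measure (cov Z). g x)"
proof -
  have ZL: "Z \<in> L2_space M" using Z by (simp add: positive_def)
  interpret stieltjes "cov Z" by (rule positive_stieltjes[OF Z])
  let ?I = "LINT x:{a<..b}|interval_measure (cov Z). g x"
  have lim1: "(\<lambda>n. l2inner M Z (usum g a b n)) \<longlonglongrightarrow> l2inner M Z K"
    using K ab by (intro tendsto_l2inner ZL has_RS_integral_L2[OF K] eventually_usum_L2 has_RS_integral_usum)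
  have "(\<lambda>n. l2inner M Z (usum g a b n)) \<longlonglongrightarrow> ?I"
    unfolding tendsto_iff
  proof (intro allI impI)
    fix \<epsilon> :: real assume e: "0 < \<epsilon>"
    define w where "w = \<epsilon> / (cov Z b - cov Z a + 1)"
    have den: "cov Z b - cov Z a + 1 > 0"
      using mono[OF ab(2)] by simp
    then have w: "w > 0" using e by (simp add: w_def)
    have "uniformly_continuous_on {a..b} g"
      using g by (intro compact_uniformly_continuous) auto
    then obtain \<delta> where d: "\<delta> > 0" "\<And>x y. x \<in> {a..b} \<Longrightarrow> y \<in> {a..b} \<Longrightarrow> dist y x < \<delta> \<Longrightarrow> dist (g y) (g x) < w"
      unfolding uniformly_continuous_on_def using w by metis
    have osc: "\<bar>g x - g y\<bar> \<le> w" if "x \<in> {a..b}" "y \<in> {a..b}" "\<bar>x - y\<bar> < \<delta>" for x y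
      using d(2)[of y x] that by (simp add: dist_real_def)
    have lt: "w * (cov Z b - cov Z a) < \<epsilon>"
    proof -
      have "w * (cov Z b - cov Z a) < w * (cov Z b - cov Z a + 1)"
        using w by simp
      also have "\<dots> = \<epsilon>" using den by (simp add: w_def)
      finally show ?thesis .
    qed
    show "\<forall>\<^sub>F n in sequentially. dist (l2inner M Z (usum g a b n)) ?I < \<epsilon>"
      using eventually_uniform_partition[OF ab(2) d(1)]
    proof eventually_elim
      case (elim n)
      show ?case
        using RS_sum_error[OF elim g osc] l2inner_rs_sum[OF elim ab(1) ZL, of g] lt by (simp add: dist_real_def)
    qed
  qed
  then show ?thesis
    using lim1 LIMSEQ_unique by blast
qed

section \<open>Integrals with a power singularity at the upper limit\<close>

text \<open>Increments over a length h have size h^H, so near the upper limit a singularity of order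
  \<beta> - 1 contributes h^(\<beta>+H-1), which is small exactly if the exponent is positive. In
  the absence of noise there is no condition.\<close>

definition admissible :: "real \<Rightarrow> bool" where
  "admissible \<beta> \<longleftrightarrow> A = 0 \<or> 1 < \<beta> + H"

text \<open>The geometric series of c sqrt(A) (x / 2^k)^\<theta> over k \<ge> 1, where \<theta> =
  \<beta> + H - 1. Its k-th term bounds the integral over the k-th dyadic interval towards the
  singularity.\<close>

definition tail_bound :: "real \<Rightarrow> real \<Rightarrow> real \<Rightarrow> real" where
  "tail_bound \<beta> c x = c * (sqrt A * x powr (\<beta> + H - 1)) / (2 powr (\<beta> + H - 1) - 1)"

lemma admissible_cases:
  assumes "admissible \<beta>"
  obtains "A = 0" | "0 < \<beta> + H - 1" "1 < 2 powr (\<beta> + H - 1)"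
  using assms gr_one_powr[of 2 "\<beta> + H - 1"] unfolding admissible_def by fastforce

lemma tail_bound_mono:
  assumes "admissible \<beta>" "0 \<le> c" "0 \<le> x" "x \<le> y"
  shows "0 \<le> tail_bound \<beta> c x" and "tail_bound \<beta> c x \<le> tail_bound \<beta> c y"
proof -
  have "0 \<le> tail_bound \<beta> c x \<and> tail_bound \<beta> c x \<le> tail_bound \<beta> c y"
    using assms(1)
  proof (cases rule: admissible_cases)
    case 1
    then show ?thesis
      unfolding tail_bound_def by simp
  next
    case 2
    then show ?thesis
      using assms A_nonneg unfolding tail_bound_def
      by (intro conjI divide_right_mono divide_nonneg_nonneg mult_left_mono mult_nonneg_nonneg powr_mono2)
        (auto simp: ge_one_powr_ge_zero)
  qed
  then show "0 \<le> tail_bound \<beta> c x" "tail_bound \<beta> c x \<le> tail_bound \<beta> c y"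
    by auto
qed

lemma tail_bound_tendsto:
  assumes "admissible \<beta>" "(f \<longlongrightarrow> 0) F" "\<forall>\<^sub>F x in F. 0 \<le> f x"
  shows "((\<lambda>x. tail_bound \<beta> c (f x)) \<longlongrightarrow> 0) F"
  using assms(1)
proof (cases rule: admissible_cases)
  case 1
  then show ?thesis unfolding tail_bound_def by simp
next
  case 2
  have "((\<lambda>x. c * (sqrt A * f x powr (\<beta> + H - 1)) / (2 powr (\<beta> + H - 1) - 1)) \<longlongrightarrow>
      c * (sqrt A * 0) / (2 powr (\<beta> + H - 1) - 1)) F"
    using 2 assms by (intro tendsto_intros tendsto_powr_zero) auto
  then show ?thesis by (simp add: tail_bound_def)
qed

text \<open>As \<beta> \<le> 1, the bound on \<open>g\<close> is largest at the right end of
  [r, r'].\<close>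

lemma RS_increment_bound:
  assumes K: "\<And>r. r \<in> {0..<t} \<Longrightarrow> has_RS_integral M g B 0 r (K r)"
    and g: "\<And>s. 0 \<le> s \<Longrightarrow> s < t \<Longrightarrow> \<bar>g s\<bar> \<le> c * (t - s) powr (\<beta> - 1)"
    and "0 \<le> c" "\<beta> \<le> 1" "0 \<le> r" "r \<le> r'" "r' < t"
  shows "l2norm M (\<lambda>\<omega>. K r' \<omega> - K r \<omega>) \<le> c * (t - r') powr (\<beta> - 1) * (sqrt A * (r' - r) powr H)"
proof (rule has_RS_integral_norm_le)
  show "has_RS_integral M g B r r' (\<lambda>\<omega>. K r' \<omega> - K r \<omega>)"
    using assms by (intro has_RS_integral_split[of _ 0] K) auto
  fix x assume x: "x \<in> {r..r'}"
  have "\<bar>g x\<bar> \<le> c * (t - x) powr (\<beta> - 1)"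
    using x assms by (intro g) auto
  also have "\<dots> \<le> c * (t - r') powr (\<beta> - 1)"
    using x assms by (intro mult_left_mono powr_mono2') auto
  finally show "\<bar>g x\<bar> \<le> c * (t - r') powr (\<beta> - 1)" .
qed (use assms in auto)

text \<open>Sum the increments over the dyadic intervals accumulating at \<open>t\<close>.\<close>
lemma RS_tail_bound:
  assumes adm: "admissible \<beta>"
    and K: "\<And>r. r \<in> {0..<t} \<Longrightarrow> has_RS_integral M g B 0 r (K r)"
    and g: "\<And>s. 0 \<le> s \<Longrightarrow> s < t \<Longrightarrow> \<bar>g s\<bar> \<le> c * (t - s) powr (\<beta> - 1)"
    and c: "0 \<le> c" and \<beta>: "\<beta> \<le> 1" and "0 \<le> r" "r \<le> r'" "r' < t"
  shows "l2norm M (\<lambda>\<omega>. K r' \<omega> - K r \<omega>) \<le> tail_bound \<beta> c (t - r)"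
  using adm
proof (cases rule: admissible_cases)
  case 1
  then show ?thesis
    using RS_increment_bound[OF K g c \<beta> assms(6-8)] unfolding tail_bound_def by simp
next
  case 2
  let ?\<theta> = "\<beta> + H - 1"
  \<comment> \<open>Self-similarity of the geometric series: its first term plus the same series at
    half the distance.\<close>
  have half: "c * (sqrt A * (x / 2) powr ?\<theta>) + tail_bound \<beta> c (x / 2) = tail_bound \<beta> c x" if "0 < x" for x
  proof -
    have "(x / 2) powr ?\<theta> = x powr ?\<theta> / 2 powr ?\<theta>"
      using that by (simp add: powr_divide)
    then show ?thesis
      using 2 unfolding tail_bound_def by (simp add: field_simps)
  qed
  have L2: "K r \<in> L2_space M" if "0 \<le> r" "r < t" for r
    using K[of r] that by (auto intro: has_RS_integral_L2)
  \<comment> \<open>\<open>m\<close> bounds the number of halvings of the distance to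
    \<open>t\<close> on the way from \<open>r\<close> to \<open>r'\<close>; it drives the
    induction.\<close>
  have "l2norm M (\<lambda>\<omega>. K r' \<omega> - K r \<omega>) \<le> tail_bound \<beta> c (t - r)"
    if "0 \<le> r" "r \<le> r'" "r' < t" "t - r \<le> 2 ^ m * (t - r')" for m r r'
    using that
  proof (induction m arbitrary: r r')
    case 0
    then have "r' = r" by simp
    then show ?case
      using tail_bound_mono(1)[OF adm c, of "t - r" "t - r"] 0 by (simp add: l2norm_def)
  next
    case (Suc m)
    define q where "q = (t + r) / 2"
    have q: "r < q" "q < t" "0 \<le> q" "t - q = (t - r) / 2" "q - r = (t - r) / 2"
      using Suc.prems by (auto simp: q_def field_simps)
    \<comment> \<open>On [r, q] the distance to the singularity is at least (t - r) / 2 and the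
      length at most (t - r) / 2, so the two powers combine to one of exponent \<theta>.\<close>
    have first: "l2norm M (\<lambda>\<omega>. K s \<omega> - K r \<omega>) \<le> c * (sqrt A * ((t - r) / 2) powr ?\<theta>)" if s: "r \<le> s" "s \<le> q" for s
    proof -
      have "l2norm M (\<lambda>\<omega>. K s \<omega> - K r \<omega>) \<le> c * (t - s) powr (\<beta> - 1) * (sqrt A * (s - r) powr H)"
        using s q Suc.prems by (intro RS_increment_bound[OF K g c \<beta>]) auto
      also have "\<dots> \<le> c * ((t - r) / 2) powr (\<beta> - 1) * (sqrt A * ((t - r) / 2) powr H)"
      proof (intro mult_mono)
        show "(t - s) powr (\<beta> - 1) \<le> ((t - r) / 2) powr (\<beta> - 1)"
          using s q \<beta> Suc.prems by (intro powr_mono2') auto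
        show "(s - r) powr H \<le> ((t - r) / 2) powr H"
          using s q H by (intro powr_mono2) auto
      qed (use c A_nonneg in auto)
      also have "\<dots> = c * (sqrt A * ((t - r) / 2) powr ?\<theta>)"
        using Suc.prems by (simp add: powr_add[symmetric] algebra_simps)
      finally show ?thesis .
    qed
    show ?case
    proof (cases "r' \<le> q")
      case True
      have "0 \<le> tail_bound \<beta> c ((t - r) / 2)"
        using tail_bound_mono(1)[OF adm c, of "(t - r) / 2" "(t - r) / 2"] Suc.prems by simp
      then show ?thesis
        using first[of r'] True Suc.prems half[of "t - r"] by simp
    next
      case False
      have "l2norm M (\<lambda>\<omega>. K r' \<omega> - K q \<omega>) \<le> tail_bound \<beta> c (t - q)"
        using False q Suc.prems by (intro Suc.IH) auto
      moreover have "l2norm M (\<lambda>\<omega>. K r' \<omega> - K r \<omega>) \<le> l2norm M (\<lambda>\<omega>. K r' \<omega> - K q \<omega>) + l2norm M (\<lambda>\<omega>. K q \<omega> - K r \<omega>)"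
        using False q Suc.prems by (intro l2norm_triangle_diff L2) auto
      ultimately show ?thesis
        using first[of q] q half[of "t - r"] Suc.prems by simp
    qed
  qed
  moreover obtain m :: nat where "(t - r) / (t - r') < 2 ^ m"
    using real_arch_pow[of 2 "(t - r) / (t - r')"] by auto
  then have "t - r \<le> 2 ^ m * (t - r')"
    using assms by (simp add: field_simps)
  ultimately show ?thesis
    using assms by blast
qed

text \<open>The integrals \<open>K\<close> are arbitrary representatives. They agree almost surely
  with those in the definition of the improper integral, because the difference integrates 0. The
  bound between \<open>r\<close> and \<open>s\<close> then passes to the limit as s approaches
  t.\<close>

lemma improper_RS_integral_tail:
  assumes adm: "admissible \<beta>" and t: "0 < t" and J: "has_improper_RS_integral M g B t J"
    and K: "\<And>r. r \<in> {0..<t} \<Longrightarrow> has_RS_integral M g B 0 r (K r)"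
    and g: "\<And>s. 0 \<le> s \<Longrightarrow> s < t \<Longrightarrow> \<bar>g s\<bar> \<le> c * (t - s) powr (\<beta> - 1)"
    and c: "0 \<le> c" and \<beta>: "\<beta> \<le> 1" and r: "0 \<le> r" "r < t"
  shows "l2norm M (\<lambda>\<omega>. K r \<omega> - J \<omega>) \<le> tail_bound \<beta> c (t - r)"
proof -
  obtain K' where "\<forall>r\<in>{0..<t}. has_RS_integral M g B 0 r (K' r)"
    and lim: "((\<lambda>r. sq_dist M (K' r) J) \<longlongrightarrow> 0) (at_left t)"
    using J t by (auto simp: has_improper_RS_integral_def)
  then have K': "\<And>r. r \<in> {0..<t} \<Longrightarrow> has_RS_integral M g B 0 r (K' r)"
    by blast
  have J2: "J \<in> L2_space M"
    using J by (simp add: has_improper_RS_integral_def)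
  have L2: "K r \<in> L2_space M" "K' r \<in> L2_space M" if "r \<in> {0..<t}" for r
    using K[OF that] K'[OF that] by (auto intro: has_RS_integral_L2)
  have ev: "\<forall>\<^sub>F s in at_left t. s \<in> {r<..<t}"
    using r by (intro eventually_at_leftI[of r]) auto
  have ev2: "\<forall>\<^sub>F s in at_left t. K' s \<in> L2_space M"
    using ev by eventually_elim (use r L2 in auto)
  have lim': "((\<lambda>s. l2norm M (\<lambda>\<omega>. K' s \<omega> - J \<omega>)) \<longlongrightarrow> 0) (at_left t)"
    using lim tendsto_sq_dist_iff[OF ev2, of "\<lambda>_. J"] J2 by simp
  have "l2norm M (\<lambda>\<omega>. K r \<omega> - K' r \<omega>) \<le> 0 * (sqrt A * (r - 0) powr H)"
    using r by (intro has_RS_integral_norm_le[OF has_RS_integral_diff[OF K K']]) auto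
  then have KK: "l2norm M (\<lambda>\<omega>. K r \<omega> - K' r \<omega>) = 0"
    using l2norm_nonneg[of M "\<lambda>\<omega>. K r \<omega> - K' r \<omega>"] by simp
  have "l2norm M (\<lambda>\<omega>. K r \<omega> - J \<omega>) \<le> tail_bound \<beta> c (t - r) + 0"
  proof (rule tendsto_lowerbound)
    show "((\<lambda>s. tail_bound \<beta> c (t - r) + l2norm M (\<lambda>\<omega>. K' s \<omega> - J \<omega>)) \<longlongrightarrow> tail_bound \<beta> c (t - r) + 0) (at_left t)"
      by (intro tendsto_intros lim')
    show "\<forall>\<^sub>F s in at_left t. l2norm M (\<lambda>\<omega>. K r \<omega> - J \<omega>) \<le> tail_bound \<beta> c (t - r) + l2norm M (\<lambda>\<omega>. K' s \<omega> - J \<omega>)"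
      using ev
    proof eventually_elim
      case (elim s)
      have "l2norm M (\<lambda>\<omega>. K r \<omega> - J \<omega>) \<le> l2norm M (\<lambda>\<omega>. K r \<omega> - K' r \<omega>) + l2norm M (\<lambda>\<omega>. K' r \<omega> - J \<omega>)"
        using r L2 J2 by (intro l2norm_triangle_diff) auto
      also have "l2norm M (\<lambda>\<omega>. K' r \<omega> - J \<omega>) \<le> l2norm M (\<lambda>\<omega>. K' r \<omega> - K' s \<omega>) + l2norm M (\<lambda>\<omega>. K' s \<omega> - J \<omega>)"
        using r elim L2 J2 by (intro l2norm_triangle_diff) auto
      also have "l2norm M (\<lambda>\<omega>. K' r \<omega> - K' s \<omega>) = l2norm M (\<lambda>\<omega>. K' s \<omega> - K' r \<omega>)"
        by (rule l2norm_minus_commute)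
      also have "\<dots> \<le> tail_bound \<beta> c (t - r)"
        using r elim by (intro RS_tail_bound[OF adm K' g c \<beta>]) auto
      finally show ?case
        using KK by simp
    qed
  qed simp
  then show ?thesis by simp
qed

text \<open>The tail bound makes the integrals Cauchy along one sequence of times increasing to
  \<open>t\<close>. Applied once more, between an arbitrary \<open>r\<close> and members of the
  sequence, it turns the sequential limit into a full left limit.\<close>

lemma improper_RS_integral_exists:
  assumes adm: "admissible \<beta>" and t: "0 < t"
    and cont: "continuous_on {0..<t} g" and g: "\<And>s. 0 \<le> s \<Longrightarrow> s < t \<Longrightarrow> 0 \<le> g s"
    and gc: "\<And>s. 0 \<le> s \<Longrightarrow> s < t \<Longrightarrow> g s \<le> c * (t - s) powr (\<beta> - 1)"
    and c: "0 \<le> c" and \<beta>: "\<beta> \<le> 1"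
  shows "\<exists>J. has_improper_RS_integral M g B t J"
proof -
  have "\<exists>K. has_RS_integral M g B 0 r K" if "r \<in> {0..<t}" for r
  proof -
    have "continuous_on {0..r} g"
      using that by (intro continuous_on_subset[OF cont]) auto
    moreover have "0 \<le> g x" if "x \<in> {0..r}" for x
      using that \<open>r \<in> {0..<t}\<close> by (intro g) auto
    ultimately show ?thesis
      using that has_RS_integral_exists[of 0 r g] by auto
  qed
  then obtain K where K: "\<And>r. r \<in> {0..<t} \<Longrightarrow> has_RS_integral M g B 0 r (K r)"
    by metis
  have ga: "\<bar>g s\<bar> \<le> c * (t - s) powr (\<beta> - 1)" if "0 \<le> s" "s < t" for s
    using g[OF that] gc[OF that] by simp
  have L2: "K r \<in> L2_space M" if "r \<in> {0..<t}" for r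
    using K[OF that] by (rule has_RS_integral_L2)
  have tail: "l2norm M (\<lambda>\<omega>. K r' \<omega> - K r \<omega>) \<le> tail_bound \<beta> c (t - r)" if "0 \<le> r" "r \<le> r'" "r' < t" for r r'
    by (rule RS_tail_bound[OF adm K ga c \<beta> that])
  define q where "q = (\<lambda>n::nat. t - t / (real n + 1))"
  have q: "q n \<in> {0..<t}" for n
    using t by (auto simp: q_def field_simps)
  have qm: "q m \<le> q n" if "m \<le> n" for m n
    using that t by (auto simp: q_def field_simps intro!: divide_left_mono)
  have qlim: "(\<lambda>n. t - q n) \<longlonglongrightarrow> 0"
  proof -
    have "(\<lambda>n. t * inverse (real (Suc n))) \<longlonglongrightarrow> t * 0"
      by (intro tendsto_intros LIMSEQ_inverse_real_of_nat)
    then show ?thesis by (simp add: q_def divide_inverse add.commute)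
  qed
  have tb: "(\<lambda>n. tail_bound \<beta> c (t - q n)) \<longlonglongrightarrow> 0"
    using q by (intro tail_bound_tendsto[OF adm qlim] always_eventually) (auto simp: less_imp_le)
  obtain J where J: "J \<in> L2_space M" "(\<lambda>n. l2norm M (\<lambda>\<omega>. K (q n) \<omega> - J \<omega>)) \<longlonglongrightarrow> 0"
  proof (rule L2_space_complete[of "\<lambda>n. K (q n)"])
    show "K (q n) \<in> L2_space M" for n
      using L2 q by simp
    fix \<epsilon> :: real assume "0 < \<epsilon>"
    then have "\<forall>\<^sub>F n in sequentially. dist (tail_bound \<beta> c (t - q n)) 0 < \<epsilon> / 2"
      using tb unfolding tendsto_iff by (meson half_gt_zero)
    then obtain N where "dist (tail_bound \<beta> c (t - q N)) 0 < \<epsilon> / 2"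
      unfolding eventually_at_top_linorder by blast
    then have N: "tail_bound \<beta> c (t - q N) < \<epsilon> / 2"
      by (simp add: dist_real_def)
    have "l2norm M (\<lambda>\<omega>. K (q m) \<omega> - K (q n) \<omega>) < \<epsilon>" if "m \<ge> N" "n \<ge> N" for m n
    proof -
      have "l2norm M (\<lambda>\<omega>. K (q m) \<omega> - K (q n) \<omega>)
          \<le> l2norm M (\<lambda>\<omega>. K (q m) \<omega> - K (q N) \<omega>) + l2norm M (\<lambda>\<omega>. K (q N) \<omega> - K (q n) \<omega>)"
        using L2 q by (intro l2norm_triangle_diff) auto
      also have "l2norm M (\<lambda>\<omega>. K (q N) \<omega> - K (q n) \<omega>) = l2norm M (\<lambda>\<omega>. K (q n) \<omega> - K (q N) \<omega>)"
        by (rule l2norm_minus_commute)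
      also have "l2norm M (\<lambda>\<omega>. K (q m) \<omega> - K (q N) \<omega>) + l2norm M (\<lambda>\<omega>. K (q n) \<omega> - K (q N) \<omega>)
          \<le> tail_bound \<beta> c (t - q N) + tail_bound \<beta> c (t - q N)"
        using q qm that by (intro add_mono tail) auto
      finally show ?thesis using N by simp
    qed
    then show "\<exists>N. \<forall>m\<ge>N. \<forall>n\<ge>N. l2norm M (\<lambda>\<omega>. K (q m) \<omega> - K (q n) \<omega>) < \<epsilon>"
      by blast
  qed
  have KJ: "l2norm M (\<lambda>\<omega>. K r \<omega> - J \<omega>) \<le> tail_bound \<beta> c (t - r)" if r: "0 \<le> r" "r < t" for r
  proof -
    have "(\<lambda>n. tail_bound \<beta> c (t - r) + l2norm M (\<lambda>\<omega>. K (q n) \<omega> - J \<omega>)) \<longlonglongrightarrow> tail_bound \<beta> c (t - r) + 0"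
      by (intro tendsto_intros J)
    moreover have "\<forall>\<^sub>F n in sequentially. l2norm M (\<lambda>\<omega>. K r \<omega> - J \<omega>) \<le> tail_bound \<beta> c (t - r) + l2norm M (\<lambda>\<omega>. K (q n) \<omega> - J \<omega>)"
    proof -
      have "\<forall>\<^sub>F n in sequentially. t - q n < t - r"
        using qlim r by (intro order_tendstoD) auto
      then show ?thesis
      proof eventually_elim
        case (elim n)
        have "l2norm M (\<lambda>\<omega>. K r \<omega> - J \<omega>) \<le> l2norm M (\<lambda>\<omega>. K r \<omega> - K (q n) \<omega>) + l2norm M (\<lambda>\<omega>. K (q n) \<omega> - J \<omega>)"
          using L2 q r J by (intro l2norm_triangle_diff) auto
        also have "l2norm M (\<lambda>\<omega>. K r \<omega> - K (q n) \<omega>) = l2norm M (\<lambda>\<omega>. K (q n) \<omega> - K r \<omega>)"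
          by (rule l2norm_minus_commute)
        also have "\<dots> \<le> tail_bound \<beta> c (t - r)"
          using r elim q[of n] by (intro tail) auto
        finally show ?case by simp
      qed
    qed
    ultimately have "l2norm M (\<lambda>\<omega>. K r \<omega> - J \<omega>) \<le> tail_bound \<beta> c (t - r) + 0"
      by (rule tendsto_lowerbound) simp
    then show ?thesis by simp
  qed
  have ev: "\<forall>\<^sub>F s in at_left t. s \<in> {0<..<t}"
    using t by (intro eventually_at_leftI[of 0]) auto
  have "((\<lambda>r. l2norm M (\<lambda>\<omega>. K r \<omega> - J \<omega>)) \<longlongrightarrow> 0) (at_left t)"
  proof (rule Lim_null_comparison)
    show "\<forall>\<^sub>F r in at_left t. norm (l2norm M (\<lambda>\<omega>. K r \<omega> - J \<omega>)) \<le> tail_bound \<beta> c (t - r)"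
      using ev by eventually_elim (use KJ in auto)
    have "((\<lambda>r. t - r) \<longlongrightarrow> t - t) (at_left t)"
      by (intro tendsto_intros)
    then show "((\<lambda>r. tail_bound \<beta> c (t - r)) \<longlongrightarrow> 0) (at_left t)"
      by (intro tail_bound_tendsto[OF adm]) (use ev in \<open>auto elim: eventually_mono\<close>)
  qed
  moreover have "\<forall>\<^sub>F r in at_left t. K r \<in> L2_space M"
    using ev by eventually_elim (use L2 in auto)
  ultimately have "((\<lambda>r. sq_dist M (K r) J) \<longlongrightarrow> 0) (at_left t)"
    using tendsto_sq_dist_iff[of K M "at_left t" "\<lambda>_. J"] J(1) by simp
  then have "has_improper_RS_integral M g B t J"
    unfolding has_improper_RS_integral_def using K J(1) t by (auto intro!: exI[of _ K])
  then show ?thesis by blast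
qed

end

lemma kernel_bounds:
  assumes "0 < \<beta>" "\<beta> \<le> 1" "0 \<le> \<mu>" "s < t"
  shows "0 \<le> kernel \<beta> \<mu> t s" and "kernel \<beta> \<mu> t s \<le> 1 / Gamma \<beta> * (t - s) powr (\<beta> - 1)"
  using relaxation_pos[OF assms(1-3), of "t - s"] relaxation_le[OF assms(1-3), of "t - s"] assms(4)
  by (simp_all add: kernel_eq_relaxation)

lemma continuous_on_kernel:
  assumes "0 < \<beta>"
  shows "continuous_on {..<t} (kernel \<beta> \<mu> t)"
  unfolding kernel_eq_relaxation[abs_def]
  by (rule continuous_on_compose2[OF continuous_on_relaxation[OF assms]]) (auto intro!: continuous_intros)

lemma kernel_measurable [measurable]:
  assumes "0 < \<beta>"
  shows "kernel \<beta> \<mu> t \<in> borel_measurable borel"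
proof -
  have [measurable]: "relaxation \<beta> \<beta> \<mu> \<in> borel_measurable borel"
    using assms by measurable
  show ?thesis
    unfolding kernel_eq_relaxation[abs_def] by measurable
qed

section \<open>The stochastic convolution of one real mode\<close>

locale fbm_kernel = fbm +
  fixes \<beta> \<mu> :: real
  assumes \<beta>: "0 < \<beta>" "\<beta> \<le> 1" and \<mu>: "0 \<le> \<mu>"
begin

lemma Gamma_\<beta>: "0 < Gamma \<beta>"
  using \<beta> by simp

definition solution :: "(real \<Rightarrow> 'a \<Rightarrow> real) \<Rightarrow> bool" where
  "solution J \<longleftrightarrow> (\<forall>t\<ge>0. has_improper_RS_integral M (kernel \<beta> \<mu> t) B t (J t))"

lemma solution_exists:
  assumes "admissible \<beta>"
  shows "\<exists>J. solution J"
proof -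
  have "\<exists>J. has_improper_RS_integral M (kernel \<beta> \<mu> t) B t J" if t: "0 \<le> t" for t
  proof (cases "t = 0")
    case True
    then show ?thesis
      by (auto simp: has_improper_RS_integral_def intro!: exI[of _ "\<lambda>_. 0"])
  next
    case False
    show ?thesis
      using False t \<beta> \<mu> Gamma_\<beta> kernel_bounds
      by (intro improper_RS_integral_exists[OF assms, where c = "1 / Gamma \<beta>"]
          continuous_on_subset[OF continuous_on_kernel]) auto
  qed
  then show ?thesis
    unfolding solution_def by metis
qed

lemma solution_L2: "solution J \<Longrightarrow> 0 \<le> t \<Longrightarrow> J t \<in> L2_space M"
  by (auto simp: solution_def has_improper_RS_integral_def)

lemma solution_0: "solution J \<Longrightarrow> AE \<omega> in M. J 0 \<omega> = 0"
  by (auto simp: solution_def has_improper_RS_integral_def)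

lemma kernel_RS_exists: "\<exists>K. \<forall>t r. 0 \<le> r \<longrightarrow> r < t \<longrightarrow> has_RS_integral M (kernel \<beta> \<mu> t) B 0 r (K t r)"
proof -
  have "\<exists>K. has_RS_integral M (kernel \<beta> \<mu> t) B 0 r K" if "0 \<le> r" "r < t" for r t
  proof -
    have "continuous_on {0..r} (kernel \<beta> \<mu> t)"
      using that by (intro continuous_on_subset[OF continuous_on_kernel[OF \<beta>(1)]]) auto
    moreover have "0 \<le> kernel \<beta> \<mu> t x" if "x \<in> {0..r}" for x
      using that \<open>r < t\<close> by (intro kernel_bounds[OF \<beta> \<mu>]) auto
    ultimately show ?thesis
      using that has_RS_integral_exists[of 0 r "kernel \<beta> \<mu> t"] by auto
  qed
  from someI_ex[OF this] show ?thesis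
    by (intro exI allI impI)
qed

lemma solution_tail:
  assumes "admissible \<beta>" "solution J" "0 \<le> r" "r < t"
    and K: "\<And>r. 0 \<le> r \<Longrightarrow> r < t \<Longrightarrow> has_RS_integral M (kernel \<beta> \<mu> t) B 0 r (K r)"
  shows "l2norm M (\<lambda>\<omega>. K r \<omega> - J t \<omega>) \<le> tail_bound \<beta> (1 / Gamma \<beta>) (t - r)"
  using assms(2-4) \<beta> \<mu> Gamma_\<beta> kernel_bounds[OF \<beta> \<mu>, of _ t]
  by (intro improper_RS_integral_tail[OF assms(1), where g = "kernel \<beta> \<mu> t"] K) (auto simp: solution_def)

text \<open>The tail estimate from r = 0, where the integral has norm 0. The bound is free of \<mu>;
  this uniformity is what makes the expansion converge.\<close>

lemma solution_norm_le:
  assumes "admissible \<beta>" "solution J" "0 \<le> t"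
  shows "l2norm M (J t) \<le> tail_bound \<beta> (1 / Gamma \<beta>) t"
proof (cases "t = 0")
  case True
  have "l2norm M (J 0) = 0"
    using solution_0[OF assms(2)] solution_L2[OF assms(2), of 0] by (simp add: l2norm_eq_0_iff_AE)
  then show ?thesis
    using tail_bound_mono(1)[OF assms(1), of "1 / Gamma \<beta>" t t] True Gamma_\<beta> by simp
next
  case False
  then have t: "0 < t" using assms by simp
  obtain K where K: "\<And>t r. 0 \<le> r \<Longrightarrow> r < t \<Longrightarrow> has_RS_integral M (kernel \<beta> \<mu> t) B 0 r (K t r)"
    using kernel_RS_exists by blast
  have K2: "K t 0 \<in> L2_space M"
    using K[of 0 t] t by (auto intro: has_RS_integral_L2)
  have "l2norm M (K t 0) \<le> \<bar>kernel \<beta> \<mu> t 0\<bar> * (sqrt A * (0 - 0) powr H)"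
    using t by (intro has_RS_integral_norm_le[OF K[of 0 t]]) auto
  then have "l2norm M (K t 0) \<le> 0" by simp
  moreover have "l2norm M (\<lambda>\<omega>. K t 0 \<omega> - J t \<omega>) \<le> tail_bound \<beta> (1 / Gamma \<beta>) (t - 0)"
    using t K by (intro solution_tail[OF assms(1,2)]) auto
  moreover have "\<bar>l2norm M (K t 0) - l2norm M (J t)\<bar> \<le> l2norm M (\<lambda>\<omega>. K t 0 \<omega> - J t \<omega>)"
    by (rule l2norm_diff_ineq[OF K2 solution_L2[OF assms(2,3)]])
  ultimately show ?thesis by simp
qed

end

lemma left_approximation:
  assumes t: "0 < (t::real)"
  defines "q \<equiv> \<lambda>n::nat. t - t / (real n + 1)"
  shows "q n \<in> {0..<t}" and "incseq q" and "(\<lambda>n. t - q n) \<longlonglongrightarrow> 0"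
proof -
  show "q n \<in> {0..<t}"
    using t by (auto simp: q_def field_simps)
  show "incseq q"
    using t by (auto simp: q_def incseq_def field_simps intro!: divide_left_mono)
  have "(\<lambda>n. t * inverse (real (Suc n))) \<longlonglongrightarrow> t * 0"
    by (intro tendsto_intros LIMSEQ_inverse_real_of_nat)
  then show "(\<lambda>n. t - q n) \<longlonglongrightarrow> 0"
    by (simp add: q_def divide_inverse add.commute)
qed

context fbm_kernel
begin

text \<open>The kernel moves with t, so J s - J t is not an integral over [s, t]. Both integrals are
  cut at a common r < t: the two singular tails are small by the tail bound, and up to r the kernels
  are uniformly close because their arguments stay away from 0.\<close>

lemma solution_continuous:
  assumes adm: "admissible \<beta>" and J: "solution J"
  shows "l2_continuous M J"
  unfolding l2_continuous_def
proof (intro conjI allI impI)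
  let ?tb = "tail_bound \<beta> (1 / Gamma \<beta>)"
  fix t \<epsilon> :: real assume t: "0 \<le> t" and e: "0 < \<epsilon>"
  have "(?tb \<longlongrightarrow> 0) (at_right 0)"
    using tail_bound_tendsto[OF adm tendsto_ident_at[of 0 "{0<..}"]] by (auto simp: eventually_at_filter)
  then have "\<forall>\<^sub>F x in at_right 0. ?tb x < \<epsilon> / 3"
    using e by (intro order_tendstoD) auto
  then obtain \<eta> where \<eta>: "\<eta> > 0" "\<And>x. 0 < x \<Longrightarrow> x < \<eta> \<Longrightarrow> ?tb x < \<epsilon> / 3"
    unfolding eventually_at_right_field by auto
  have tb0: "?tb 0 = 0"
    by (simp add: tail_bound_def)
  show "\<exists>\<delta>>0. \<forall>s\<ge>0. \<bar>s - t\<bar> < \<delta> \<longrightarrow> l2norm M (\<lambda>x. J s x - J t x) < \<epsilon>"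
  proof (cases "t = 0")
    case True
    have "l2norm M (\<lambda>x. J s x - J t x) < \<epsilon>" if s: "0 \<le> s" "\<bar>s - t\<bar> < \<eta>" for s
    proof -
      have "l2norm M (\<lambda>x. J s x - J t x) \<le> l2norm M (J s) + l2norm M (J t)"
        using J s t by (intro L2_space_diff solution_L2)
      also have "\<dots> \<le> ?tb s + ?tb t"
        using s t by (intro add_mono solution_norm_le adm J)
      also have "\<dots> < \<epsilon>"
        using \<eta>(2)[of s] s e True tb0 by (cases "s = 0") auto
      finally show ?thesis .
    qed
    then show ?thesis using \<eta>(1) by blast
  next
    case False
    then have t: "0 < t" using t by simp
    \<comment> \<open>For |s - t| < h/2 the distance from r = t - h to s lies between h/2 and 3h/2 <
      \<eta>: away from the singularity, yet within reach of the tail bound.\<close>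
    define h where "h = min (t / 2) (\<eta> / 2)"
    have h: "0 < h" "h \<le> t / 2" "h \<le> \<eta> / 2"
      using t \<eta>(1) by (auto simp: h_def)
    define r where "r = t - h"
    have r: "0 \<le> r" "r < t" using h t by (auto simp: r_def)
    define V where "V = sqrt A * r powr H"
    have V: "V \<ge> 0" using A_nonneg by (simp add: V_def)
    define w where "w = \<epsilon> / (3 * (V + 1))"
    have w: "w > 0" using e V by (simp add: w_def)
    have wV: "w * V < \<epsilon> / 3"
    proof -
      have "w * V < w * (V + 1)" using w by simp
      also have "\<dots> = \<epsilon> / 3" using V by (simp add: w_def field_simps)
      finally show ?thesis .
    qed
    have "uniformly_continuous_on {h/2..t+h} (relaxation \<beta> \<beta> \<mu>)"
      using h by (intro compact_uniformly_continuous continuous_on_subset[OF continuous_on_relaxation[OF \<beta>(1)]]) auto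
    then obtain d where d: "d > 0" "\<forall>x\<in>{h/2..t+h}. \<forall>y\<in>{h/2..t+h}. dist y x < d \<longrightarrow> dist (relaxation \<beta> \<beta> \<mu> y) (relaxation \<beta> \<beta> \<mu> x) < w"
      unfolding uniformly_continuous_on_def using w by blast
    obtain K where K: "\<forall>t r. 0 \<le> r \<longrightarrow> r < t \<longrightarrow> has_RS_integral M (kernel \<beta> \<mu> t) B 0 r (K t r)"
      using kernel_RS_exists by blast
    have tail: "l2norm M (\<lambda>\<omega>. K s r \<omega> - J s \<omega>) < \<epsilon> / 3" if "0 < s - r" "s - r < \<eta>" for s
    proof -
      have "l2norm M (\<lambda>\<omega>. K s r \<omega> - J s \<omega>) \<le> ?tb (s - r)"
        using K r that by (intro solution_tail[OF adm J]) auto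
      also have "\<dots> < \<epsilon> / 3"
        using that by (rule \<eta>(2))
      finally show ?thesis .
    qed
    have "l2norm M (\<lambda>x. J s x - J t x) < \<epsilon>" if s: "0 \<le> s" "\<bar>s - t\<bar> < min (h / 2) d" for s
    proof -
      have sr: "h / 2 < s - r" "s - r < \<eta>" "r < s" "s < t + h"
        using s h unfolding r_def min_less_iff_conj abs_less_iff by linarith+
      have KL: "K s r \<in> L2_space M" "K t r \<in> L2_space M"
        using K r sr has_RS_integral_L2 by blast+
      have JL: "J s \<in> L2_space M" "J t \<in> L2_space M"
        using J s t by (auto intro: solution_L2)
      have "l2norm M (\<lambda>\<omega>. K s r \<omega> - K t r \<omega>) \<le> w * (sqrt A * (r - 0) powr H)"
      proof (rule has_RS_integral_norm_le[OF has_RS_integral_diff])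
        show "has_RS_integral M (kernel \<beta> \<mu> s) B 0 r (K s r)" "has_RS_integral M (kernel \<beta> \<mu> t) B 0 r (K t r)"
          using K r sr by auto
        fix x assume x: "x \<in> {0..r}"
        have "s - x \<in> {h/2..t+h}" "t - x \<in> {h/2..t+h}" "dist (s - x) (t - x) < d"
          using x sr h s by (auto simp: r_def dist_real_def)
        then have "dist (relaxation \<beta> \<beta> \<mu> (s - x)) (relaxation \<beta> \<beta> \<mu> (t - x)) < w"
          using d(2) by blast
        then show "\<bar>kernel \<beta> \<mu> s x - kernel \<beta> \<mu> t x\<bar> \<le> w"
          by (simp add: kernel_eq_relaxation dist_real_def)
      qed (use r in auto)
      then have mid: "l2norm M (\<lambda>\<omega>. K s r \<omega> - K t r \<omega>) < \<epsilon> / 3"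
        using wV by (simp add: V_def)
      have "l2norm M (\<lambda>x. J s x - J t x) \<le> l2norm M (\<lambda>x. J s x - K s r x) + l2norm M (\<lambda>x. K s r x - J t x)"
        using KL JL by (intro l2norm_triangle_diff)
      also have "l2norm M (\<lambda>x. K s r x - J t x) \<le> l2norm M (\<lambda>x. K s r x - K t r x) + l2norm M (\<lambda>x. K t r x - J t x)"
        using KL JL by (intro l2norm_triangle_diff)
      also have "l2norm M (\<lambda>x. J s x - K s r x) = l2norm M (\<lambda>x. K s r x - J s x)"
        by (rule l2norm_minus_commute)
      finally have "l2norm M (\<lambda>x. J s x - J t x)
          \<le> l2norm M (\<lambda>x. K s r x - J s x) + (l2norm M (\<lambda>x. K s r x - K t r x) + l2norm M (\<lambda>x. K t r x - J t x))"
        by simp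
      moreover have "l2norm M (\<lambda>x. K s r x - J s x) < \<epsilon> / 3" "l2norm M (\<lambda>x. K t r x - J t x) < \<epsilon> / 3"
        using tail[of s] tail[of t] sr h \<eta>(1) by (auto simp: r_def)
      ultimately show ?thesis
        using mid by simp
    qed
    moreover have "min (h / 2) d > 0"
      using h d(1) by simp
    ultimately show ?thesis
      by blast
  qed
qed (rule solution_L2[OF J])

text \<open>
  For \<open>\<beta> + H \<le> 1\<close> the integral of the kernel over \<open>[r, (1 + r)/2]\<close> does not tend to zero as \<open>r \<rightarrow> 1\<close>.
\<close>
lemma solution_imp_admissible:
  assumes "has_improper_RS_integral M (kernel \<beta> \<mu> 1) B 1 J"
  shows "admissible \<beta>"
proof (rule ccontr)
  assume "\<not> admissible \<beta>"
  then have A: "A > 0" and \<theta>: "\<beta> + H - 1 \<le> 0"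
    using A_nonneg by (auto simp: admissible_def)
  obtain K where K: "\<forall>r\<in>{0..<1}. has_RS_integral M (kernel \<beta> \<mu> 1) B 0 r (K r)"
    and lim: "((\<lambda>r. sq_dist M (K r) J) \<longlongrightarrow> 0) (at_left 1)"
    using assms by (auto simp: has_improper_RS_integral_def)
  have J2: "J \<in> L2_space M"
    using assms by (simp add: has_improper_RS_integral_def)
  have L2: "K r \<in> L2_space M" if "r \<in> {0..<1}" for r
    using K that has_RS_integral_L2 by blast
  have "\<forall>\<^sub>F r in at_left 1. K r \<in> L2_space M"
    using L2 by (intro eventually_at_leftI[of 0]) auto
  then have lim': "((\<lambda>r. l2norm M (\<lambda>\<omega>. K r \<omega> - J \<omega>)) \<longlongrightarrow> 0) (at_left 1)"
    using lim tendsto_sq_dist_iff[of K M "at_left 1" "\<lambda>_. J"] J2 by simp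
  obtain c where c: "c > 0" "\<And>x. 0 < x \<Longrightarrow> x \<le> 1 \<Longrightarrow> c * x powr (\<beta> - 1) \<le> relaxation \<beta> \<beta> \<mu> x"
    using relaxation_lower_bound[OF \<beta> \<mu>, of 1] by auto
  \<comment> \<open>A lower bound, independent of r, for the integral over the left half of [r, 1]:
    the powers of 1 - r combine to the exponent \<beta> + H - 1 \<le> 0 and contribute a factor of
    at least 1.\<close>
  define e where "e = c * sqrt A * (1 / 2) powr H"
  have e: "e > 0" using c A by (simp add: e_def)
  have "\<forall>\<^sub>F r in at_left 1. l2norm M (\<lambda>\<omega>. K r \<omega> - J \<omega>) < e / 2"
    using lim' e by (intro order_tendstoD) auto
  then obtain b where b: "b < 1" "\<And>r. b < r \<Longrightarrow> r < 1 \<Longrightarrow> l2norm M (\<lambda>\<omega>. K r \<omega> - J \<omega>) < e / 2"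
    unfolding eventually_at_left_field by auto
  define r where "r = (1 + max b 0) / 2"
  define q where "q = (1 + r) / 2"
  have r: "b < r" "0 \<le> r" "r < 1" using b(1) by (auto simp: r_def)
  have q: "r < q" "q < 1" "q - r = (1 - r) / 2" using r by (auto simp: q_def field_simps)
  have "c * (1 - r) powr (\<beta> - 1) * (sqrt A * (q - r) powr H) \<le> l2norm M (\<lambda>\<omega>. K q \<omega> - K r \<omega>)"
  proof (rule has_RS_integral_norm_ge)
    show "has_RS_integral M (kernel \<beta> \<mu> 1) B r q (\<lambda>\<omega>. K q \<omega> - K r \<omega>)"
      using K r q by (intro has_RS_integral_split[of _ 0]) auto
    fix x assume x: "x \<in> {r..q}"
    have "(1 - r) powr (\<beta> - 1) \<le> (1 - x) powr (\<beta> - 1)"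
      using x q \<beta> by (intro powr_mono2') auto
    then have "c * (1 - r) powr (\<beta> - 1) \<le> c * (1 - x) powr (\<beta> - 1)"
      using c by simp
    also have "\<dots> \<le> kernel \<beta> \<mu> 1 x"
      using c(2)[of "1 - x"] x q r by (simp add: kernel_eq_relaxation)
    finally show "c * (1 - r) powr (\<beta> - 1) \<le> kernel \<beta> \<mu> 1 x" .
  qed (use r q c in auto)
  moreover have "e \<le> c * (1 - r) powr (\<beta> - 1) * (sqrt A * (q - r) powr H)"
  proof -
    have "(1 - r) powr 0 \<le> (1 - r) powr (\<beta> + H - 1)"
      using r \<theta> by (intro powr_mono') auto
    then have "1 \<le> (1 - r) powr (\<beta> - 1) * (1 - r) powr H"
      using r by (simp add: powr_add[symmetric] algebra_simps)
    then have "e * 1 \<le> e * ((1 - r) powr (\<beta> - 1) * (1 - r) powr H)"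
      using e by (intro mult_left_mono) auto
    also have "\<dots> = c * (1 - r) powr (\<beta> - 1) * (sqrt A * ((1 / 2) * (1 - r)) powr H)"
      using r by (subst powr_mult) (auto simp: e_def)
    finally show ?thesis unfolding q(3) by simp
  qed
  moreover have "l2norm M (\<lambda>\<omega>. K q \<omega> - K r \<omega>) \<le> l2norm M (\<lambda>\<omega>. K q \<omega> - J \<omega>) + l2norm M (\<lambda>\<omega>. J \<omega> - K r \<omega>)"
    using r q L2 J2 by (intro l2norm_triangle_diff) auto
  moreover have "l2norm M (\<lambda>\<omega>. J \<omega> - K r \<omega>) = l2norm M (\<lambda>\<omega>. K r \<omega> - J \<omega>)"
    by (rule l2norm_minus_commute)
  ultimately show False
    using b(2)[of r] b(2)[of q] r q by simp
qed

lemma solution_limit: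
  assumes adm: "admissible \<beta>" and J: "solution J" and t: "0 < t"
    and K: "\<And>r. 0 \<le> r \<Longrightarrow> r < t \<Longrightarrow> has_RS_integral M (kernel \<beta> \<mu> t) B 0 r (K r)"
    and D: "D \<in> L2_space M"
  shows "(\<lambda>n. l2inner M D (K (t - t / (real n + 1)))) \<longlonglongrightarrow> l2inner M D (J t)"
proof (rule tendsto_l2inner[OF D solution_L2[OF J]])
  note q = left_approximation[OF t]
  show "\<forall>\<^sub>F n in sequentially. K (t - t / (real n + 1)) \<in> L2_space M"
    using q(1) by (intro always_eventually allI has_RS_integral_L2[OF K]) auto
  show "(\<lambda>n. l2norm M (\<lambda>x. K (t - t / (real n + 1)) x - J t x)) \<longlonglongrightarrow> 0"
  proof (rule Lim_null_comparison)
    show "\<forall>\<^sub>F n in sequentially. norm (l2norm M (\<lambda>x. K (t - t / (real n + 1)) x - J t x))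
        \<le> tail_bound \<beta> (1 / Gamma \<beta>) (t - (t - t / (real n + 1)))"
    proof (rule always_eventually, rule allI)
      fix n
      show "norm (l2norm M (\<lambda>x. K (t - t / (real n + 1)) x - J t x))
          \<le> tail_bound \<beta> (1 / Gamma \<beta>) (t - (t - t / (real n + 1)))"
        using q(1)[of n] solution_tail[OF adm J _ _ K, of "t - t / (real n + 1)"] by simp
    qed
    show "(\<lambda>n. tail_bound \<beta> (1 / Gamma \<beta>) (t - (t - t / (real n + 1)))) \<longlonglongrightarrow> 0"
      using q(1) t by (intro tail_bound_tendsto[OF adm q(3)] always_eventually) simp
  qed
qed (use t in simp)

text \<open>Monotone convergence as the upper limit increases to \<open>t\<close>. The kernel is
  nonnegative, so its singularity needs no separate integrability; finiteness comes out of the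
  identity.\<close>

lemma solution_covariance:
  assumes adm: "admissible \<beta>" and J: "solution J" and t: "0 < t" and Z: "positive Z"
  shows "(\<integral>\<^sup>+s. ennreal (indicator {0<..<t} s * kernel \<beta> \<mu> t s) \<partial>interval_measure (cov Z)) = ennreal (l2inner M Z (J t))"
proof -
  have ZL: "Z \<in> L2_space M" using Z by (simp add: positive_def)
  interpret stieltjes "cov Z" by (rule positive_stieltjes[OF Z])
  obtain K' where K': "\<forall>t r. 0 \<le> r \<longrightarrow> r < t \<longrightarrow> has_RS_integral M (kernel \<beta> \<mu> t) B 0 r (K' t r)"
    using kernel_RS_exists by blast
  define K where "K = K' t"
  have K: "has_RS_integral M (kernel \<beta> \<mu> t) B 0 r (K r)" if "0 \<le> r" "r < t" for r
    using K' that by (simp add: K_def)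
  define q where "q = (\<lambda>n::nat. t - t / (real n + 1))"
  have q: "q n \<in> {0..<t}" "incseq q" "(\<lambda>n. t - q n) \<longlonglongrightarrow> 0" for n
    unfolding q_def by (rule left_approximation[OF t])+
  have km [measurable]: "kernel \<beta> \<mu> t \<in> borel_measurable borel"
    using \<beta> by measurable
  let ?f = "\<lambda>n s. ennreal (indicator {0<..q n} s * kernel \<beta> \<mu> t s)"
  have val: "(\<integral>\<^sup>+s. ?f n s \<partial>interval_measure (cov Z)) = ennreal (l2inner M Z (K (q n)))" for n
  proof -
    have qn: "0 \<le> q n" "q n < t" using q(1)[of n] by auto
    have cont: "continuous_on {0..q n} (kernel \<beta> \<mu> t)"
      using qn by (intro continuous_on_subset[OF continuous_on_kernel[OF \<beta>(1)]]) auto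
    have int: "integrable (interval_measure (cov Z)) (\<lambda>s. indicator {0<..q n} s * kernel \<beta> \<mu> t s)"
      using continuous_set_integrable[OF cont, of 0 "q n"] by (simp add: set_integrable_def)
    have "0 \<le> kernel \<beta> \<mu> t s" if "s \<le> q n" for s
      using that qn by (intro kernel_bounds[OF \<beta> \<mu>]) auto
    then have "(\<integral>\<^sup>+s. ?f n s \<partial>interval_measure (cov Z)) = ennreal (\<integral>s. indicator {0<..q n} s * kernel \<beta> \<mu> t s \<partial>interval_measure (cov Z))"
      by (intro nn_integral_eq_integral int AE_I2) (auto simp: indicator_def)
    also have "(\<integral>s. indicator {0<..q n} s * kernel \<beta> \<mu> t s \<partial>interval_measure (cov Z)) = l2inner M Z (K (q n))"
      using l2inner_has_RS_integral[OF K[OF qn] _ qn(1) cont Z] by (simp add: set_lebesgue_integral_def)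
    finally show ?thesis .
  qed
  have "(\<lambda>n. \<integral>\<^sup>+s. ?f n s \<partial>interval_measure (cov Z)) \<longlonglongrightarrow> (\<integral>\<^sup>+s. ennreal (indicator {0<..<t} s * kernel \<beta> \<mu> t s) \<partial>interval_measure (cov Z))"
  proof (rule nn_integral_LIMSEQ)
    show "incseq ?f"
    proof (intro incseq_SucI le_funI ennreal_leI)
      fix n s
      have "q n \<le> q (Suc n)" "q (Suc n) < t"
        using incseq_SucD[OF q(2)] q(1)[of "Suc n"] by auto
      then show "indicator {0<..q n} s * kernel \<beta> \<mu> t s \<le> indicator {0<..q (Suc n)} s * kernel \<beta> \<mu> t s"
        using kernel_bounds(1)[OF \<beta> \<mu>, of s t] by (auto simp: indicator_def)
    qed
    show "?f n \<in> borel_measurable (interval_measure (cov Z))" for n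
      by measurable
    fix s
    have "\<forall>\<^sub>F n in sequentially. ?f n s = ennreal (indicator {0<..<t} s * kernel \<beta> \<mu> t s)"
    proof (cases "s < t")
      case True
      then have "\<forall>\<^sub>F n in sequentially. t - q n < t - s"
        using q(3) by (intro order_tendstoD) auto
      then show ?thesis
        by eventually_elim (use True in \<open>auto simp: indicator_def\<close>)
    next
      case False
      then have "s \<notin> {0<..q n}" for n using q(1)[of n] by auto
      then show ?thesis using False by simp
    qed
    then show "(\<lambda>n. ?f n s) \<longlonglongrightarrow> ennreal (indicator {0<..<t} s * kernel \<beta> \<mu> t s)"
      by (rule tendsto_eventually)
  qed
  moreover have "(\<lambda>n. ennreal (l2inner M Z (K (q n)))) \<longlonglongrightarrow> ennreal (l2inner M Z (J t))"
    using solution_limit[OF adm J t K ZL] unfolding q_def by (intro tendsto_ennrealI)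
  ultimately show ?thesis
    unfolding val by (rule LIMSEQ_unique)
qed

lemma solution_covariance_nonneg:
  assumes adm: "admissible \<beta>" and J: "solution J" and t: "0 \<le> t" and Z: "positive Z"
  shows "0 \<le> l2inner M Z (J t)"
proof (cases "t = 0")
  case True
  have ZL: "Z \<in> L2_space M" using Z by (simp add: positive_def)
  have "l2norm M (J 0) = 0"
    using solution_0[OF J] solution_L2[OF J, of 0] by (simp add: l2norm_eq_0_iff_AE)
  then show ?thesis
    using abs_l2inner_le[OF ZL solution_L2[OF J, of 0]] True by simp
next
  case False
  then have t: "0 < t" using t by simp
  have ZL: "Z \<in> L2_space M" using Z by (simp add: positive_def)
  obtain K' where K': "\<forall>t r. 0 \<le> r \<longrightarrow> r < t \<longrightarrow> has_RS_integral M (kernel \<beta> \<mu> t) B 0 r (K' t r)"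
    using kernel_RS_exists by blast
  then have K: "has_RS_integral M (kernel \<beta> \<mu> t) B 0 r (K' t r)" if "0 \<le> r" "r < t" for r
    using that by blast
  show ?thesis
  proof (rule tendsto_lowerbound[OF solution_limit[OF adm J t K ZL]])
    have "0 \<le> l2inner M Z (K' t r)" if r: "0 \<le> r" "r < t" for r
    proof -
      have cont: "continuous_on {0..r} (kernel \<beta> \<mu> t)"
        using r by (intro continuous_on_subset[OF continuous_on_kernel[OF \<beta>(1)]]) auto
      have "0 \<le> (LINT x:{0<..r}|interval_measure (cov Z). kernel \<beta> \<mu> t x)"
        unfolding set_lebesgue_integral_def
        by (intro Bochner_Integration.integral_nonneg)
          (use r kernel_bounds(1)[OF \<beta> \<mu>, of _ t] in \<open>auto simp: indicator_def\<close>)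
      then show ?thesis
        using l2inner_has_RS_integral[OF K[OF r] _ r(1) cont Z] by simp
    qed
    then show "\<forall>\<^sub>F n in sequentially. 0 \<le> l2inner M Z (K' t (t - t / (real n + 1)))"
      using left_approximation(1)[OF t] by (intro always_eventually) auto
  qed auto
qed

text \<open>\<open>J t\<close> is a limit of linear combinations of values of \<open>B\<close>. This
  is the usable form of its membership in their closed span.\<close>

lemma solution_orthogonal:
  assumes adm: "admissible \<beta>" and J: "solution J" and t: "0 \<le> t" and D: "D \<in> L2_space M"
    and orth: "\<And>a. 0 \<le> a \<Longrightarrow> l2inner M D (B a) = 0"
  shows "l2inner M D (J t) = 0"
proof (cases "t = 0")
  case True
  have "l2norm M (J 0) = 0"
    using solution_0[OF J] solution_L2[OF J, of 0] by (simp add: l2norm_eq_0_iff_AE)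
  then show ?thesis
    using abs_l2inner_le[OF D solution_L2[OF J, of 0]] True by simp
next
  case False
  then have t: "0 < t" using t by simp
  obtain K' where K': "\<forall>t r. 0 \<le> r \<longrightarrow> r < t \<longrightarrow> has_RS_integral M (kernel \<beta> \<mu> t) B 0 r (K' t r)"
    using kernel_RS_exists by blast
  then have K: "has_RS_integral M (kernel \<beta> \<mu> t) B 0 r (K' t r)" if "0 \<le> r" "r < t" for r
    using that by blast
  have cov: "cov D s = 0" for s
    by (simp add: cov_def orth)
  have "l2inner M D (K' t r) = 0" if r: "0 \<le> r" "r < t" for r
  proof -
    have lim: "(\<lambda>n. l2inner M D (usum (kernel \<beta> \<mu> t) 0 r n)) \<longlonglongrightarrow> l2inner M D (K' t r)"
      using r by (intro tendsto_l2inner D has_RS_integral_L2[OF K] eventually_usum_L2 has_RS_integral_usum[OF K]) auto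
    have "\<forall>\<^sub>F n in sequentially. l2inner M D (usum (kernel \<beta> \<mu> t) 0 r n) = 0"
      using eventually_uniform_partition[OF r(1) zero_less_one]
      by eventually_elim (simp add: l2inner_rs_sum[OF _ order_refl D] cov)
    from LIMSEQ_unique[OF lim tendsto_eventually[OF this]] show ?thesis .
  qed
  then have "(\<lambda>n. 0) \<longlonglongrightarrow> l2inner M D (J t)"
    using solution_limit[OF adm J t K D] left_approximation(1)[OF t] by simp
  then show ?thesis
    by (simp add: LIMSEQ_const_iff)
qed

end

section \<open>The integrated equation for one coefficient\<close>

text \<open>
  Integration against \<open>history \<beta> t\<close> is the fractional integral of order \<open>1 - \<beta>\<close> up to time \<open>t\<close>, the
  identity for \<open>\<beta> = 1\<close>. The integrated equation then reads
  \<open>\<integral> u d(history \<beta> t) + \<mu> \<integral> u d(history 0 t) = B t\<close>.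
\<close>
definition history :: "real \<Rightarrow> real \<Rightarrow> real measure" where
  "history \<beta> t = (if \<beta> = 1 then return borel t
     else density lborel (\<lambda>s. ennreal (indicator {0<..<t} s * frac_kernel (1 - \<beta>) (t - s))))"

lemma sets_history [simp, measurable_cong]: "sets (history \<beta> t) = sets borel"
  by (simp add: history_def)

lemma space_history [simp]: "space (history \<beta> t) = UNIV"
  by (simp add: history_def)

lemma AE_history:
  assumes "0 \<le> t"
  shows "AE s in history \<beta> t. s \<in> {0..t}"
proof (cases "\<beta> = 1")
  case True
  then have eq: "history \<beta> t = return borel t"
    by (simp add: history_def)
  show ?thesis
    unfolding eq using assms by (subst AE_return) auto
next
  case False
  then have eq: "history \<beta> t = density lborel (\<lambda>s. ennreal (indicator {0<..<t} s * frac_kernel (1 - \<beta>) (t - s)))"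
    by (simp add: history_def)
  show ?thesis
    unfolding eq by (subst AE_density) (auto simp: indicator_def)
qed

lemma nn_integral_history:
  assumes "\<beta> < 1" "f \<in> borel_measurable borel" "\<And>s. 0 \<le> f s"
  shows "(\<integral>\<^sup>+s. ennreal (f s) \<partial>history \<beta> t)
    = (\<integral>\<^sup>+s. ennreal (indicator {0<..<t} s * (frac_kernel (1 - \<beta>) (t - s) * f s)) \<partial>lborel)"
proof -
  have [measurable]: "f \<in> borel_measurable borel" by fact
  show ?thesis
    using assms(1,3)
    by (simp add: history_def nn_integral_density)
      (auto intro!: nn_integral_cong simp: ennreal_mult'[symmetric] frac_kernel_nonneg indicator_def)
qed

text \<open>The total mass is the convolution of the power kernels of orders 1 - \<beta> and
  1.\<close>

lemma emeasure_history:
  assumes "0 \<le> \<beta>" "\<beta> < 1" "0 < t"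
  shows "emeasure (history \<beta> t) UNIV = ennreal (frac_kernel (2 - \<beta>) t)"
proof -
  have "emeasure (history \<beta> t) UNIV = (\<integral>\<^sup>+s. ennreal 1 \<partial>history \<beta> t)"
    by simp
  also have "\<dots> = (\<integral>\<^sup>+s. ennreal (indicator {0<..<t} s * (frac_kernel (1 - \<beta>) (t - s) * frac_kernel 1 s)) \<partial>lborel)"
    using assms by (subst nn_integral_history) (auto intro!: nn_integral_cong simp: indicator_def frac_kernel_1)
  also have "\<dots> = ennreal (frac_kernel (1 - \<beta> + 1) t)"
    using frac_kernel_convolution[of "1 - \<beta>" 1 t] assms
    by (subst nn_integral_eq_integral)
      (auto simp: has_bochner_integral_iff intro!: AE_I2 mult_nonneg_nonneg frac_kernel_nonneg)
  finally show ?thesis by simp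
qed

lemma finite_measure_history:
  assumes "0 \<le> \<beta>" "\<beta> \<le> 1"
  shows "finite_measure (history \<beta> t)"
proof (cases "\<beta> = 1")
  case True
  have "prob_space (return borel t)"
    by (rule prob_space_return) simp
  then show ?thesis
    using True by (simp add: history_def prob_space.axioms(1))
next
  case False
  show ?thesis
  proof (cases "0 < t")
    case True
    then show ?thesis
      using emeasure_history[of \<beta> t] assms False by (intro finite_measureI) simp
  next
    case t: False
    have "emeasure (history \<beta> t) UNIV = 0"
      using False t by (simp add: history_def emeasure_density)
    then show ?thesis
      by (intro finite_measureI) simp
  qed
qed

lemma integrable_history:
  assumes "0 \<le> \<beta>" "\<beta> \<le> 1" "0 \<le> t" and f: "f \<in> borel_measurable borel" "\<And>s. s \<in> {0..t} \<Longrightarrow> \<bar>f s\<bar> \<le> (C::real)"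
  shows "integrable (history \<beta> t) f" and "\<bar>\<integral>s. f s \<partial>history \<beta> t\<bar> \<le> C * measure (history \<beta> t) UNIV"
proof -
  interpret finite_measure "history \<beta> t"
    by (rule finite_measure_history[OF assms(1,2)])
  have ae: "AE s in history \<beta> t. \<bar>f s\<bar> \<le> C"
    using AE_history[OF assms(3)] by eventually_elim (use f in auto)
  show int: "integrable (history \<beta> t) f"
    using ae f(1) by (intro integrable_const_bound[where B = C]) auto
  have "\<bar>\<integral>s. f s \<partial>history \<beta> t\<bar> \<le> (\<integral>s. \<bar>f s\<bar> \<partial>history \<beta> t)"
    using integral_norm_bound[of "history \<beta> t" f] by simp
  also have "\<dots> \<le> (\<integral>s. C \<partial>history \<beta> t)"
    using int ae by (intro integral_mono_AE) auto
  finally show "\<bar>\<integral>s. f s \<partial>history \<beta> t\<bar> \<le> C * measure (history \<beta> t) UNIV"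
    by (simp add: mult.commute)
qed

lemma integrable_history_continuous:
  assumes "0 \<le> \<beta>" "\<beta> \<le> 1" "0 \<le> t" "continuous_on UNIV (f :: real \<Rightarrow> real)"
  shows "integrable (history \<beta> t) f"
proof -
  have "bounded (f ` {0..t})"
    using assms by (intro compact_imp_bounded compact_continuous_image continuous_on_subset[OF assms(4)]) auto
  then obtain C where "\<forall>x\<in>{0..t}. norm (f x) \<le> C"
    unfolding bounded_iff by auto
  then show ?thesis
    using assms by (intro integrable_history[where C = C] borel_measurable_continuous_onI) auto
qed

lemma relaxation_nonneg:
  assumes "0 < \<beta>" "\<beta> \<le> 1" "0 \<le> \<mu>" "0 < a" "0 < x"
  shows "0 \<le> relaxation \<beta> (a + \<beta>) \<mu> x"
proof -
  have "relaxation \<beta> (a + \<beta>) \<mu> x = (\<integral>s. indicator {0<..<x} s * (frac_kernel a (x - s) * relaxation \<beta> \<beta> \<mu> s) \<partial>lborel)"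
    using relaxation_convolution[of \<beta> a \<beta> x \<mu>] assms by (simp add: has_bochner_integral_iff)
  also have "\<dots> \<ge> 0"
    using assms
    by (intro Bochner_Integration.integral_nonneg)
      (auto simp: indicator_def frac_kernel_nonneg less_imp_le[OF relaxation_pos])
  finally show ?thesis .
qed

text \<open>After a shift of time by \<open>r\<close> this is the convolution of the power kernel of
  order 1 - b with the relaxation kernel.\<close>

lemma nn_integral_history_kernel:
  assumes \<beta>: "0 < \<beta>" "\<beta> \<le> 1" and \<mu>: "0 \<le> \<mu>" and b: "0 \<le> b" "b < 1" and r: "0 \<le> r" "r < t"
  shows "(\<integral>\<^sup>+s. ennreal (indicator {r<..} s * kernel \<beta> \<mu> s r) \<partial>history b t) = ennreal (relaxation \<beta> (1 - b + \<beta>) \<mu> (t - r))"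
proof -
  have [measurable]: "relaxation \<beta> \<beta> \<mu> \<in> borel_measurable borel"
    using \<beta> by measurable
  have [measurable]: "(\<lambda>s. kernel \<beta> \<mu> s r) \<in> borel_measurable borel"
    unfolding kernel_eq_relaxation by measurable
  have nn: "0 \<le> indicator {r<..} s * kernel \<beta> \<mu> s r" for s
    using kernel_bounds(1)[OF \<beta> \<mu>, of r s] by (auto simp: indicator_def)
  let ?f = "\<lambda>s. ennreal (indicator {0<..<t} s * (frac_kernel (1 - b) (t - s) * (indicator {r<..} s * kernel \<beta> \<mu> s r)))"
  have "(\<integral>\<^sup>+s. ennreal (indicator {r<..} s * kernel \<beta> \<mu> s r) \<partial>history b t) = (\<integral>\<^sup>+s. ?f s \<partial>lborel)"
    using b nn by (intro nn_integral_history) auto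
  also have "\<dots> = (\<integral>\<^sup>+x. ?f (r + 1 * x) \<partial>lborel)"
    by (subst nn_integral_real_affine[of ?f 1 r]) auto
  also have "\<dots> = (\<integral>\<^sup>+x. ennreal (indicator {0<..<t-r} x * (frac_kernel (1 - b) (t - r - x) * relaxation \<beta> \<beta> \<mu> x)) \<partial>lborel)"
    using r by (intro nn_integral_cong) (auto simp: indicator_def kernel_eq_relaxation algebra_simps)
  also have "\<dots> = ennreal (relaxation \<beta> (1 - b + \<beta>) \<mu> (t - r))"
  proof -
    have "has_bochner_integral lborel (\<lambda>x. indicator {0<..<t-r} x * (frac_kernel (1 - b) (t - r - x) * relaxation \<beta> \<beta> \<mu> x))
        (relaxation \<beta> (1 - b + \<beta>) \<mu> (t - r))"
      using \<beta> b r by (intro relaxation_convolution) auto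
    moreover have "0 \<le> indicator {0<..<t-r} x * (frac_kernel (1 - b) (t - r - x) * relaxation \<beta> \<beta> \<mu> x)" for x
      using b relaxation_pos[OF \<beta> \<mu>, of x] by (auto simp: indicator_def frac_kernel_nonneg)
    ultimately show ?thesis
      by (subst nn_integral_eq_integral) (auto simp: has_bochner_integral_iff)
  qed
  finally show ?thesis .
qed

lemma relaxation_resolvent:
  assumes "0 < \<beta>" "0 < x"
  shows "relaxation \<beta> 1 \<mu> x + \<mu> * relaxation \<beta> (1 + \<beta>) \<mu> x = 1"
  using relaxation_recurrence[of \<beta> 1 x \<mu>] assms by (simp add: frac_kernel_1 add.commute)

text \<open>The kernel started at time \<open>r\<close> solves the integrated equation driven by a
  unit step at \<open>r\<close>, by the resolvent identity. The equation for the noise is a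
  superposition of these. For t \<le> r the history ends before the kernel starts, and both
  integrals vanish.\<close>

lemma history_kernel:
  assumes \<beta>: "0 < \<beta>" "\<beta> \<le> 1" and \<mu>: "0 \<le> \<mu>" and r: "0 \<le> r" and t: "0 \<le> t"
  shows "(\<integral>\<^sup>+s. ennreal (indicator {r<..} s * kernel \<beta> \<mu> s r) \<partial>history \<beta> t)
    + ennreal \<mu> * (\<integral>\<^sup>+s. ennreal (indicator {r<..} s * kernel \<beta> \<mu> s r) \<partial>history 0 t) = indicator {r<..} t"
proof (cases "r < t")
  case True
  have [measurable]: "relaxation \<beta> \<beta> \<mu> \<in> borel_measurable borel"
    using \<beta> by measurable
  have [measurable]: "(\<lambda>s. kernel \<beta> \<mu> s r) \<in> borel_measurable borel"
    unfolding kernel_eq_relaxation by measurable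
  have nn: "0 \<le> relaxation \<beta> (1 + \<beta>) \<mu> (t - r)" "0 \<le> relaxation \<beta> 1 \<mu> (t - r)"
    using relaxation_nonneg[OF \<beta> \<mu>, of 1 "t - r"] relaxation_nonneg[OF \<beta> \<mu>, of "1 - \<beta>" "t - r"]
      relaxation_pos[OF \<beta> \<mu>, of "t - r"] True \<beta>
    by (cases "\<beta> = 1"; simp)+
  have "(\<integral>\<^sup>+s. ennreal (indicator {r<..} s * kernel \<beta> \<mu> s r) \<partial>history \<beta> t) = ennreal (relaxation \<beta> 1 \<mu> (t - r))"
  proof (cases "\<beta> = 1")
    case True
    then show ?thesis
      using \<open>r < t\<close> by (simp add: history_def nn_integral_return kernel_eq_relaxation)
  next
    case False
    then show ?thesis
      using nn_integral_history_kernel[OF \<beta> \<mu>, of \<beta> r t] \<beta> r \<open>r < t\<close> by simp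
  qed
  moreover have "(\<integral>\<^sup>+s. ennreal (indicator {r<..} s * kernel \<beta> \<mu> s r) \<partial>history 0 t) = ennreal (relaxation \<beta> (1 + \<beta>) \<mu> (t - r))"
    using nn_integral_history_kernel[OF \<beta> \<mu>, of 0 r t] r \<open>r < t\<close> by simp
  ultimately show ?thesis
    using relaxation_resolvent[OF \<beta>(1), of "t - r" \<mu>] nn \<mu> True
    by (simp add: ennreal_mult[symmetric] ennreal_plus[symmetric] del: ennreal_plus)
next
  case False
  have "(\<integral>\<^sup>+s. ennreal (indicator {r<..} s * kernel \<beta> \<mu> s r) \<partial>history b t) = (\<integral>\<^sup>+s. 0 \<partial>history b t)" for b
    using AE_history[OF t]
    by (intro nn_integral_cong_AE, eventually_elim) (use False in \<open>auto simp: indicator_def\<close>)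
  then show ?thesis
    using False by simp
qed

section \<open>Uniqueness for the deterministic scalar equation\<close>

lemma integral_zero_imp_zero:
  fixes v :: "real \<Rightarrow> real"
  assumes cont: "continuous_on UNIV v" and zero: "\<And>T. 0 \<le> T \<Longrightarrow> integral {0..T} v = 0" and t: "0 < t"
  shows "v t = 0"
proof -
  have "((\<lambda>x. integral {0..x} v) has_real_derivative v t) (at t within {0..t+1})"
    using t by (intro integral_has_real_derivative continuous_on_subset[OF cont]) auto
  then have "((\<lambda>x. 0) has_real_derivative v t) (at t within {0..t+1})"
    by (rule has_field_derivative_transform_within[where d = 1]) (use t zero in auto)
  then have "((\<lambda>x. 0) has_real_derivative v t) (at t)"
    using t by (simp add: at_within_Icc_at)
  then show ?thesis
    using DERIV_unique[OF _ DERIV_const] by blast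
qed

lemma integral_history_eq:
  fixes f :: "real \<Rightarrow> 'v::{banach, second_countable_topology}"
  assumes "0 \<le> \<beta>" "\<beta> < 1" "f \<in> borel_measurable borel"
  shows "integrable (history \<beta> t) f \<longleftrightarrow> integrable lborel (\<lambda>s. (indicator {0<..<t} s * frac_kernel (1 - \<beta>) (t - s)) *\<^sub>R f s)"
    and "(\<integral>s. f s \<partial>history \<beta> t) = (\<integral>s. (indicator {0<..<t} s * frac_kernel (1 - \<beta>) (t - s)) *\<^sub>R f s \<partial>lborel)"
  using assms unfolding history_def
  by (auto simp: integrable_density integral_density frac_kernel_nonneg)

text \<open>For the primitive V of \<open>v\<close> the equation reads V' + \<mu> V = 0, with
  integrating factor exp (\<mu> x).\<close>

lemma history_injective_one:
  fixes v :: "real \<Rightarrow> real"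
  assumes cont: "continuous_on UNIV v" and t: "0 \<le> t"
    and zero: "\<And>T. 0 \<le> T \<Longrightarrow> v T + \<mu> * integral {0..T} v = 0"
  shows "v t = 0"
proof -
  let ?W = "\<lambda>x. exp (\<mu> * x) * integral {0..x} v"
  have "\<exists>c. \<forall>x\<in>{0..t}. ?W x = c"
  proof (rule has_field_derivative_zero_constant)
    fix x assume x: "x \<in> {0..t}"
    have V: "((\<lambda>x. integral {0..x} v) has_real_derivative v x) (at x within {0..t})"
      using x by (intro integral_has_real_derivative continuous_on_subset[OF cont]) auto
    have E: "((\<lambda>x. exp (\<mu> * x)) has_real_derivative exp (\<mu> * x) * \<mu>) (at x within {0..t})"
      by (auto intro!: derivative_eq_intros)
    have "exp (\<mu> * x) * \<mu> * integral {0..x} v + v x * exp (\<mu> * x) = exp (\<mu> * x) * (v x + \<mu> * integral {0..x} v)"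
      by (simp add: algebra_simps)
    also have "\<dots> = 0"
      using zero[of x] x by simp
    finally show "(?W has_real_derivative 0) (at x within {0..t})"
      using DERIV_mult[OF E V] by simp
  qed simp
  then obtain c where c: "\<And>x. x \<in> {0..t} \<Longrightarrow> ?W x = c"
    by blast
  have "c = 0"
    using c[of 0] t by simp
  then have "integral {0..t} v = 0"
    using c[of t] t by simp
  then show ?thesis
    using zero[OF t] by simp
qed

text \<open>For \<beta> < 1 the equation says that \<open>v\<close> convolved with h vanishes, where
  h is the power kernel of order 1 - \<beta> plus the constant \<mu>. The relaxation kernel k
  inverts h in the sense that h convolved with k is 1, so convolving the equation with k shows that
  the primitive of \<open>v\<close> vanishes. For \<beta> = 1 the measure has a point mass and a
  differential equation takes over.\<close>

lemma history_injective:
  fixes v :: "real \<Rightarrow> real"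
  assumes \<beta>: "0 < \<beta>" "\<beta> \<le> 1" and \<mu>: "0 \<le> \<mu>" and cont: "continuous_on UNIV v"
    and zero: "\<And>t. 0 \<le> t \<Longrightarrow> (\<integral>s. v s \<partial>history \<beta> t) + \<mu> * (\<integral>s. v s \<partial>history 0 t) = 0" and t: "0 < t"
  shows "v t = 0"
proof -
  have vm [measurable]: "v \<in> borel_measurable borel"
    by (rule borel_measurable_continuous_onI[OF cont])
  have int0: "(\<integral>s. v s \<partial>history 0 T) = integral {0..T} v" "set_integrable lborel {0<..<T} v" for T
  proof -
    have "set_integrable lborel {0..T} v"
      by (rule borel_integrable_compact[folded set_integrable_def]) (auto intro: continuous_on_subset[OF cont])
    then show "set_integrable lborel {0<..<T} v"
      by (rule set_integrable_subset) auto
    then have "(LINT s:{0<..<T}|lborel. v s) = integral {0<..<T} v"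
      by (rule set_borel_integral_eq_integral)
    moreover have "(\<integral>s. v s \<partial>history 0 T) = (LINT s:{0<..<T}|lborel. v s)"
      unfolding integral_history_eq(2)[OF order_refl zero_less_one vm] set_lebesgue_integral_def
      by (intro Bochner_Integration.integral_cong) (auto simp: indicator_def frac_kernel_1)
    ultimately show "(\<integral>s. v s \<partial>history 0 T) = integral {0..T} v"
      by (simp add: integral_open_interval_real)
  qed
  show ?thesis
  proof (cases "\<beta> = 1")
    case True
    have "v T + \<mu> * integral {0..T} v = 0" if "0 \<le> T" for T
      using zero[OF that] True int0 by (simp add: history_def integral_return)
    then show ?thesis
      using t by (intro history_injective_one[OF cont]) auto
  next
    case False
    then have \<beta>1: "\<beta> < 1" using \<beta> by simp
    have [measurable]: "relaxation \<beta> \<beta> \<mu> \<in> borel_measurable borel"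
      using \<beta> by measurable
    let ?h = "\<lambda>x. frac_kernel (1 - \<beta>) x + \<mu> * frac_kernel 1 x"
    let ?k = "relaxation \<beta> \<beta> \<mu>"
    have h_nn: "0 \<le> ?h x" for x
      using \<beta>1 \<mu> by (simp add: frac_kernel_nonneg)
    have "integral {0..T} v = 0" if "0 \<le> T" for T
    proof (cases "T = 0")
      case False
      then have T: "0 < T" using that by simp
      \<comment> \<open>The resolvent identity in the variable reflected at \<open>T\<close>: h
        convolved with k is constantly 1.\<close>
      have inner: "has_bochner_integral lborel (\<lambda>t. indicator {s<..<T} t * (?h (t - s) * ?k (T - t))) 1" if s: "s < T" for s
      proof -
        let ?f = "\<lambda>t. indicator {s<..<T} t * (?h (t - s) * ?k (T - t))"
        have "has_bochner_integral lborel (\<lambda>x. indicator {0<..<T-s} x * (frac_kernel (1 - \<beta>) (T - s - x) * ?k x)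
            + \<mu> * (indicator {0<..<T-s} x * (frac_kernel 1 (T - s - x) * ?k x)))
            (relaxation \<beta> (1 - \<beta> + \<beta>) \<mu> (T - s) + \<mu> * relaxation \<beta> (1 + \<beta>) \<mu> (T - s))"
          using s \<beta> \<beta>1
          by (intro has_bochner_integral_add has_bochner_integral_mult_right relaxation_convolution) auto
        moreover have "(\<lambda>x. indicator {0<..<T-s} x * (frac_kernel (1 - \<beta>) (T - s - x) * ?k x)
            + \<mu> * (indicator {0<..<T-s} x * (frac_kernel 1 (T - s - x) * ?k x))) = (\<lambda>x. ?f (T + (-1) * x))"
          by (auto simp: fun_eq_iff indicator_def algebra_simps)
        ultimately have "has_bochner_integral lborel (\<lambda>x. ?f (T + (-1) * x)) 1"
          using relaxation_resolvent[OF \<beta>(1), of "T - s" \<mu>] s by simp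
        then show ?thesis
          using lborel_integrable_real_affine_iff[of "-1" ?f T] lborel_integral_real_affine[of "-1" ?f T]
          by (simp add: has_bochner_integral_iff)
      qed
      note inner_val = has_bochner_integral_integral_eq[OF inner]
      define F where "F = (\<lambda>(s, t). indicator {0<..<T} s * v s * (indicator {s<..<T} t * (?h (t - s) * ?k (T - t))))"
      have Fm [measurable]: "F \<in> borel_measurable (lborel \<Otimes>\<^sub>M lborel)"
      proof -
        have "F = (\<lambda>z. indicator {0<..<T} (fst z) * v (fst z) * ((if fst z < snd z \<and> snd z < T then 1 else 0) *
            (?h (snd z - fst z) * ?k (T - snd z))))"
          by (auto simp: F_def fun_eq_iff indicator_def)
        then show ?thesis
          by simp
      qed
      \<comment> \<open>As h and k are nonnegative, \<open>inner\<close> also evaluates the integral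
        of the absolute value, and integrability of \<open>F\<close> reduces to that of
        \<open>v\<close>.\<close>
      have normF: "(\<integral>t. norm (F (s, t)) \<partial>lborel) = indicator {0<..<T} s * \<bar>v s\<bar>" for s
      proof (cases "s \<in> {0<..<T}")
        case True
        have "(\<integral>t. norm (F (s, t)) \<partial>lborel) = (\<integral>t. \<bar>v s\<bar> * (indicator {s<..<T} t * (?h (t - s) * ?k (T - t))) \<partial>lborel)"
        proof (rule Bochner_Integration.integral_cong[OF refl])
          fix t
          show "norm (F (s, t)) = \<bar>v s\<bar> * (indicator {s<..<T} t * (?h (t - s) * ?k (T - t)))"
          proof (cases "t \<in> {s<..<T}")
            case t: True
            then have "0 \<le> ?h (t - s) * ?k (T - t)"
              using relaxation_pos[OF \<beta> \<mu>, of "T - t"] by (intro mult_nonneg_nonneg h_nn) auto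
            then have "\<bar>?h (t - s) * ?k (T - t)\<bar> = ?h (t - s) * ?k (T - t)"
              by (rule abs_of_nonneg)
            moreover have "F (s, t) = v s * (?h (t - s) * ?k (T - t))"
              using True t by (simp add: F_def)
            ultimately show ?thesis
              using t by (simp only: real_norm_def abs_mult[of "v s"] indicator_simps mult_1)
          qed (simp add: F_def)
        qed
        also have "\<dots> = \<bar>v s\<bar> * 1"
          using True by (simp only: Bochner_Integration.integral_mult_right_zero inner_val[of s] greaterThanLessThan_iff)
        finally show ?thesis using True by simp
      qed (simp add: F_def)
      have intF: "integrable (lborel \<Otimes>\<^sub>M lborel) F"
      proof (rule lborel_pair.Fubini_integrable[OF Fm])
        have "integrable lborel (\<lambda>s. norm (indicator {0<..<T} s *\<^sub>R v s))"
          using int0(2)[of T] unfolding set_integrable_def by (rule integrable_norm)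
        then show "integrable lborel (\<lambda>s. \<integral>t. norm (F (s, t)) \<partial>lborel)"
          unfolding normF by (simp add: abs_mult)
        show "AE s in lborel. integrable lborel (\<lambda>t. F (s, t))"
        proof (rule AE_I2)
          fix s
          show "integrable lborel (\<lambda>t. F (s, t))"
          proof (cases "s \<in> {0<..<T}")
            case True
            then show ?thesis
              unfolding F_def prod.case
              by (intro integrable_mult_right has_bochner_integral_iff[THEN iffD1, THEN conjunct1, OF inner]) auto
          qed (simp add: F_def)
        qed
      qed
      have "(\<integral>t. (\<integral>s. F (s, t) \<partial>lborel) \<partial>lborel) = (\<integral>s. (\<integral>t. F (s, t) \<partial>lborel) \<partial>lborel)"
        using lborel_pair.Fubini_integral[of "\<lambda>s t. F (s, t)"] intF by simp
      \<comment> \<open>Integrating over s first produces the assumed equation at time t, multiplied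
        by k(T - t).\<close>
      moreover have "(\<integral>s. F (s, t) \<partial>lborel) = 0" for t
      proof (cases "t \<in> {0<..<T}")
        case True
        have i: "integrable lborel (\<lambda>s. (indicator {0<..<t} s * frac_kernel (1 - b) (t - s)) *\<^sub>R v s)" if "0 \<le> b" "b < 1" for b
          using integrable_history_continuous[of b t v] True cont that integral_history_eq(1)[OF that vm, of t] by auto
        have "(\<integral>s. F (s, t) \<partial>lborel) = (\<integral>s. ?k (T - t) * ((indicator {0<..<t} s * frac_kernel (1 - \<beta>) (t - s)) *\<^sub>R v s
            + \<mu> * ((indicator {0<..<t} s * frac_kernel (1 - 0) (t - s)) *\<^sub>R v s)) \<partial>lborel)"
          using True by (intro Bochner_Integration.integral_cong) (auto simp: F_def indicator_def algebra_simps)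
        also have "\<dots> = ?k (T - t) * ((\<integral>s. v s \<partial>history \<beta> t) + \<mu> * (\<integral>s. v s \<partial>history 0 t))"
          using i[of \<beta>] i[of 0] \<beta> \<beta>1 vm by (simp add: integral_history_eq(2))
        also have "\<dots> = 0"
          using zero[of t] True by simp
        finally show ?thesis .
      next
        case False
        then have "F (s, t) = 0" for s
          by (auto simp: F_def indicator_def)
        then show ?thesis by simp
      qed
      \<comment> \<open>Integrating over t first leaves \<open>v\<close> alone, because h convolved
        with k is 1.\<close>
      moreover have "(\<integral>t. F (s, t) \<partial>lborel) = indicator {0<..<T} s *\<^sub>R v s" for s
      proof (cases "s \<in> {0<..<T}")
        case True
        then show ?thesis
          by (simp only: F_def prod.case Bochner_Integration.integral_mult_right_zero inner_val[of s] greaterThanLessThan_iff)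
            simp
      qed (simp add: F_def)
      ultimately have "(LINT s:{0<..<T}|lborel. v s) = 0"
        by (simp add: set_lebesgue_integral_def)
      then show ?thesis
        using set_borel_integral_eq_integral(2)[OF int0(2)[of T]] by (simp add: integral_open_interval_real)
    qed simp
    then show ?thesis
      using t by (intro integral_zero_imp_zero[OF cont]) auto
  qed
qed

section \<open>Time integrals of square-integrable processes\<close>

text \<open>Cauchy-Schwarz in time bounds the squared time integral by the total mass times the time
  integral of the square, which has finite expectation by Tonelli. Fubini moves the inner product
  with \<open>Z\<close> under the time integral.\<close>

lemma (in prob_space) time_integral:
  fixes u :: "real \<Rightarrow> 'a \<Rightarrow> real"
  assumes \<nu>: "finite_measure \<nu>" "sets \<nu> = sets borel" "AE s in \<nu>. s \<in> {0..t}"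
    and u: "(\<lambda>(s, \<omega>). u s \<omega>) \<in> borel_measurable (borel \<Otimes>\<^sub>M M)"
    and C: "\<And>s. s \<in> {0..t} \<Longrightarrow> u s \<in> L2_space M" "\<And>s. s \<in> {0..t} \<Longrightarrow> l2norm M (u s) \<le> C"
  shows "(\<lambda>\<omega>. \<integral>s. u s \<omega> \<partial>\<nu>) \<in> L2_space M"
    and "\<And>Z. Z \<in> L2_space M \<Longrightarrow> integrable \<nu> (\<lambda>s. l2inner M Z (u s))"
    and "\<And>Z. Z \<in> L2_space M \<Longrightarrow> l2inner M Z (\<lambda>\<omega>. \<integral>s. u s \<omega> \<partial>\<nu>) = (\<integral>s. l2inner M Z (u s) \<partial>\<nu>)"
    and "AE \<omega> in M. integrable \<nu> (\<lambda>s. u s \<omega>)"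
proof -
  interpret \<nu>: finite_measure \<nu> by fact
  interpret P: pair_sigma_finite \<nu> M ..
  note [measurable_cong] = \<nu>(2)
  have um [measurable]: "(\<lambda>(s, \<omega>). u s \<omega>) \<in> borel_measurable (\<nu> \<Otimes>\<^sub>M M)"
    using u by (simp cong: measurable_cong_sets)
  have um' [measurable]: "(\<lambda>(\<omega>, s). u s \<omega>) \<in> borel_measurable (M \<Otimes>\<^sub>M \<nu>)"
    using measurable_compose[OF measurable_pair_swap' um] by (simp add: case_prod_beta')
  have us [measurable]: "u s \<in> borel_measurable M" for s
    using measurable_compose[OF measurable_Pair1'[of s borel M] u] by simp
  have C0: "AE s in \<nu>. (\<integral>\<^sup>+\<omega>. ennreal ((u s \<omega>)\<^sup>2) \<partial>M) \<le> ennreal (C\<^sup>2)"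
    using \<nu>(3)
  proof eventually_elim
    case (elim s)
    then show ?case
      using nn_integral_norm_power2[OF C(1)[OF elim]] C(2)[OF elim] power_mono[OF C(2)[OF elim] l2norm_nonneg, of 2]
      by (simp add: ennreal_leI)
  qed
  have fin: "(\<integral>\<^sup>+\<omega>. (\<integral>\<^sup>+s. ennreal ((u s \<omega>)\<^sup>2) \<partial>\<nu>) \<partial>M) < \<infinity>"
  proof -
    have "(\<integral>\<^sup>+\<omega>. (\<integral>\<^sup>+s. ennreal ((u s \<omega>)\<^sup>2) \<partial>\<nu>) \<partial>M) = (\<integral>\<^sup>+s. (\<integral>\<^sup>+\<omega>. ennreal ((u s \<omega>)\<^sup>2) \<partial>M) \<partial>\<nu>)"
      using P.Fubini'[of "\<lambda>s \<omega>. ennreal ((u s \<omega>)\<^sup>2)"] by simp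
    also have "\<dots> \<le> (\<integral>\<^sup>+s. ennreal (C\<^sup>2) \<partial>\<nu>)"
      by (rule nn_integral_mono_AE[OF C0])
    also have "\<dots> < \<infinity>"
      using \<nu>.emeasure_finite[of "space \<nu>"] by (simp add: ennreal_mult_eq_top_iff less_top[symmetric])
    finally show ?thesis .
  qed
  have Um [measurable]: "(\<lambda>\<omega>. \<integral>s. u s \<omega> \<partial>\<nu>) \<in> borel_measurable M"
    by measurable
  have "(\<integral>\<^sup>+\<omega>. ennreal ((norm (\<integral>s. u s \<omega> \<partial>\<nu>))\<^sup>2) \<partial>M)
      \<le> (\<integral>\<^sup>+\<omega>. emeasure \<nu> (space \<nu>) * (\<integral>\<^sup>+s. ennreal ((u s \<omega>)\<^sup>2) \<partial>\<nu>) \<partial>M)"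
  proof (rule nn_integral_mono)
    fix \<omega> assume "\<omega> \<in> space M"
    then have [measurable]: "(\<lambda>s. u s \<omega>) \<in> borel_measurable \<nu>"
      using measurable_compose[OF measurable_Pair2' um] by simp
    \<comment> \<open>For a path that is not integrable the integral is 0 by convention, so the
      inequality holds for every \<omega>.\<close>
    have "ennreal (norm (\<integral>s. u s \<omega> \<partial>\<nu>)) \<le> (\<integral>\<^sup>+s. ennreal \<bar>u s \<omega>\<bar> \<partial>\<nu>)"
    proof (cases "integrable \<nu> (\<lambda>s. u s \<omega>)")
      case True
      from integral_norm_bound_ennreal[OF this] show ?thesis by simp
    qed (simp add: not_integrable_integral_eq)
    then have "(ennreal (norm (\<integral>s. u s \<omega> \<partial>\<nu>)))\<^sup>2 \<le> (\<integral>\<^sup>+s. ennreal \<bar>u s \<omega>\<bar> * 1 \<partial>\<nu>)\<^sup>2"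
      by (simp add: power_mono)
    also have "\<dots> \<le> (\<integral>\<^sup>+s. (ennreal \<bar>u s \<omega>\<bar>)\<^sup>2 \<partial>\<nu>) * (\<integral>\<^sup>+s. 1\<^sup>2 \<partial>\<nu>)"
      by (rule Cauchy_Schwarz_nn_integral) auto
    finally show "ennreal ((norm (\<integral>s. u s \<omega> \<partial>\<nu>))\<^sup>2) \<le> emeasure \<nu> (space \<nu>) * (\<integral>\<^sup>+s. ennreal ((u s \<omega>)\<^sup>2) \<partial>\<nu>)"
      by (simp add: ennreal_power mult.commute)
  qed
  also have "\<dots> = emeasure \<nu> (space \<nu>) * (\<integral>\<^sup>+\<omega>. (\<integral>\<^sup>+s. ennreal ((u s \<omega>)\<^sup>2) \<partial>\<nu>) \<partial>M)"
    by (rule nn_integral_cmult) measurable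
  also have "\<dots> < \<infinity>"
    using fin \<nu>.emeasure_finite[of "space \<nu>"] by (simp add: ennreal_mult_eq_top_iff less_top[symmetric])
  finally show "(\<lambda>\<omega>. \<integral>s. u s \<omega> \<partial>\<nu>) \<in> L2_space M"
    by (simp add: L2_space_iff)
  have int: "integrable (\<nu> \<Otimes>\<^sub>M M) (\<lambda>(s, \<omega>). Z \<omega> * u s \<omega>)" if Z: "Z \<in> L2_space M" for Z
  proof (rule integrableI_bounded)
    have [measurable]: "Z \<in> borel_measurable M" using Z by auto
    show m: "(\<lambda>(s, \<omega>). Z \<omega> * u s \<omega>) \<in> borel_measurable (\<nu> \<Otimes>\<^sub>M M)"
      by measurable
    have "(\<integral>\<^sup>+z. ennreal (norm (case z of (s, \<omega>) \<Rightarrow> Z \<omega> * u s \<omega>)) \<partial>(\<nu> \<Otimes>\<^sub>M M))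
        = (\<integral>\<^sup>+s. (\<integral>\<^sup>+\<omega>. ennreal (norm (Z \<omega> * u s \<omega>)) \<partial>M) \<partial>\<nu>)"
      using m by (subst nn_integral_fst[symmetric]) auto
    also have "\<dots> \<le> (\<integral>\<^sup>+s. ennreal (l2norm M Z * C) \<partial>\<nu>)"
    proof (rule nn_integral_mono_AE)
      show "AE s in \<nu>. (\<integral>\<^sup>+\<omega>. ennreal (norm (Z \<omega> * u s \<omega>)) \<partial>M) \<le> ennreal (l2norm M Z * C)"
        using \<nu>(3)
      proof eventually_elim
        case (elim s)
        have "(\<integral>\<^sup>+\<omega>. ennreal (norm (Z \<omega> * u s \<omega>)) \<partial>M) = ennreal (LINT \<omega>|M. norm (Z \<omega>) * norm (u s \<omega>))"
          using L2_space_norm_mult(1)[OF Z C(1)[OF elim]] by (subst nn_integral_eq_integral) (auto simp: abs_mult)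
        also have "(LINT \<omega>|M. norm (Z \<omega>) * norm (u s \<omega>)) \<le> l2norm M Z * l2norm M (u s)"
          by (rule L2_space_norm_mult(2)[OF Z C(1)[OF elim]])
        also have "\<dots> \<le> l2norm M Z * C"
          using C(2)[OF elim] by (intro mult_left_mono) auto
        finally show ?case by (simp add: ennreal_leI)
      qed
    qed
    also have "\<dots> < \<infinity>"
      using \<nu>.emeasure_finite[of "space \<nu>"] by (simp add: ennreal_mult_eq_top_iff less_top[symmetric])
    finally show "(\<integral>\<^sup>+z. ennreal (norm (case z of (s, \<omega>) \<Rightarrow> Z \<omega> * u s \<omega>)) \<partial>(\<nu> \<Otimes>\<^sub>M M)) < \<infinity>" .
  qed
  show "integrable \<nu> (\<lambda>s. l2inner M Z (u s))" if "Z \<in> L2_space M" for Z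
    using P.integrable_fst[OF int[OF that]] by (simp add: l2inner_def)
  show "l2inner M Z (\<lambda>\<omega>. \<integral>s. u s \<omega> \<partial>\<nu>) = (\<integral>s. l2inner M Z (u s) \<partial>\<nu>)" if "Z \<in> L2_space M" for Z
    using P.Fubini_integral[OF int[OF that]] by (simp add: l2inner_def)
  \<comment> \<open>Testing against the constant 1 shows that almost every path is
    integrable.\<close>
  have "(\<lambda>_. 1::real) \<in> L2_space M"
    by (simp add: L2_space_def)
  from P.AE_integrable_snd[OF int[OF this]] show "AE \<omega> in M. integrable \<nu> (\<lambda>s. u s \<omega>)"
    by simp
qed

lemma continuous_l2inner:
  assumes "l2_continuous M u" "Z \<in> L2_space M"
  shows "continuous_on UNIV (\<lambda>s. l2inner M Z (u (max 0 s)))"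
  unfolding continuous_on_eq_continuous_at[OF open_UNIV] isCont_def
proof
  fix s :: real
  have "((\<lambda>x. l2norm M (\<lambda>\<omega>. u (max 0 x) \<omega> - u (max 0 s) \<omega>)) \<longlongrightarrow> 0) (at s)"
    unfolding tendsto_iff
  proof (intro allI impI)
    fix \<epsilon> :: real assume "0 < \<epsilon>"
    then obtain \<delta> where \<delta>: "\<delta> > 0" "\<forall>x\<ge>0. \<bar>x - max 0 s\<bar> < \<delta> \<longrightarrow> l2norm M (\<lambda>\<omega>. u x \<omega> - u (max 0 s) \<omega>) < \<epsilon>"
      using assms(1) unfolding l2_continuous_def by (meson max.cobounded1)
    have "dist (l2norm M (\<lambda>\<omega>. u (max 0 x) \<omega> - u (max 0 s) \<omega>)) 0 < \<epsilon>" if "dist x s < \<delta>" for x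
    proof -
      have "\<bar>max 0 x - max 0 s\<bar> < \<delta>"
        using that by (auto simp: dist_real_def max_def)
      then show ?thesis
        using \<delta>(2) by simp
    qed
    then show "\<forall>\<^sub>F x in at s. dist (l2norm M (\<lambda>\<omega>. u (max 0 x) \<omega> - u (max 0 s) \<omega>)) 0 < \<epsilon>"
      using \<delta>(1) unfolding eventually_at by blast
  qed
  then show "(\<lambda>s. l2inner M Z (u (max 0 s))) \<midarrow>s\<rightarrow> l2inner M Z (u (max 0 s))"
    using assms by (intro tendsto_l2inner always_eventually allI) (auto simp: l2_continuous_def)
qed

lemma has_improper_RS_integral_AE_cong:
  assumes "has_improper_RS_integral M g B t J" "J' \<in> L2_space M" "AE \<omega> in M. J \<omega> = J' \<omega>"
  shows "has_improper_RS_integral M g B t J'"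
proof -
  have "sq_dist M f J' = sq_dist M f J" for f
    unfolding sq_dist_def using assms(3) by (intro nn_integral_cong_AE) auto
  moreover have "AE \<omega> in M. J' \<omega> = 0" if "AE \<omega> in M. J \<omega> = 0"
    using that assms(3) by eventually_elim simp
  ultimately show ?thesis
    using assms(1,2) unfolding has_improper_RS_integral_def by (auto split: if_splits)
qed

section \<open>Equation and formula for one real mode\<close>

context fbm_kernel
begin

definition solves :: "(real \<Rightarrow> 'a \<Rightarrow> real) \<Rightarrow> bool" where
  "solves u \<longleftrightarrow> (\<forall>t\<ge>0. AE \<omega> in M. integrable (history \<beta> t) (\<lambda>s. u s \<omega>) \<and> integrable (history 0 t) (\<lambda>s. u s \<omega>) \<and>
     (\<integral>s. u s \<omega> \<partial>history \<beta> t) + \<mu> * (\<integral>s. u s \<omega> \<partial>history 0 t) = B t \<omega>)"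

text \<open>E[Z J(s)] is the convolution of the kernel with the measure of \<open>cov Z\<close>.
  Tonelli moves the time integrals inside, where the kernel answers a unit step; what remains is the
  mass of (0, t], which is \<open>cov Z t\<close>.\<close>

lemma solution_weak_equation:
  assumes adm: "admissible \<beta>" and J: "solution J" and t: "0 \<le> t" and Z: "positive Z"
  shows "(\<integral>s. l2inner M Z (J (max 0 s)) \<partial>history \<beta> t) + \<mu> * (\<integral>s. l2inner M Z (J (max 0 s)) \<partial>history 0 t) = cov Z t"
proof -
  have ZL: "Z \<in> L2_space M" using Z by (simp add: positive_def)
  interpret S: stieltjes "cov Z" by (rule positive_stieltjes[OF Z])
  interpret \<phi>: sigma_finite_measure "interval_measure (cov Z)"
    by (rule sigma_finite_interval_measure[OF S.mono S.right_cont])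
  have [measurable]: "relaxation \<beta> \<beta> \<mu> \<in> borel_measurable borel"
    using \<beta> by measurable
  let ?w = "\<lambda>s. l2inner M Z (J (max 0 s))"
  let ?I = "\<lambda>r b. \<integral>\<^sup>+s. ennreal (indicator {r<..} s * kernel \<beta> \<mu> s r) \<partial>history b t"
  have w_nn: "0 \<le> ?w s" for s
    by (rule solution_covariance_nonneg[OF adm J _ Z]) simp
  have w_cont: "continuous_on UNIV ?w"
    by (rule continuous_l2inner[OF solution_continuous[OF adm J] ZL])
  have Im: "(\<lambda>r. ?I r b) \<in> borel_measurable borel"
    and tonelli: "ennreal (\<integral>s. ?w s \<partial>history b t) = (\<integral>\<^sup>+r. indicator {0<..} r * ?I r b \<partial>interval_measure (cov Z))"
    if b: "0 \<le> b" "b \<le> 1" for b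
  proof -
    interpret h: finite_measure "history b t"
      by (rule finite_measure_history[OF b])
    interpret P: pair_sigma_finite "history b t" "interval_measure (cov Z)" ..
    define f where "f = (\<lambda>(s, r). ennreal (indicator {r<..} s * kernel \<beta> \<mu> s r))"
    have fm0: "f \<in> borel_measurable (borel \<Otimes>\<^sub>M borel)"
    proof -
      have "f = (\<lambda>z. ennreal ((if snd z < fst z then 1 else 0) * relaxation \<beta> \<beta> \<mu> (fst z - snd z)))"
        by (auto simp: f_def kernel_eq_relaxation indicator_def fun_eq_iff)
      then show ?thesis by simp
    qed
    have fm [measurable]: "f \<in> borel_measurable (history b t \<Otimes>\<^sub>M interval_measure (cov Z))"
      using fm0 by (simp cong: measurable_cong_sets sets_pair_measure_cong)
    have "(\<lambda>r. \<integral>\<^sup>+s. f (s, r) \<partial>history b t) \<in> borel_measurable (interval_measure (cov Z))"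
      by measurable
    then show "(\<lambda>r. ?I r b) \<in> borel_measurable borel"
      by (simp add: f_def cong: measurable_cong_sets)
    have "ennreal (\<integral>s. ?w s \<partial>history b t) = (\<integral>\<^sup>+s. ennreal (?w s) \<partial>history b t)"
      using w_nn integrable_history_continuous[OF b t w_cont] by (simp add: nn_integral_eq_integral)
    also have "\<dots> = (\<integral>\<^sup>+s. (\<integral>\<^sup>+r. indicator {0<..} r * f (s, r) \<partial>interval_measure (cov Z)) \<partial>history b t)"
    proof (rule nn_integral_cong_AE)
      show "AE s in history b t. ennreal (?w s) = (\<integral>\<^sup>+r. indicator {0<..} r * f (s, r) \<partial>interval_measure (cov Z))"
        using AE_history[OF t]
      proof eventually_elim
        case (elim s)
        have "(\<integral>\<^sup>+r. indicator {0<..} r * f (s, r) \<partial>interval_measure (cov Z))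
            = (\<integral>\<^sup>+r. ennreal (indicator {0<..<s} r * kernel \<beta> \<mu> s r) \<partial>interval_measure (cov Z))"
          by (intro nn_integral_cong) (auto simp: f_def indicator_def)
        also have "\<dots> = ennreal (?w s)"
        proof (cases "s = 0")
          case True
          have "l2norm M (J 0) = 0"
            using solution_0[OF J] solution_L2[OF J, of 0] by (simp add: l2norm_eq_0_iff_AE)
          then have "?w s = 0"
            using True abs_l2inner_le[OF ZL solution_L2[OF J, of 0]] by simp
          then show ?thesis using True by simp
        next
          case False
          then show ?thesis
            using elim solution_covariance[OF adm J _ Z, of s] by simp
        qed
        finally show ?case by simp
      qed
    qed
    also have "\<dots> = (\<integral>\<^sup>+r. (\<integral>\<^sup>+s. indicator {0<..} r * f (s, r) \<partial>history b t) \<partial>interval_measure (cov Z))"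
      using P.Fubini'[of "\<lambda>s r. indicator {0<..} r * f (s, r)"] by simp
    also have "\<dots> = (\<integral>\<^sup>+r. indicator {0<..} r * ?I r b \<partial>interval_measure (cov Z))"
      by (intro nn_integral_cong) (auto simp: f_def indicator_def)
    finally show "ennreal (\<integral>s. ?w s \<partial>history b t) = (\<integral>\<^sup>+r. indicator {0<..} r * ?I r b \<partial>interval_measure (cov Z))" .
  qed
  note [measurable] = Im
  let ?L = "(\<integral>s. ?w s \<partial>history \<beta> t)" and ?R = "(\<integral>s. ?w s \<partial>history 0 t)"
  have nn: "0 \<le> ?L" "0 \<le> ?R"
    using w_nn by (auto intro: Bochner_Integration.integral_nonneg)
  have [measurable]: "(\<lambda>r. ?I r \<beta>) \<in> borel_measurable borel" "(\<lambda>r. ?I r 0) \<in> borel_measurable borel"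
    using Im[of \<beta>] Im[of 0] \<beta> by auto
  have "ennreal (?L + \<mu> * ?R) = ennreal ?L + ennreal \<mu> * ennreal ?R"
    using nn \<mu> by (simp add: ennreal_mult)
  also have "ennreal ?L = (\<integral>\<^sup>+r. indicator {0<..} r * ?I r \<beta> \<partial>interval_measure (cov Z))"
    using \<beta> by (intro tonelli) auto
  also have "ennreal ?R = (\<integral>\<^sup>+r. indicator {0<..} r * ?I r 0 \<partial>interval_measure (cov Z))"
    by (intro tonelli) auto
  also have "(\<integral>\<^sup>+r. indicator {0<..} r * ?I r \<beta> \<partial>interval_measure (cov Z))
      + ennreal \<mu> * (\<integral>\<^sup>+r. indicator {0<..} r * ?I r 0 \<partial>interval_measure (cov Z))
      = (\<integral>\<^sup>+r. indicator {0<..} r * ?I r \<beta> + ennreal \<mu> * (indicator {0<..} r * ?I r 0) \<partial>interval_measure (cov Z))"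
    by (subst nn_integral_add) (auto simp: nn_integral_cmult)
  also have "\<dots> = (\<integral>\<^sup>+r. indicator {0<..t} r \<partial>interval_measure (cov Z))"
  proof (rule nn_integral_cong_AE)
    \<comment> \<open>The unit step excludes r = t, whereas the mass is taken over (0, t]. The
      single point is null because \<open>cov Z\<close> is continuous.\<close>
    have "AE r in interval_measure (cov Z). r \<noteq> t"
      using S.emeasure_singleton[of t] by (intro AE_I[of _ _ "{t}"]) auto
    then show "AE r in interval_measure (cov Z). indicator {0<..} r * ?I r \<beta> + ennreal \<mu> * (indicator {0<..} r * ?I r 0) = indicator {0<..t} r"
    proof eventually_elim
      case (elim r)
      show ?case
      proof (cases "0 < r")
        case True
        then show ?thesis
          using history_kernel[OF \<beta> \<mu> _ t, of r] elim by (auto simp: indicator_def)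
      qed auto
    qed
  qed
  also have "\<dots> = ennreal (cov Z t)"
    using t cov_0[OF ZL] by (simp add: S.emeasure_Ioc)
  finally have "ennreal (?L + \<mu> * ?R) = ennreal (cov Z t)" .
  moreover have "0 \<le> ?L + \<mu> * ?R" "0 \<le> cov Z t"
    using nn \<mu> S.mono[OF t] cov_0[OF ZL] by simp_all
  ultimately show ?thesis
    using ennreal_inj by blast
qed

lemma l2inner_self_eq_0:
  assumes "D \<in> L2_space M" "l2inner M D D = 0"
  shows "AE \<omega> in M. D \<omega> = 0"
  using assms by (simp add: l2inner_self l2norm_eq_0_iff_AE)

context
  fixes u :: "real \<Rightarrow> 'a \<Rightarrow> real"
  assumes um: "(\<lambda>(s, \<omega>). u s \<omega>) \<in> borel_measurable (borel \<Otimes>\<^sub>M M)"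
    and uc: "l2_continuous M u" and uneg: "\<And>s. s \<le> 0 \<Longrightarrow> u s = u 0"
begin

text \<open>Constancy on negative times makes inner products with \<open>u\<close> continuous on the
  whole line. The history measures live on [0, t], so no integral is affected.\<close>

lemma u_max: "u (max 0 s) = u s"
  using uneg[of s] by (cases "s \<le> 0") auto

lemma u_L2: "u s \<in> L2_space M"
  using uc u_max[of s] unfolding l2_continuous_def by (metis max.cobounded1)

lemma continuous_u:
  assumes "Z \<in> L2_space M"
  shows "continuous_on UNIV (\<lambda>s. l2inner M Z (u s))"
  using continuous_l2inner[OF uc assms] by (simp add: u_max)

lemma history_integral:
  assumes "0 \<le> t" "0 \<le> b" "b \<le> 1"
  shows "(\<lambda>\<omega>. \<integral>s. u s \<omega> \<partial>history b t) \<in> L2_space M"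
    and "\<And>Z. Z \<in> L2_space M \<Longrightarrow> l2inner M Z (\<lambda>\<omega>. \<integral>s. u s \<omega> \<partial>history b t) = (\<integral>s. l2inner M Z (u s) \<partial>history b t)"
    and "AE \<omega> in M. integrable (history b t) (\<lambda>s. u s \<omega>)"
proof -
  obtain C where C: "\<And>s. s \<in> {0..t} \<Longrightarrow> l2norm M (u s) \<le> C"
    using l2_continuous_bounded[OF uc] by blast
  note * = time_integral[OF finite_measure_history[OF assms(2,3)] sets_history AE_history[OF assms(1)] um u_L2 C]
  show "(\<lambda>\<omega>. \<integral>s. u s \<omega> \<partial>history b t) \<in> L2_space M"
    "\<And>Z. Z \<in> L2_space M \<Longrightarrow> l2inner M Z (\<lambda>\<omega>. \<integral>s. u s \<omega> \<partial>history b t) = (\<integral>s. l2inner M Z (u s) \<partial>history b t)"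
    "AE \<omega> in M. integrable (history b t) (\<lambda>s. u s \<omega>)"
    using * by auto
qed

definition memory :: "real \<Rightarrow> 'a \<Rightarrow> real" where
  "memory t \<omega> = (\<integral>s. u s \<omega> \<partial>history \<beta> t) + \<mu> * (\<integral>s. u s \<omega> \<partial>history 0 t)"

lemma memory_L2: "0 \<le> t \<Longrightarrow> memory t \<in> L2_space M"
  unfolding memory_def[abs_def] using \<beta>
  by (intro L2_space_add L2_space_mult_left history_integral) auto

lemma l2inner_memory:
  assumes "0 \<le> t" "Z \<in> L2_space M"
  shows "l2inner M Z (memory t) = (\<integral>s. l2inner M Z (u s) \<partial>history \<beta> t) + \<mu> * (\<integral>s. l2inner M Z (u s) \<partial>history 0 t)"
proof -
  have L2: "(\<lambda>\<omega>. \<integral>s. u s \<omega> \<partial>history \<beta> t) \<in> L2_space M" "(\<lambda>\<omega>. \<integral>s. u s \<omega> \<partial>history 0 t) \<in> L2_space M"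
    using assms \<beta> by (auto intro: history_integral)
  have "l2inner M Z (memory t) = l2inner M Z (\<lambda>\<omega>. \<integral>s. u s \<omega> \<partial>history \<beta> t) + \<mu> * l2inner M Z (\<lambda>\<omega>. \<integral>s. u s \<omega> \<partial>history 0 t)"
    using L2_space_integrable_mult[OF assms(2) L2(1)] L2_space_integrable_mult[OF assms(2) L2_space_mult_left(1)[OF L2(2), of \<mu>]]
    by (simp add: memory_def[abs_def] l2inner_def distrib_left mult.left_commute)
  then show ?thesis
    using assms \<beta> by (simp add: history_integral(2))
qed

lemma solves_iff_memory: "solves u \<longleftrightarrow> (\<forall>t\<ge>0. AE \<omega> in M. memory t \<omega> = B t \<omega>)"
proof -
  have "(AE \<omega> in M. integrable (history \<beta> t) (\<lambda>s. u s \<omega>) \<and> integrable (history 0 t) (\<lambda>s. u s \<omega>) \<and>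
     (\<integral>s. u s \<omega> \<partial>history \<beta> t) + \<mu> * (\<integral>s. u s \<omega> \<partial>history 0 t) = B t \<omega>) \<longleftrightarrow> (AE \<omega> in M. memory t \<omega> = B t \<omega>)"
    if t: "0 \<le> t" for t
  proof -
    have "AE \<omega> in M. integrable (history \<beta> t) (\<lambda>s. u s \<omega>)" "AE \<omega> in M. integrable (history 0 t) (\<lambda>s. u s \<omega>)"
      using t \<beta> by (auto intro: history_integral)
    then show ?thesis
      by (simp add: memory_def)
  qed
  then show ?thesis
    unfolding solves_def by auto
qed

text \<open>The defect of the equation at time t is orthogonal to every \<open>B a\<close> by the
  weak equation, hence to every value of \<open>u\<close>, which lies in their closed span, hence to
  the time integrals of \<open>u\<close>. So it is orthogonal to itself.\<close>

lemma solution_imp_solves: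
  assumes adm: "admissible \<beta>" and J: "solution u"
  shows "solves u"
  unfolding solves_iff_memory
proof (intro allI impI)
  fix t :: real assume t: "0 \<le> t"
  define D where "D = (\<lambda>\<omega>. memory t \<omega> - B t \<omega>)"
  have L2: "memory t \<in> L2_space M" "B t \<in> L2_space M"
    using t by (auto intro: memory_L2 B_L2)
  then have D: "D \<in> L2_space M"
    unfolding D_def by (rule L2_space_diff)
  have DB: "l2inner M D (B a) = 0" if a: "0 \<le> a" for a
  proof -
    have "l2inner M (B a) D = l2inner M (B a) (memory t) - l2inner M (B a) (B t)"
      unfolding D_def using L2 B_L2[OF a] by (intro l2inner_diff_right)
    also have "\<dots> = 0"
      using solution_weak_equation[OF adm J t positive_B[OF a]] t
      by (simp add: l2inner_memory B_L2 a u_max) (simp add: cov_def)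
    finally show ?thesis
      by (simp add: l2inner_commute)
  qed
  have "l2inner M D (u s) = 0" for s
    using solution_orthogonal[OF adm J _ D DB, of "max 0 s"] by (simp add: u_max)
  then have "l2inner M D (memory t) = 0"
    using t D by (simp add: l2inner_memory)
  then have "l2inner M D D = 0"
    using DB[OF t] l2inner_diff_right[OF D L2] by (simp add: D_def)
  then show "AE \<omega> in M. memory t \<omega> = B t \<omega>"
    using l2inner_self_eq_0[OF D] by (simp add: D_def)
qed

text \<open>\<open>u\<close> is compared with some solution \<open>J\<close> given by the formula.
  Tested against \<open>B a\<close>, the difference satisfies the homogeneous scalar equation and
  vanishes. This still permits a component of \<open>u\<close> orthogonal to the noise; pairing it
  with \<open>u\<close> gives another solution of the homogeneous equation.\<close>

lemma solves_imp_solution: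
  assumes adm: "admissible \<beta>" and eq: "solves u" and u0: "AE \<omega> in M. u 0 \<omega> = 0"
  shows "solution u"
proof -
  obtain J where J: "solution J"
    using solution_exists[OF adm] by blast
  have Jc: "l2_continuous M J"
    by (rule solution_continuous[OF adm J])
  have mem: "l2inner M Z (memory t) = l2inner M Z (B t)" if "0 \<le> t" "Z \<in> L2_space M" for Z t
  proof -
    have [measurable]: "Z \<in> borel_measurable M" "memory t \<in> borel_measurable M" "B t \<in> borel_measurable M"
      using that memory_L2 B_L2 by (auto intro: L2_space_measurable)
    have "AE \<omega> in M. memory t \<omega> = B t \<omega>"
      using eq that unfolding solves_iff_memory by blast
    then show ?thesis
      unfolding l2inner_def by (intro integral_cong_AE) auto
  qed
  have ae: "AE \<omega> in M. J t \<omega> = u t \<omega>" if "0 \<le> t" for t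
  proof (cases "t = 0")
    case True
    show ?thesis
      using solution_0[OF J] u0 unfolding True by eventually_elim simp
  next
    case False
    then have t: "0 < t" using that by simp
    define D where "D = (\<lambda>\<omega>. u t \<omega> - J t \<omega>)"
    have JL: "J t \<in> L2_space M"
      using J t by (auto intro: solution_L2)
    then have D: "D \<in> L2_space M"
      unfolding D_def by (intro L2_space_diff u_L2)
    have DB: "l2inner M D (B a) = 0" if a: "0 \<le> a" for a
    proof -
      let ?v = "\<lambda>s. l2inner M (B a) (u s) - l2inner M (B a) (J (max 0 s))"
      have c: "continuous_on UNIV (\<lambda>s. l2inner M (B a) (u s))" "continuous_on UNIV (\<lambda>s. l2inner M (B a) (J (max 0 s)))"
        using continuous_u[OF B_L2[OF a]] continuous_l2inner[OF Jc B_L2[OF a]] by auto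
      have "?v t = 0"
      proof (rule history_injective[OF \<beta> \<mu> _ _ t])
        show "continuous_on UNIV ?v"
          using c by (intro continuous_on_diff)
        fix t' :: real assume t': "0 \<le> t'"
        have i: "integrable (history b t') (\<lambda>s. l2inner M (B a) (u s))" "integrable (history b t') (\<lambda>s. l2inner M (B a) (J (max 0 s)))"
          if "0 \<le> b" "b \<le> 1" for b
          using c that t' by (auto intro: integrable_history_continuous)
        have "(\<integral>s. ?v s \<partial>history \<beta> t') + \<mu> * (\<integral>s. ?v s \<partial>history 0 t')
            = ((\<integral>s. l2inner M (B a) (u s) \<partial>history \<beta> t') + \<mu> * (\<integral>s. l2inner M (B a) (u s) \<partial>history 0 t'))
              - ((\<integral>s. l2inner M (B a) (J (max 0 s)) \<partial>history \<beta> t') + \<mu> * (\<integral>s. l2inner M (B a) (J (max 0 s)) \<partial>history 0 t'))"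
          using i[of \<beta>] i[of 0] \<beta> by (simp add: algebra_simps)
        also have "\<dots> = l2inner M (B a) (memory t') - cov (B a) t'"
          using solution_weak_equation[OF adm J t' positive_B[OF a]] t' a by (simp add: l2inner_memory B_L2)
        also have "\<dots> = 0"
          using mem[OF t' B_L2[OF a]] t' by (simp add: cov_def)
        finally show "(\<integral>s. ?v s \<partial>history \<beta> t') + \<mu> * (\<integral>s. ?v s \<partial>history 0 t') = 0" .
      qed
      then show ?thesis
        using t l2inner_diff_right[OF B_L2[OF a] u_L2[of t] JL] by (simp add: D_def l2inner_commute)
    qed
    \<comment> \<open>\<open>D\<close> is orthogonal to the noise, so pairing the equation for
      \<open>u\<close> with \<open>D\<close> removes the right-hand side.\<close>
    have "l2inner M D (u t) = 0"
    proof (rule history_injective[OF \<beta> \<mu> continuous_u[OF D] _ t])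
      fix t' :: real assume t': "0 \<le> t'"
      show "(\<integral>s. l2inner M D (u s) \<partial>history \<beta> t') + \<mu> * (\<integral>s. l2inner M D (u s) \<partial>history 0 t') = 0"
        using l2inner_memory[OF t' D] mem[OF t' D] DB[OF t'] by simp
    qed
    moreover have "l2inner M D (J t) = 0"
      using t by (intro solution_orthogonal[OF adm J _ D DB]) auto
    ultimately have "l2inner M D D = 0"
      using l2inner_diff_right[OF D u_L2[of t] JL] by (simp add: D_def)
    from l2inner_self_eq_0[OF D this] show ?thesis
      by eventually_elim (simp add: D_def)
  qed
  show ?thesis
    unfolding solution_def
  proof (intro allI impI)
    fix t :: real assume t: "0 \<le> t"
    show "has_improper_RS_integral M (kernel \<beta> \<mu> t) B t (u t)"
      using J t by (intro has_improper_RS_integral_AE_cong[OF _ u_L2 ae[OF t]]) (auto simp: solution_def)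
  qed
qed

text \<open>
  Otherwise \<open>\<sqrt>A t\<^sup>H = \<parallel>B t\<parallel> = o(t\<^sup>1\<^sup>-\<^sup>\<beta>)\<close> as \<open>t \<rightarrow> 0\<close>, because \<open>u\<close> is continuous with \<open>u 0 = 0\<close>.
\<close>
lemma solves_imp_admissible:
  assumes eq: "solves u" and u0: "AE \<omega> in M. u 0 \<omega> = 0"
  shows "admissible \<beta>"
proof (rule ccontr)
  assume "\<not> admissible \<beta>"
  then have A: "0 < A" and \<theta>: "\<beta> + H \<le> 1"
    using A_nonneg by (auto simp: admissible_def)
  have \<beta>1: "\<beta> < 1" using \<theta> H by simp
  have G: "0 < Gamma (2 - \<beta>)"
    using \<beta>1 by (intro Gamma_real_pos) simp
  \<comment> \<open>For t \<le> 1 both t^(1-\<beta>) and t are at most t^H, so the masses of the two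
    history measures, the second weighted with \<mu>, add up to at most m t^H.\<close>
  define m where "m = 1 / Gamma (2 - \<beta>) + \<mu>"
  have m: "0 < m" using G \<mu> by (simp add: m_def add_pos_nonneg)
  \<comment> \<open>Chosen so that e m is half of sqrt(A): the memory of a process of norm at most
    \<open>e\<close> is then too small to balance the noise.\<close>
  define e where "e = sqrt A / (2 * m)"
  have e: "0 < e" using A m by (simp add: e_def)
  obtain \<delta> where \<delta>: "\<delta> > 0" "\<forall>s\<ge>0. \<bar>s - 0\<bar> < \<delta> \<longrightarrow> l2norm M (\<lambda>x. u s x - u 0 x) < e"
    using uc e unfolding l2_continuous_def by (meson order_refl)
  define t where "t = min 1 (\<delta> / 2)"
  have t: "0 < t" "t \<le> 1" "t < \<delta>" using \<delta>(1) by (auto simp: t_def)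
  have small: "l2norm M (u s) \<le> e" if "s \<in> {0..t}" for s
  proof -
    have "AE \<omega> in M. u s \<omega> - u 0 \<omega> = u s \<omega>"
      using u0 by eventually_elim simp
    then have "l2norm M (u s) = l2norm M (\<lambda>x. u s x - u 0 x)"
      using u_L2 by (intro L2_space_AE_cong(2) L2_space_diff) auto
    also have "\<dots> < e"
      using \<delta>(2) that t by auto
    finally show ?thesis by simp
  qed
  have BL: "B t \<in> L2_space M" using t by (intro B_L2) simp
  have [measurable]: "memory t \<in> borel_measurable M" "B t \<in> borel_measurable M"
    using BL memory_L2[of t] t by auto
  have "AE \<omega> in M. memory t \<omega> = B t \<omega>"
    using eq t unfolding solves_iff_memory by auto
  then have "l2inner M (B t) (B t) = l2inner M (B t) (memory t)"
    unfolding l2inner_def by (intro integral_cong_AE) auto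
  also have "\<dots> = (\<integral>s. l2inner M (B t) (u s) \<partial>history \<beta> t) + \<mu> * (\<integral>s. l2inner M (B t) (u s) \<partial>history 0 t)"
    using t BL by (intro l2inner_memory) auto
  also have "\<dots> \<le> l2norm M (B t) * e * measure (history \<beta> t) UNIV + \<mu> * (l2norm M (B t) * e * measure (history 0 t) UNIV)"
  proof -
    have "\<bar>l2inner M (B t) (u s)\<bar> \<le> l2norm M (B t) * e" if "s \<in> {0..t}" for s
      using order_trans[OF abs_l2inner_le[OF BL u_L2[of s]] mult_left_mono[OF small[OF that] l2norm_nonneg]] .
    then have "\<bar>\<integral>s. l2inner M (B t) (u s) \<partial>history b t\<bar> \<le> l2norm M (B t) * e * measure (history b t) UNIV" if "0 \<le> b" "b \<le> 1" for b
      using that t continuous_u[OF BL] by (intro integrable_history borel_measurable_continuous_onI) auto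
    from this[of \<beta>] this[of 0] show ?thesis
      using \<beta> \<mu> by (intro add_mono mult_left_mono) auto
  qed
  also have "measure (history \<beta> t) UNIV = t powr (1 - \<beta>) / Gamma (2 - \<beta>)"
    using emeasure_history[of \<beta> t] \<beta> \<beta>1 t G by (simp add: measure_def frac_kernel_def)
  also have "measure (history 0 t) UNIV = t"
    using emeasure_history[of 0 t] t Gamma_fact[of 1, where 'a = real] by (simp add: measure_def frac_kernel_def)
  also have "l2norm M (B t) * e * (t powr (1 - \<beta>) / Gamma (2 - \<beta>)) + \<mu> * (l2norm M (B t) * e * t)
      \<le> l2norm M (B t) * (e * m * t powr H)"
  proof -
    have 1: "t powr (1 - \<beta>) \<le> t powr H"
      using t \<theta> by (intro powr_mono') auto
    have 2: "t \<le> t powr H"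
      using t H powr_mono'[of H 1 t] by simp
    have "l2norm M (B t) * e * (t powr (1 - \<beta>) / Gamma (2 - \<beta>)) + \<mu> * (l2norm M (B t) * e * t)
        = l2norm M (B t) * e * (t powr (1 - \<beta>) / Gamma (2 - \<beta>) + \<mu> * t)"
      by (simp add: algebra_simps)
    also have "\<dots> \<le> l2norm M (B t) * e * (t powr H / Gamma (2 - \<beta>) + \<mu> * t powr H)"
      using 1 2 e G \<mu> by (intro mult_left_mono add_mono divide_right_mono mult_nonneg_nonneg) auto
    also have "\<dots> = l2norm M (B t) * (e * m * t powr H)"
      by (simp add: m_def algebra_simps)
    finally show ?thesis .
  qed
  finally have "l2norm M (B t) * l2norm M (B t) \<le> l2norm M (B t) * (e * m * t powr H)"
    by (simp add: l2inner_self power2_eq_square)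
  moreover have Bn: "l2norm M (B t) = sqrt A * t powr H"
    using t by (intro B_norm) simp
  moreover have "0 < sqrt A * t powr H"
    using A t by simp
  ultimately have "sqrt A * t powr H \<le> e * m * t powr H"
    by (simp add: mult_le_cancel_left_pos)
  then have "sqrt A \<le> e * m"
    using t by simp
  then show False
    using A m by (simp add: e_def)
qed

end

end

section \<open>Expansions in vector spherical harmonics\<close>

lemma finite_measure_S2: "finite_measure S2_measure"
proof -
  have fin: "finite_measure (restrict_space lborel (ball 0 1 - {0}) :: (real^3) measure)"
  proof (rule finite_measureI)
    have "emeasure lborel (ball 0 1 - {0} :: (real^3) set) \<le> emeasure lborel (ball 0 1 :: (real^3) set)"
      by (intro emeasure_mono) auto
    also have "\<dots> < \<infinity>"
      using emeasure_bounded_finite[of "ball 0 1 :: (real^3) set"] by simp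
    finally show "emeasure (restrict_space lborel (ball 0 1 - {0})) (space (restrict_space lborel (ball 0 1 - {0} :: (real^3) set))) \<noteq> \<infinity>"
      by (simp add: emeasure_restrict_space space_restrict_space)
  qed
  have "sgn \<in> restrict_space lborel (ball 0 1 - {0}) \<rightarrow>\<^sub>M (restrict_space borel (sphere 0 1) :: (real^3) measure)"
    by (intro measurable_restrict_space2 measurable_restrict_space1)
      (auto simp: space_restrict_space norm_sgn)
  then have "finite_measure (distr (restrict_space lborel (ball 0 1 - {0})) (restrict_space borel (sphere 0 1) :: (real^3) measure) sgn)"
    by (intro finite_measure.finite_measure_distr fin)
  then show ?thesis
    unfolding S2_measure_def
    by (intro finite_measureI)
      (simp add: emeasure_scale_measure ennreal_mult_eq_top_iff finite_measure.emeasure_finite space_scale_measure)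
qed

lemma space_S2: "space S2_measure = sphere 0 1"
  by (simp add: S2_measure_def space_scale_measure space_restrict_space)

lemma sets_S2: "sets S2_measure = sets (restrict_space borel (sphere 0 1))"
  by (simp add: S2_measure_def)

lemma borel_measurable_S2 [measurable (raw)]:
  assumes "f \<in> N \<rightarrow>\<^sub>M S2_measure"
  shows "f \<in> borel_measurable N"
proof -
  have "f \<in> N \<rightarrow>\<^sub>M restrict_space borel (sphere 0 1)"
    using assms by (simp cong: measurable_cong_sets add: sets_S2)
  then show ?thesis
    by (simp add: measurable_restrict_space2_iff)
qed

lemma vec_nth_measurable [measurable (raw)]:
  fixes f :: "'a \<Rightarrow> 'b::{second_countable_topology, t2_space} ^ 'n"
  assumes "f \<in> borel_measurable M"
  shows "(\<lambda>x. f x $ i) \<in> borel_measurable M"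
proof -
  have "continuous_on UNIV (\<lambda>v :: 'b ^ 'n. v $ i)"
    by (intro continuous_on_component continuous_on_id)
  from measurable_compose[OF assms borel_measurable_continuous_onI[OF this]] show ?thesis .
qed

lemma cdot_measurable [measurable (raw)]:
  assumes [measurable]: "f \<in> borel_measurable M" "g \<in> borel_measurable M"
  shows "(\<lambda>x. cdot (f x) (g x)) \<in> borel_measurable M"
proof -
  have [measurable]: "cnj \<in> borel_measurable borel"
    by (intro borel_measurable_continuous_onI continuous_intros)
  show ?thesis
    unfolding cdot_def by measurable
qed

lemma cvec_measurable [measurable (raw)]:
  assumes "f \<in> borel_measurable M"
  shows "(\<lambda>x. cvec (f x)) \<in> borel_measurable M"
proof -
  have "continuous_on UNIV cvec"
    unfolding cvec_def[abs_def] by (intro continuous_on_vec_lambda continuous_intros)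
  from measurable_compose[OF assms borel_measurable_continuous_onI[OF this]] show ?thesis .
qed

lemma scalar_mult_measurable [measurable (raw)]:
  fixes f :: "'a \<Rightarrow> complex ^ 3"
  assumes "c \<in> borel_measurable M" "f \<in> borel_measurable M"
  shows "(\<lambda>x. c x *s f x) \<in> borel_measurable M"
proof (rule borel_measurable_continuous_Pair[OF assms])
  show "continuous_on UNIV (\<lambda>x :: complex \<times> (complex ^ 3). fst x *s snd x)"
    unfolding vector_scalar_mult_def by (intro continuous_on_vec_lambda continuous_intros)
qed

lemma cdot_self: "cdot a a = complex_of_real ((norm a)\<^sup>2)"
  unfolding cdot_def norm_vec_def L2_set_def
  by (simp add: complex_norm_square[symmetric] sum_nonneg)

lemma norm_cdot_le: "norm (cdot a b) \<le> norm a * norm b"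
proof -
  have "norm (cdot a b) \<le> (\<Sum>i\<in>UNIV. \<bar>norm (a $ i)\<bar> * \<bar>norm (b $ i)\<bar>)"
    unfolding cdot_def by (rule order_trans[OF norm_sum]) (simp add: norm_mult)
  also have "\<dots> \<le> norm a * norm b"
    unfolding norm_vec_def by (rule L2_set_mult_ineq)
  finally show ?thesis .
qed

lemma norm_scalar_mult: "norm (k *s a) = norm k * norm (a :: complex ^ 3)"
  unfolding norm_vec_def by (simp add: norm_mult L2_set_right_distrib)

lemma cdot_add_left: "cdot (a + b) c = cdot a c + cdot b c"
  by (simp add: cdot_def distrib_right sum.distrib)

lemma cdot_add_right: "cdot a (b + c) = cdot a b + cdot a c"
  by (simp add: cdot_def distrib_left sum.distrib)

lemma cdot_diff_left: "cdot (a - b) c = cdot a c - cdot b c"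
  by (simp add: cdot_def left_diff_distrib sum_subtractf)

lemma cdot_scale_left: "cdot (k *s a) b = k * cdot a b"
  by (simp add: cdot_def sum_distrib_left mult.assoc)

lemma cdot_scale_right: "cdot a (k *s b) = cnj k * cdot a b"
  by (simp add: cdot_def sum_distrib_left mult.left_commute)

lemma cdot_0_left [simp]: "cdot 0 b = 0"
  by (simp add: cdot_def)

lemma cdot_0_right [simp]: "cdot b 0 = 0"
  by (simp add: cdot_def)

lemma cdot_sum_left: "cdot (\<Sum>i\<in>I. f i) b = (\<Sum>i\<in>I. cdot (f i) b)"
  by (induction I rule: infinite_finite_induct) (auto simp: cdot_add_left)

lemma cdot_sum_right: "cdot b (\<Sum>i\<in>I. f i) = (\<Sum>i\<in>I. cdot b (f i))"
  by (induction I rule: infinite_finite_induct) (auto simp: cdot_add_right)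

lemma norm_cvec: "norm (cvec x) = norm x"
  by (simp add: norm_vec_def cvec_def)

lemma L2_space_scalar_mult:
  fixes f :: "'a \<Rightarrow> complex ^ 3"
  assumes "f \<in> L2_space N"
  shows "(\<lambda>x. k *s f x) \<in> L2_space N"
proof -
  have [measurable]: "f \<in> borel_measurable N" using assms by auto
  show ?thesis
    using L2_space_integrable[OF assms] by (simp add: L2_space_def norm_scalar_mult power_mult_distrib)
qed

lemma coeff_integrable:
  assumes "f \<in> L2_space S2_measure" "g \<in> L2_space S2_measure"
  shows "integrable S2_measure (\<lambda>x. cdot (f x) (g x))" and "norm (coeff f g) \<le> l2norm S2_measure f * l2norm S2_measure g"
proof -
  have [measurable]: "f \<in> borel_measurable S2_measure" "g \<in> borel_measurable S2_measure"
    using assms by auto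
  show int: "integrable S2_measure (\<lambda>x. cdot (f x) (g x))"
    by (rule Bochner_Integration.integrable_bound[OF L2_space_norm_mult(1)[OF assms]]) (auto simp: norm_cdot_le)
  have "norm (coeff f g) \<le> (LINT x|S2_measure. norm (cdot (f x) (g x)))"
    unfolding coeff_def by (rule integral_norm_bound)
  also have "\<dots> \<le> (LINT x|S2_measure. norm (f x) * norm (g x))"
    using int L2_space_norm_mult(1)[OF assms] by (intro integral_mono integrable_norm norm_cdot_le)
  also have "\<dots> \<le> l2norm S2_measure f * l2norm S2_measure g"
    by (rule L2_space_norm_mult(2)[OF assms])
  finally show "norm (coeff f g) \<le> l2norm S2_measure f * l2norm S2_measure g" .
qed

lemma coeff_self: "coeff f f = complex_of_real ((l2norm S2_measure f)\<^sup>2)"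
  by (simp add: coeff_def cdot_self l2norm_power2 del: of_real_power)

lemma coeff_diff:
  assumes "f \<in> L2_space S2_measure" "g \<in> L2_space S2_measure" "h \<in> L2_space S2_measure"
  shows "coeff (\<lambda>x. f x - g x) h = coeff f h - coeff g h"
  using assms by (simp add: coeff_def cdot_diff_left coeff_integrable)

lemma coeff_sum_left:
  assumes "\<And>i. i \<in> J \<Longrightarrow> f i \<in> L2_space S2_measure" "g \<in> L2_space S2_measure"
  shows "coeff (\<lambda>x. \<Sum>i\<in>J. c i *s f i x) g = (\<Sum>i\<in>J. c i * coeff (f i) g)"
  using assms by (simp add: coeff_def cdot_sum_left cdot_scale_left coeff_integrable)

lemma coeff_sum_right:
  assumes "\<And>i. i \<in> J \<Longrightarrow> f i \<in> L2_space S2_measure" "g \<in> L2_space S2_measure"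
  shows "coeff g (\<lambda>x. \<Sum>i\<in>J. c i *s f i x) = (\<Sum>i\<in>J. cnj (c i) * coeff g (f i))"
  using assms by (simp add: coeff_def cdot_sum_right cdot_scale_right coeff_integrable)

lemma coeff_cnj: "coeff g f = cnj (coeff f g)"
proof -
  have "cdot (g x) (f x) = cnj (cdot (f x) (g x))" for x
    by (simp add: cdot_def mult.commute)
  then show ?thesis
    by (simp add: coeff_def)
qed

lemma l2norm_pythagoras:
  assumes f: "f \<in> L2_space S2_measure" and g: "g \<in> L2_space S2_measure" and orth: "coeff f g = 0"
  shows "(l2norm S2_measure (\<lambda>x. f x + g x))\<^sup>2 = (l2norm S2_measure f)\<^sup>2 + (l2norm S2_measure g)\<^sup>2"
proof -
  have "coeff (\<lambda>x. f x + g x) (\<lambda>x. f x + g x) = coeff f f + coeff f g + (coeff g f + coeff g g)"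
    using f g by (simp add: coeff_def cdot_add_left cdot_add_right coeff_integrable)
  also have "\<dots> = coeff f f + coeff g g"
    using orth coeff_cnj[of g f] by simp
  finally have "complex_of_real ((l2norm S2_measure (\<lambda>x. f x + g x))\<^sup>2) = complex_of_real ((l2norm S2_measure f)\<^sup>2 + (l2norm S2_measure g)\<^sup>2)"
    by (simp add: coeff_self)
  then show ?thesis
    using of_real_eq_iff by blast
qed

section \<open>Deterministic tangent fields in an orthonormal frame\<close>

locale vector_frame =
  fixes Y :: "nat \<Rightarrow> int \<Rightarrow> real ^ 3 \<Rightarrow> complex"
  assumes basis: "vector_harmonic_basis Y"
begin

abbreviation S :: "(real ^ 3) measure" where "S \<equiv> S2_measure"

definition frame :: "(nat \<times> int) + (nat \<times> int) \<Rightarrow> real ^ 3 \<Rightarrow> complex ^ 3" where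
  "frame = case_sum (\<lambda>(l, m). yv Y l m) (\<lambda>(l, m). zv Y l m)"

abbreviation indices :: "((nat \<times> int) + (nat \<times> int)) set" where
  "indices \<equiv> vec_indices <+> vec_indices"

text \<open>The index set of the N-th partial sum in \<open>has_L2_expansion\<close>: all orders of
  the degrees 1 to N, in both families.\<close>

definition window :: "nat \<Rightarrow> ((nat \<times> int) + (nat \<times> int)) set" where
  "window N = (SIGMA l:{1..N}. {- int l..int l}) <+> (SIGMA l:{1..N}. {- int l..int l})"

lemma frame_L2_tangent: "i \<in> indices \<Longrightarrow> frame i \<in> L2_tangent"
  using basis unfolding vector_harmonic_basis_def orthonormal_basis_L2_def frame_def by blast

lemma frame_L2: "i \<in> indices \<Longrightarrow> frame i \<in> L2_space S"
  using frame_L2_tangent[of i] by (simp add: L2_tangent_def)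

lemma frame_orthonormal: "i \<in> indices \<Longrightarrow> j \<in> indices \<Longrightarrow> coeff (frame i) (frame j) = (if i = j then 1 else 0)"
  using basis unfolding vector_harmonic_basis_def orthonormal_basis_L2_def frame_def coeff_def by blast

lemma frame_dense:
  assumes "f \<in> L2_tangent" "0 < \<epsilon>"
  obtains J c where "finite J" "J \<subseteq> indices" "sq_dist S f (\<lambda>x. \<Sum>i\<in>J. c i *s frame i x) < ennreal \<epsilon>"
proof -
  have "\<forall>f\<in>L2_tangent. \<forall>\<epsilon>>0. \<exists>J c. finite J \<and> J \<subseteq> indices \<and> sq_dist S f (\<lambda>x. \<Sum>i\<in>J. c i *s frame i x) < ennreal \<epsilon>"
    using basis unfolding vector_harmonic_basis_def orthonormal_basis_L2_def frame_def by simp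
  then have "\<exists>J c. finite J \<and> J \<subseteq> indices \<and> sq_dist S f (\<lambda>x. \<Sum>i\<in>J. c i *s frame i x) < ennreal \<epsilon>"
    using assms by simp
  then show thesis
    using that by (elim exE conjE)
qed

lemma finite_window: "finite (window N)"
  by (auto simp: window_def)

lemma window_subset: "window N \<subseteq> indices"
  by (auto simp: window_def vec_indices_def)

lemma window_mono: "N \<le> N' \<Longrightarrow> window N \<subseteq> window N'"
  by (auto simp: window_def)

lemma window_exhausts:
  assumes "finite J" "J \<subseteq> indices"
  obtains N0 where "\<And>N. N0 \<le> N \<Longrightarrow> J \<subseteq> window N"
proof -
  let ?d = "case_sum fst fst :: (nat \<times> int) + (nat \<times> int) \<Rightarrow> nat"
  have "J \<subseteq> window N" if "Max (insert 0 (?d ` J)) \<le> N" for N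
  proof
    fix i assume i: "i \<in> J"
    then have "?d i \<le> Max (insert 0 (?d ` J))"
      using assms(1) by (intro Max_ge) auto
    then have "?d i \<le> N" using that by simp
    moreover have "i \<in> indices" using i assms by auto
    ultimately show "i \<in> window N"
      by (auto simp: window_def vec_indices_def)
  qed
  then show thesis by (rule that)
qed

definition comb :: "((nat \<times> int) + (nat \<times> int)) set \<Rightarrow> ((nat \<times> int) + (nat \<times> int) \<Rightarrow> complex) \<Rightarrow> real ^ 3 \<Rightarrow> complex ^ 3" where
  "comb J c x = (\<Sum>i\<in>J. c i *s frame i x)"

lemma comb_L2: "J \<subseteq> indices \<Longrightarrow> comb J c \<in> L2_space S"
  unfolding comb_def[abs_def] by (intro L2_space_sum L2_space_scalar_mult frame_L2) auto

lemma coeff_comb: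
  assumes "finite J" "J \<subseteq> indices" "i \<in> J"
  shows "coeff (comb J c) (frame i) = c i"
proof -
  have "coeff (comb J c) (frame i) = (\<Sum>j\<in>J. c j * coeff (frame j) (frame i))"
    unfolding comb_def[abs_def] using assms by (intro coeff_sum_left frame_L2) auto
  also have "\<dots> = (\<Sum>j\<in>J. if j = i then c i else 0)"
    using assms by (intro sum.cong) (auto simp: frame_orthonormal subset_iff)
  finally show ?thesis
    using assms by simp
qed

lemma comb_norm:
  assumes "finite J" "J \<subseteq> indices"
  shows "(l2norm S (comb J c))\<^sup>2 = (\<Sum>i\<in>J. (norm (c i))\<^sup>2)"
proof -
  have "coeff (comb J c) (comb J c) = (\<Sum>i\<in>J. cnj (c i) * coeff (comb J c) (frame i))"
    unfolding comb_def[of J c, abs_def]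
    using assms by (intro coeff_sum_right frame_L2 L2_space_sum L2_space_scalar_mult) auto
  also have "\<dots> = (\<Sum>i\<in>J. complex_of_real ((norm (c i))\<^sup>2))"
    using assms by (intro sum.cong) (auto simp: coeff_comb complex_norm_square mult.commute simp del: of_real_power)
  finally have "complex_of_real ((l2norm S (comb J c))\<^sup>2) = complex_of_real (\<Sum>i\<in>J. (norm (c i))\<^sup>2)"
    by (simp add: coeff_self)
  then show ?thesis
    using of_real_eq_iff by blast
qed

lemma comb_diff: "comb J c x - comb J d x = comb J (\<lambda>i. c i - d i) x"
  by (simp add: comb_def vector_sub_rdistrib sum_subtractf)

text \<open>The error of the Fourier sum is orthogonal to the span of the frame members in
  \<open>J\<close>, so Pythagoras splits off the difference of the coefficients.\<close>

lemma comb_best_approximation: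
  assumes f: "f \<in> L2_space S" and J: "finite J" "J \<subseteq> indices"
  shows "(l2norm S (\<lambda>x. f x - comb J d x))\<^sup>2
    = (l2norm S (\<lambda>x. f x - comb J (\<lambda>i. coeff f (frame i)) x))\<^sup>2 + (\<Sum>i\<in>J. (norm (coeff f (frame i) - d i))\<^sup>2)"
proof -
  let ?c = "\<lambda>i. coeff f (frame i)"
  let ?h = "\<lambda>x. f x - comb J ?c x"
  have h: "?h \<in> L2_space S"
    using f J by (intro L2_space_diff comb_L2)
  have "coeff ?h (frame i) = 0" if "i \<in> J" for i
    using that J f by (subst coeff_diff) (auto simp: coeff_comb frame_L2 comb_L2 subset_iff)
  then have "coeff ?h (comb J (\<lambda>i. ?c i - d i)) = 0"
    unfolding comb_def[of J "\<lambda>i. ?c i - d i", abs_def]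
    using h J frame_L2 by (subst coeff_sum_right) auto
  from l2norm_pythagoras[OF h comb_L2[OF J(2)] this] show ?thesis
    by (simp add: comb_norm[OF J] comb_diff[symmetric])
qed

text \<open>Density supplies some finite combination close to \<open>f\<close>, and every large
  window contains its indices. Within a window the Fourier coefficients do at least as well.\<close>

lemma comb_window_converges:
  assumes "f \<in> L2_tangent"
  shows "(\<lambda>N. sq_dist S f (comb (window N) (\<lambda>i. coeff f (frame i)))) \<longlonglongrightarrow> 0"
proof -
  have f: "f \<in> L2_space S"
    using assms by (simp add: L2_tangent_def)
  have "\<forall>\<^sub>F N in sequentially. sq_dist S f (comb (window N) (\<lambda>i. coeff f (frame i))) < e" if e: "0 < e" for e
  proof -
    \<comment> \<open>The bound \<open>e\<close> may be infinite, whereas density asks for a real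
      number; an intermediate \<open>r\<close> is finite.\<close>
    obtain r where r: "0 < r" "r < e"
      using dense[OF e] by auto
    define \<epsilon> where "\<epsilon> = enn2real r"
    have "r < \<top>"
      using r(2) top_greatest by (rule less_le_trans)
    then have \<epsilon>: "0 < \<epsilon>" "ennreal \<epsilon> < e"
      using r by (auto simp: \<epsilon>_def enn2real_positive_iff)
    obtain J c where J: "finite J" "J \<subseteq> indices" "sq_dist S f (\<lambda>x. \<Sum>i\<in>J. c i *s frame i x) < ennreal \<epsilon>"
      by (rule frame_dense[OF assms \<epsilon>(1)])
    obtain N0 where N0: "\<And>N. N0 \<le> N \<Longrightarrow> J \<subseteq> window N"
      using window_exhausts[OF J(1,2)] by blast
    have "sq_dist S f (comb (window N) (\<lambda>i. coeff f (frame i))) < e" if "N0 \<le> N" for N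
    proof -
      let ?d = "\<lambda>i. if i \<in> J then c i else 0"
      have "comb (window N) ?d = (\<lambda>x. \<Sum>i\<in>J. c i *s frame i x)"
        unfolding comb_def using N0[OF that] finite_window
        by (intro ext sum.mono_neutral_cong_right) auto
      then have lt: "sq_dist S f (comb (window N) ?d) < ennreal \<epsilon>"
        using J(3) by simp
      have "sq_dist S f (comb (window N) (\<lambda>i. coeff f (frame i))) \<le> sq_dist S f (comb (window N) ?d)"
        using comb_best_approximation[OF f finite_window[of N] window_subset[of N], of ?d] f window_subset
        by (simp add: sq_dist_eq_l2norm comb_L2 sum_nonneg ennreal_leI)
      also have "\<dots> < e"
        using lt \<epsilon>(2) by (rule less_trans)
      finally show ?thesis .
    qed
    then show ?thesis
      unfolding eventually_at_top_linorder by blast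
  qed
  then show ?thesis
    by (intro order_tendstoI) auto
qed

lemma harmonic_sum_eq_comb:
  "(\<Sum>l = 1..N. \<Sum>m = - int l..int l. a l m *s yv Y l m x + b l m *s zv Y l m x)
    = comb (window N) (case_sum (\<lambda>(l, m). a l m) (\<lambda>(l, m). b l m)) x"
proof -
  have "comb (window N) (case_sum (\<lambda>(l, m). a l m) (\<lambda>(l, m). b l m)) x
      = (\<Sum>(l, m)\<in>(SIGMA l:{1..N}. {- int l..int l}). a l m *s yv Y l m x)
      + (\<Sum>(l, m)\<in>(SIGMA l:{1..N}. {- int l..int l}). b l m *s zv Y l m x)"
    unfolding comb_def window_def
    by (subst sum.Plus) (auto simp: frame_def case_prod_unfold)
  also have "\<dots> = (\<Sum>l = 1..N. \<Sum>m = - int l..int l. a l m *s yv Y l m x) + (\<Sum>l = 1..N. \<Sum>m = - int l..int l. b l m *s zv Y l m x)"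
    by (simp add: sum.Sigma)
  finally show ?thesis
    by (simp add: sum.distrib)
qed

end

lemma L2_space_Re_Im:
  fixes f :: "'a \<Rightarrow> complex"
  shows "f \<in> L2_space N \<longleftrightarrow> (\<lambda>x. Re (f x)) \<in> L2_space N \<and> (\<lambda>x. Im (f x)) \<in> L2_space N"
    and "f \<in> L2_space N \<Longrightarrow> (l2norm N f)\<^sup>2 = (l2norm N (\<lambda>x. Re (f x)))\<^sup>2 + (l2norm N (\<lambda>x. Im (f x)))\<^sup>2"
proof -
  show iff: "f \<in> L2_space N \<longleftrightarrow> (\<lambda>x. Re (f x)) \<in> L2_space N \<and> (\<lambda>x. Im (f x)) \<in> L2_space N"
  proof (intro iffI conjI; (elim conjE)?)
    assume f: "f \<in> L2_space N"
    then have [measurable]: "f \<in> borel_measurable N" by auto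
    have "integrable N (\<lambda>x. (norm (g (f x)))\<^sup>2)" if "g = Re \<or> g = Im" for g
    proof (rule Bochner_Integration.integrable_bound[OF L2_space_integrable[OF f]])
      show "(\<lambda>x. (norm (g (f x)))\<^sup>2) \<in> borel_measurable N"
        using that by auto
      have "\<bar>g (f x)\<bar> \<le> norm (f x)" for x
        using that abs_Re_le_cmod abs_Im_le_cmod by auto
      then have "(norm (g (f x)))\<^sup>2 \<le> (norm (f x))\<^sup>2" for x
        by (intro power_mono) auto
      then show "AE x in N. norm ((norm (g (f x)))\<^sup>2) \<le> norm ((norm (f x))\<^sup>2)"
        by simp
    qed
    then show "(\<lambda>x. Re (f x)) \<in> L2_space N" "(\<lambda>x. Im (f x)) \<in> L2_space N"
      by (auto simp: L2_space_def)
  next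
    assume R: "(\<lambda>x. Re (f x)) \<in> L2_space N" "(\<lambda>x. Im (f x)) \<in> L2_space N"
    then have "f \<in> borel_measurable N"
      by (subst borel_measurable_complex_iff) auto
    moreover have "integrable N (\<lambda>x. (norm (f x))\<^sup>2)"
      using Bochner_Integration.integrable_add[OF R[THEN L2_space_integrable]] by (simp add: cmod_power2)
    ultimately show "f \<in> L2_space N"
      by (simp add: L2_space_def)
  qed
  assume "f \<in> L2_space N"
  then have R: "(\<lambda>x. Re (f x)) \<in> L2_space N" "(\<lambda>x. Im (f x)) \<in> L2_space N"
    using iff by auto
  show "(l2norm N f)\<^sup>2 = (l2norm N (\<lambda>x. Re (f x)))\<^sup>2 + (l2norm N (\<lambda>x. Im (f x)))\<^sup>2"
    using R[THEN L2_space_integrable] by (simp add: l2norm_power2 cmod_power2)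
qed

lemma l2norm_Re_Im_le:
  fixes f :: "'a \<Rightarrow> complex"
  assumes "f \<in> L2_space N"
  shows "l2norm N (\<lambda>x. Re (f x)) \<le> l2norm N f" and "l2norm N (\<lambda>x. Im (f x)) \<le> l2norm N f"
  using L2_space_Re_Im(2)[OF assms] by (auto intro!: power2_le_imp_le[OF _ l2norm_nonneg])

lemma l2_continuous_Re_Im:
  fixes u :: "real \<Rightarrow> 'a \<Rightarrow> complex"
  shows "l2_continuous N u \<longleftrightarrow> l2_continuous N (\<lambda>t x. Re (u t x)) \<and> l2_continuous N (\<lambda>t x. Im (u t x))"
proof (intro iffI conjI; (elim conjE)?)
  assume u: "l2_continuous N u"
  have L2: "u t \<in> L2_space N" if "0 \<le> t" for t
    using l2_continuousD(1)[OF u that] .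
  have ev: "\<forall>\<^sub>F s in at t within {0..}. 0 \<le> s" for t :: real
    by (auto simp: eventually_at_filter)
  show "l2_continuous N (\<lambda>t x. Re (u t x))"
  proof (rule l2_continuousI)
    fix t :: real assume t: "0 \<le> t"
    show "(\<lambda>x. Re (u t x)) \<in> L2_space N" using L2[OF t] L2_space_Re_Im(1) by blast
    show "((\<lambda>s. l2norm N (\<lambda>x. Re (u s x) - Re (u t x))) \<longlongrightarrow> 0) (at t within {0..})"
      by (rule Lim_null_comparison[OF _ l2_continuousD(2)[OF u t]], rule eventually_mono[OF ev])
        (use l2norm_Re_Im_le(1)[OF L2_space_diff(1)[OF L2 L2[OF t]]] in simp)
  qed
  show "l2_continuous N (\<lambda>t x. Im (u t x))"
  proof (rule l2_continuousI)
    fix t :: real assume t: "0 \<le> t"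
    show "(\<lambda>x. Im (u t x)) \<in> L2_space N" using L2[OF t] L2_space_Re_Im(1) by blast
    show "((\<lambda>s. l2norm N (\<lambda>x. Im (u s x) - Im (u t x))) \<longlongrightarrow> 0) (at t within {0..})"
      by (rule Lim_null_comparison[OF _ l2_continuousD(2)[OF u t]], rule eventually_mono[OF ev])
        (use l2norm_Re_Im_le(2)[OF L2_space_diff(1)[OF L2 L2[OF t]]] in simp)
  qed
next
  assume R: "l2_continuous N (\<lambda>t x. Re (u t x))" and I: "l2_continuous N (\<lambda>t x. Im (u t x))"
  have L2: "u t \<in> L2_space N" if "0 \<le> t" for t
    using l2_continuousD(1)[OF R that] l2_continuousD(1)[OF I that] L2_space_Re_Im(1) by blast
  have ev: "\<forall>\<^sub>F s in at t within {0..}. 0 \<le> s" for t :: real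
    by (auto simp: eventually_at_filter)
  show "l2_continuous N u"
  proof (rule l2_continuousI[OF L2])
    fix t :: real assume t: "0 \<le> t"
    show "((\<lambda>s. l2norm N (\<lambda>x. u s x - u t x)) \<longlongrightarrow> 0) (at t within {0..})"
    proof (rule Lim_null_comparison)
      show "\<forall>\<^sub>F s in at t within {0..}. norm (l2norm N (\<lambda>x. u s x - u t x))
          \<le> l2norm N (\<lambda>x. Re (u s x) - Re (u t x)) + l2norm N (\<lambda>x. Im (u s x) - Im (u t x))"
      proof (rule eventually_mono[OF ev])
        fix s :: real assume s: "0 \<le> s"
        let ?a = "l2norm N (\<lambda>x. Re (u s x) - Re (u t x))" and ?b = "l2norm N (\<lambda>x. Im (u s x) - Im (u t x))"
        have "(l2norm N (\<lambda>x. u s x - u t x))\<^sup>2 = ?a\<^sup>2 + ?b\<^sup>2"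
          using L2_space_Re_Im(2)[OF L2_space_diff(1)[OF L2[OF s] L2[OF t]]] by simp
        also have "\<dots> \<le> (?a + ?b)\<^sup>2"
          by (simp add: power2_sum)
        finally have "l2norm N (\<lambda>x. u s x - u t x) \<le> ?a + ?b"
          by (rule power2_le_imp_le) simp
        then show "norm (l2norm N (\<lambda>x. u s x - u t x)) \<le> ?a + ?b"
          by (simp only: real_norm_def abs_of_nonneg l2norm_nonneg)
      qed
      show "((\<lambda>s. l2norm N (\<lambda>x. Re (u s x) - Re (u t x)) + l2norm N (\<lambda>x. Im (u s x) - Im (u t x))) \<longlongrightarrow> 0) (at t within {0..})"
        using tendsto_add[OF l2_continuousD(2)[OF R t] l2_continuousD(2)[OF I t]] by simp
    qed
  qed
qed

section \<open>Random tangent fields and their expansions\<close>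

locale random_frame = prob_space M + vector_frame Y
  for M :: "'w measure" and Y :: "nat \<Rightarrow> int \<Rightarrow> real ^ 3 \<Rightarrow> complex"
begin

abbreviation MS :: "('w \<times> (real ^ 3)) measure" where "MS \<equiv> M \<Otimes>\<^sub>M S"

interpretation S: finite_measure S
  by (rule finite_measure_S2)

interpretation MS: pair_sigma_finite M S ..

lemma finite_measure_MS: "finite_measure MS"
  by (intro finite_measure_pair_measure finite_measure_axioms S.finite_measure_axioms)

definition rcomb :: "((nat \<times> int) + (nat \<times> int)) set \<Rightarrow> ((nat \<times> int) + (nat \<times> int) \<Rightarrow> 'w \<Rightarrow> complex) \<Rightarrow> 'w \<times> (real ^ 3) \<Rightarrow> complex ^ 3" where
  "rcomb J c = (\<lambda>(\<omega>, x). comb J (\<lambda>i. c i \<omega>) x)"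

definition rcoeff :: "('w \<times> (real ^ 3) \<Rightarrow> complex ^ 3) \<Rightarrow> (nat \<times> int) + (nat \<times> int) \<Rightarrow> 'w \<Rightarrow> complex" where
  "rcoeff F i \<omega> = coeff (\<lambda>x. F (\<omega>, x)) (frame i)"

lemma sq_norm_sections:
  assumes "F \<in> L2_space MS"
  shows "(\<integral>\<^sup>+\<omega>. (\<integral>\<^sup>+x. ennreal ((norm (F (\<omega>, x)))\<^sup>2) \<partial>S) \<partial>M) = ennreal ((l2norm MS F)\<^sup>2)"
proof -
  have [measurable]: "F \<in> borel_measurable MS" using assms by auto
  show ?thesis
    using nn_integral_norm_power2[OF assms] by (subst S.nn_integral_fst) auto
qed

lemma AE_section_L2:
  assumes "F \<in> L2_space MS"
  shows "AE \<omega> in M. (\<lambda>x. F (\<omega>, x)) \<in> L2_space S"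
proof -
  have [measurable]: "F \<in> borel_measurable MS" using assms by auto
  have "AE \<omega> in M. (\<integral>\<^sup>+x. ennreal ((norm (F (\<omega>, x)))\<^sup>2) \<partial>S) \<noteq> \<infinity>"
    by (rule nn_integral_PInf_AE) (use sq_norm_sections[OF assms] in auto)
  then show ?thesis
    using AE_space by eventually_elim (auto simp: L2_space_iff less_top)
qed

lemma rcomb_measurable:
  assumes "J \<subseteq> indices" "\<And>i. i \<in> J \<Longrightarrow> c i \<in> borel_measurable M"
  shows "rcomb J c \<in> borel_measurable MS"
proof -
  have "(\<lambda>z. \<Sum>i\<in>J. c i (fst z) *s frame i (snd z)) \<in> borel_measurable MS"
  proof (intro borel_measurable_sum scalar_mult_measurable)
    fix i assume i: "i \<in> J"
    show "(\<lambda>z. c i (fst z)) \<in> borel_measurable MS"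
      using assms(2)[OF i] by simp
    have "frame i \<in> borel_measurable S"
      using i assms(1) by (intro L2_space_measurable frame_L2) auto
    then show "(\<lambda>z. frame i (snd z)) \<in> borel_measurable MS"
      by (rule measurable_compose[OF measurable_snd])
  qed
  then show ?thesis
    by (simp add: rcomb_def comb_def case_prod_beta')
qed

text \<open>Parseval for each \<omega>, followed by expectation.\<close>

lemma rcomb_L2:
  assumes J: "finite J" "J \<subseteq> indices" and c: "\<And>i. i \<in> J \<Longrightarrow> c i \<in> L2_space M"
  shows "rcomb J c \<in> L2_space MS" and "(l2norm MS (rcomb J c))\<^sup>2 = (\<Sum>i\<in>J. (l2norm M (c i))\<^sup>2)"
proof -
  have [measurable]: "\<And>i. i \<in> J \<Longrightarrow> c i \<in> borel_measurable M" using c by auto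
  have m [measurable]: "rcomb J c \<in> borel_measurable MS"
    using J by (intro rcomb_measurable) auto
  have "(\<integral>\<^sup>+z. ennreal ((norm (rcomb J c z))\<^sup>2) \<partial>MS)
      = (\<integral>\<^sup>+\<omega>. (\<integral>\<^sup>+x. ennreal ((norm (rcomb J c (\<omega>, x)))\<^sup>2) \<partial>S) \<partial>M)"
    by (subst S.nn_integral_fst[symmetric]) auto
  also have "\<dots> = (\<integral>\<^sup>+\<omega>. (\<Sum>i\<in>J. ennreal ((norm (c i \<omega>))\<^sup>2)) \<partial>M)"
    using J by (simp add: rcomb_def nn_integral_norm_power2 comb_L2 comb_norm)
  also have "\<dots> = (\<Sum>i\<in>J. \<integral>\<^sup>+\<omega>. ennreal ((norm (c i \<omega>))\<^sup>2) \<partial>M)"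
    by (rule nn_integral_sum) measurable
  also have "\<dots> = (\<Sum>i\<in>J. ennreal ((l2norm M (c i))\<^sup>2))"
    using c by (intro sum.cong) (auto simp: nn_integral_norm_power2)
  also have "\<dots> = ennreal (\<Sum>i\<in>J. (l2norm M (c i))\<^sup>2)"
    by (simp add: sum_ennreal)
  finally have eq: "(\<integral>\<^sup>+z. ennreal ((norm (rcomb J c z))\<^sup>2) \<partial>MS) = ennreal (\<Sum>i\<in>J. (l2norm M (c i))\<^sup>2)" .
  then show L2: "rcomb J c \<in> L2_space MS"
    using m by (simp add: L2_space_iff)
  have "ennreal ((l2norm MS (rcomb J c))\<^sup>2) = ennreal (\<Sum>i\<in>J. (l2norm M (c i))\<^sup>2)"
    using eq nn_integral_norm_power2[OF L2] by simp
  then show "(l2norm MS (rcomb J c))\<^sup>2 = (\<Sum>i\<in>J. (l2norm M (c i))\<^sup>2)"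
    by (subst (asm) ennreal_inj) (auto intro: sum_nonneg)
qed

lemma rcoeff_L2:
  assumes F: "F \<in> L2_space MS" and i: "i \<in> indices"
  shows "rcoeff F i \<in> L2_space M" and "l2norm M (rcoeff F i) \<le> l2norm MS F"
proof -
  have [measurable]: "F \<in> borel_measurable MS" using F by auto
  have [measurable]: "frame i \<in> borel_measurable S" using frame_L2[OF i] by auto
  have "(\<lambda>\<omega>. LINT x|S. cdot (F (\<omega>, x)) (frame i x)) \<in> borel_measurable M"
  proof (rule S.borel_measurable_lebesgue_integral)
    have "(\<lambda>z. cdot (F z) (frame i (snd z))) \<in> borel_measurable MS"
      by measurable
    then show "(\<lambda>(\<omega>, x). cdot (F (\<omega>, x)) (frame i x)) \<in> borel_measurable MS"
      by (simp add: case_prod_beta')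
  qed
  then have m: "rcoeff F i \<in> borel_measurable M"
    by (simp add: rcoeff_def[abs_def] coeff_def)
  have fn: "l2norm S (frame i) = 1"
    using frame_orthonormal[OF i i] coeff_self[of "frame i"]
    by (metis l2norm_nonneg of_real_eq_1_iff power2_eq_1_iff not_one_le_zero neg_0_le_iff_le)
  have "AE \<omega> in M. ennreal ((norm (rcoeff F i \<omega>))\<^sup>2) \<le> (\<integral>\<^sup>+x. ennreal ((norm (F (\<omega>, x)))\<^sup>2) \<partial>S)"
    using AE_section_L2[OF F]
  proof eventually_elim
    case (elim \<omega>)
    have "norm (rcoeff F i \<omega>) \<le> l2norm S (\<lambda>x. F (\<omega>, x))"
      using coeff_integrable(2)[OF elim frame_L2[OF i]] by (simp add: rcoeff_def fn)
    then show ?case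
      using elim by (simp add: nn_integral_norm_power2 ennreal_leI power_mono)
  qed
  then have le: "(\<integral>\<^sup>+\<omega>. ennreal ((norm (rcoeff F i \<omega>))\<^sup>2) \<partial>M) \<le> ennreal ((l2norm MS F)\<^sup>2)"
    unfolding sq_norm_sections[OF F, symmetric] by (rule nn_integral_mono_AE)
  then show L2: "rcoeff F i \<in> L2_space M"
    using m by (auto simp: L2_space_iff intro: le_less_trans)
  show "l2norm M (rcoeff F i) \<le> l2norm MS F"
    using le by (subst l2norm_le_iff_nn_integral[OF L2]) auto
qed

lemma AE_rcoeff_diff:
  assumes "F \<in> L2_space MS" "G \<in> L2_space MS" "i \<in> indices"
  shows "AE \<omega> in M. rcoeff (\<lambda>z. F z - G z) i \<omega> = rcoeff F i \<omega> - rcoeff G i \<omega>"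
  using AE_section_L2[OF assms(1)] AE_section_L2[OF assms(2)]
  by eventually_elim (simp add: rcoeff_def coeff_diff frame_L2 assms(3))

lemma rcoeff_diff_norm:
  assumes "F \<in> L2_space MS" "G \<in> L2_space MS" "i \<in> indices"
  shows "l2norm M (\<lambda>\<omega>. rcoeff F i \<omega> - rcoeff G i \<omega>) \<le> l2norm MS (\<lambda>z. F z - G z)"
proof -
  have "l2norm M (\<lambda>\<omega>. rcoeff F i \<omega> - rcoeff G i \<omega>) = l2norm M (rcoeff (\<lambda>z. F z - G z) i)"
    using assms AE_rcoeff_diff[OF assms]
    by (intro L2_space_AE_cong(2) rcoeff_L2 L2_space_diff borel_measurable_diff L2_space_measurable) auto
  also have "\<dots> \<le> l2norm MS (\<lambda>z. F z - G z)"
    using assms by (intro rcoeff_L2 L2_space_diff)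
  finally show ?thesis .
qed

lemma rcoeff_rcomb:
  assumes "finite J" "J \<subseteq> indices" "i \<in> J"
  shows "rcoeff (rcomb J c) i \<omega> = c i \<omega>"
  using coeff_comb[OF assms, of "\<lambda>i. c i \<omega>"] by (simp add: rcoeff_def rcomb_def)

text \<open>Taking a coefficient is a contraction, and once the window contains \<open>i\<close> the
  coefficient of the partial sum is \<open>c i\<close>.\<close>

lemma AE_rcoeff_eqI:
  assumes F: "F \<in> L2_space MS" and c: "\<And>i. i \<in> indices \<Longrightarrow> c i \<in> L2_space M" and i: "i \<in> indices"
    and lim: "(\<lambda>N. l2norm MS (\<lambda>z. F z - rcomb (window N) c z)) \<longlonglongrightarrow> 0"
  shows "AE \<omega> in M. rcoeff F i \<omega> = c i \<omega>"
proof -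
  obtain N0 where N0: "\<And>N. N0 \<le> N \<Longrightarrow> {i} \<subseteq> window N"
    using window_exhausts[of "{i}"] i by auto
  have L2: "rcomb (window N) c \<in> L2_space MS" for N
    using window_subset by (intro rcomb_L2 finite_window c) auto
  have "l2norm M (\<lambda>\<omega>. rcoeff F i \<omega> - c i \<omega>) \<le> 0"
  proof (rule tendsto_lowerbound[OF lim])
    have "l2norm M (\<lambda>\<omega>. rcoeff F i \<omega> - c i \<omega>) \<le> l2norm MS (\<lambda>z. F z - rcomb (window N) c z)" if "N0 \<le> N" for N
      using rcoeff_diff_norm[OF F L2[of N] i] rcoeff_rcomb[OF finite_window[of N] window_subset[of N], of i c] N0[OF that] by simp
    then show "\<forall>\<^sub>F N in sequentially. l2norm M (\<lambda>\<omega>. rcoeff F i \<omega> - c i \<omega>) \<le> l2norm MS (\<lambda>z. F z - rcomb (window N) c z)"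
      unfolding eventually_at_top_linorder by blast
  qed simp
  then have "l2norm M (\<lambda>\<omega>. rcoeff F i \<omega> - c i \<omega>) = 0"
    by (simp add: antisym)
  then show ?thesis
    using l2norm_eq_0_iff_AE[OF L2_space_diff(1)[OF rcoeff_L2(1)[OF F i] c[OF i]]] by simp
qed

text \<open>Almost every section is a square-integrable tangent field, so its Fourier sums converge.
  The squared errors are dominated by the squared norm of the section, by comparison with the zero
  combination, and dominated convergence in \<omega> concludes.\<close>

lemma rcomb_rcoeff_converges:
  assumes F: "F \<in> L2_random_tangent M"
  shows "(\<lambda>N. sq_dist MS F (rcomb (window N) (rcoeff F))) \<longlonglongrightarrow> 0"
proof -
  have FL: "F \<in> L2_space MS" and tan: "AE p in MS. cdot (F p) (cvec (snd p)) = 0"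
    using F by (auto simp: L2_random_tangent_def)
  have [measurable]: "F \<in> borel_measurable MS" using FL by auto
  have rm [measurable]: "rcomb (window N) (rcoeff F) \<in> borel_measurable MS" for N
    using rcoeff_L2(1)[OF FL] window_subset by (intro rcomb_measurable L2_space_measurable) blast+
  have tan': "AE \<omega> in M. (\<lambda>x. F (\<omega>, x)) \<in> L2_tangent"
    using MS.AE_pair[OF tan] AE_section_L2[OF FL] by eventually_elim (simp add: L2_tangent_def)
  let ?d = "\<lambda>N \<omega>. \<integral>\<^sup>+x. ennreal ((norm (F (\<omega>, x) - rcomb (window N) (rcoeff F) (\<omega>, x)))\<^sup>2) \<partial>S"
  have d_eq: "?d N \<omega> = sq_dist S (\<lambda>x. F (\<omega>, x)) (comb (window N) (\<lambda>i. coeff (\<lambda>x. F (\<omega>, x)) (frame i)))" for N \<omega>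
    by (simp add: sq_dist_def rcomb_def rcoeff_def)
  have "(\<lambda>N. \<integral>\<^sup>+\<omega>. ?d N \<omega> \<partial>M) \<longlonglongrightarrow> (\<integral>\<^sup>+\<omega>. 0 \<partial>M)"
  proof (rule nn_integral_dominated_convergence)
    show "(\<lambda>\<omega>. \<integral>\<^sup>+x. ennreal ((norm (F (\<omega>, x)))\<^sup>2) \<partial>S) \<in> borel_measurable M"
      by measurable
    show "?d N \<in> borel_measurable M" for N
      by measurable
    show "AE \<omega> in M. ?d N \<omega> \<le> (\<integral>\<^sup>+x. ennreal ((norm (F (\<omega>, x)))\<^sup>2) \<partial>S)" for N
      using AE_section_L2[OF FL]
    proof eventually_elim
      case (elim \<omega>)
      let ?f = "\<lambda>x. F (\<omega>, x)"
      have "comb (window N) (\<lambda>_. 0) = (\<lambda>_. 0)"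
        by (simp add: comb_def fun_eq_iff)
      then have "(l2norm S (\<lambda>x. ?f x - comb (window N) (\<lambda>i. coeff ?f (frame i)) x))\<^sup>2 \<le> (l2norm S ?f)\<^sup>2"
        using comb_best_approximation[OF elim finite_window[of N] window_subset[of N], of "\<lambda>_. 0"] by (simp add: sum_nonneg)
      then show ?case
        unfolding d_eq using elim window_subset[of N]
        by (simp add: sq_dist_eq_l2norm comb_L2 nn_integral_norm_power2 ennreal_leI)
    qed
    show "(\<integral>\<^sup>+\<omega>. (\<integral>\<^sup>+x. ennreal ((norm (F (\<omega>, x)))\<^sup>2) \<partial>S) \<partial>M) < \<infinity>"
      by (simp add: sq_norm_sections[OF FL])
    show "AE \<omega> in M. (\<lambda>N. ?d N \<omega>) \<longlonglongrightarrow> 0"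
      using tan' unfolding d_eq by eventually_elim (rule comb_window_converges)
  qed simp
  moreover have "sq_dist MS F (rcomb (window N) (rcoeff F)) = (\<integral>\<^sup>+\<omega>. ?d N \<omega> \<partial>M)" for N
    unfolding sq_dist_def by (subst S.nn_integral_fst[symmetric]) auto
  ultimately show ?thesis
    by simp
qed

text \<open>The partial sums are tangent and the normal vector x has length 1, so the normal
  component of \<open>F\<close> is almost everywhere at most the distance from \<open>F\<close> to
  the partial sum.\<close>

lemma L2_random_tangent_closed:
  assumes F: "F \<in> L2_space MS" and c: "\<And>i. i \<in> indices \<Longrightarrow> c i \<in> L2_space M"
    and lim: "(\<lambda>N. l2norm MS (\<lambda>z. F z - rcomb (window N) c z)) \<longlonglongrightarrow> 0"
  shows "F \<in> L2_random_tangent M"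
proof -
  have [measurable]: "F \<in> borel_measurable MS" using F by auto
  have sm [measurable]: "snd \<in> borel_measurable MS"
    by (rule borel_measurable_S2) simp
  have L2: "rcomb (window N) c \<in> L2_space MS" for N
    using window_subset by (intro rcomb_L2 finite_window c) auto
  have tan: "AE z in MS. cdot (rcomb (window N) c z) (cvec (snd z)) = 0" for N
  proof -
    have "AE z in MS. cdot (frame i (snd z)) (cvec (snd z)) = 0" if "i \<in> window N" for i
    proof -
      have i: "i \<in> indices" using that window_subset by auto
      have [measurable]: "frame i \<in> borel_measurable S" using frame_L2[OF i] by auto
      have "AE x in S. cdot (frame i x) (cvec x) = 0"
        using frame_L2_tangent[OF i] by (simp add: L2_tangent_def)
      then have "AE \<omega> in M. AE x in S. cdot (frame i (snd (\<omega>, x))) (cvec (snd (\<omega>, x))) = 0"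
        by simp
      then show ?thesis
        by (intro MS.AE_pair_measure) measurable
    qed
    then have "AE z in MS. \<forall>i\<in>window N. cdot (frame i (snd z)) (cvec (snd z)) = 0"
      using finite_window by (simp add: AE_finite_all)
    then show ?thesis
      by eventually_elim (auto simp: rcomb_def comb_def case_prod_beta' cdot_sum_left cdot_scale_left)
  qed
  have "(\<integral>\<^sup>+z. ennreal ((norm (cdot (F z) (cvec (snd z))))\<^sup>2) \<partial>MS) \<le> 0"
  proof (rule tendsto_lowerbound)
    show "(\<lambda>N. sq_dist MS F (rcomb (window N) c)) \<longlonglongrightarrow> 0"
      using tendsto_sq_dist_iff[of "\<lambda>_. F" MS sequentially "\<lambda>N. rcomb (window N) c"] F L2 lim by simp
    show "\<forall>\<^sub>F N in sequentially. (\<integral>\<^sup>+z. ennreal ((norm (cdot (F z) (cvec (snd z))))\<^sup>2) \<partial>MS) \<le> sq_dist MS F (rcomb (window N) c)"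
    proof (rule always_eventually, rule allI)
      fix N
      have "AE z in MS. ennreal ((norm (cdot (F z) (cvec (snd z))))\<^sup>2) \<le> ennreal ((norm (F z - rcomb (window N) c z))\<^sup>2)"
        using tan[of N] AE_space[of MS]
      proof eventually_elim
        case (elim z)
        have "norm (cdot (F z) (cvec (snd z))) = norm (cdot (F z - rcomb (window N) c z) (cvec (snd z)))"
          using elim by (simp add: cdot_diff_left)
        also have "\<dots> \<le> norm (F z - rcomb (window N) c z) * norm (cvec (snd z))"
          by (rule norm_cdot_le)
        also have "norm (cvec (snd z)) = 1"
          using elim by (auto simp: norm_cvec space_pair_measure space_S2)
        finally show ?case
          by (simp add: ennreal_leI power_mono)
      qed
      then show "(\<integral>\<^sup>+z. ennreal ((norm (cdot (F z) (cvec (snd z))))\<^sup>2) \<partial>MS) \<le> sq_dist MS F (rcomb (window N) c)"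
        unfolding sq_dist_def by (rule nn_integral_mono_AE)
    qed
  qed simp
  then have "AE z in MS. ennreal ((norm (cdot (F z) (cvec (snd z))))\<^sup>2) = 0"
    by (subst nn_integral_0_iff_AE[symmetric]) auto
  then have "AE z in MS. cdot (F z) (cvec (snd z)) = 0"
    by eventually_elim simp
  then show ?thesis
    using F by (simp add: L2_random_tangent_def)
qed

lemma rcomb_diff: "rcomb J c z - rcomb J d z = rcomb J (\<lambda>i \<omega>. c i \<omega> - d i \<omega>) z"
  by (cases z) (simp add: rcomb_def comb_diff)

lemma rcomb_subset_diff:
  assumes "finite J" "I \<subseteq> J"
  shows "rcomb J c z - rcomb I c z = rcomb (J - I) c z"
  using assms by (cases z) (simp add: rcomb_def comb_def sum_diff)

text \<open>Cauchy's criterion along the windows, the form in which tails of expansions are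
  estimated.\<close>

definition summable_weight :: "((nat \<times> int) + (nat \<times> int) \<Rightarrow> real) \<Rightarrow> bool" where
  "summable_weight W \<longleftrightarrow> (\<forall>i\<in>indices. 0 \<le> W i) \<and> (\<forall>\<epsilon>>0. \<exists>N. \<forall>n\<ge>N. (\<Sum>i\<in>window n - window N. W i) < \<epsilon>)"

lemma rcomb_tail:
  assumes W: "\<And>i. i \<in> indices \<Longrightarrow> 0 \<le> W i" and K: "0 \<le> K"
    and c: "\<And>i. i \<in> indices \<Longrightarrow> c i \<in> L2_space M" "\<And>i. i \<in> indices \<Longrightarrow> (l2norm M (c i))\<^sup>2 \<le> K * W i"
    and N: "\<And>n. N \<le> n \<Longrightarrow> (\<Sum>i\<in>window n - window N. W i) < \<epsilon>" and "N \<le> n"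
  shows "l2norm MS (\<lambda>z. rcomb (window n) c z - rcomb (window N) c z) \<le> sqrt (K * \<epsilon>)"
proof -
  have J: "finite (window n - window N)" "window n - window N \<subseteq> indices"
    using finite_window window_subset by auto
  have "(l2norm MS (rcomb (window n - window N) c))\<^sup>2 = (\<Sum>i\<in>window n - window N. (l2norm M (c i))\<^sup>2)"
    using J c by (intro rcomb_L2) auto
  also have "\<dots> \<le> (\<Sum>i\<in>window n - window N. K * W i)"
    using J c by (intro sum_mono) auto
  also have "\<dots> \<le> K * \<epsilon>"
    using N[OF \<open>N \<le> n\<close>] K by (simp add: sum_distrib_left[symmetric] mult_left_mono)
  finally have "l2norm MS (rcomb (window n - window N) c) \<le> sqrt (K * \<epsilon>)"
    using real_le_rsqrt by blast
  then show ?thesis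
    by (simp add: rcomb_subset_diff[OF finite_window window_mono[OF \<open>N \<le> n\<close>]])
qed

lemma rcomb_limit_tail:
  assumes F: "F \<in> L2_space MS" and lim: "(\<lambda>N. l2norm MS (\<lambda>z. F z - rcomb (window N) c z)) \<longlonglongrightarrow> 0"
    and W: "\<And>i. i \<in> indices \<Longrightarrow> 0 \<le> W i" and K: "0 \<le> K"
    and c: "\<And>i. i \<in> indices \<Longrightarrow> c i \<in> L2_space M" "\<And>i. i \<in> indices \<Longrightarrow> (l2norm M (c i))\<^sup>2 \<le> K * W i"
    and N: "\<And>n. N \<le> n \<Longrightarrow> (\<Sum>i\<in>window n - window N. W i) < \<epsilon>"
  shows "l2norm MS (\<lambda>z. F z - rcomb (window N) c z) \<le> sqrt (K * \<epsilon>)"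
proof -
  have L2: "rcomb (window N) c \<in> L2_space MS" for N
    using window_subset by (intro rcomb_L2 finite_window c) auto
  have "l2norm MS (\<lambda>z. F z - rcomb (window N) c z) \<le> 0 + sqrt (K * \<epsilon>)"
  proof (rule tendsto_lowerbound)
    show "(\<lambda>n. l2norm MS (\<lambda>z. F z - rcomb (window n) c z) + sqrt (K * \<epsilon>)) \<longlonglongrightarrow> 0 + sqrt (K * \<epsilon>)"
      by (intro tendsto_intros lim)
    have "l2norm MS (\<lambda>z. F z - rcomb (window N) c z) \<le> l2norm MS (\<lambda>z. F z - rcomb (window n) c z) + sqrt (K * \<epsilon>)" if "N \<le> n" for n
      using l2norm_triangle_diff[OF F L2[of n] L2[of N]] rcomb_tail[OF W K c N that] by simp
    then show "\<forall>\<^sub>F n in sequentially. l2norm MS (\<lambda>z. F z - rcomb (window N) c z) \<le> l2norm MS (\<lambda>z. F z - rcomb (window n) c z) + sqrt (K * \<epsilon>)"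
      unfolding eventually_at_top_linorder by blast
  qed simp
  then show ?thesis by simp
qed

lemma rcomb_limit_exists:
  assumes W: "summable_weight W" and K: "0 \<le> K"
    and c: "\<And>i. i \<in> indices \<Longrightarrow> c i \<in> L2_space M" "\<And>i. i \<in> indices \<Longrightarrow> (l2norm M (c i))\<^sup>2 \<le> K * W i"
  obtains F where "F \<in> L2_random_tangent M" "(\<lambda>N. l2norm MS (\<lambda>z. F z - rcomb (window N) c z)) \<longlonglongrightarrow> 0"
proof -
  have W0: "\<And>i. i \<in> indices \<Longrightarrow> 0 \<le> W i"
    using W by (simp add: summable_weight_def)
  have L2: "rcomb (window N) c \<in> L2_space MS" for N
    using window_subset by (intro rcomb_L2 finite_window c) auto
  interpret MSf: finite_measure MS by (rule finite_measure_MS)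
  obtain F where F: "F \<in> L2_space MS" "(\<lambda>n. l2norm MS (\<lambda>z. rcomb (window n) c z - F z)) \<longlonglongrightarrow> 0"
  proof (rule MSf.L2_space_complete[of "\<lambda>n. rcomb (window n) c", OF L2])
    fix \<epsilon> :: real assume e: "0 < \<epsilon>"
    \<comment> \<open>Yields sqrt (K \<eta>) < \<epsilon>/2. Dividing by K + 1 rather than K permits
      K = 0.\<close>
    define \<eta> where "\<eta> = (\<epsilon> / 2)\<^sup>2 / (K + 1) / 2"
    have \<eta>: "0 < \<eta>" using e K by (simp add: \<eta>_def)
    obtain N where N: "\<And>n. N \<le> n \<Longrightarrow> (\<Sum>i\<in>window n - window N. W i) < \<eta>"
      using W \<eta> unfolding summable_weight_def by blast
    have "K * \<eta> < (K + 1) * (2 * \<eta>)"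
      using \<eta> mult_nonneg_nonneg[OF K less_imp_le[OF \<eta>]] by (simp add: algebra_simps)
    also have "\<dots> = (\<epsilon> / 2)\<^sup>2"
      using K by (simp add: \<eta>_def field_simps)
    finally have "sqrt (K * \<eta>) < \<epsilon> / 2"
      using e by (intro real_less_lsqrt) auto
    then have near: "l2norm MS (\<lambda>z. rcomb (window n) c z - rcomb (window N) c z) < \<epsilon> / 2" if "N \<le> n" for n
      using rcomb_tail[OF W0 K c N that] by simp
    have "l2norm MS (\<lambda>z. rcomb (window m) c z - rcomb (window n) c z) < \<epsilon>" if "N \<le> m" "N \<le> n" for m n
      using l2norm_triangle_diff[OF L2[of m] L2[of N] L2[of n]] near[OF that(1)] near[OF that(2)]
        l2norm_minus_commute[of MS "rcomb (window n) c" "rcomb (window N) c"] by simp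
    then show "\<exists>N. \<forall>m\<ge>N. \<forall>n\<ge>N. l2norm MS (\<lambda>z. rcomb (window m) c z - rcomb (window n) c z) < \<epsilon>"
      by blast
  qed
  have lim: "(\<lambda>N. l2norm MS (\<lambda>z. F z - rcomb (window N) c z)) \<longlonglongrightarrow> 0"
    using F(2) by (simp add: l2norm_minus_commute[of MS F])
  show thesis
    by (rule that[OF L2_random_tangent_closed[OF F(1) c(1) lim] lim])
qed

text \<open>The weights bound the tails uniformly for times in [0, t + 1], so that continuity at
  \<open>t\<close> reduces to that of the finitely many modes in one window.\<close>

lemma expansion_l2_continuous:
  assumes F: "\<And>t. 0 \<le> t \<Longrightarrow> F t \<in> L2_space MS"
    and lim: "\<And>t. 0 \<le> t \<Longrightarrow> (\<lambda>N. l2norm MS (\<lambda>z. F t z - rcomb (window N) (\<lambda>i. c i t) z)) \<longlonglongrightarrow> 0"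
    and c: "\<And>i. i \<in> indices \<Longrightarrow> l2_continuous M (c i)" and W: "summable_weight W"
    and K: "\<And>T. \<exists>K\<ge>0. \<forall>t\<in>{0..T}. \<forall>i\<in>indices. (l2norm M (c i t))\<^sup>2 \<le> K * W i"
  shows "l2_continuous MS F"
proof (rule l2_continuousI[OF F])
  fix t :: real assume t: "0 \<le> t"
  have W0: "\<And>i. i \<in> indices \<Longrightarrow> 0 \<le> W i"
    using W by (simp add: summable_weight_def)
  have cL: "c i s \<in> L2_space M" if "i \<in> indices" "0 \<le> s" for i s
    using l2_continuousD(1)[OF c[OF that(1)] that(2)] .
  have L2: "rcomb (window N) (\<lambda>i. c i s) \<in> L2_space MS" if "0 \<le> s" for N s
    using window_subset that by (intro rcomb_L2 finite_window cL) auto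
  obtain K where K0: "0 \<le> K" and Kb: "\<And>s i. s \<in> {0..t+1} \<Longrightarrow> i \<in> indices \<Longrightarrow> (l2norm M (c i s))\<^sup>2 \<le> K * W i"
    using K[of "t + 1"] by blast
  show "((\<lambda>s. l2norm MS (\<lambda>x. F s x - F t x)) \<longlongrightarrow> 0) (at t within {0..})"
    unfolding tendsto_iff
  proof (intro allI impI)
    fix \<epsilon> :: real assume e: "0 < \<epsilon>"
    define \<eta> where "\<eta> = (\<epsilon> / 3)\<^sup>2 / (K + 1) / 2"
    have \<eta>: "0 < \<eta>" using e K0 by (simp add: \<eta>_def)
    obtain N where N: "\<And>n. N \<le> n \<Longrightarrow> (\<Sum>i\<in>window n - window N. W i) < \<eta>"
      using W \<eta> unfolding summable_weight_def by blast
    have "K * \<eta> < (K + 1) * (2 * \<eta>)"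
      using \<eta> mult_nonneg_nonneg[OF K0 less_imp_le[OF \<eta>]] by (simp add: algebra_simps)
    also have "\<dots> = (\<epsilon> / 3)\<^sup>2"
      using K0 by (simp add: \<eta>_def field_simps)
    finally have small: "sqrt (K * \<eta>) < \<epsilon> / 3"
      using e by (intro real_less_lsqrt) auto
    have tail: "l2norm MS (\<lambda>z. F s z - rcomb (window N) (\<lambda>i. c i s) z) < \<epsilon> / 3" if "s \<in> {0..t+1}" for s
    proof -
      have "l2norm MS (\<lambda>z. F s z - rcomb (window N) (\<lambda>i. c i s) z) \<le> sqrt (K * \<eta>)"
        by (rule rcomb_limit_tail[OF F lim W0 K0 cL Kb N]) (use that in auto)
      then show ?thesis using small by simp
    qed
    have "((\<lambda>s. \<Sum>i\<in>window N. (l2norm M (\<lambda>\<omega>. c i s \<omega> - c i t \<omega>))\<^sup>2) \<longlongrightarrow> (\<Sum>i\<in>window N. 0\<^sup>2)) (at t within {0..})"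
      using window_subset t by (intro tendsto_sum tendsto_power l2_continuousD c) auto
    then have "((\<lambda>s. \<Sum>i\<in>window N. (l2norm M (\<lambda>\<omega>. c i s \<omega> - c i t \<omega>))\<^sup>2) \<longlongrightarrow> 0) (at t within {0..})"
      by simp
    then have ev1: "\<forall>\<^sub>F s in at t within {0..}. (\<Sum>i\<in>window N. (l2norm M (\<lambda>\<omega>. c i s \<omega> - c i t \<omega>))\<^sup>2) < (\<epsilon> / 3)\<^sup>2"
      using e by (intro order_tendstoD) auto
    have ev2: "\<forall>\<^sub>F s in at t within {0..}. s \<in> {0..t+1}"
      unfolding eventually_at by (intro exI[of _ 1]) (auto simp: dist_real_def)
    show "\<forall>\<^sub>F s in at t within {0..}. dist (l2norm MS (\<lambda>x. F s x - F t x)) 0 < \<epsilon>"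
      using ev1 ev2
    proof eventually_elim
      case (elim s)
      let ?S = "\<lambda>s. rcomb (window N) (\<lambda>i. c i s)"
      have s: "0 \<le> s" using elim by simp
      have "(l2norm MS (\<lambda>z. ?S s z - ?S t z))\<^sup>2 = (\<Sum>i\<in>window N. (l2norm M (\<lambda>\<omega>. c i s \<omega> - c i t \<omega>))\<^sup>2)"
        unfolding rcomb_diff using window_subset s t by (intro rcomb_L2 finite_window L2_space_diff cL) auto
      then have mid: "l2norm MS (\<lambda>z. ?S s z - ?S t z) < \<epsilon> / 3"
        using elim e by (intro power2_less_imp_less[of _ "\<epsilon> / 3"]) auto
      have "l2norm MS (\<lambda>z. F s z - F t z) \<le> l2norm MS (\<lambda>z. F s z - ?S s z) + l2norm MS (\<lambda>z. ?S s z - F t z)"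
        by (intro l2norm_triangle_diff F L2 s t)
      moreover have "l2norm MS (\<lambda>z. ?S s z - F t z) \<le> l2norm MS (\<lambda>z. ?S s z - ?S t z) + l2norm MS (\<lambda>z. ?S t z - F t z)"
        by (intro l2norm_triangle_diff F L2 s t)
      moreover have "l2norm MS (\<lambda>z. ?S t z - F t z) = l2norm MS (\<lambda>z. F t z - ?S t z)"
        by (rule l2norm_minus_commute)
      ultimately show ?case
        using mid tail[of s] tail[of t] elim t by (simp add: dist_real_def)
    qed
  qed
qed

lemma has_L2_expansion_iff:
  "has_L2_expansion M Y a b F \<longleftrightarrow> case_prod F \<in> L2_random_tangent M \<and>
    (\<lambda>N. sq_dist MS (case_prod F) (rcomb (window N) (case_sum (\<lambda>(l, m). a l m) (\<lambda>(l, m). b l m)))) \<longlonglongrightarrow> 0"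
proof -
  have "(\<lambda>(\<omega>, x). \<Sum>l = 1..N. \<Sum>m = - int l..int l. a l m \<omega> *s yv Y l m x + b l m \<omega> *s zv Y l m x)
      = rcomb (window N) (case_sum (\<lambda>(l, m). a l m) (\<lambda>(l, m). b l m))" for N
    unfolding rcomb_def
  proof (intro ext, clarify)
    fix \<omega> x
    have "case_sum (\<lambda>(l, m). a l m \<omega>) (\<lambda>(l, m). b l m \<omega>) = (\<lambda>i. case_sum (\<lambda>(l, m). a l m) (\<lambda>(l, m). b l m) i \<omega>)"
      by (auto simp: fun_eq_iff split: sum.split)
    then show "(\<Sum>l = 1..N. \<Sum>m = - int l..int l. a l m \<omega> *s yv Y l m x + b l m \<omega> *s zv Y l m x)
        = comb (window N) (\<lambda>i. case_sum (\<lambda>(l, m). a l m) (\<lambda>(l, m). b l m) i \<omega>) x"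
      using harmonic_sum_eq_comb[of "\<lambda>l m. a l m \<omega>" x "\<lambda>l m. b l m \<omega>" N] by simp
  qed
  then show ?thesis
    unfolding has_L2_expansion_def by simp
qed

end

section \<open>The equation on the sphere\<close>

lemma ball_Plus: "(\<forall>i\<in>A <+> B. P i) \<longleftrightarrow> (\<forall>x\<in>A. P (Inl x)) \<and> (\<forall>x\<in>B. P (Inr x))"
  by auto

lemma integrable_Re_Im_iff:
  "integrable N f \<longleftrightarrow> integrable N (\<lambda>x. Re (f x)) \<and> integrable N (\<lambda>x. Im (f x))"
proof (intro iffI conjI; (elim conjE)?)
  assume "integrable N (\<lambda>x. Re (f x))" "integrable N (\<lambda>x. Im (f x))"
  then have "integrable N (\<lambda>x. complex_of_real (Re (f x)) + \<i> * complex_of_real (Im (f x)))"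
    by (intro Bochner_Integration.integrable_add integrable_mult_right integrable_of_real)
  then show "integrable N f"
    by (simp add: complex_eq[symmetric])
qed auto

lemma history_zero_iff:
  fixes f :: "real \<Rightarrow> complex"
  assumes [measurable]: "f \<in> borel_measurable borel"
  shows "integrable (history 0 t) f \<longleftrightarrow> set_integrable lborel {0..t} f"
    and "(\<integral>s. f s \<partial>history 0 t) = set_lebesgue_integral lborel {0..t} f"
proof -
  have "AE s in lborel. s \<noteq> 0" "AE s in lborel. s \<noteq> t"
    by (rule AE_lborel_singleton)+
  then have ae: "AE s in lborel. (indicator {0<..<t} s * frac_kernel (1 - 0) (t - s)) *\<^sub>R f s = indicator {0..t} s *\<^sub>R f s"
    by eventually_elim (auto simp: indicator_def frac_kernel_1)
  show "integrable (history 0 t) f \<longleftrightarrow> set_integrable lborel {0..t} f"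
    unfolding integral_history_eq(1)[OF order_refl zero_less_one assms] set_integrable_def
    by (rule integrable_cong_AE[OF _ _ ae]) measurable
  show "(\<integral>s. f s \<partial>history 0 t) = set_lebesgue_integral lborel {0..t} f"
    unfolding integral_history_eq(2)[OF order_refl zero_less_one assms] set_lebesgue_integral_def
    by (rule integral_cong_AE[OF _ _ ae]) measurable
qed

lemma history_frac_iff:
  fixes f :: "real \<Rightarrow> complex"
  assumes [measurable]: "f \<in> borel_measurable borel" and \<beta>: "0 < \<beta>" "\<beta> < 1"
  shows "integrable (history \<beta> t) f \<longleftrightarrow> set_integrable lborel {0..t} (\<lambda>s. (t - s) powr (- \<beta>) *\<^sub>R f s)"
    and "(\<integral>s. f s \<partial>history \<beta> t) = (1 / Gamma (1 - \<beta>)) *\<^sub>R set_lebesgue_integral lborel {0..t} (\<lambda>s. (t - s) powr (- \<beta>) *\<^sub>R f s)"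
proof -
  have G: "Gamma (1 - \<beta>) > 0" using \<beta> by (intro Gamma_real_pos) simp
  have "AE s in lborel. s \<noteq> 0" "AE s in lborel. s \<noteq> t"
    by (rule AE_lborel_singleton)+
  then have ae: "AE s in lborel. (indicator {0<..<t} s * frac_kernel (1 - \<beta>) (t - s)) *\<^sub>R f s
      = (1 / Gamma (1 - \<beta>)) *\<^sub>R (indicator {0..t} s *\<^sub>R ((t - s) powr (- \<beta>) *\<^sub>R f s))"
    by eventually_elim (auto simp: indicator_def frac_kernel_def)
  have "integrable (history \<beta> t) f \<longleftrightarrow> integrable lborel (\<lambda>s. (1 / Gamma (1 - \<beta>)) *\<^sub>R (indicator {0..t} s *\<^sub>R ((t - s) powr (- \<beta>) *\<^sub>R f s)))"
    unfolding integral_history_eq(1)[OF less_imp_le[OF \<beta>(1)] \<beta>(2) assms(1)]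
    by (rule integrable_cong_AE[OF _ _ ae]) measurable
  also have "\<dots> \<longleftrightarrow> set_integrable lborel {0..t} (\<lambda>s. (t - s) powr (- \<beta>) *\<^sub>R f s)"
  proof
    assume "integrable lborel (\<lambda>s. (1 / Gamma (1 - \<beta>)) *\<^sub>R (indicator {0..t} s *\<^sub>R ((t - s) powr (- \<beta>) *\<^sub>R f s)))"
    from integrable_scaleR_right[OF this, of "Gamma (1 - \<beta>)"] show "set_integrable lborel {0..t} (\<lambda>s. (t - s) powr (- \<beta>) *\<^sub>R f s)"
      using G by (simp add: set_integrable_def)
  next
    assume "set_integrable lborel {0..t} (\<lambda>s. (t - s) powr (- \<beta>) *\<^sub>R f s)"
    then have "integrable lborel (\<lambda>s. indicator {0..t} s *\<^sub>R ((t - s) powr (- \<beta>) *\<^sub>R f s))"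
      by (simp only: set_integrable_def)
    from integrable_scaleR_right[OF this, of "1 / Gamma (1 - \<beta>)"]
    show "integrable lborel (\<lambda>s. (1 / Gamma (1 - \<beta>)) *\<^sub>R (indicator {0..t} s *\<^sub>R ((t - s) powr (- \<beta>) *\<^sub>R f s)))" .
  qed
  finally show "integrable (history \<beta> t) f \<longleftrightarrow> set_integrable lborel {0..t} (\<lambda>s. (t - s) powr (- \<beta>) *\<^sub>R f s)" .
  have "(\<integral>s. f s \<partial>history \<beta> t) = (\<integral>s. (1 / Gamma (1 - \<beta>)) *\<^sub>R (indicator {0..t} s *\<^sub>R ((t - s) powr (- \<beta>) *\<^sub>R f s)) \<partial>lborel)"
    unfolding integral_history_eq(2)[OF less_imp_le[OF \<beta>(1)] \<beta>(2) assms(1)]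
    by (rule integral_cong_AE[OF _ _ ae]) measurable
  then show "(\<integral>s. f s \<partial>history \<beta> t) = (1 / Gamma (1 - \<beta>)) *\<^sub>R set_lebesgue_integral lborel {0..t} (\<lambda>s. (t - s) powr (- \<beta>) *\<^sub>R f s)"
    by (simp only: integral_scaleR_right set_lebesgue_integral_def)
qed

text \<open>The vanishing initial value removes the subtraction of \<open>f 0\<close>. For \<beta> =
  1 the history measure is a point mass, which integrates every measurable function, in accordance
  with the absence of an integrability condition in that case. What remains is the separation into
  real and imaginary parts.\<close>

lemma integrated_equation_iff:
  fixes f :: "real \<Rightarrow> complex"
  assumes fm: "f \<in> borel_measurable borel" and \<beta>: "0 < \<beta>" "\<beta> \<le> 1" and f0: "f 0 = 0"
  shows "(set_integrable lborel {0..t} f \<and> (\<beta> < 1 \<longrightarrow> set_integrable lborel {0..t} (\<lambda>s. (t - s) powr (- \<beta>) *\<^sub>R (f s - f 0))) \<and>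
      integrated_caputo \<beta> f t = - (\<mu> *\<^sub>R set_lebesgue_integral lborel {0..t} f) + b) \<longleftrightarrow>
    (integrable (history \<beta> t) (\<lambda>s. Re (f s)) \<and> integrable (history 0 t) (\<lambda>s. Re (f s)) \<and>
      (\<integral>s. Re (f s) \<partial>history \<beta> t) + \<mu> * (\<integral>s. Re (f s) \<partial>history 0 t) = Re b) \<and>
    (integrable (history \<beta> t) (\<lambda>s. Im (f s)) \<and> integrable (history 0 t) (\<lambda>s. Im (f s)) \<and>
      (\<integral>s. Im (f s) \<partial>history \<beta> t) + \<mu> * (\<integral>s. Im (f s) \<partial>history 0 t) = Im b)"
proof -
  have frac: "(\<beta> < 1 \<longrightarrow> set_integrable lborel {0..t} (\<lambda>s. (t - s) powr (- \<beta>) *\<^sub>R (f s - f 0))) \<longleftrightarrow> integrable (history \<beta> t) f"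
    and cap: "integrated_caputo \<beta> f t = (\<integral>s. f s \<partial>history \<beta> t)"
  proof -
    show "(\<beta> < 1 \<longrightarrow> set_integrable lborel {0..t} (\<lambda>s. (t - s) powr (- \<beta>) *\<^sub>R (f s - f 0))) \<longleftrightarrow> integrable (history \<beta> t) f"
    proof (cases "\<beta> = 1")
      case True
      interpret prob_space "return borel t" by (rule prob_space_return) simp
      have "integrable (return borel t) f"
      proof (rule integrable_const_bound[where B = "norm (f t)"])
        show "AE s in return borel t. norm (f s) \<le> norm (f t)"
          using fm by (subst AE_return) auto
        show "f \<in> borel_measurable (return borel t)"
          using fm by simp
      qed
      then show ?thesis using True by (simp add: history_def)
    qed (use history_frac_iff(1)[OF fm \<beta>(1), of t] \<beta> f0 in auto)
    show "integrated_caputo \<beta> f t = (\<integral>s. f s \<partial>history \<beta> t)"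
    proof (cases "\<beta> = 1")
      case True
      then show ?thesis
        using fm f0 by (simp add: integrated_caputo_def history_def integral_return)
    qed (use history_frac_iff(2)[OF fm \<beta>(1), of t] \<beta> f0 in \<open>auto simp: integrated_caputo_def\<close>)
  qed
  have "(set_integrable lborel {0..t} f \<and> (\<beta> < 1 \<longrightarrow> set_integrable lborel {0..t} (\<lambda>s. (t - s) powr (- \<beta>) *\<^sub>R (f s - f 0))) \<and>
      integrated_caputo \<beta> f t = - (\<mu> *\<^sub>R set_lebesgue_integral lborel {0..t} f) + b) \<longleftrightarrow>
    (integrable (history \<beta> t) f \<and> integrable (history 0 t) f \<and> (\<integral>s. f s \<partial>history \<beta> t) + \<mu> *\<^sub>R (\<integral>s. f s \<partial>history 0 t) = b)"
    unfolding cap frac history_zero_iff[OF fm] by (auto simp: algebra_simps)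
  also have "\<dots> \<longleftrightarrow> (integrable (history \<beta> t) (\<lambda>s. Re (f s)) \<and> integrable (history 0 t) (\<lambda>s. Re (f s)) \<and>
      (\<integral>s. Re (f s) \<partial>history \<beta> t) + \<mu> * (\<integral>s. Re (f s) \<partial>history 0 t) = Re b) \<and>
    (integrable (history \<beta> t) (\<lambda>s. Im (f s)) \<and> integrable (history 0 t) (\<lambda>s. Im (f s)) \<and>
      (\<integral>s. Im (f s) \<partial>history \<beta> t) + \<mu> * (\<integral>s. Im (f s) \<partial>history 0 t) = Im b)"
  proof (cases "integrable (history \<beta> t) f \<and> integrable (history 0 t) f")
    case True
    then have i: "integrable (history \<beta> t) f" "integrable (history 0 t) f" by auto
    have "(\<integral>s. Re (f s) \<partial>history \<beta> t) = Re (\<integral>s. f s \<partial>history \<beta> t)" "(\<integral>s. Im (f s) \<partial>history \<beta> t) = Im (\<integral>s. f s \<partial>history \<beta> t)"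
      "(\<integral>s. Re (f s) \<partial>history 0 t) = Re (\<integral>s. f s \<partial>history 0 t)" "(\<integral>s. Im (f s) \<partial>history 0 t) = Im (\<integral>s. f s \<partial>history 0 t)"
      by (rule integral_Re[OF i(1)] integral_Im[OF i(1)] integral_Re[OF i(2)] integral_Im[OF i(2)])+
    then show ?thesis
      using i integrable_Re_Im_iff[of "history \<beta> t" f] integrable_Re_Im_iff[of "history 0 t" f]
      by (simp only: complex_eq_iff plus_complex.sel scaleR_complex.sel simp_thms)
  next
    case False
    then show ?thesis
      using integrable_Re_Im_iff[of "history \<beta> t" f] integrable_Re_Im_iff[of "history 0 t" f] by argo
  qed
  finally show ?thesis .
qed

lemma solves_coefficient_cong:
  assumes "\<And>s. 0 \<le> s \<Longrightarrow> u s = v s"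
  shows "solves_coefficient M \<beta> \<mu> b u \<longleftrightarrow> solves_coefficient M \<beta> \<mu> b v"
proof -
  have i: "set_integrable lborel {0..t} f = set_integrable lborel {0..t} g"
    and I: "set_lebesgue_integral lborel {0..t} f = set_lebesgue_integral lborel {0..t} g"
    if "\<And>s. s \<in> {0..t} \<Longrightarrow> f s = g s" for f g :: "real \<Rightarrow> complex" and t
  proof -
    have eq: "indicator {0..t} s *\<^sub>R f s = indicator {0..t} s *\<^sub>R g s" for s
      using that[of s] by (cases "s \<in> {0..t}") auto
    show "set_integrable lborel {0..t} f = set_integrable lborel {0..t} g"
      "set_lebesgue_integral lborel {0..t} f = set_lebesgue_integral lborel {0..t} g"
      unfolding set_integrable_def set_lebesgue_integral_def by (simp_all only: eq)
  qed
  have e: "set_integrable lborel {0..t} (\<lambda>s. u s \<omega>) = set_integrable lborel {0..t} (\<lambda>s. v s \<omega>)"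
    "set_integrable lborel {0..t} (\<lambda>s. (t - s) powr (- \<beta>) *\<^sub>R (u s \<omega> - u 0 \<omega>)) = set_integrable lborel {0..t} (\<lambda>s. (t - s) powr (- \<beta>) *\<^sub>R (v s \<omega> - v 0 \<omega>))"
    "set_lebesgue_integral lborel {0..t} (\<lambda>s. u s \<omega>) = set_lebesgue_integral lborel {0..t} (\<lambda>s. v s \<omega>)"
    "set_lebesgue_integral lborel {0..t} (\<lambda>s. (t - s) powr (- \<beta>) *\<^sub>R (u s \<omega> - u 0 \<omega>)) = set_lebesgue_integral lborel {0..t} (\<lambda>s. (t - s) powr (- \<beta>) *\<^sub>R (v s \<omega> - v 0 \<omega>))"
    for t \<omega>
    using assms by (intro i I; simp)+
  show ?thesis
    unfolding solves_coefficient_def integrated_caputo_def e using assms by (simp cong: conj_cong)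
qed

text \<open>The equivalence is applied path by path, outside a null set that may depend on t, as it
  may in both notions of solution.\<close>

lemma (in prob_space) solves_coefficient_iff:
  fixes u B :: "real \<Rightarrow> 'a \<Rightarrow> complex"
  assumes R: "fbm_kernel M H A (\<lambda>t \<omega>. Re (B t \<omega>)) \<beta> \<mu>" and I: "fbm_kernel M H A (\<lambda>t \<omega>. Im (B t \<omega>)) \<beta> \<mu>"
    and um: "(\<lambda>(s, \<omega>). u s \<omega>) \<in> borel_measurable (borel \<Otimes>\<^sub>M M)"
    and u0: "AE \<omega> in M. u 0 \<omega> = 0" and b: "\<And>t. 0 \<le> t \<Longrightarrow> AE \<omega> in M. b t \<omega> = B t \<omega>"
  shows "solves_coefficient M \<beta> \<mu> b u \<longleftrightarrow>
    fbm_kernel.solves M (\<lambda>t \<omega>. Re (B t \<omega>)) \<beta> \<mu> (\<lambda>s \<omega>. Re (u s \<omega>)) \<and>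
    fbm_kernel.solves M (\<lambda>t \<omega>. Im (B t \<omega>)) \<beta> \<mu> (\<lambda>s \<omega>. Im (u s \<omega>))"
proof -
  interpret R: fbm_kernel M H A "\<lambda>t \<omega>. Re (B t \<omega>)" \<beta> \<mu> by (rule R)
  interpret I: fbm_kernel M H A "\<lambda>t \<omega>. Im (B t \<omega>)" \<beta> \<mu> by (rule I)
  let ?P = "\<lambda>g t \<omega>. integrable (history \<beta> t) (\<lambda>s. g (u s \<omega>)) \<and> integrable (history 0 t) (\<lambda>s. g (u s \<omega>)) \<and>
      (\<integral>s. g (u s \<omega>) \<partial>history \<beta> t) + \<mu> * (\<integral>s. g (u s \<omega>) \<partial>history 0 t) = g (B t \<omega>)"
  have "(AE \<omega> in M. set_integrable lborel {0..t} (\<lambda>s. u s \<omega>) \<and>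
        (\<beta> < 1 \<longrightarrow> set_integrable lborel {0..t} (\<lambda>s. (t - s) powr (- \<beta>) *\<^sub>R (u s \<omega> - u 0 \<omega>))) \<and>
        integrated_caputo \<beta> (\<lambda>s. u s \<omega>) t = - (\<mu> *\<^sub>R set_lebesgue_integral lborel {0..t} (\<lambda>s. u s \<omega>)) + b t \<omega>)
      \<longleftrightarrow> (AE \<omega> in M. ?P Re t \<omega> \<and> ?P Im t \<omega>)" if t: "0 \<le> t" for t
  proof -
    have "AE \<omega> in M. (set_integrable lborel {0..t} (\<lambda>s. u s \<omega>) \<and>
        (\<beta> < 1 \<longrightarrow> set_integrable lborel {0..t} (\<lambda>s. (t - s) powr (- \<beta>) *\<^sub>R (u s \<omega> - u 0 \<omega>))) \<and>
        integrated_caputo \<beta> (\<lambda>s. u s \<omega>) t = - (\<mu> *\<^sub>R set_lebesgue_integral lborel {0..t} (\<lambda>s. u s \<omega>)) + b t \<omega>)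
        \<longleftrightarrow> ?P Re t \<omega> \<and> ?P Im t \<omega>"
      using u0 b[OF t] AE_space
    proof eventually_elim
      case (elim \<omega>)
      have "(\<lambda>s. u s \<omega>) \<in> borel_measurable borel"
        using measurable_compose[OF measurable_Pair2'[OF elim(3)] um] by simp
      from integrated_equation_iff[OF this R.\<beta> elim(1), of t \<mu> "b t \<omega>"] show ?case
        unfolding elim(2) .
    qed
    then show ?thesis
      by (rule eventually_cong)
  qed
  then have "solves_coefficient M \<beta> \<mu> b u \<longleftrightarrow> (\<forall>t\<ge>0. AE \<omega> in M. ?P Re t \<omega> \<and> ?P Im t \<omega>)"
    unfolding solves_coefficient_def by simp
  also have "\<dots> \<longleftrightarrow> (\<forall>t\<ge>0. AE \<omega> in M. ?P Re t \<omega>) \<and> (\<forall>t\<ge>0. AE \<omega> in M. ?P Im t \<omega>)"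
    by (auto simp only: eventually_conj_iff)
  finally show ?thesis
    unfolding R.solves_def I.solves_def .
qed

section \<open>Reduction of the field to its modes\<close>

locale sphere_equation = random_frame M Y
  for M :: "'w measure" and Y :: "nat \<Rightarrow> int \<Rightarrow> real ^ 3 \<Rightarrow> complex" +
  fixes \<alpha> \<beta> \<gamma> H :: real and A1 A2 :: "nat \<Rightarrow> real"
    and Bh Bt :: "nat \<Rightarrow> int \<Rightarrow> real \<Rightarrow> 'w \<Rightarrow> complex"
    and BH :: "real \<Rightarrow> 'w \<Rightarrow> real ^ 3 \<Rightarrow> complex ^ 3"
  assumes \<beta>: "0 < \<beta>" "\<beta> \<le> 1" and H: "1 / 2 \<le> H" "H < 1"
    and noise: "tangential_fbm M Y H A1 A2 Bh Bt BH"
begin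

text \<open>The divergence-free and the curl-free family share one index set, so that each argument
  about modes is made once.\<close>

definition noise_at :: "(nat \<times> int) + (nat \<times> int) \<Rightarrow> real \<Rightarrow> 'w \<Rightarrow> complex" where
  "noise_at = case_sum (\<lambda>(l, m). Bh l m) (\<lambda>(l, m). Bt l m)"

definition variance_at :: "(nat \<times> int) + (nat \<times> int) \<Rightarrow> real" where
  "variance_at = case_sum (\<lambda>(l, m). A1 l) (\<lambda>(l, m). A2 l)"

definition rate_at :: "(nat \<times> int) + (nat \<times> int) \<Rightarrow> real" where
  "rate_at i = psi \<alpha> \<gamma> (eigval (case_sum fst fst i))"

abbreviation reproc where "reproc u \<equiv> (\<lambda>t \<omega>. Re (u t \<omega>))"
abbreviation improc where "improc u \<equiv> (\<lambda>t \<omega>. Im (u t \<omega>))"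

lemma fbm_kernels:
  assumes "i \<in> indices"
  shows "fbm_kernel M H (variance_at i) (reproc (noise_at i)) \<beta> (rate_at i)"
    and "fbm_kernel M H (variance_at i) (improc (noise_at i)) \<beta> (rate_at i)"
proof -
  have "complex_fbm M H (variance_at i) (noise_at i)"
    using noise assms by (auto simp: tangential_fbm_def noise_at_def variance_at_def)
  moreover have "0 \<le> rate_at i"
    by (simp add: rate_at_def psi_def)
  ultimately show "fbm_kernel M H (variance_at i) (reproc (noise_at i)) \<beta> (rate_at i)"
    "fbm_kernel M H (variance_at i) (improc (noise_at i)) \<beta> (rate_at i)"
    using \<beta> H by (auto intro!: fbm_kernel.intro fbm.intro fbm_axioms.intro fbm_kernel_axioms.intro
        prob_space_axioms simp: complex_fbm_def)
qed

lemma noise_at_L2: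
  assumes "i \<in> indices" "0 \<le> t"
  shows "noise_at i t \<in> L2_space M"
proof -
  interpret R: fbm_kernel M H "variance_at i" "reproc (noise_at i)" \<beta> "rate_at i" by (rule fbm_kernels(1)[OF assms(1)])
  interpret I: fbm_kernel M H "variance_at i" "improc (noise_at i)" \<beta> "rate_at i" by (rule fbm_kernels(2)[OF assms(1)])
  show ?thesis
    using R.B_L2[OF assms(2)] I.B_L2[OF assms(2)] L2_space_Re_Im(1)[of "noise_at i t"] by simp
qed

lemma variance_at_nonneg: "i \<in> indices \<Longrightarrow> 0 \<le> variance_at i"
  using fbm_kernels(1)[of i] fbm.A_nonneg by (auto simp: fbm_kernel_def)

lemma expansion_coefficients:
  assumes F: "case_prod F \<in> L2_random_tangent M" and c: "\<And>i. i \<in> indices \<Longrightarrow> c i \<in> L2_space M"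
    and lim: "(\<lambda>N. sq_dist MS (case_prod F) (rcomb (window N) c)) \<longlonglongrightarrow> 0"
  shows "(\<lambda>N. l2norm MS (\<lambda>z. case_prod F z - rcomb (window N) c z)) \<longlonglongrightarrow> 0"
    and "i \<in> indices \<Longrightarrow> AE \<omega> in M. coeff (F \<omega>) (frame i) = c i \<omega>"
proof -
  have FL: "case_prod F \<in> L2_space MS"
    using F by (simp add: L2_random_tangent_def)
  have L2: "rcomb (window N) c \<in> L2_space MS" for N
    using window_subset by (intro rcomb_L2 finite_window c) auto
  show *: "(\<lambda>N. l2norm MS (\<lambda>z. case_prod F z - rcomb (window N) c z)) \<longlonglongrightarrow> 0"
    using lim tendsto_sq_dist_iff[of "\<lambda>_. case_prod F" MS sequentially "\<lambda>N. rcomb (window N) c"] FL L2 by simp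
  show "AE \<omega> in M. coeff (F \<omega>) (frame i) = c i \<omega>" if "i \<in> indices"
    using AE_rcoeff_eqI[OF FL c that *] by (simp add: rcoeff_def)
qed

lemma noise_coefficients:
  assumes "i \<in> indices" "0 \<le> t"
  shows "AE \<omega> in M. coeff (BH t \<omega>) (frame i) = noise_at i t \<omega>"
proof -
  have "has_L2_expansion M Y (\<lambda>l m. Bh l m t) (\<lambda>l m. Bt l m t) (BH t)"
    using noise assms(2) by (simp add: tangential_fbm_def)
  moreover have "case_sum (\<lambda>(l, m). Bh l m t) (\<lambda>(l, m). Bt l m t) = (\<lambda>i. noise_at i t)"
    by (auto simp: fun_eq_iff noise_at_def split: sum.split)
  ultimately show ?thesis
    using assms by (intro expansion_coefficients(2)) (auto simp: has_L2_expansion_iff noise_at_L2)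
qed

definition mode_solution :: "(nat \<times> int) + (nat \<times> int) \<Rightarrow> (real \<Rightarrow> 'w \<Rightarrow> complex) \<Rightarrow> bool" where
  "mode_solution i J \<longleftrightarrow> (\<forall>t\<ge>0. has_complex_RS_integral M (kernel \<beta> (rate_at i) t) (noise_at i) t (J t))"

lemma mode_solution_iff:
  assumes "i \<in> indices"
  shows "mode_solution i J \<longleftrightarrow>
    fbm_kernel.solution M (reproc (noise_at i)) \<beta> (rate_at i) (reproc J) \<and>
    fbm_kernel.solution M (improc (noise_at i)) \<beta> (rate_at i) (improc J)"
proof -
  interpret R: fbm_kernel M H "variance_at i" "reproc (noise_at i)" \<beta> "rate_at i" by (rule fbm_kernels(1)[OF assms])
  interpret I: fbm_kernel M H "variance_at i" "improc (noise_at i)" \<beta> "rate_at i" by (rule fbm_kernels(2)[OF assms])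
  show ?thesis
    unfolding mode_solution_def R.solution_def I.solution_def has_complex_RS_integral_def by blast
qed

lemma solution_integrals_iff:
  "solution_integrals M \<beta> (psi \<alpha> \<gamma>) Bh Bt Jh Jt \<longleftrightarrow>
    (\<forall>i\<in>indices. mode_solution i (case_sum (\<lambda>(l, m). Jh l m) (\<lambda>(l, m). Jt l m) i))"
  unfolding solution_integrals_def mode_solution_def ball_Plus
  by (auto simp: rate_at_def noise_at_def)

lemma solution_integrals_exist_iff:
  "(\<exists>Jh Jt. solution_integrals M \<beta> (psi \<alpha> \<gamma>) Bh Bt Jh Jt) \<longleftrightarrow> (\<exists>J. \<forall>i\<in>indices. mode_solution i (J i))"
proof
  assume "\<exists>J. \<forall>i\<in>indices. mode_solution i (J i)"
  then obtain J where J: "\<forall>i\<in>indices. mode_solution i (J i)" by blast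
  have "case_sum (\<lambda>(l, m). J (Inl (l, m))) (\<lambda>(l, m). J (Inr (l, m))) = J"
    by (auto simp: fun_eq_iff split: sum.split)
  then have "solution_integrals M \<beta> (psi \<alpha> \<gamma>) Bh Bt (\<lambda>l m. J (Inl (l, m))) (\<lambda>l m. J (Inr (l, m)))"
    using J by (simp add: solution_integrals_iff)
  then show "\<exists>Jh Jt. solution_integrals M \<beta> (psi \<alpha> \<gamma>) Bh Bt Jh Jt" by blast
qed (auto simp: solution_integrals_iff)

lemma given_by_formula_iff:
  "given_by_formula M Y \<beta> (psi \<alpha> \<gamma>) Bh Bt X \<longleftrightarrow>
    (\<exists>J. (\<forall>i\<in>indices. mode_solution i (J i)) \<and>
      (\<forall>t\<ge>0. case_prod (X t) \<in> L2_random_tangent M \<and>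
        (\<lambda>N. sq_dist MS (case_prod (X t)) (rcomb (window N) (\<lambda>i. J i t))) \<longlonglongrightarrow> 0))"
    (is "?L \<longleftrightarrow> (\<exists>J. ?P J)")
proof
  have eq: "case_sum (\<lambda>(l, m). Jh l m t) (\<lambda>(l, m). Jt l m t) = (\<lambda>i. case_sum (\<lambda>(l, m). Jh l m) (\<lambda>(l, m). Jt l m) i t)"
    for Jh Jt :: "nat \<Rightarrow> int \<Rightarrow> real \<Rightarrow> 'w \<Rightarrow> complex" and t
    by (auto simp: fun_eq_iff split: sum.split)
  {
    assume ?L
    then obtain Jh Jt where "solution_integrals M \<beta> (psi \<alpha> \<gamma>) Bh Bt Jh Jt"
      "\<forall>t\<ge>0. has_L2_expansion M Y (\<lambda>l m. Jh l m t) (\<lambda>l m. Jt l m t) (X t)"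
      unfolding given_by_formula_def by blast
    then have "?P (case_sum (\<lambda>(l, m). Jh l m) (\<lambda>(l, m). Jt l m))"
      unfolding solution_integrals_iff has_L2_expansion_iff eq by blast
    then show "\<exists>J. ?P J" by blast
  next
    assume "\<exists>J. ?P J"
    then obtain J where J: "?P J" by blast
    have "case_sum (\<lambda>(l, m). J (Inl (l, m))) (\<lambda>(l, m). J (Inr (l, m))) = J"
      by (auto simp: fun_eq_iff split: sum.split)
    moreover have "case_sum (\<lambda>(l, m). J (Inl (l, m)) t) (\<lambda>(l, m). J (Inr (l, m)) t) = (\<lambda>i. J i t)" for t
      by (auto simp: fun_eq_iff split: sum.split)
    ultimately have "solution_integrals M \<beta> (psi \<alpha> \<gamma>) Bh Bt (\<lambda>l m. J (Inl (l, m))) (\<lambda>l m. J (Inr (l, m))) \<and>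
      (\<forall>t\<ge>0. has_L2_expansion M Y (\<lambda>l m. J (Inl (l, m)) t) (\<lambda>l m. J (Inr (l, m)) t) (X t))"
      unfolding solution_integrals_iff has_L2_expansion_iff using J by simp
    then show ?L
      unfolding given_by_formula_def by (intro exI)
  }
qed

lemma solves_equation_iff:
  "solves_equation M Y \<beta> (psi \<alpha> \<gamma>) BH X \<longleftrightarrow>
    (\<forall>t\<ge>0. ((\<lambda>s. sq_dist MS (case_prod (X s)) (case_prod (X t))) \<longlongrightarrow> 0) (at t within {0..})) \<and>
    (AE (\<omega>, x) in MS. X 0 \<omega> x = 0) \<and>
    (\<forall>i\<in>indices. solves_coefficient M \<beta> (rate_at i) (\<lambda>t \<omega>. coeff (BH t \<omega>) (frame i)) (\<lambda>t \<omega>. coeff (X t \<omega>) (frame i)))"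
proof -
  have "(\<forall>(l, m)\<in>vec_indices.
        solves_coefficient M \<beta> (psi \<alpha> \<gamma> (eigval l)) (\<lambda>t \<omega>. coeff (BH t \<omega>) (yv Y l m)) (\<lambda>t \<omega>. coeff (X t \<omega>) (yv Y l m)) \<and>
        solves_coefficient M \<beta> (psi \<alpha> \<gamma> (eigval l)) (\<lambda>t \<omega>. coeff (BH t \<omega>) (zv Y l m)) (\<lambda>t \<omega>. coeff (X t \<omega>) (zv Y l m)))
    \<longleftrightarrow> (\<forall>i\<in>indices. solves_coefficient M \<beta> (rate_at i) (\<lambda>t \<omega>. coeff (BH t \<omega>) (frame i)) (\<lambda>t \<omega>. coeff (X t \<omega>) (frame i)))"
    unfolding ball_Plus by (auto simp: rate_at_def frame_def)
  then show ?thesis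
    unfolding solves_equation_def by simp
qed

lemma mode_solution_exists:
  assumes "i \<in> indices" "variance_at i = 0 \<or> 1 < \<beta> + H"
  shows "\<exists>J. mode_solution i J"
proof -
  interpret R: fbm_kernel M H "variance_at i" "reproc (noise_at i)" \<beta> "rate_at i" by (rule fbm_kernels(1)[OF assms(1)])
  interpret I: fbm_kernel M H "variance_at i" "improc (noise_at i)" \<beta> "rate_at i" by (rule fbm_kernels(2)[OF assms(1)])
  obtain JR JI where "R.solution JR" "I.solution JI"
    using R.solution_exists I.solution_exists assms(2) by (auto simp: R.admissible_def)
  then have "mode_solution i (\<lambda>t \<omega>. Complex (JR t \<omega>) (JI t \<omega>))"
    using assms(1) by (simp add: mode_solution_iff)
  then show ?thesis by blast
qed

text \<open>Existence of the integral already forces admissibility, so the estimates for one real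
  mode apply to both parts. In the last bound only the variance depends on \<open>i\<close>; when
  \<beta> + H \<le> 1 the variance is 0 and so is the bound.\<close>

lemma mode_solution_properties:
  assumes i: "i \<in> indices" and J: "mode_solution i J"
  shows "variance_at i = 0 \<or> 1 < \<beta> + H" and "l2_continuous M J" and "0 \<le> t \<Longrightarrow> J t \<in> L2_space M"
    and "AE \<omega> in M. J 0 \<omega> = 0"
    and "0 \<le> t \<Longrightarrow> t \<le> T \<Longrightarrow>
      (l2norm M (J t))\<^sup>2 \<le> 2 * (1 / Gamma \<beta> * T powr (\<beta> + H - 1) / (2 powr (\<beta> + H - 1) - 1))\<^sup>2 * variance_at i"
proof -
  interpret R: fbm_kernel M H "variance_at i" "reproc (noise_at i)" \<beta> "rate_at i" by (rule fbm_kernels(1)[OF i])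
  interpret I: fbm_kernel M H "variance_at i" "improc (noise_at i)" \<beta> "rate_at i" by (rule fbm_kernels(2)[OF i])
  have RJ: "R.solution (reproc J)" and IJ: "I.solution (improc J)"
    using J mode_solution_iff[OF i] by auto
  have adm: "R.admissible \<beta>"
    using RJ by (intro R.solution_imp_admissible[of "reproc J 1"]) (simp add: R.solution_def)
  then show "variance_at i = 0 \<or> 1 < \<beta> + H"
    by (simp add: R.admissible_def)
  then have admI: "I.admissible \<beta>"
    by (simp add: I.admissible_def)
  show cont: "l2_continuous M J"
    unfolding l2_continuous_Re_Im[of M J] using R.solution_continuous[OF adm RJ] I.solution_continuous[OF admI IJ] by simp
  show L2: "J t \<in> L2_space M" if "0 \<le> t" for t
    using l2_continuousD(1)[OF cont that] .
  show "AE \<omega> in M. J 0 \<omega> = 0"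
    using R.solution_0[OF RJ] I.solution_0[OF IJ] by eventually_elim (simp add: complex_eq_iff)
  show "(l2norm M (J t))\<^sup>2 \<le> 2 * (1 / Gamma \<beta> * T powr (\<beta> + H - 1) / (2 powr (\<beta> + H - 1) - 1))\<^sup>2 * variance_at i"
    if t: "0 \<le> t" "t \<le> T"
  proof -
    let ?b = "R.tail_bound \<beta> (1 / Gamma \<beta>) T"
    have "l2norm M (reproc J t) \<le> ?b"
      using R.solution_norm_le[OF adm RJ t(1)] R.tail_bound_mono(2)[OF adm _ t, of "1 / Gamma \<beta>"] R.Gamma_\<beta> by simp
    moreover have "l2norm M (improc J t) \<le> ?b"
      using I.solution_norm_le[OF admI IJ t(1)] R.tail_bound_mono(2)[OF adm _ t, of "1 / Gamma \<beta>"] R.Gamma_\<beta>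
      by (simp add: R.tail_bound_def I.tail_bound_def)
    \<comment> \<open>Real and imaginary part obey the same bound, whence the factor 2.\<close>
    ultimately have "(l2norm M (J t))\<^sup>2 \<le> ?b\<^sup>2 + ?b\<^sup>2"
      unfolding L2_space_Re_Im(2)[OF L2[OF t(1)]] by (intro add_mono power_mono) auto
    also have "\<dots> = 2 * (1 / Gamma \<beta> * T powr (\<beta> + H - 1) / (2 powr (\<beta> + H - 1) - 1))\<^sup>2 * (sqrt (variance_at i))\<^sup>2"
      by (simp add: R.tail_bound_def power_divide power_mult_distrib)
    finally show ?thesis
      using variance_at_nonneg[OF i] by simp
  qed
qed

text \<open>Degree l has 2l + 1 orders in each family, so the sum over a window is a partial sum of
  the convergent series in the definition of the noise.\<close>

lemma summable_variance: "summable_weight variance_at"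
proof -
  let ?a = "\<lambda>l. (2 * real l + 1) * (A1 l + A2 l)"
  have A: "0 \<le> A1 l" "0 \<le> A2 l" if "1 \<le> l" for l
  proof -
    have "Inl (l, 0) \<in> indices" "Inr (l, 0) \<in> indices"
      using that by (auto simp: vec_indices_def)
    from this[THEN variance_at_nonneg] show "0 \<le> A1 l" "0 \<le> A2 l"
      by (simp_all add: variance_at_def)
  qed
  have win: "(\<Sum>i\<in>window n. variance_at i) = (\<Sum>l=1..n. ?a l)" for n
  proof -
    have "(\<Sum>i\<in>window n. variance_at i)
        = (\<Sum>(l, m)\<in>(SIGMA l:{1..n}. {- int l..int l}). A1 l) + (\<Sum>(l, m)\<in>(SIGMA l:{1..n}. {- int l..int l}). A2 l)"
      unfolding window_def by (subst sum.Plus) (auto simp: variance_at_def case_prod_unfold)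
    also have "\<dots> = (\<Sum>l=1..n. \<Sum>m=-int l..int l. A1 l) + (\<Sum>l=1..n. \<Sum>m=-int l..int l. A2 l)"
      by (intro arg_cong2[where f = "(+)"] sum.Sigma[symmetric]) auto
    also have "\<dots> = (\<Sum>l=1..n. ?a l)"
      by (simp add: sum.distrib[symmetric] algebra_simps nat_add_distrib)
    finally show ?thesis .
  qed
  have "(\<lambda>l. (2 * real l + 1) * A1 l + (2 * real l + 1) * A2 l) summable_on {1..}"
    using noise by (intro summable_on_add) (auto simp: tangential_fbm_def)
  then have sm: "?a summable_on {1..}"
    by (simp add: algebra_simps)
  have "\<forall>n. (\<Sum>l=1..n. ?a l) \<le> infsum ?a {1..}"
    by (intro allI finite_sum_le_infsum[OF sm]) (use A in auto)
  moreover have "incseq (\<lambda>n. \<Sum>l=1..n. ?a l)"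
    using A by (intro incseq_SucI) simp
  ultimately obtain L where L: "(\<lambda>n. \<Sum>l=1..n. ?a l) \<longlonglongrightarrow> L"
    using incseq_convergent[of "\<lambda>n. \<Sum>l=1..n. ?a l" "infsum ?a {1..}"] by blast
  have "\<exists>N. \<forall>n\<ge>N. (\<Sum>i\<in>window n - window N. variance_at i) < \<epsilon>" if \<epsilon>: "0 < \<epsilon>" for \<epsilon>
  proof -
    obtain N where N: "\<And>m n. N \<le> m \<Longrightarrow> N \<le> n \<Longrightarrow> norm ((\<Sum>l=1..m. ?a l) - (\<Sum>l=1..n. ?a l)) < \<epsilon>"
      using CauchyD[OF LIMSEQ_imp_Cauchy[OF L] \<epsilon>] by blast
    have "(\<Sum>i\<in>window n - window N. variance_at i) < \<epsilon>" if "N \<le> n" for n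
    proof -
      have "(\<Sum>i\<in>window n - window N. variance_at i) = (\<Sum>l=1..n. ?a l) - (\<Sum>l=1..N. ?a l)"
        using sum_diff[OF finite_window window_mono[OF that], of variance_at] by (simp only: win)
      also have "\<dots> < \<epsilon>"
        using N[OF that order_refl] by simp
      finally show ?thesis .
    qed
    then show ?thesis by blast
  qed
  then show ?thesis
    using variance_at_nonneg by (simp add: summable_weight_def)
qed

lemma expansion_continuous:
  assumes J: "\<And>i. i \<in> indices \<Longrightarrow> mode_solution i (J i)"
    and F: "\<And>t. 0 \<le> t \<Longrightarrow> F t \<in> L2_space MS"
    and lim: "\<And>t. 0 \<le> t \<Longrightarrow> (\<lambda>N. l2norm MS (\<lambda>z. F t z - rcomb (window N) (\<lambda>i. J i t) z)) \<longlonglongrightarrow> 0"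
  shows "l2_continuous MS F"
proof (rule expansion_l2_continuous[OF F lim _ summable_variance])
  show "l2_continuous M (J i)" if "i \<in> indices" for i
    using mode_solution_properties(2)[OF that J[OF that]] .
  show "\<exists>K\<ge>0. \<forall>t\<in>{0..T}. \<forall>i\<in>indices. (l2norm M (J i t))\<^sup>2 \<le> K * variance_at i" for T
    using mode_solution_properties(5)[OF _ J]
    by (intro exI[of _ "2 * (1 / Gamma \<beta> * T powr (\<beta> + H - 1) / (2 powr (\<beta> + H - 1) - 1))\<^sup>2"]) auto
qed

text \<open>Time is frozen at 0 on the negative axis, as the results on one mode require.\<close>

definition mode :: "(real \<Rightarrow> 'w \<Rightarrow> real ^ 3 \<Rightarrow> complex ^ 3) \<Rightarrow> (nat \<times> int) + (nat \<times> int) \<Rightarrow> real \<Rightarrow> 'w \<Rightarrow> complex" where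
  "mode X i t \<omega> = coeff (X (max 0 t) \<omega>) (frame i)"

lemma mode_measurable:
  assumes X: "random_tangent_field M X" and i: "i \<in> indices"
  shows "(\<lambda>(s, \<omega>). mode X i s \<omega>) \<in> borel_measurable (borel \<Otimes>\<^sub>M M)"
proof -
  interpret S: finite_measure S by (rule finite_measure_S2)
  have Xm: "(\<lambda>(t, \<omega>, x). X t \<omega> x) \<in> borel_measurable (restrict_space borel {0..} \<Otimes>\<^sub>M MS)"
    using X by (simp add: random_tangent_field_def)
  have [measurable]: "frame i \<in> borel_measurable S" using frame_L2[OF i] by auto
  have mx: "(\<lambda>s. max 0 s) \<in> borel \<rightarrow>\<^sub>M (restrict_space borel {0..} :: real measure)"
    by (intro measurable_restrict_space2) auto
  have "(\<lambda>z. (max 0 (fst (fst z)), snd (fst z), snd z)) \<in> (borel \<Otimes>\<^sub>M M) \<Otimes>\<^sub>M S \<rightarrow>\<^sub>M (restrict_space borel {0..} :: real measure) \<Otimes>\<^sub>M MS"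
  proof (intro measurable_Pair)
    have "(\<lambda>z. fst (fst z)) \<in> (borel \<Otimes>\<^sub>M M) \<Otimes>\<^sub>M S \<rightarrow>\<^sub>M (borel :: real measure)"
      by measurable
    from measurable_compose[OF this mx]
    show "(\<lambda>z. max 0 (fst (fst z))) \<in> (borel \<Otimes>\<^sub>M M) \<Otimes>\<^sub>M S \<rightarrow>\<^sub>M (restrict_space borel {0..} :: real measure)" .
    show "(\<lambda>z. snd (fst z)) \<in> (borel \<Otimes>\<^sub>M M) \<Otimes>\<^sub>M S \<rightarrow>\<^sub>M M"
      by (rule measurable_compose[OF measurable_fst measurable_snd])
    show "snd \<in> (borel \<Otimes>\<^sub>M M) \<Otimes>\<^sub>M S \<rightarrow>\<^sub>M S"
      by (rule measurable_snd)
  qed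
  from measurable_compose[OF this Xm]
  have [measurable]: "(\<lambda>z. X (max 0 (fst (fst z))) (snd (fst z)) (snd z)) \<in> borel_measurable ((borel \<Otimes>\<^sub>M M) \<Otimes>\<^sub>M S)"
    by simp
  have "(\<lambda>z. cdot (X (max 0 (fst (fst z))) (snd (fst z)) (snd z)) (frame i (snd z))) \<in> borel_measurable ((borel \<Otimes>\<^sub>M M) \<Otimes>\<^sub>M S)"
    by measurable
  then have "(\<lambda>(p, x). cdot (X (max 0 (fst p)) (snd p) x) (frame i x)) \<in> borel_measurable ((borel \<Otimes>\<^sub>M M) \<Otimes>\<^sub>M S)"
    by (simp add: case_prod_beta')
  then have "(\<lambda>p. LINT x|S. cdot (X (max 0 (fst p)) (snd p) x) (frame i x)) \<in> borel_measurable (borel \<Otimes>\<^sub>M M)"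
    by (rule S.borel_measurable_lebesgue_integral)
  then show ?thesis
    by (simp add: mode_def coeff_def case_prod_beta')
qed

lemma mode_eq_rcoeff: "0 \<le> t \<Longrightarrow> mode X i t = rcoeff (case_prod (X t)) i"
  by (simp add: mode_def rcoeff_def fun_eq_iff)

lemma mode_equation_iff:
  assumes X: "random_tangent_field M X" and i: "i \<in> indices" and zero: "AE \<omega> in M. mode X i 0 \<omega> = 0"
  shows "solves_coefficient M \<beta> (rate_at i) (\<lambda>t \<omega>. coeff (BH t \<omega>) (frame i)) (\<lambda>t \<omega>. coeff (X t \<omega>) (frame i)) \<longleftrightarrow>
    fbm_kernel.solves M (reproc (noise_at i)) \<beta> (rate_at i) (reproc (mode X i)) \<and>
    fbm_kernel.solves M (improc (noise_at i)) \<beta> (rate_at i) (improc (mode X i))"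
proof -
  have "solves_coefficient M \<beta> (rate_at i) (\<lambda>t \<omega>. coeff (BH t \<omega>) (frame i)) (\<lambda>t \<omega>. coeff (X t \<omega>) (frame i)) \<longleftrightarrow>
      solves_coefficient M \<beta> (rate_at i) (\<lambda>t \<omega>. coeff (BH t \<omega>) (frame i)) (mode X i)"
    by (rule solves_coefficient_cong) (simp add: mode_def fun_eq_iff)
  also have "\<dots> \<longleftrightarrow> fbm_kernel.solves M (reproc (noise_at i)) \<beta> (rate_at i) (reproc (mode X i)) \<and>
    fbm_kernel.solves M (improc (noise_at i)) \<beta> (rate_at i) (improc (mode X i))"
    by (rule solves_coefficient_iff[OF fbm_kernels[OF i] mode_measurable[OF X i] zero noise_coefficients[OF i]])
  finally show ?thesis .
qed

lemma mode_parts_measurable: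
  assumes X: "random_tangent_field M X" and i: "i \<in> indices"
  shows "(\<lambda>(s, \<omega>). Re (mode X i s \<omega>)) \<in> borel_measurable (borel \<Otimes>\<^sub>M M)"
    and "(\<lambda>(s, \<omega>). Im (mode X i s \<omega>)) \<in> borel_measurable (borel \<Otimes>\<^sub>M M)"
proof -
  have [measurable]: "(\<lambda>z. mode X i (fst z) (snd z)) \<in> borel_measurable (borel \<Otimes>\<^sub>M M)"
    using mode_measurable[OF assms] by (simp add: case_prod_beta')
  show "(\<lambda>(s, \<omega>). Re (mode X i s \<omega>)) \<in> borel_measurable (borel \<Otimes>\<^sub>M M)"
    "(\<lambda>(s, \<omega>). Im (mode X i s \<omega>)) \<in> borel_measurable (borel \<Otimes>\<^sub>M M)"
    unfolding case_prod_beta' by measurable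
qed

section \<open>Passage between the field and its modes\<close>

text \<open>The coefficient map is a contraction, so each mode of \<open>X\<close> inherits
  mean-square continuity and the zero initial value, and uniqueness for one mode identifies it as
  the stochastic integral. The expansion in the formula is then the Fourier expansion of
  \<open>X\<close> itself.\<close>

lemma solves_equation_imp_formula:
  assumes X: "random_tangent_field M X" and eq: "solves_equation M Y \<beta> (psi \<alpha> \<gamma>) BH X"
  shows "given_by_formula M Y \<beta> (psi \<alpha> \<gamma>) Bh Bt X"
proof -
  have XT: "case_prod (X t) \<in> L2_random_tangent M" if "0 \<le> t" for t
    using X that by (simp add: random_tangent_field_def)
  then have XL: "case_prod (X t) \<in> L2_space MS" if "0 \<le> t" for t
    using that by (auto simp: L2_random_tangent_def)
  have Xlim: "((\<lambda>s. sq_dist MS (case_prod (X s)) (case_prod (X t))) \<longlongrightarrow> 0) (at t within {0..})" if "0 \<le> t" for t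
    using eq that by (simp add: solves_equation_iff)
  have X0: "AE (\<omega>, x) in MS. X 0 \<omega> x = 0"
    using eq by (simp add: solves_equation_iff)
  have Xc: "l2_continuous MS (\<lambda>t. case_prod (X t))"
  proof (rule l2_continuousI[OF XL])
    fix t :: real assume t: "0 \<le> t"
    have "\<forall>\<^sub>F s in at t within {0..}. case_prod (X s) \<in> L2_space MS"
      using XL by (auto simp: eventually_at_filter)
    then show "((\<lambda>s. l2norm MS (\<lambda>x. case_prod (X s) x - case_prod (X t) x)) \<longlongrightarrow> 0) (at t within {0..})"
      using Xlim[OF t] tendsto_sq_dist_iff[of "\<lambda>s. case_prod (X s)" MS "at t within {0..}" "\<lambda>_. case_prod (X t)"] XL[OF t]
      by simp
  qed
  have "mode_solution i (mode X i)" if i: "i \<in> indices" for i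
  proof -
    interpret R: fbm_kernel M H "variance_at i" "reproc (noise_at i)" \<beta> "rate_at i" by (rule fbm_kernels(1)[OF i])
    interpret I: fbm_kernel M H "variance_at i" "improc (noise_at i)" \<beta> "rate_at i" by (rule fbm_kernels(2)[OF i])
    have ml2: "mode X i t \<in> L2_space M" if "0 \<le> t" for t
      using rcoeff_L2(1)[OF XL[OF that] i] that by (simp add: mode_eq_rcoeff)
    have "l2norm MS (case_prod (X 0)) = 0"
      using X0 l2norm_eq_0_iff_AE[OF XL[OF order_refl]] by (simp add: case_prod_beta')
    then have "l2norm M (mode X i 0) = 0"
      using rcoeff_L2(2)[OF XL[of 0] i] by (simp add: mode_eq_rcoeff antisym)
    then have m0: "AE \<omega> in M. mode X i 0 \<omega> = 0"
      using l2norm_eq_0_iff_AE[OF ml2[of 0]] by simp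
    have mc: "l2_continuous M (mode X i)"
    proof (rule l2_continuousI[OF ml2])
      fix t :: real assume t: "0 \<le> t"
      show "((\<lambda>s. l2norm M (\<lambda>\<omega>. mode X i s \<omega> - mode X i t \<omega>)) \<longlongrightarrow> 0) (at t within {0..})"
      proof (rule Lim_null_comparison[OF _ l2_continuousD(2)[OF Xc t]])
        show "\<forall>\<^sub>F s in at t within {0..}. norm (l2norm M (\<lambda>\<omega>. mode X i s \<omega> - mode X i t \<omega>))
            \<le> l2norm MS (\<lambda>x. case_prod (X s) x - case_prod (X t) x)"
          using rcoeff_diff_norm[OF XL XL i] t by (auto simp: eventually_at_filter mode_eq_rcoeff)
      qed
    qed
    then have c: "l2_continuous M (reproc (mode X i))" "l2_continuous M (improc (mode X i))"
      using l2_continuous_Re_Im[of M "mode X i"] by auto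
    have neg: "reproc (mode X i) s = reproc (mode X i) 0" "improc (mode X i) s = improc (mode X i) 0" if "s \<le> 0" for s
      using that by (auto simp: mode_def fun_eq_iff max_def)
    have m0': "AE \<omega> in M. reproc (mode X i) 0 \<omega> = 0" "AE \<omega> in M. improc (mode X i) 0 \<omega> = 0"
      using m0 by auto
    have "solves_coefficient M \<beta> (rate_at i) (\<lambda>t \<omega>. coeff (BH t \<omega>) (frame i)) (\<lambda>t \<omega>. coeff (X t \<omega>) (frame i))"
      using eq i unfolding solves_equation_iff by blast
    then have s: "R.solves (reproc (mode X i))" "I.solves (improc (mode X i))"
      using mode_equation_iff[OF X i m0] by auto
    have adm: "R.admissible \<beta>"
      by (rule R.solves_imp_admissible[OF mode_parts_measurable(1)[OF X i] c(1) neg(1) s(1) m0'(1)])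
    then have admI: "I.admissible \<beta>"
      by (simp add: R.admissible_def I.admissible_def)
    have "R.solution (reproc (mode X i))"
      by (rule R.solves_imp_solution[OF mode_parts_measurable(1)[OF X i] c(1) neg(1) adm s(1) m0'(1)])
    moreover have "I.solution (improc (mode X i))"
      by (rule I.solves_imp_solution[OF mode_parts_measurable(2)[OF X i] c(2) neg(2) admI s(2) m0'(2)])
    ultimately show ?thesis
      using mode_solution_iff[OF i] by blast
  qed
  moreover have "(\<lambda>N. sq_dist MS (case_prod (X t)) (rcomb (window N) (\<lambda>i. mode X i t))) \<longlonglongrightarrow> 0" if "0 \<le> t" for t
    using rcomb_rcoeff_converges[OF XT[OF that]] that by (simp add: mode_eq_rcoeff)
  ultimately show ?thesis
    unfolding given_by_formula_iff using XT by blast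
qed

text \<open>At each time the modes of \<open>X\<close> agree almost surely with the integrals
  \<open>J\<close>, but joint measurability is known only for the modes. The property of being a
  stochastic integral is therefore transferred to them before any time integral is taken.\<close>

lemma formula_imp_solves_equation:
  assumes X: "random_tangent_field M X" and "given_by_formula M Y \<beta> (psi \<alpha> \<gamma>) Bh Bt X"
  shows "solves_equation M Y \<beta> (psi \<alpha> \<gamma>) BH X"
proof -
  obtain J where J: "\<And>i. i \<in> indices \<Longrightarrow> mode_solution i (J i)"
    and ex: "\<And>t. 0 \<le> t \<Longrightarrow> (\<lambda>N. sq_dist MS (case_prod (X t)) (rcomb (window N) (\<lambda>i. J i t))) \<longlonglongrightarrow> 0"
    using assms(2) unfolding given_by_formula_iff by blast
  have XT: "case_prod (X t) \<in> L2_random_tangent M" if "0 \<le> t" for t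
    using X that by (simp add: random_tangent_field_def)
  then have XL: "case_prod (X t) \<in> L2_space MS" if "0 \<le> t" for t
    using that by (auto simp: L2_random_tangent_def)
  have JL: "J i t \<in> L2_space M" if "i \<in> indices" "0 \<le> t" for i t
    using mode_solution_properties(3)[OF that(1) J[OF that(1)] that(2)] .
  have lim: "(\<lambda>N. l2norm MS (\<lambda>z. case_prod (X t) z - rcomb (window N) (\<lambda>i. J i t) z)) \<longlonglongrightarrow> 0" if "0 \<le> t" for t
    by (rule expansion_coefficients(1)[OF XT[OF that] JL[OF _ that] ex[OF that]])
  have Xc: "l2_continuous MS (\<lambda>t. case_prod (X t))"
    by (rule expansion_continuous[OF J XL lim])
  have X0: "l2norm MS (case_prod (X 0)) = 0"
  proof -
    have "l2norm MS (rcomb (window N) (\<lambda>i. J i 0)) = 0" for N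
    proof -
      have "l2norm M (J i 0) = 0" if "i \<in> window N" for i
        using that window_subset mode_solution_properties(4)[of i, OF _ J] JL[of i 0] by (subst l2norm_eq_0_iff_AE) auto
      then have "(l2norm MS (rcomb (window N) (\<lambda>i. J i 0)))\<^sup>2 = 0"
        by (subst rcomb_L2(2)) (use window_subset[of N] in \<open>auto simp: finite_window intro!: JL\<close>)
      then show ?thesis by simp
    qed
    moreover have "rcomb (window N) (\<lambda>i. J i 0) \<in> L2_space MS" for N
      using window_subset[of N] by (intro rcomb_L2(1) finite_window) (auto intro: JL)
    then have "(\<lambda>N. l2norm MS (rcomb (window N) (\<lambda>i. J i 0))) \<longlonglongrightarrow> l2norm MS (case_prod (X 0))"
      using lim[of 0] XL[of 0]
      by (intro tendsto_l2norm always_eventually) (auto simp: l2norm_minus_commute[of MS "case_prod (X 0)"])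
    ultimately show ?thesis
      by (simp add: LIMSEQ_const_iff)
  qed
  have "solves_coefficient M \<beta> (rate_at i) (\<lambda>t \<omega>. coeff (BH t \<omega>) (frame i)) (\<lambda>t \<omega>. coeff (X t \<omega>) (frame i))" if i: "i \<in> indices" for i
  proof -
    interpret R: fbm_kernel M H "variance_at i" "reproc (noise_at i)" \<beta> "rate_at i" by (rule fbm_kernels(1)[OF i])
    interpret I: fbm_kernel M H "variance_at i" "improc (noise_at i)" \<beta> "rate_at i" by (rule fbm_kernels(2)[OF i])
    have ml2: "mode X i t \<in> L2_space M" if "0 \<le> t" for t
      using rcoeff_L2(1)[OF XL[OF that] i] that by (simp add: mode_eq_rcoeff)
    have ae: "AE \<omega> in M. J i t \<omega> = mode X i t \<omega>" if "0 \<le> t" for t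
    proof -
      have "AE \<omega> in M. coeff (X t \<omega>) (frame i) = J i t \<omega>"
        by (rule expansion_coefficients(2)[OF XT[OF that] JL[OF _ that] ex[OF that] i])
      then show ?thesis
        by eventually_elim (use that in \<open>simp add: mode_def\<close>)
    qed
    have parts: "reproc (mode X i) t \<in> L2_space M" "improc (mode X i) t \<in> L2_space M" if "0 \<le> t" for t
      using ml2[OF that] L2_space_Re_Im(1)[of "mode X i t" M] by auto
    have sol: "R.solution (reproc (mode X i))" "I.solution (improc (mode X i))"
    proof -
      have JR: "R.solution (reproc (J i))" and JI: "I.solution (improc (J i))"
        using J[OF i] mode_solution_iff[OF i] by auto
      show "R.solution (reproc (mode X i))"
        unfolding R.solution_def
      proof (intro allI impI)
        fix t :: real assume t: "0 \<le> t"
        show "has_improper_RS_integral M (kernel \<beta> (rate_at i) t) (reproc (noise_at i)) t (reproc (mode X i) t)"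
        proof (rule has_improper_RS_integral_AE_cong[OF _ parts(1)[OF t]])
          show "has_improper_RS_integral M (kernel \<beta> (rate_at i) t) (reproc (noise_at i)) t (reproc (J i) t)"
            using JR t by (simp add: R.solution_def)
          show "AE \<omega> in M. reproc (J i) t \<omega> = reproc (mode X i) t \<omega>"
            using ae[OF t] by eventually_elim simp
        qed
      qed
      show "I.solution (improc (mode X i))"
        unfolding I.solution_def
      proof (intro allI impI)
        fix t :: real assume t: "0 \<le> t"
        show "has_improper_RS_integral M (kernel \<beta> (rate_at i) t) (improc (noise_at i)) t (improc (mode X i) t)"
        proof (rule has_improper_RS_integral_AE_cong[OF _ parts(2)[OF t]])
          show "has_improper_RS_integral M (kernel \<beta> (rate_at i) t) (improc (noise_at i)) t (improc (J i) t)"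
            using JI t by (simp add: I.solution_def)
          show "AE \<omega> in M. improc (J i) t \<omega> = improc (mode X i) t \<omega>"
            using ae[OF t] by eventually_elim simp
        qed
      qed
    qed
    have adm: "R.admissible \<beta>" "I.admissible \<beta>"
      using mode_solution_properties(1)[OF i J[OF i]] by (auto simp: R.admissible_def I.admissible_def)
    have neg: "reproc (mode X i) s = reproc (mode X i) 0" "improc (mode X i) s = improc (mode X i) 0" if "s \<le> 0" for s
      using that by (auto simp: mode_def fun_eq_iff max_def)
    have m0: "AE \<omega> in M. mode X i 0 \<omega> = 0"
      using ae[of 0] mode_solution_properties(4)[OF i J[OF i]] by (auto elim: eventually_elim2)
    have "R.solves (reproc (mode X i))"
      by (rule R.solution_imp_solves[OF mode_parts_measurable(1)[OF X i] R.solution_continuous[OF adm(1) sol(1)] neg(1) adm(1) sol(1)])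
    moreover have "I.solves (improc (mode X i))"
      by (rule I.solution_imp_solves[OF mode_parts_measurable(2)[OF X i] I.solution_continuous[OF adm(2) sol(2)] neg(2) adm(2) sol(2)])
    ultimately show ?thesis
      using mode_equation_iff[OF X i m0] by blast
  qed
  moreover have "AE (\<omega>, x) in MS. X 0 \<omega> x = 0"
    using X0 l2norm_eq_0_iff_AE[OF XL[OF order_refl]] by (simp add: case_prod_beta')
  moreover have "((\<lambda>s. sq_dist MS (case_prod (X s)) (case_prod (X t))) \<longlongrightarrow> 0) (at t within {0..})" if t: "0 \<le> t" for t
  proof -
    have "\<forall>\<^sub>F s in at t within {0..}. case_prod (X s) \<in> L2_space MS"
      using XL by (auto simp: eventually_at_filter)
    then show ?thesis
      using l2_continuousD(2)[OF Xc t] XL[OF t]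
        tendsto_sq_dist_iff[of "\<lambda>s. case_prod (X s)" MS "at t within {0..}" "\<lambda>_. case_prod (X t)"] by simp
  qed
  ultimately show ?thesis
    unfolding solves_equation_iff by blast
qed

text \<open>The series is summed separately at each time, which gives no joint measurability of the
  limit. Since the tails are uniform on bounded time intervals, the limit is continuous in mean and
  has a jointly measurable version, which is still tangent and has the same expansion.\<close>

lemma formula_field_exists:
  assumes J: "\<And>i. i \<in> indices \<Longrightarrow> mode_solution i (J i)"
  shows "\<exists>X. random_tangent_field M X \<and> given_by_formula M Y \<beta> (psi \<alpha> \<gamma>) Bh Bt X"
proof -
  interpret MS: finite_measure MS by (rule finite_measure_MS)
  have JL: "J i t \<in> L2_space M" if "i \<in> indices" "0 \<le> t" for i t
    using mode_solution_properties(3)[OF that(1) J[OF that(1)] that(2)] .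
  have RL: "rcomb (window N) (\<lambda>i. J i t) \<in> L2_space MS" if "0 \<le> t" for N t
    using window_subset[of N] that by (intro rcomb_L2(1) finite_window) (auto intro: JL)
  have "\<exists>F. F \<in> L2_random_tangent M \<and> (\<lambda>N. l2norm MS (\<lambda>z. F z - rcomb (window N) (\<lambda>i. J i t) z)) \<longlonglongrightarrow> 0" if t: "0 \<le> t" for t
  proof -
    define K where "K = 2 * (1 / Gamma \<beta> * t powr (\<beta> + H - 1) / (2 powr (\<beta> + H - 1) - 1))\<^sup>2"
    have K: "0 \<le> K" by (simp add: K_def)
    have b: "(l2norm M (J i t))\<^sup>2 \<le> K * variance_at i" if "i \<in> indices" for i
      unfolding K_def using mode_solution_properties(5)[OF that J[OF that] t order_refl] .
    obtain F where "F \<in> L2_random_tangent M" "(\<lambda>N. l2norm MS (\<lambda>z. F z - rcomb (window N) (\<lambda>i. J i t) z)) \<longlonglongrightarrow> 0"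
      by (rule rcomb_limit_exists[OF summable_variance K JL[OF _ t] b])
    then show ?thesis by blast
  qed
  then have "\<exists>F. \<forall>t\<in>{0..}. F t \<in> L2_random_tangent M \<and>
      (\<lambda>N. l2norm MS (\<lambda>z. F t z - rcomb (window N) (\<lambda>i. J i t) z)) \<longlonglongrightarrow> 0"
    by (intro bchoice) simp
  then obtain F where "\<forall>t\<in>{0..}. F t \<in> L2_random_tangent M \<and>
      (\<lambda>N. l2norm MS (\<lambda>z. F t z - rcomb (window N) (\<lambda>i. J i t) z)) \<longlonglongrightarrow> 0"
    by (elim exE)
  then have F: "\<And>t. 0 \<le> t \<Longrightarrow> F t \<in> L2_random_tangent M"
    "\<And>t. 0 \<le> t \<Longrightarrow> (\<lambda>N. l2norm MS (\<lambda>z. F t z - rcomb (window N) (\<lambda>i. J i t) z)) \<longlonglongrightarrow> 0"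
    by simp_all
  have FL: "F t \<in> L2_space MS" if "0 \<le> t" for t
    using F(1)[OF that] by (simp add: L2_random_tangent_def)
  obtain G where G: "(\<lambda>(t, z). G t z) \<in> borel_measurable (restrict_space borel {0..} \<Otimes>\<^sub>M MS)"
    "\<forall>t\<ge>0. AE z in MS. G t z = F t z"
    by (rule MS.l2_continuous_modification[OF expansion_continuous[OF J FL F(2)]])
  define X where "X = (\<lambda>t \<omega> x. G t (\<omega>, x))"
  have XG: "case_prod (X t) = G t" for t
    by (simp add: X_def fun_eq_iff)
  have Gm: "G t \<in> borel_measurable MS" if "0 \<le> t" for t
    using measurable_compose[OF measurable_Pair1'[of t "restrict_space borel {0..}" MS] G(1)] that
    by (simp add: space_restrict_space)
  have GL: "G t \<in> L2_space MS" if "0 \<le> t" for t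
    using G(2)[rule_format, OF that] by (intro L2_space_AE_cong(1)[OF FL[OF that] Gm[OF that]]) auto
  have GT: "G t \<in> L2_random_tangent M" if "0 \<le> t" for t
  proof -
    have "AE p in MS. cdot (F t p) (cvec (snd p)) = 0"
      using F(1)[OF that] by (simp add: L2_random_tangent_def)
    then have "AE p in MS. cdot (G t p) (cvec (snd p)) = 0"
      using G(2)[rule_format, OF that] by eventually_elim simp
    then show ?thesis
      using GL[OF that] by (simp add: L2_random_tangent_def)
  qed
  have "sq_dist MS (G t) f = sq_dist MS (F t) f" if "0 \<le> t" for t f
    unfolding sq_dist_def using G(2)[rule_format, OF that] by (intro nn_integral_cong_AE) auto
  moreover have "(\<lambda>N. sq_dist MS (F t) (rcomb (window N) (\<lambda>i. J i t))) \<longlonglongrightarrow> 0" if "0 \<le> t" for t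
    using F(2)[OF that] tendsto_sq_dist_iff[of "\<lambda>_. F t" MS sequentially "\<lambda>N. rcomb (window N) (\<lambda>i. J i t)"] FL[OF that] RL[OF that]
    by simp
  ultimately have "given_by_formula M Y \<beta> (psi \<alpha> \<gamma>) Bh Bt X"
    unfolding given_by_formula_iff XG using J GT by (intro conjI exI[of _ J]) auto
  moreover have "random_tangent_field M X"
    unfolding random_tangent_field_def XG using G(1) GT by (simp add: X_def case_prod_beta')
  ultimately show ?thesis by blast
qed

end

theorem theorem4p3:
  fixes M :: "'w measure"
    and Y :: "nat \<Rightarrow> int \<Rightarrow> real ^ 3 \<Rightarrow> complex"
    and \<alpha> \<beta> \<gamma> H \<tau> :: real
    and A1 A2 :: "nat \<Rightarrow> real"
    and Bh Bt :: "nat \<Rightarrow> int \<Rightarrow> real \<Rightarrow> 'w \<Rightarrow> complex"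
    and BH :: "real \<Rightarrow> 'w \<Rightarrow> real ^ 3 \<Rightarrow> complex ^ 3"
  assumes prob: "prob_space M"
    and basis: "spherical_harmonic_basis Y"
    and vector_basis: "vector_harmonic_basis Y"
    and params: "\<alpha> \<in> {0<..2}" "\<alpha> + \<gamma> \<in> {0..2}" "\<beta> \<in> {0<..1}" "H \<in> {1/2..<1}"
    and noise: "tangential_fbm M Y H A1 A2 Bh Bt BH"
    and tau: "\<tau> = max (2 / \<beta> * (1 - \<beta> - H)) 0"
    and sum1: "(\<lambda>l. (2 * real l + 1) * psi \<alpha> \<gamma> (eigval l) powr \<tau> * A1 l) summable_on {1..}"
    and sum2: "(\<lambda>l. (2 * real l + 1) * psi \<alpha> \<gamma> (eigval l) powr \<tau> * A2 l) summable_on {1..}"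
  shows "(\<forall>X. random_tangent_field M X \<longrightarrow>
            (solves_equation M Y \<beta> (psi \<alpha> \<gamma>) BH X \<longleftrightarrow>
             given_by_formula M Y \<beta> (psi \<alpha> \<gamma>) Bh Bt X)) \<and>
         ((\<exists>Jh Jt. solution_integrals M \<beta> (psi \<alpha> \<gamma>) Bh Bt Jh Jt) \<longrightarrow>
            (\<exists>X. random_tangent_field M X \<and> given_by_formula M Y \<beta> (psi \<alpha> \<gamma>) Bh Bt X)) \<and>
         (1 - \<beta> < H \<longrightarrow> (\<exists>Jh Jt. solution_integrals M \<beta> (psi \<alpha> \<gamma>) Bh Bt Jh Jt))"
proof -
  interpret sphere_equation M Y \<alpha> \<beta> \<gamma> H A1 A2 Bh Bt BH
    using prob vector_basis params noise
    by (intro sphere_equation.intro random_frame.intro vector_frame.intro sphere_equation_axioms.intro) auto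
  have "\<exists>J. mode_solution i J" if "1 - \<beta> < H" "i \<in> indices" for i
    using that mode_solution_exists[of i] by auto
  then have "\<exists>J. \<forall>i\<in>indices. mode_solution i (J i)" if "1 - \<beta> < H"
    using that by (intro bchoice) auto
  then show ?thesis
    unfolding solution_integrals_exist_iff
  proof (intro conjI allI impI)
    show "solves_equation M Y \<beta> (psi \<alpha> \<gamma>) BH X \<longleftrightarrow> given_by_formula M Y \<beta> (psi \<alpha> \<gamma>) Bh Bt X"
      if "random_tangent_field M X" for X
      using solves_equation_imp_formula[OF that] formula_imp_solves_equation[OF that] by (rule iffI)
    show "\<exists>X. random_tangent_field M X \<and> given_by_formula M Y \<beta> (psi \<alpha> \<gamma>) Bh Bt X"
      if "\<exists>J. \<forall>i\<in>indices. mode_solution i (J i)"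
    proof -
      from that obtain J where "\<forall>i\<in>indices. mode_solution i (J i)"
        by (elim exE)
      then show ?thesis
        by (intro formula_field_exists[of J]) simp
    qed
  qed
qed

end
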